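(* Let $F$ be a number field with ring of adeles $\mathbb A$, $r\ge1$ and $G=GL_r$. For a fixed convex polygon $p:[0,r]\to\mathbb R$ such that $p(0)=p(r)=0$, one has $$\mathbf 1(\overline p^g\le p)=\sum_{P\text{ standard parabolic}}(-1)^{|P|-1}\sum_{\delta\in P(F)\backslash G(F)}\mathbf 1\big(p_P^{\delta g}>_Pp\big)\qquad\text{for all }g\in G(\mathbb A).$$
   Context: To $g=(g_f;g_\infty)\in GL_r(\mathbb A)$ is associated an $\mathcal O_F$-lattice $\Lambda^g$: the module $F^r\cap\prod_{v\text{ finite}}g_v\mathcal O_v^r$ (column vectors) with, at each Archimedean place $\sigma$, the inner product on $F_\sigma^r$ giving the norm $\|x\|_\sigma=\|g_\sigma^{-1}x\|_{\mathrm{std}}$. For an $\mathcal O_F$-lattice $\Lambda$ of rank $n$ (projective module with inner products at the Archimedean places), $\deg(\Lambda)=-\log\mathrm{Vol}(\Lambda)+\frac n2\log\Delta_F$, where $\Delta_F$ is the absolute discriminant and $\mathrm{Vol}(\Lambda)$ is $2^{r_2n}$ times the covolume of $\Lambda$ in $\Lambda\otimes_{\mathbb Z}\mathbb R=\prod_\sigma\Lambda\otimes F_\sigma$ for the inner product $\sum_{\sigma\text{ real}}\langle\cdot,\cdot\rangle_\sigma+\sum_{\sigma\text{ complex}}\mathrm{Re}\langle\cdot,\cdot\rangle_\sigma$ ($r_2$ = number of complex places). A parabolic subgroup $Q$ of $GL_r$ over $F$ is the stabilizer of a flag $0=W_0\subset W_1\subset\dots\subset W_{|Q|}=F^r$ (strict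 inclusions; $|Q|$ is the number of steps, so $|G|=1$). It induces the filtration $\Lambda_i^{g,Q}=\Lambda^g\cap W_i$ with restricted metrics. The polygon $p_Q^g:[0,r]\to\mathbb R$ is the function with $p_Q^g(0)=p_Q^g(r)=0$, affine on each $[\dim W_{i-1},\dim W_i]$, and $p_Q^g(\dim W_i)=\deg(\Lambda_i^{g,Q})-\dim W_i\cdot\frac{\deg(\Lambda^g)}r$. There is a unique polygon $\overline p^g$ of the form $p^g_{\overline Q}$ that bounds from above all $p_Q^g$ ($Q$ running over all $F$-parabolic subgroups); it is the polygon of the canonical (Harder–Narasimhan) filtration of $\Lambda^g$. The standard parabolic subgroups are those containing the Borel subgroup of upper triangular matrices, i.e. the stabilizers $P$ of flags of coordinate subspaces $F^{r_i}\times0$, $0<r_1<\dots<r_{|P|}=r$. For polygons $p,q:[0,r]\to\mathbb R$ vanishing at $0$ and $r$, and a standard parabolic subgroup $P$ which is the stabilizer of the flag of coordinate subspaces $F^{r_i}\times0$ of dimensions $0<r_1<\dots<r_{|P|}=r$, write $q>_Pp$ if $q(r_i)-p(r_i)>0$ for all $i=1,\dots,|P|-1$ (an empty condition if $P=G$). $\mathbf 1(\cdot)$ equals $1$ if the condition holds and $0$ otherwise; $\overline p^g\le p$ is pointwise inequality on $[0,r]$. A polygon is a continuous piecewise affine function, and "convex" means that its slopes decrease from left to right (the region under the graph is convex). *)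

theory Defs
  imports
    "HOL-Analysis.Infinite_Sum"
    "HOL-Algebra.Chinese_Remainder"
    "HOL-Algebra.QuotRing"
    "Jordan_Normal_Form.VS_Connect"
begin

section \<open>Number fields and their places\<close>

class number_field = field_char_0 +
  assumes finite_degree:
    "\<exists>B. finite B \<and> (\<forall>x. \<exists>c. x = (\<Sum>b\<in>B. of_rat (c b) * b))"

instance rat :: number_field
proof
  show "\<exists>B::rat set. finite B \<and> (\<forall>x. \<exists>c. x = (\<Sum>b\<in>B. of_rat (c b) * b))"
    by (rule exI[of _ "{1}"]) (auto intro!: exI[of _ "\<lambda>_. _"])
qed

definition ring_of_integers :: "'a::number_field ring" where
  "ring_of_integers = class_ring\<lparr>carrier := {x. algebraic_int x}\<rparr>"

definition finite_places :: "'a::number_field set set" where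
  "finite_places = {v. primeideal v ring_of_integers \<and> v \<noteq> {0}}"

definition embeddings :: "('a::number_field \<Rightarrow> complex) set" where
  "embeddings = {\<sigma>. field_hom \<sigma>}"

text \<open>An Archimedean place is a conjugacy class of complex embeddings; it is a singleton exactly
  when the place is real.\<close>

definition arch_places :: "('a::number_field \<Rightarrow> complex) set set" where
  "arch_places = {{\<sigma>, cnj \<circ> \<sigma>} |\<sigma>. \<sigma> \<in> embeddings}"

definition real_place :: "('a::number_field \<Rightarrow> complex) set \<Rightarrow> bool" where
  "real_place w \<longleftrightarrow> card w = 1"

definition complex_places :: "('a::number_field \<Rightarrow> complex) set set" where
  "complex_places = {w \<in> arch_places. \<not> real_place w}"

text \<open>At a complex place one of the two conjugate embeddings is chosen once and for all, to identify
  the completion with the complex numbers.\<close>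

definition arch_emb :: "('a::number_field \<Rightarrow> complex) set \<Rightarrow> 'a \<Rightarrow> complex" where
  "arch_emb w = (SOME \<sigma>. \<sigma> \<in> w)"

definition arch_field :: "('a::number_field \<Rightarrow> complex) set \<Rightarrow> complex ring" where
  "arch_field w = class_ring\<lparr>carrier := (if real_place w then \<real> else UNIV)\<rparr>"


section \<open>Completions at the finite places\<close>

definition place_ord_int :: "'a::number_field set \<Rightarrow> 'a \<Rightarrow> nat" where
  "place_ord_int v a = (GREATEST n. a \<in> v [^]\<^bsub>ideals_set ring_of_integers\<^esub> n)"

definition place_ord :: "'a::number_field set \<Rightarrow> 'a \<Rightarrow> int" where
  "place_ord v x = (THE k. \<exists>a b. algebraic_int a \<and> algebraic_int b \<and> a \<noteq> 0 \<and> b \<noteq> 0 \<and> x = a / b \<and>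
     k = int (place_ord_int v a) - int (place_ord_int v b))"

definition place_abs :: "'a::number_field set \<Rightarrow> 'a \<Rightarrow> real" where
  "place_abs v x = (if x = 0 then 0
     else real (card (carrier (ring_of_integers Quot v))) powi (- place_ord v x))"

definition cauchy_ring :: "'a::number_field set \<Rightarrow> (nat \<Rightarrow> 'a) ring" where
  "cauchy_ring v =
    \<lparr>carrier = {x. \<forall>e>0. \<exists>N. \<forall>m\<ge>N. \<forall>n\<ge>N. place_abs v (x m - x n) < e},
     mult = (\<lambda>x y n. x n * y n), one = (\<lambda>_. 1), zero = (\<lambda>_. 0), add = (\<lambda>x y n. x n + y n)\<rparr>"

definition null_seqs :: "'a::number_field set \<Rightarrow> (nat \<Rightarrow> 'a) set" where
  "null_seqs v = {x. (\<lambda>n. place_abs v (x n)) \<longlonglongrightarrow> 0}"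

definition local_field :: "'a::number_field set \<Rightarrow> (nat \<Rightarrow> 'a) set ring" where
  "local_field v = cauchy_ring v Quot null_seqs v"

definition local_emb :: "'a::number_field set \<Rightarrow> 'a \<Rightarrow> (nat \<Rightarrow> 'a) set" where
  "local_emb v x = null_seqs v +>\<^bsub>cauchy_ring v\<^esub> (\<lambda>_. x)"

text \<open>The limit is the absolute value on the completion; it is the same for all representatives.\<close>

definition local_integers :: "'a::number_field set \<Rightarrow> (nat \<Rightarrow> 'a) set set" where
  "local_integers v =
    {c \<in> carrier (local_field v). \<exists>x\<in>c. lim (\<lambda>n. place_abs v (x n)) \<le> 1}"


section \<open>Adeles and general linear groups\<close>

definition product_ring :: "'i set \<Rightarrow> ('i \<Rightarrow> 'b ring) \<Rightarrow> ('i \<Rightarrow> 'b) ring" where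
  "product_ring I R =
    \<lparr>carrier = (\<Pi>\<^sub>E i\<in>I. carrier (R i)),
     mult = (\<lambda>a b. \<lambda>i\<in>I. a i \<otimes>\<^bsub>R i\<^esub> b i), one = (\<lambda>i\<in>I. \<one>\<^bsub>R i\<^esub>),
     zero = (\<lambda>i\<in>I. \<zero>\<^bsub>R i\<^esub>), add = (\<lambda>a b. \<lambda>i\<in>I. a i \<oplus>\<^bsub>R i\<^esub> b i)\<rparr>"

type_synonym 'a adele =
  "('a set \<Rightarrow> (nat \<Rightarrow> 'a) set) \<times> (('a \<Rightarrow> complex) set \<Rightarrow> complex)"

definition finite_adele_ring :: "('a::number_field set \<Rightarrow> (nat \<Rightarrow> 'a) set) ring" where
  "finite_adele_ring = (product_ring finite_places local_field)
    \<lparr>carrier := {a \<in> carrier (product_ring finite_places local_field).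
                  finite {v \<in> finite_places. a v \<notin> local_integers v}}\<rparr>"

definition adele_ring :: "'a::number_field adele ring" where
  "adele_ring = RDirProd finite_adele_ring (product_ring arch_places arch_field)"

definition adele_diag :: "'a::number_field \<Rightarrow> 'a adele" where
  "adele_diag x = (\<lambda>v\<in>finite_places. local_emb v x, \<lambda>w\<in>arch_places. arch_emb w x)"

text \<open>Matrices over a ring given by a record; the multiplication of the matrix library is only
  available for type-class rings.\<close>

definition mat_times :: "('b, 'm) ring_scheme \<Rightarrow> 'b mat \<Rightarrow> 'b mat \<Rightarrow> 'b mat" where
  "mat_times R A B = mat (dim_row A) (dim_col B)
     (\<lambda>(i, j). \<Oplus>\<^bsub>R\<^esub>k\<in>{..<dim_col A}. A $$ (i, k) \<otimes>\<^bsub>R\<^esub> B $$ (k, j))"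

definition mat_times_vec :: "('b, 'm) ring_scheme \<Rightarrow> 'b mat \<Rightarrow> 'b vec \<Rightarrow> 'b vec" where
  "mat_times_vec R A x = vec (dim_row A)
     (\<lambda>i. \<Oplus>\<^bsub>R\<^esub>k\<in>{..<dim_col A}. A $$ (i, k) \<otimes>\<^bsub>R\<^esub> x $ k)"

definition mat_monoid :: "nat \<Rightarrow> ('b, 'm) ring_scheme \<Rightarrow> 'b mat monoid" where
  "mat_monoid r R =
    \<lparr>carrier = {A \<in> carrier_mat r r. \<forall>i<r. \<forall>j<r. A $$ (i, j) \<in> carrier R},
     mult = mat_times R,
     one = mat r r (\<lambda>(i, j). if i = j then \<one>\<^bsub>R\<^esub> else \<zero>\<^bsub>R\<^esub>)\<rparr>"

definition GL_adele :: "nat \<Rightarrow> 'a::number_field adele mat monoid" where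
  "GL_adele r = units_of (mat_monoid r adele_ring)"

definition GL_field :: "nat \<Rightarrow> 'b::field mat monoid" where
  "GL_field r = units_of (ring_mat TYPE('b) r ())"

definition rational_mult :: "nat \<Rightarrow> 'a::number_field mat \<Rightarrow> 'a adele mat \<Rightarrow> 'a adele mat" where
  "rational_mult r \<delta> g = map_mat adele_diag \<delta> \<otimes>\<^bsub>GL_adele r\<^esub> g"

definition fin_comp :: "'a adele mat \<Rightarrow> 'a::number_field set \<Rightarrow> (nat \<Rightarrow> 'a) set mat" where
  "fin_comp g v = map_mat (\<lambda>a. fst a v) g"

definition arch_comp :: "'a adele mat \<Rightarrow> ('a::number_field \<Rightarrow> complex) set \<Rightarrow> complex mat" where
  "arch_comp g w = map_mat (\<lambda>a. snd a w) g"


section \<open>Lattices and their degrees\<close>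

text \<open>A hermitian lattice inside \<open>F\<^sup>r\<close> is given by a module \<open>M\<close> and, for every Archimedean place
  \<open>w\<close>, an inner product \<open>h w\<close> on the completion of \<open>F\<^sup>r\<close> at \<open>w\<close>; the metric of the lattice is
  its restriction to the span of \<open>M\<close>.\<close>

type_synonym 'a metric = "('a \<Rightarrow> complex) set \<Rightarrow> complex vec \<Rightarrow> complex vec \<Rightarrow> complex"

definition adelic_module :: "nat \<Rightarrow> 'a::number_field adele mat \<Rightarrow> 'a vec set" where
  "adelic_module r g =
    {x \<in> carrier_vec r. \<forall>v\<in>finite_places. \<exists>y\<in>carrier_vec r. (\<forall>i<r. y $ i \<in> local_integers v) \<and>
       map_vec (local_emb v) x = mat_times_vec (local_field v) (fin_comp g v) y}"

definition adelic_metric :: "nat \<Rightarrow> 'a::number_field adele mat \<Rightarrow> 'a metric" where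
  "adelic_metric r g w x y =
    (let B = inv\<^bsub>GL_field r\<^esub> (arch_comp g w) in (B *\<^sub>v x) \<bullet>c (B *\<^sub>v y))"

definition subspace_dim :: "nat \<Rightarrow> 'a::field vec set \<Rightarrow> nat" where
  "subspace_dim r W = vectorspace.dim class_ring ((module_vec TYPE('a) r)\<lparr>carrier := W\<rparr>)"

definition lattice_rank :: "nat \<Rightarrow> 'a::number_field vec set \<Rightarrow> nat" where
  "lattice_rank r M =
     subspace_dim r (LinearCombinations.module.span class_ring (module_vec TYPE('a) r) M)"

definition int_basis :: "('b, 'm) ring_scheme \<Rightarrow> 'b set \<Rightarrow> 'b list \<Rightarrow> bool" where
  "int_basis G M bs \<longleftrightarrow>
    bij_betw (\<lambda>c. \<Oplus>\<^bsub>G\<^esub>i\<in>{..<length bs}. [c i] \<cdot>\<^bsub>G\<^esub> (bs ! i))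
      ({..<length bs} \<rightarrow>\<^sub>E (UNIV :: int set)) M"

text \<open>At a real place the inner product of vectors of \<open>F\<^sup>r\<close> is real, so that taking real parts
  changes nothing there.\<close>

definition euclid_ip :: "'a::number_field metric \<Rightarrow> 'a vec \<Rightarrow> 'a vec \<Rightarrow> real" where
  "euclid_ip h x y =
    (\<Sum>w\<in>arch_places. Re (h w (map_vec (arch_emb w) x) (map_vec (arch_emb w) y)))"

text \<open>The covolume of a lattice in a Euclidean space, as the square root of the Gram determinant of
  any basis over the integers. Such a basis of \<open>M\<close> is a basis over the reals of \<open>M\<close> tensored with
  the reals.\<close>

definition covolume :: "nat \<Rightarrow> 'a::number_field vec set \<Rightarrow> 'a metric \<Rightarrow> real" where
  "covolume r M h = (THE V. \<exists>bs. int_basis (module_vec TYPE('a) r) M bs \<and>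
     V = sqrt (det (mat (length bs) (length bs) (\<lambda>(i, j). euclid_ip h (bs ! i) (bs ! j)))))"

definition lattice_volume :: "nat \<Rightarrow> 'a::number_field vec set \<Rightarrow> 'a metric \<Rightarrow> real" where
  "lattice_volume r M h =
     2 ^ (card (complex_places :: ('a \<Rightarrow> complex) set set) * lattice_rank r M) * covolume r M h"

definition abs_discriminant :: "'a::number_field itself \<Rightarrow> real" where
  "abs_discriminant _ = (THE D. \<exists>(bs :: 'a list) ss.
     int_basis class_ring {x. algebraic_int x} bs \<and> distinct ss \<and> set ss = embeddings \<and>
     D = cmod ((det (mat (length ss) (length bs) (\<lambda>(i, j). (ss ! i) (bs ! j))))\<^sup>2))"

definition lattice_deg :: "nat \<Rightarrow> 'a::number_field vec set \<Rightarrow> 'a metric \<Rightarrow> real" where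
  "lattice_deg r M h =
     - ln (lattice_volume r M h) + real (lattice_rank r M) / 2 * ln (abs_discriminant TYPE('a))"


section \<open>Parabolic subgroups\<close>

definition is_flag :: "nat \<Rightarrow> 'a::field vec set list \<Rightarrow> bool" where
  "is_flag r Ws \<longleftrightarrow> Ws \<noteq> [] \<and> hd Ws = {0\<^sub>v r} \<and> last Ws = carrier_vec r \<and>
     (\<forall>W\<in>set Ws. subspace class_ring W (module_vec TYPE('a) r)) \<and> sorted_wrt (\<subset>) Ws"

definition flag_stabilizer :: "nat \<Rightarrow> 'a::field vec set list \<Rightarrow> 'a mat set" where
  "flag_stabilizer r Ws = {A \<in> carrier (GL_field r). \<forall>W\<in>set Ws. (\<lambda>x. A *\<^sub>v x) ` W = W}"

text \<open>A parabolic subgroup over \<open>F\<close> is represented by its group of \<open>F\<close>-rational points, which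
  determines the flag since \<open>F\<close> is infinite.\<close>

definition parabolics :: "nat \<Rightarrow> 'a::number_field mat set set" where
  "parabolics r = {Q. \<exists>Ws. is_flag r Ws \<and> Q = flag_stabilizer r Ws}"

definition parabolic_flag :: "nat \<Rightarrow> 'a::number_field mat set \<Rightarrow> 'a vec set list" where
  "parabolic_flag r Q = (THE Ws. is_flag r Ws \<and> Q = flag_stabilizer r Ws)"

definition parabolic_steps :: "nat \<Rightarrow> 'a::number_field mat set \<Rightarrow> nat" where
  "parabolic_steps r Q = length (parabolic_flag r Q) - 1"

definition borel_subgroup :: "nat \<Rightarrow> 'a::field mat set" where
  "borel_subgroup r = {A \<in> carrier (GL_field r). upper_triangular A}"

definition standard_parabolics :: "nat \<Rightarrow> 'a::number_field mat set set" where
  "standard_parabolics r = {P \<in> parabolics r. borel_subgroup r \<subseteq> P}"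


section \<open>Polygons\<close>

text \<open>\<open>p\<close> is continuous on \<open>[0, r]\<close> and affine with slope \<open>ss ! i\<close> between the breakpoints
  \<open>xs ! i\<close> and \<open>xs ! Suc i\<close>, the slopes decreasing from left to right. So, as a function, \<open>p\<close> is
  concave; it is the region under the graph that is convex.\<close>

definition convex_polygon :: "nat \<Rightarrow> (real \<Rightarrow> real) \<Rightarrow> bool" where
  "convex_polygon r p \<longleftrightarrow> (\<exists>xs ss. length xs = Suc (length ss) \<and> sorted_wrt (<) xs \<and>
     hd xs = 0 \<and> last xs = real r \<and>
     (\<forall>i<length ss. \<forall>t\<in>{xs ! i..xs ! Suc i}. p t = p (xs ! i) + ss ! i * (t - xs ! i)) \<and>
     sorted_wrt (\<ge>) ss)"

text \<open>For a strictly increasing list \<open>xs\<close>: the function on \<open>[hd xs, last xs]\<close> that takes the values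
  \<open>ys\<close> at \<open>xs\<close> and is affine in between.\<close>

definition interpolation :: "real list \<Rightarrow> real list \<Rightarrow> real \<Rightarrow> real" where
  "interpolation xs ys = (\<lambda>t\<in>{hd xs..last xs}. let i = (LEAST i. t \<le> xs ! Suc i) in
     ys ! i + (ys ! Suc i - ys ! i) / (xs ! Suc i - xs ! i) * (t - xs ! i))"

text \<open>The values prescribed at \<open>0\<close> and at \<open>r\<close> are both \<open>0\<close>.\<close>

definition parabolic_polygon ::
  "nat \<Rightarrow> 'a::number_field adele mat \<Rightarrow> 'a mat set \<Rightarrow> real \<Rightarrow> real" where
  "parabolic_polygon r g Q =
    (let M = adelic_module r g; h = adelic_metric r g; Ws = parabolic_flag r Q in
     interpolation (map (\<lambda>W. real (subspace_dim r W)) Ws)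
       (map (\<lambda>W. lattice_deg r (M \<inter> W) h - real (subspace_dim r W) * (lattice_deg r M h / real r)) Ws))"

definition canonical_polygon :: "nat \<Rightarrow> 'a::number_field adele mat \<Rightarrow> real \<Rightarrow> real" where
  "canonical_polygon r g = (THE q. (\<exists>Q\<in>parabolics r. q = parabolic_polygon r g Q) \<and>
     (\<forall>Q\<in>parabolics r. \<forall>t\<in>{0..real r}. parabolic_polygon r g Q t \<le> q t))"

definition polygon_gt ::
  "nat \<Rightarrow> 'a::number_field mat set \<Rightarrow> (real \<Rightarrow> real) \<Rightarrow> (real \<Rightarrow> real) \<Rightarrow> bool" where
  "polygon_gt r P q p \<longleftrightarrow> (\<forall>i\<in>{1..<parabolic_steps r P}.
     let d = real (subspace_dim r (parabolic_flag r P ! i)) in q d - p d > 0)"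

text \<open>The contribution of a coset in \<open>P(F)\G(F)\<close>, computed with an arbitrary representative.\<close>

definition coset_term ::
  "nat \<Rightarrow> (real \<Rightarrow> real) \<Rightarrow> 'a::number_field adele mat \<Rightarrow> 'a mat set \<Rightarrow> 'a mat set \<Rightarrow> real" where
  "coset_term r p g P c =
    (let \<delta> = (SOME \<delta>. \<delta> \<in> c) in
     of_bool (polygon_gt r P (parabolic_polygon r (rational_mult r \<delta> g) P) p))"

end

theory Submission
 imports
 Defs
 "HOL-Computational_Algebra.Field_as_Ring"
 "HOL-Computational_Algebra.Fundamental_Theorem_Algebra"
 "HOL-Library.Function_Algebras"
 "Jordan_Normal_Form.Char_Poly"
begin

text \<open>For a rational subspace \<open>W\<close> let \<open>node W\<close> be its ordinate in the polygons. Fischer's inequality for Gram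
determinants makes \<open>node\<close> supermodular on the lattice of subspaces, and only finitely many nodes exceed
a given bound. Cosets \<open>\<delta>\<close> of a standard parabolic correspond to chains of subspaces of prescribed
dimensions, and the term of \<open>\<delta>\<close> says that the chain lies in \<open>{W. node W > p (dim W)}\<close>. So the right-hand
side is the alternating count of chains in this finite set; by supermodularity and concavity of \<open>p\<close> its
order complex is contractible unless it is empty, which happens exactly when the canonical polygon lies below \<open>p\<close>.\<close>

text \<open>Everything metric reduces to Gram determinants of integral bases: the powers of 2 and
  the discriminant enter the degree linearly in the rank, so they cancel in \<open>node\<close>. The
  definite descriptions in the definitions (covolume, order at a place, flag of a parabolic,
  canonical polygon) have a meaning only once uniqueness is known, and this dictates the arithmetic
  to be built: valuations of prime ideals, obtained from an inverse uniformizer instead of unique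
  factorization; finite generation of the module of an adelic matrix, by squeezing it between two
  lattices; and real independence of rationally independent vectors, because the embeddings span the
  rational functionals. Concavity of \<open>p\<close> enters twice: it makes \<open>node\<close>
  minus \<open>p\<close> supermodular, and it lets the vertices alone decide whether a polygon lies
  below \<open>p\<close>. Vectors are turned into functions on the naturals, which form a
  commutative ring, so that integral combinations of field elements and of vectors are treated
  alike.\<close>

abbreviation (input) "FP \<equiv> finite_places"
abbreviation (input) "aint \<equiv> algebraic_int"
abbreviation mvec (infixl "*v" 70) where "A *v x \<equiv> A *\<^sub>v x"

section \<open>Alternating sums over chains\<close>

lemma sum_involution_zero:
 fixes g :: "'b => real"
 assumes "!!x. x : S ==> i x : S" "!!x. x : S ==> i (i x) = x" "!!x. x : S ==> g (i x) = - g x"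
 shows "sum g S = 0"
proof -
 have "sum g S = (SUM x:S. - g x)"
 by (rule sum.reindex_bij_witness[of _ i i]) (use assms in auto)
 then show ?thesis by (simp add: sum_negf)
qed

definition chains_in :: "'b set set => 'b set set set" where
 "chains_in D = {K. K <= D & (ALL A:K. ALL B:K. A <= B \<or> B <= A)}"

definition toggle :: "'b => 'b set => 'b set" where
 "toggle a K = (if a : K then K - {a} else insert a K)"

lemma toggle_toggle [simp]: "toggle a (toggle a K) = K"
 by (auto simp: toggle_def)

lemma toggle_sign: "finite K ==> (-1) ^ card (toggle a K) = - ((-1) ^ card K :: real)"
 by (cases "card K") (auto simp: toggle_def card_insert_if card_Diff_singleton)

lemma chain_Inter_mem:
 assumes "finite N" "N ~= {}" "ALL A:N. ALL B:N. A <= B \<or> B <= A"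
 shows "\<Inter>N : N"
 using assms
proof (induction N rule: finite_ne_induct)
 case (insert A N)
 then have "\<Inter>N : N" by auto
 then have "A Int \<Inter>N = A \<or> A Int \<Inter>N = \<Inter>N" using insert.prems by blast
 then show ?case using \<open>\<Inter>N : N\<close> by auto
qed simp

text \<open>The order complex is contracted by \<open>A >= A Int W <= W\<close>. The involution toggles \<open>A Int W\<close>, where
 \<open>A\<close> is the smallest member of the chain not contained in \<open>W\<close>, or \<open>W\<close> if there is none.\<close>

lemma alternating_sum_chains_zero:
 assumes "finite D" "W : D" and meet: "!!A. A : D ==> A Int W : D"
 shows "(SUM K:chains_in D. (-1) ^ card K :: real) = 0"
proof -
 define N where "N K = {A : K. ~ A <= W}" for K
 define a where "a K = (if N K = {} then W else \<Inter>(N K) Int W)" for K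
 have aW: "a K <= W" for K by (auto simp: a_def)
 have fin: "finite K" if "K : chains_in D" for K
 using that assms(1) by (auto simp: chains_in_def intro: finite_subset)
 have a_in: "a K : D" if "K : chains_in D" for K
 proof (cases "N K = {}")
 case False
 have "\<Inter>(N K) : N K" using False fin[OF that] that
 by (intro chain_Inter_mem) (auto simp: N_def chains_in_def)
 then have "\<Inter>(N K) : D" using that by (auto simp: N_def chains_in_def)
 then show ?thesis using False meet by (simp add: a_def)
 qed (use assms in "auto simp: a_def")
 \<comment> \<open>Members not contained in \<open>W\<close> contain the intersection of
   \<open>N K\<close>, hence \<open>a K\<close>. A member \<open>B\<close> inside \<open>W\<close>
   lies below every \<open>A\<close> in \<open>N K\<close>, since \<open>A <= B\<close> would put
   \<open>A\<close> inside \<open>W\<close>.\<close>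
 have cmp: "B <= a K \<or> a K <= B" if "K : chains_in D" "B : K" for K B
 proof (cases "B <= W")
 case True
 show ?thesis
 proof (cases "N K = {}")
 case False
 have "B <= A" if "A : N K" for A
 proof -
 have "A : K" "~ A <= W" using that by (auto simp: N_def)
 moreover have "A <= B \<or> B <= A" using \<open>K : _\<close> \<open>B : K\<close> \<open>A : K\<close> unfolding chains_in_def by blast
 ultimately show ?thesis using True by blast
 qed
 then show ?thesis using True False by (auto simp: a_def)
 qed (use True in "auto simp: a_def")
 qed (use that in "auto simp: a_def N_def")
 \<comment> \<open>As \<open>a K\<close> lies inside \<open>W\<close>, toggling it leaves
   \<open>N K\<close> unchanged, and with it \<open>a K\<close> itself. Without this the map would
   not be an involution.\<close>
 have N_toggle: "N (toggle (a K) K) = N K" for K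
 using aW[of K] by (auto simp: N_def toggle_def)
 then have a_toggle: "a (toggle (a K) K) = a K" for K by (subst (1 2) a_def) (simp only: N_toggle)
 show ?thesis
 proof (rule sum_involution_zero[where i = "%K. toggle (a K) K"])
 show "toggle (a K) K : chains_in D" if "K : chains_in D" for K
 proof -
 have "ALL A:K. ALL B:K. A <= B \<or> B <= A" "K <= D" using that by (auto simp: chains_in_def)
 then show ?thesis using a_in[OF that] cmp[OF that] unfolding chains_in_def toggle_def by auto
 qed
 qed (auto simp: a_toggle toggle_sign fin)
qed

lemma finite_chain_list_exists:
 assumes "finite K" "ALL A:K. ALL B:K. A <= B \<or> B <= A"
 shows "EX Ws. set Ws = K & sorted_wrt (\<subset>) Ws"
 using assms
proof (induction "card K" arbitrary: K)
 case (Suc n)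
 then have *: "\<Inter>K : K" using chain_Inter_mem[of K] by force
 obtain Ws where "set Ws = K - {\<Inter>K}" "sorted_wrt (\<subset>) Ws"
 using Suc.hyps(1)[of "K - {\<Inter>K}"] Suc.hyps(2) Suc.prems * by force
 then have "set (\<Inter>K # Ws) = K & sorted_wrt (\<subset>) (\<Inter>K # Ws)" using * by auto
 then show ?case by blast
qed auto

lemma psubset_sorted_unique:
 assumes "sorted_wrt (\<subset>) xs" "sorted_wrt (\<subset>) ys" "set xs = set ys"
 shows "xs = ys"
 using assms
proof (induction xs arbitrary: ys)
 case (Cons x xs)
 then obtain y ys' where [simp]: "ys = y # ys'" by (cases ys) auto
 have "x : set (y # ys')" "y : set (x # xs)" using Cons.prems(3) by auto
 then have "x = y \<or> y \<subset> x" "x = y \<or> x \<subset> y" using Cons.prems(1,2) by auto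
 then have "x = y" by blast
 moreover have "x ~: set xs" "y ~: set ys'" using Cons.prems by auto
 ultimately have "set xs = set ys'" using Cons.prems(3) by (metis \<open>ys = y # ys'\<close> insert_ident list.simps(15))
 then show ?case using Cons \<open>x = y\<close> by auto
qed simp

lemma psubset_nth_mono:
 assumes "sorted_wrt (\<subset>) Ws" "i <= j" "j < length Ws"
 shows "Ws ! i <= Ws ! j"
proof (cases "i = j")
 case False
 then have "Ws ! i \<subset> Ws ! j" using sorted_wrt_nth_less[OF assms(1), of i j] assms(2,3) by simp
 then show ?thesis by (rule psubset_imp_subset)
qed simp

section \<open>Supermodular functions and the Harder-Narasimhan chain\<close>

text \<open>Abstract form of the lattice of rational subspaces: \<open>join\<close> is the sum,
  \<open>dm\<close> the dimension, \<open>bt\<close> and \<open>tp\<close> are zero and the whole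
  space, \<open>f\<close> is \<open>node\<close>. Meets are plain intersections.
  \<open>finite_ge\<close> supplies every maximum taken below.\<close>

locale supermodular_lattice =
 fixes S :: "'b set set" and join :: "'b set => 'b set => 'b set" and dm :: "'b set => nat"
 and bt tp :: "'b set" and r :: nat and f :: "'b set => real"
 assumes inter: "A : S ==> B : S ==> A Int B : S"
 and join: "A : S ==> B : S ==> join A B : S"
 and join_ge: "A : S ==> B : S ==> A <= join A B" "A : S ==> B : S ==> B <= join A B"
 and dm_modular: "A : S ==> B : S ==> dm (join A B) + dm (A Int B) = dm A + dm B"
 and dm_strict: "A : S ==> B : S ==> A \<subset> B ==> dm A < dm B"
 and bt: "bt : S" "!!A. A : S ==> bt <= A" "dm bt = 0" "f bt = 0"
 and tp: "tp : S" "!!A. A : S ==> A <= tp" "dm tp = r" "f tp = 0"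
 and supermod: "A : S ==> B : S ==> f A + f B <= f (join A B) + f (A Int B)"
 and finite_ge: "finite {A : S. f A >= C}"
begin

lemma dm_mono: "A : S ==> B : S ==> A <= B ==> dm A <= dm B"
 using dm_strict[of A B] by (cases "A = B") (auto simp: psubset_eq)

lemma dm_le: "A : S ==> dm A <= r"
 using dm_mono[OF _ tp(1) tp(2)] tp(3) by auto

lemma dm_eq: "A : S ==> B : S ==> A <= B ==> dm A = dm B ==> A = B"
 using dm_strict[of A B] by auto

lemma finite_gt:
 fixes q :: "nat => real"
 shows "finite {A : S. f A > q (dm A)}"
proof (rule finite_subset)
 show "{A : S. f A > q (dm A)} <= {A : S. f A >= Min (q ` {..r})}"
 proof safe
 fix A assume A: "A : S" "q (dm A) < f A"
 then have "Min (q ` {..r}) <= q (dm A)" using dm_le by (intro Min_le) auto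
 then show "Min (q ` {..r}) <= f A" using A by simp
 qed
qed (rule finite_ge)

text \<open>The difference \<open>g\<close> of \<open>f\<close> and \<open>q\<close> is
  supermodular: concavity of \<open>q\<close> is the opposite inequality for the dimensions of meet,
  join and the two members. For a maximizer \<open>W\<close> of \<open>g\<close> the join with
  \<open>A\<close> gains nothing over \<open>W\<close>, so the meet loses nothing against
  \<open>A\<close> and stays where \<open>g\<close> is positive.\<close>

lemma meet_witness:
 fixes q :: "nat => real"
 assumes q: "!!a b c d. a <= c ==> c <= b ==> a + b = c + d ==> b <= r ==> q a + q b <= q c + q d"
 and D: "D = {A : S. f A > q (dm A)}" "D ~= {}"
 shows "EX W:D. ALL A:D. A Int W : D"
proof -
 define g where "g A = f A - q (dm A)" for A
 have "finite D" using finite_gt D by simp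
 then have fin: "finite (g ` D)" "g ` D ~= {}" using D by auto
 obtain W where W: "W : D" "g W = Max (g ` D)" using Max_in[OF fin] by auto
 \<comment> \<open>Maximality within \<open>D\<close> extends to all of \<open>S\<close>, because
   \<open>g\<close> is positive at \<open>W\<close> and nonpositive outside \<open>D\<close>. It is
   applied to the join, which need not lie in \<open>D\<close>.\<close>
 have Wmax: "g A <= g W" if "A : S" for A
 proof (cases "A : D")
 case True then show ?thesis using W fin by simp
 next
 case False
 then have "g A <= 0" "g W > 0" using that D W by (auto simp: g_def)
 then show ?thesis by simp
 qed
 have "A Int W : D" if A: "A : D" for A
 proof -
 have S: "A : S" "W : S" using A W D by auto
 have "q (dm (A Int W)) + q (dm (join A W)) <= q (dm A) + q (dm W)"
 using dm_modular[OF S] S dm_mono[of "A Int W" A] dm_mono[of A "join A W"] inter[OF S] join[OF S] join_ge(1)[OF S]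
 by (intro q) (auto intro: dm_le)
 then have "g A + g W <= g (join A W) + g (A Int W)" using supermod[OF S] by (simp add: g_def)
 moreover have "g (join A W) <= g W" using Wmax join S by blast
 ultimately have "g A <= g (A Int W)" by simp
 moreover have "g A > 0" using A D by (auto simp: g_def)
 ultimately show ?thesis using D inter S by (auto simp: g_def)
 qed
 then show ?thesis using W by blast
qed

text \<open>The vertex of the upper hull of the points \<open>(dm B, f B)\<close> at which a line of
  slope \<open>s\<close> touches it. Taking the rightmost vertex in case of a tie makes the
  maximizer unique and monotone in \<open>s\<close>.\<close>

definition slope_max :: "real => 'b set => bool" where
 "slope_max s A \<longleftrightarrow> A : S & (ALL B:S. f B - s * dm B <= f A - s * dm A &
 (f B - s * dm B = f A - s * dm A --> dm B <= dm A))"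

lemma slope_maxD:
 fixes s :: real
 assumes "slope_max s A" "B : S"
 shows "f B - s * dm B <= f A - s * dm A"
 and "f B - s * dm B = f A - s * dm A ==> dm B <= dm A"
 using assms by (simp_all add: slope_max_def)

lemma slope_max_strictI:
 fixes s :: real
 assumes "A : S" "!!B. B : S ==> f B - s * dm B < f A - s * dm A \<or> B = A"
 shows "slope_max s A"
 unfolding slope_max_def
proof (intro conjI ballI impI)
 fix B assume "B : S"
 from assms(2)[OF this] show "f B - s * dm B <= f A - s * dm A" by auto
 assume "f B - s * dm B = f A - s * dm A"
 then show "dm B <= dm A" using assms(2)[OF \<open>B : S\<close>] by auto
qed (rule assms)

lemma slope_max_exists: "EX A. slope_max s A"
proof -
 define g where "g B = f B - s * dm B" for B
 \<comment> \<open>\<open>bt\<close> has value 0, so a maximum has to be sought only where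
   \<open>g\<close> is nonnegative. There \<open>f\<close> is bounded below by
   \<open>- \<bar>s\<bar> * r\<close>, which leaves finitely many candidates.\<close>
 define T where "T = {B : S. g B >= 0}"
 have "T <= {B : S. f B >= - (\<bar>s\<bar> * r)}"
 proof
 fix B assume "B : T"
 then have B: "B : S" "f B >= s * dm B" by (auto simp: T_def g_def)
 have "\<bar>s * dm B\<bar> <= \<bar>s\<bar> * r" using dm_le[OF B(1)] by (simp add: abs_mult mult_left_mono)
 then show "B : {B : S. f B >= - (\<bar>s\<bar> * r)}" using B by auto
 qed
 then have T: "finite T" using finite_ge finite_subset by blast
 have bT: "bt : T" using bt by (auto simp: T_def g_def)
 define T' where "T' = {B : T. g B = Max (g ` T)}"
 have "Max (g ` T) : g ` T" using T bT by (intro Max_in) auto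
 then have T': "finite T'" "T' ~= {}" using T by (auto simp: T'_def)
 have "Max (dm ` T') : dm ` T'" using T' by (intro Max_in) auto
 then obtain A where A: "A : T'" "dm A = Max (dm ` T')" by auto
 have gA: "g A >= g B" if "B : S" for B
 proof (cases "B : T")
 case True then show ?thesis using A T by (auto simp: T'_def)
 qed (use that A in "auto simp: T'_def T_def")
 have "dm B <= dm A" if "B : S" "g B = g A" for B
 proof -
 have "B : T'" using that A by (auto simp: T'_def T_def)
 then show ?thesis using A T' by simp
 qed
 then have "slope_max s A" using gA A by (auto simp: slope_max_def g_def T'_def T_def)
 then show ?thesis ..
qed

text \<open>\<open>k\<close> is both the drop from \<open>A\<close> to the meet and the gain from
  \<open>B\<close> to the join. Optimality of \<open>A\<close> against the meet and of
  \<open>B\<close> against the join, combined by supermodularity, gives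
  \<open>s * k <= s' * k\<close>. A positive \<open>k\<close> would force \<open>s = s'\<close> and
  a tie between \<open>B\<close> and the larger join, which the rule for ties excludes.\<close>

lemma slope_max_mono:
 assumes A: "slope_max s A" and B: "slope_max s' B" and "s' <= s"
 shows "A <= B"
proof -
 have S: "A : S" "B : S" using A B by (auto simp: slope_max_def)
 define k where "k = real (dm A) - real (dm (A Int B))"
 have k0: "k >= 0" using dm_mono[of "A Int B" A] S inter by (auto simp: k_def)
 have kj: "real (dm (join A B)) = dm B + k" using dm_modular[OF S] by (simp add: k_def)
 have 1: "f (join A B) - s' * dm (join A B) <= f B - s' * dm B"
 using B join[OF S] by (auto simp: slope_max_def)
 have 2: "f (A Int B) - s * dm (A Int B) <= f A - s * dm A"
 using A inter[OF S] by (auto simp: slope_max_def)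
 have 3: "f (join A B) + f (A Int B) >= f A + f B" using supermod[OF S] by simp
 have "s * k <= s' * k" using 1 2 3 unfolding kj by (simp add: k_def algebra_simps)
 have "k = 0"
 proof (rule ccontr)
 assume "k ~= 0"
 then have "s = s'" using \<open>s * k <= s' * k\<close> k0 \<open>s' <= s\<close> by simp
 then have "f (join A B) - s' * dm (join A B) = f B - s' * dm B"
 using 1 2 3 unfolding kj k_def by (simp add: algebra_simps)
 then have "dm (join A B) <= dm B" using B join[OF S] by (auto simp: slope_max_def)
 then show False using kj k0 \<open>k ~= 0\<close> by simp
 qed
 then show ?thesis using dm_eq[of "A Int B" A] S inter by (auto simp: k_def)
qed

lemma slope_max_bt: "EX s. slope_max s bt" and slope_max_tp: "EX s. slope_max s tp"
proof -
 \<comment> \<open>\<open>M\<close> bounds \<open>f\<close> from above. At slope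
   \<open>M + 1\<close> a single dimension costs more than \<open>f\<close> can gain, so
   \<open>bt\<close> is strictly best; at slope \<open>- (M + 1)\<close> a single missing dimension
   costs more, so \<open>tp\<close> is strictly best.\<close>
 define M where "M = Max (f ` {A : S. f A >= 0})"
 have fin: "finite (f ` {A : S. f A >= 0})" using finite_ge by simp
 have M0: "M >= 0" unfolding M_def using fin bt by (intro Max_ge) (auto intro!: image_eqI[of _ _ bt])
 have M: "f A <= M" if "A : S" for A
 proof (cases "f A >= 0")
 case True then show ?thesis unfolding M_def using fin that by (intro Max_ge) auto
 qed (use M0 in auto)
 have "f A - (M + 1) * dm A < 0 \<or> A = bt" if "A : S" for A
 proof (cases "A = bt")
 case False
 then have "real (dm A) >= 1" using dm_strict[OF bt(1) that] bt(2)[OF that] bt(3) by force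
 then have "M + 1 <= (M + 1) * dm A" using M0 by simp
 then show ?thesis using M[OF that] by linarith
 qed simp
 then have "slope_max (M + 1) bt" using bt(1,3,4) by (intro slope_max_strictI) auto
 then show "EX s. slope_max s bt" ..
 have *: "f A + (M + 1) * dm A < (M + 1) * r \<or> A = tp" if "A : S" for A
 proof (cases "A = tp")
 case False
 then have "real (dm A) + 1 <= r" using dm_strict[OF that tp(1)] tp(2)[OF that] tp(3) by force
 then have "(M + 1) * (dm A + 1) <= (M + 1) * r" using M0 by (intro mult_left_mono) auto
 then show ?thesis using M[OF that] by (simp add: algebra_simps)
 qed simp
 have *: "f A - (- (M + 1)) * dm A < f tp - (- (M + 1)) * dm tp \<or> A = tp" if "A : S" for A
 using *[OF that] tp(3,4) by (simp only: minus_mult_left[symmetric] diff_minus_eq_add add_0)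
 have "slope_max (- (M + 1)) tp" using tp(1) * by (intro slope_max_strictI)
 then show "EX s. slope_max s tp" ..
qed

text \<open>The maximizers for all slopes are nested by \<open>slope_max_mono\<close> and differ in
  dimension, so they form a finite chain from \<open>bt\<close> to \<open>tp\<close>. That the line
  through two consecutive ones bounds \<open>f\<close> everywhere is what later makes the polygon of
  this chain dominate all others.\<close>

lemma harder_narasimhan:
 obtains Ws where "Ws ~= []" "hd Ws = bt" "last Ws = tp" "set Ws <= S" "sorted_wrt (\<subset>) Ws"
 "!!i. Suc i < length Ws ==> EX (s::real) (c::real). f (Ws ! i) = c + s * dm (Ws ! i) &
 f (Ws ! Suc i) = c + s * dm (Ws ! Suc i) & (ALL A:S. f A <= c + s * dm A)"
proof -
 define C where "C = {A. EX s. slope_max s A}"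
 have CS: "C <= S" by (auto simp: C_def slope_max_def)
 have ch: "ALL A:C. ALL B:C. A <= B \<or> B <= A"
 proof (intro ballI)
 fix A B assume "A : C" "B : C"
 then obtain s s' where "slope_max s A" "slope_max s' B" by (auto simp: C_def)
 then show "A <= B \<or> B <= A" using slope_max_mono[of s A s' B] slope_max_mono[of s' B s A] by linarith
 qed
 have "inj_on dm C"
 proof (rule inj_onI)
 fix A B assume "A : C" "B : C" "dm A = dm B"
 moreover from this have "A <= B \<or> B <= A" "A : S" "B : S" using ch CS by blast+
 ultimately show "A = B" using dm_eq[of A B] dm_eq[of B A] by auto
 qed
 moreover have "dm ` C <= {..r}" using CS dm_le by auto
 ultimately have "finite C" using finite_imageD finite_subset by blast
 then obtain Ws where Ws: "set Ws = C" "sorted_wrt (\<subset>) Ws" using finite_chain_list_exists[OF _ ch] by blast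
 have mem: "bt : C" "tp : C" using slope_max_bt slope_max_tp by (auto simp: C_def)
 then have ne: "Ws ~= []" using Ws by auto
 have hd: "hd Ws = bt"
 proof -
 obtain i where i: "i < length Ws" "bt = Ws ! i" using mem Ws by (metis in_set_conv_nth)
 have "Ws ! 0 : S" using CS Ws(1) ne nth_mem[of 0 Ws] by auto
 then have "bt <= Ws ! 0" by (rule bt(2))
 moreover have "Ws ! 0 <= bt" using psubset_nth_mono[OF Ws(2) _ i(1), of 0] i by simp
 ultimately show ?thesis using ne by (simp add: hd_conv_nth)
 qed
 have last: "last Ws = tp"
 proof -
 obtain i where i: "i < length Ws" "tp = Ws ! i" using mem Ws by (metis in_set_conv_nth)
 have "Ws ! (length Ws - 1) : S" using CS Ws(1) ne nth_mem[of "length Ws - 1" Ws] by auto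
 then have "Ws ! (length Ws - 1) <= tp" by (rule tp(2))
 moreover have "tp <= Ws ! (length Ws - 1)" using psubset_nth_mono[OF Ws(2), of i "length Ws - 1"] i by simp
 ultimately show ?thesis using ne by (simp add: last_conv_nth)
 qed
 have step: "EX (s::real) (c::real). f (Ws ! i) = c + s * dm (Ws ! i) &
 f (Ws ! Suc i) = c + s * dm (Ws ! Suc i) & (ALL A:S. f A <= c + s * dm A)"
 if i: "Suc i < length Ws" for i
 proof -
 let ?A = "Ws ! i" and ?B = "Ws ! Suc i"
 have AB: "?A \<subset> ?B" using sorted_wrt_nth_less[OF Ws(2), of i "Suc i"] i by simp
 have "?A : C" "?B : C" using Ws(1) i nth_mem[of i Ws] nth_mem[of "Suc i" Ws] by auto
 then obtain t t' where t: "slope_max t ?A" "slope_max t' ?B" by (auto simp: C_def)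
 have S: "?A : S" "?B : S" using t by (auto simp: slope_max_def)
 have dl: "dm ?A < dm ?B" using dm_strict[OF S AB] .
 define s where "s = (f ?B - f ?A) / (real (dm ?B) - dm ?A)"
 have s: "f ?B - s * dm ?B = f ?A - s * dm ?A"
 proof -
 have "s * (real (dm ?B) - dm ?A) = f ?B - f ?A" using dl by (simp add: s_def)
 then show ?thesis by (simp add: algebra_simps)
 qed
 \<comment> \<open>\<open>s\<close> is the slope of the segment from \<open>?A\<close> to
   \<open>?B\<close>. Optimality of \<open>?A\<close> at \<open>t\<close> and of \<open>?B\<close>
   at \<open>t'\<close> gives \<open>t' <= s <= t\<close>, so monotonicity squeezes \<open>W\<close>
   between them. \<open>W\<close> is not \<open>?A\<close>, since \<open>?B\<close> has the same
   value and a larger dimension; as the chain has no member strictly in between,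
   \<open>W = ?B\<close>, and the line supports.\<close>
 obtain W where W: "slope_max s W" using slope_max_exists by blast
 have "f ?B - t * dm ?B < f ?A - t * dm ?A"
 using slope_maxD[OF t(1) S(2)] dl by linarith
 then have "(s - t) * (real (dm ?B) - dm ?A) < 0" using s by (simp add: algebra_simps)
 then have "s <= t" using dl by (simp add: mult_less_0_iff)
 then have AW: "?A <= W" using slope_max_mono[OF t(1) W] by blast
 have "f ?A - t' * dm ?A <= f ?B - t' * dm ?B" using slope_maxD(1)[OF t(2) S(1)] .
 then have "(s - t') * (real (dm ?B) - dm ?A) >= 0" using s by (simp add: algebra_simps)
 then have "t' <= s" using dl by (simp add: zero_le_mult_iff)
 then have WB: "W <= ?B" using slope_max_mono[OF W t(2)] by blast
 have "W ~= ?A" using slope_maxD(2)[OF W S(2)] s dl by auto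
 have "W : set Ws" using W Ws by (auto simp: C_def)
 then obtain j where j: "j < length Ws" "W = Ws ! j" by (metis in_set_conv_nth)
 have "~ j <= i"
 proof
 assume "j <= i"
 then have "W <= ?A" using psubset_nth_mono[OF Ws(2), of j i] i j by simp
 then show False using AW \<open>W ~= ?A\<close> by blast
 qed
 then have "?B <= W" using psubset_nth_mono[OF Ws(2), of "Suc i" j] j by simp
 then have "W = ?B" using WB by blast
 then have "ALL A:S. f A - s * dm A <= f ?B - s * dm ?B" using W unfolding slope_max_def by blast
 then show ?thesis using s by (intro exI[of _ s] exI[of _ "f ?B - s * dm ?B"]) (auto simp: algebra_simps)
 qed
 show thesis
 proof (rule that[OF ne hd last _ Ws(2)])
 show "set Ws <= S" using CS Ws by simp
 qed (rule step)
qed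

end

section \<open>Integral combinations and bases of quotients\<close>

text \<open>Abelian groups are handled inside a commutative ring, where an integer multiple is a
  product with \<open>of_int\<close>. This covers number fields and, with pointwise operations,
  functions from the naturals to a number field. Coefficients are total functions of which only the
  values below the length count.\<close>

definition zcomb :: "(nat => int) => 'v::comm_ring_1 list => 'v" where
 "zcomb c xs = (SUM i<length xs. of_int (c i) * xs ! i)"

definition zspan :: "'v::comm_ring_1 list => 'v set" where
 "zspan xs = range (%c. zcomb c xs)"

definition zindep :: "'v::comm_ring_1 list => bool" where
 "zindep xs \<longleftrightarrow> (ALL c. zcomb c xs = 0 --> (ALL i<length xs. c i = 0))"

definition zsub :: "'v::comm_ring_1 set => bool" where
 "zsub H \<longleftrightarrow> 0 : H & (ALL x:H. ALL y:H. x - y : H)"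

lemma zsubD:
 assumes "zsub H"
 shows "0 : H" "x : H ==> y : H ==> x - y : H" "x : H ==> - x : H"
 "x : H ==> y : H ==> x + y : H"
proof -
 show 0: "0 : H" and d: "!!x y. x : H ==> y : H ==> x - y : H"
 using assms by (auto simp: zsub_def)
 show m: "- x : H" if "x : H" for x using d[OF 0 that] by simp
 show "x + y : H" if "x : H" "y : H" for x y using d[OF that(1) m[OF that(2)]] by simp
qed

lemma zsub_of_nat_mult: "zsub H ==> x : H ==> of_nat n * x : H"
 by (induction n) (auto simp: zsubD algebra_simps)

lemma zsub_of_int_mult: "zsub H ==> x : H ==> of_int c * x : H"
 using zsub_of_nat_mult[of H x "nat c"] zsub_of_nat_mult[of H x "nat (- c)"] zsubD(3)[of H "of_nat (nat (- c)) * x"]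
 by (cases "c >= 0") (auto simp: of_nat_nat)

lemma zsub_sum: "zsub H ==> (!!i. i : I ==> f i : H) ==> sum f I : H"
 by (induction I rule: infinite_finite_induct) (auto simp: zsubD)

lemma zcomb_cong: "(!!i. i < length xs ==> c i = d i) ==> zcomb c xs = zcomb d xs"
 by (simp add: zcomb_def)

lemma zcomb_Nil [simp]: "zcomb c [] = 0"
 by (simp add: zcomb_def)

lemma sum_lessThan_add: "(SUM i<m + n. f i) = (SUM i<m. f i) + (SUM i<n. f (m + i :: nat) :: 'b::comm_monoid_add)"
 by (induction n) (simp_all add: add.assoc)

lemma zcomb_append:
 "zcomb c (xs @ ys) = zcomb c xs + zcomb (%i. c (length xs + i)) ys"
 by (simp add: zcomb_def sum_lessThan_add nth_append)

lemma zcomb_append2: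
 "zcomb (%i. if i < length xs then c i else d (i - length xs)) (xs @ ys) = zcomb c xs + zcomb d ys"
 by (simp add: zcomb_append cong: zcomb_cong)

lemma zcomb_single [simp]: "zcomb c [x] = of_int (c 0) * x"
 by (simp add: zcomb_def)

lemma zcomb_add: "zcomb c xs + zcomb d xs = zcomb (%i. c i + d i) xs"
 by (simp add: zcomb_def sum.distrib algebra_simps)

lemma zcomb_diff: "zcomb c xs - zcomb d xs = zcomb (%i. c i - d i) xs"
 by (simp add: zcomb_def sum_subtractf algebra_simps)

lemma zcomb_mult: "of_int k * zcomb c xs = zcomb (%i. k * c i) xs"
 by (simp add: zcomb_def sum_distrib_left algebra_simps)

lemma zcomb_uminus: "- zcomb c xs = zcomb (%i. - c i) xs"
 by (simp add: zcomb_def sum_negf)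

lemma zcomb_zero [simp]: "zcomb (%i. 0) xs = 0"
 by (simp add: zcomb_def)

lemma zcomb_unit: "i < length xs ==> zcomb (%j. if j = i then k else 0) xs = of_int k * xs ! i"
 unfolding zcomb_def by (subst sum.remove[of _ i]) auto

lemma zcomb_map_mult: "zcomb c (map (%x. of_int k * x) xs) = of_int k * zcomb c xs"
 by (simp add: zcomb_def sum_distrib_left algebra_simps)

lemma zcomb_in_zspan [simp]: "zcomb c xs : zspan xs"
 by (simp add: zspan_def)

lemma zspanE: assumes "x : zspan xs" obtains c where "x = zcomb c xs"
 using assms by (auto simp: zspan_def)

lemma zsub_zspan: "zsub (zspan xs)"
 by (auto simp: zsub_def zspan_def zcomb_diff) (metis rangeI zcomb_zero)

lemma set_subset_zspan: "set xs <= zspan xs"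
 by (auto simp: in_set_conv_nth) (metis zcomb_in_zspan zcomb_unit of_int_1 mult_1)

lemma zspan_least: "zsub H ==> set xs <= H ==> zspan xs <= H"
 by (auto simp: zspan_def zcomb_def intro!: zsub_sum zsub_of_int_mult)

lemma zspan_mono: "set xs <= zspan ys ==> zspan xs <= zspan ys"
 by (rule zspan_least[OF zsub_zspan])

lemma zspan_set_mono: "set xs <= set ys ==> zspan xs <= zspan ys"
 using zspan_mono set_subset_zspan by blast

lemma zindepD: "zindep xs ==> zcomb c xs = 0 ==> i < length xs ==> c i = 0"
 by (simp add: zindep_def)

lemma zindep_unique:
 assumes "zindep xs" "zcomb c xs = zcomb d xs" "i < length xs"
 shows "c i = d i"
proof -
 have "zcomb (%i. c i - d i) xs = 0" using assms(2) by (simp add: zcomb_diff[symmetric])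
 then have "c i - d i = 0" by (rule zindepD[OF assms(1) _ assms(3)])
 then show ?thesis by simp
qed

lemma zindep_appendD:
 assumes "zindep (xs @ ys)"
 shows "zindep xs" "zindep ys"
 "zcomb c xs + zcomb d ys = 0 ==> i < length xs ==> c i = 0"
 "zcomb c xs + zcomb d ys = 0 ==> i < length ys ==> d i = 0"
proof -
 have *: "(ALL i<length xs. c i = 0) & (ALL i<length ys. d i = 0)" if "zcomb c xs + zcomb d ys = 0" for c d
 proof -
 define f where "f i = (if i < length xs then c i else d (i - length xs))" for i
 have "zcomb f (xs @ ys) = 0" using that unfolding f_def zcomb_append2 .
 then have "ALL i<length (xs @ ys). f i = 0" using assms unfolding zindep_def by blast
 then have "f i = 0" if "i < length xs" for i using that by simp
 moreover have "f (length xs + i) = 0" if "i < length ys" for i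
 using \<open>ALL i<length (xs @ ys). f i = 0\<close> that by simp
 ultimately show ?thesis by (auto simp: f_def)
 qed
 show "zcomb c xs + zcomb d ys = 0 ==> i < length xs ==> c i = 0"
 "zcomb c xs + zcomb d ys = 0 ==> i < length ys ==> d i = 0" using * by blast+
 show "zindep xs" unfolding zindep_def
 proof (intro allI impI)
 fix c i assume "zcomb c xs = 0" "i < length xs"
 then show "c i = 0" using *[of c "%_. 0"] by simp
 qed
 show "zindep ys" unfolding zindep_def
 proof (intro allI impI)
 fix c i assume "zcomb c ys = 0" "i < length ys"
 then show "c i = 0" using *[of "%_. 0" c] by simp
 qed
qed

lemma zindep_appendI:
 assumes "!!c d. zcomb c xs + zcomb d ys = 0 ==> (ALL i<length xs. c i = 0) & (ALL i<length ys. d i = 0)"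
 shows "zindep (xs @ ys)"
 unfolding zindep_def
proof (intro allI impI)
 fix c i assume "zcomb c (xs @ ys) = 0" and i: "i < length (xs @ ys)"
 then have *: "(ALL i<length xs. c i = 0) & (ALL i<length ys. c (length xs + i) = 0)"
 by (intro assms) (simp add: zcomb_append)
 show "c i = 0"
 proof (cases "i < length xs")
 case False
 then have "c (length xs + (i - length xs)) = 0" using * i by (intro *[THEN conjunct2, rule_format]) auto
 then show ?thesis using False by simp
 qed (use * in blast)
qed

lemma zindep_swap_right:
 assumes "zindep (xs @ ys @ zs)" shows "zindep (xs @ zs @ ys)"
proof (rule zindep_appendI)
 fix c d assume "zcomb c xs + zcomb d (zs @ ys) = 0"
 then have 1: "zcomb c xs + (zcomb (%i. d (length zs + i)) ys + zcomb d zs) = 0"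
 by (simp add: zcomb_append algebra_simps)
 then have 2: "zcomb c xs + zcomb (%i. if i < length ys then d (length zs + i) else d (i - length ys)) (ys @ zs) = 0"
 by (subst zcomb_append2[of ys "%i. d (length zs + i)" d zs])
 from zindep_appendD(3)[OF assms 2] have 3: "ALL i<length xs. c i = 0" by blast
 have "d i = 0" if "i < length (zs @ ys)" for i
 proof (cases "i < length zs")
 case True
 then show ?thesis using zindep_appendD(4)[OF assms 2, of "length ys + i"] by simp
 next
 case False
 then have "i - length zs < length ys" using that by simp
 then show ?thesis using zindep_appendD(4)[OF assms 2, of "i - length zs"] False by simp
 qed
 with 3 show "(ALL i<length xs. c i = 0) & (ALL i<length (zs @ ys). d i = 0)" by blast
qed

lemma zindep_map_mult: "k ~= 0 ==> zindep ys ==> zindep (map (%x. of_int k * x) ys)"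
 unfolding zindep_def
proof (intro allI impI)
 fix c i
 assume k: "k ~= 0" and ys: "ALL c. zcomb c ys = 0 --> (ALL i<length ys. c i = 0)"
 and c: "zcomb c (map (%x. of_int k * x) ys) = 0" and i: "i < length (map (%x. of_int k * x) ys)"
 have "zcomb (%i. k * c i) ys = 0" using c by (simp add: zcomb_map_mult zcomb_mult)
 then have "k * c i = 0" using ys[rule_format, of "%i. k * c i" i] i by simp
 then show "c i = 0" using k by simp
qed

lemma common_multiplier:
 assumes "finite A" "!!x. x : A ==> EX k~=0. of_int k * x : zspan zs"
 shows "EX k~=0. ALL x:A. of_int k * x : zspan zs"
 using assms
proof (induction A rule: finite_induct)
 case (insert a A)
 obtain k where kl: "k ~= 0" "ALL x:A. of_int k * x : zspan zs"
 using insert.IH[OF insert.prems] by auto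
 obtain l where l: "l ~= 0" "of_int l * a : zspan zs" using insert.prems[of a] by auto
 have "of_int (l * k) * x : zspan zs" if "x : A" for x
 using zsub_of_int_mult[OF zsub_zspan kl(2)[rule_format, OF that], of l] by (simp add: mult.assoc)
 moreover have "of_int (l * k) * a : zspan zs"
 using zsub_of_int_mult[OF zsub_zspan l(2), of k] by (simp add: mult_ac)
 ultimately show ?case using kl l by (intro exI[of _ "l * k"]) auto
qed (auto intro: exI[of _ 1])

text \<open>A generating family of minimal size is independent modulo \<open>L\<close>: given a relation, Euclid's
 algorithm on its coefficients, accompanied by changes of generators, leads to a relation with a
 single nonzero coefficient, so that one generator can be dropped.\<close>

lemma minimal_generators_independent:
 fixes s :: "nat => 'v::comm_ring_1"
 assumes L: "zsub L"
 and sat: "!!x c. x : M ==> c ~= 0 ==> of_int c * x : L ==> x : L"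
 and P_def: "!!I s. P I s \<longleftrightarrow> finite I & s ` I <= M & (ALL x:M. EX c. x - (SUM i:I. of_int (c i) * s i) : L)"
 and M: "zsub M"
 and min: "!!I s. P I s ==> n <= card I"
 shows "P I s ==> card I = n ==> (SUM i:I. of_int (c i) * s i) : L ==>
 i : I ==> c i ~= 0 ==> w = (SUM i:I. nat \<bar>c i\<bar>) ==> False"
proof (induction w arbitrary: s c i rule: less_induct)
 case (less w s c i)
 have fin: "finite I" and sM: "s ` I <= M" and gen: "!!x. x : M ==> EX c. x - (SUM i:I. of_int (c i) * s i) : L"
 using less.prems(1) P_def[of I s] by blast+
 show False
 proof (cases "EX j:I. j ~= i & c j ~= 0")
 case False
 then have "(SUM i:I. of_int (c i) * s i) = of_int (c i) * s i"
 using fin less.prems(4) by (subst sum.remove[of _ i]) (auto intro!: sum.neutral)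
 \<comment> \<open>With a single nonzero coefficient, saturation puts \<open>s i\<close> itself into
   \<open>L\<close>. Then \<open>I - {i}\<close> still generates modulo \<open>L\<close>, against
   minimality.\<close>
 then have si: "s i : L" using sat[of "s i" "c i"] sM less.prems by auto
 have "P (I - {i}) s"
 unfolding P_def
 proof (intro conjI ballI)
 fix x assume "x : M"
 then obtain d where d: "x - (SUM i:I. of_int (d i) * s i) : L" using gen by blast
 have "x - (SUM i:I - {i}. of_int (d i) * s i) = x - (SUM i:I. of_int (d i) * s i) + of_int (d i) * s i"
 using sum.remove[OF fin less.prems(4), of "%i. of_int (d i) * s i"] by (simp add: algebra_simps)
 also have "... : L" using d si L by (intro zsubD(4) zsub_of_int_mult)
 finally show "EX c. x - (SUM i:I - {i}. of_int (c i) * s i) : L" by blast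
 qed (use fin sM in auto)
 from min[OF this] show False using fin less.prems(2,4) card_Diff1_less[of I i] by simp
 next
 case True
 then obtain j0 where "j0 : I" "j0 ~= i" "c j0 ~= 0" by blast
 then obtain a b where ab: "a : I" "b : I" "a ~= b" "c b ~= 0" "\<bar>c b\<bar> <= \<bar>c a\<bar>"
 using less.prems(4,5) by (metis linear)
 \<comment> \<open>The sign makes \<open>e * c b\<close> agree in sign with \<open>c a\<close>, so
   that subtracting it shrinks \<open>c a\<close>. Replacing \<open>s b\<close> by
   \<open>s b + e * s a\<close> compensates, and the relation keeps its value while the sum of
   absolute coefficients drops.\<close>
 define e where "e = sgn (c a) * sgn (c b)"
 have ce: "\<bar>c a - e * c b\<bar> < \<bar>c a\<bar>" using ab(4,5) unfolding e_def
 by (auto simp: sgn_if abs_if split: if_splits)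
 define s' where "s' = s(b := s b + of_int e * s a)"
 define c' where "c' = c(a := c a - e * c b)"
 have split: "(SUM i:I. g i) = g a + g b + (SUM i:I - {a} - {b}. g i)" for g :: "nat => 'b::comm_monoid_add"
 using fin ab by (subst sum.remove[of I a], simp, simp, subst sum.remove[of "I - {a}" b]) (auto simp: add.assoc)
 have trans: "(SUM i:I. of_int ((d(a := d a - e * d b)) i) * s' i) = (SUM i:I. of_int (d i) * s i)" for d
 unfolding split s'_def using ab by (simp add: algebra_simps)
 have "P I s'"
 unfolding P_def
 proof (intro conjI ballI)
 show "s' ` I <= M" using sM ab M by (auto simp: s'_def image_subset_iff zsubD zsub_of_int_mult)
 fix x assume "x : M"
 then obtain d where d: "x - (SUM i:I. of_int (d i) * s i) : L" using gen by blast
 then have "x - (SUM i:I. of_int ((d(a := d a - e * d b)) i) * s' i) : L" by (simp only: trans)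
 then show "EX c. x - (SUM i:I. of_int (c i) * s' i) : L" by blast
 qed (rule fin)
 moreover have "(SUM i:I. of_int (c' i) * s' i) : L" unfolding c'_def trans by (rule less.prems(3))
 moreover have "c' b ~= 0" using ab by (simp add: c'_def)
 moreover have "(SUM i:I. nat \<bar>c' i\<bar>) < w"
 unfolding less.prems(6) split using ce ab by (auto simp: c'_def)
 ultimately show False using less.IH less.prems(2) ab(2) by blast
 qed
qed

lemma basis_modulo_exists:
 fixes M :: "'v::comm_ring_1 set"
 assumes L: "zsub L" and M: "zsub M"
 and sat: "!!x c. x : M ==> c ~= 0 ==> of_int c * x : L ==> x : L"
 and gen: "set S <= M" "!!x. x : M ==> EX y:zspan S. x - y : L"
 obtains cs where "set cs <= M" "!!x. x : M ==> EX y:zspan cs. x - y : L"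
 "!!c i. zcomb c cs : L ==> i < length cs ==> c i = 0"
proof -
 define P where "P I s \<longleftrightarrow> finite I & s ` I <= M & (ALL x:M. EX c. x - (SUM i:I. of_int (c i) * s i) : L)"
 for I :: "nat set" and s :: "nat => 'v"
 define n where "n = (LEAST n. EX I s. P I s & card I = n)"
 have "P {..<length S} ((!) S)" unfolding P_def
 proof (intro conjI ballI)
 fix x assume "x : M"
 then obtain y where "y : zspan S" "x - y : L" using gen(2) by blast
 then show "EX c. x - (SUM i:{..<length S}. of_int (c i) * S ! i) : L" by (auto simp: zspan_def zcomb_def)
 qed (use gen(1) in auto)
 then have ex: "EX n I s. P I s & card I = n" by blast
 obtain I s where Is: "P I s" "card I = n" using LeastI_ex[OF ex] unfolding n_def by blast
 have min: "n <= card I" if "P I s" for I s unfolding n_def using that by (intro Least_le) blast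
 have ind: "c i = 0" if "(SUM i:I. of_int (c i) * s i) : L" "i : I" for c i
 proof (rule ccontr)
 assume "c i ~= 0"
 then show False
 by (rule minimal_generators_independent[of L M P n I s c i, rotated -2]) (fact L sat P_def M min Is that refl)+
 qed
 have fin: "finite I" and sM: "s ` I <= M" and genI: "!!x. x : M ==> EX c. x - (SUM i:I. of_int (c i) * s i) : L"
 using Is(1) unfolding P_def by blast+
 define l where "l = sorted_list_of_set I"
 have l: "distinct l" "set l = I" using fin by (auto simp: l_def)
 have bij: "bij_betw ((!) l) {..<length l} I" using bij_betw_nth[OF l(1) refl] l(2) by simp
 define cs where "cs = map s l"
 have sum_l: "(SUM i:I. of_int (c i) * s i) = zcomb (%k. c (l ! k)) cs" for c
 unfolding zcomb_def cs_def by (subst sum.reindex_bij_betw[OF bij, symmetric]) simp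
 show thesis
 proof (rule that[of cs])
 show "set cs <= M" using sM l by (auto simp: cs_def)
 show "EX y:zspan cs. x - y : L" if "x : M" for x using genI[OF that] unfolding sum_l by auto
 fix c i assume c: "zcomb c cs : L" and i: "i < length cs"
 define d where "d j = c (inv_into {..<length l} ((!) l) j)" for j
 have d: "d (l ! k) = c k" if "k < length l" for k
 using bij that unfolding d_def bij_betw_def by simp
 have "zcomb (%k. d (l ! k)) cs = zcomb c cs" by (rule zcomb_cong) (simp add: d cs_def)
 then have "(SUM i:I. of_int (d i) * s i) : L" unfolding sum_l using c by simp
 then have "d (l ! i) = 0" by (rule ind) (use i l in "auto simp: cs_def")
 then show "c i = 0" using d i by (simp add: cs_def)
 qed
qed

section \<open>Gram determinants\<close>

text \<open>Multiplying on the right by the unipotent matrix \<open>?T\<close> clears the upper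
  right block, so the determinant factors into that of \<open>A\<close> and that of the Schur
  complement.\<close>

lemma det_schur:
 fixes A :: "real mat"
 assumes A: "A : carrier_mat n n" and B: "B : carrier_mat n n" and AB: "A * B = 1\<^sub>m n"
 and U: "U : carrier_mat n m" and V: "V : carrier_mat m n" and E: "E : carrier_mat m m"
 shows "det (four_block_mat A U V E) = det A * det (E - V * (B * U))"
proof -
 let ?T = "four_block_mat (1\<^sub>m n) (- (B * U)) (0\<^sub>m m n) (1\<^sub>m m)"
 have BU: "B * U : carrier_mat n m" using B U by simp
 have T: "?T : carrier_mat (n + m) (n + m)" by simp
 have F: "four_block_mat A U V E : carrier_mat (n + m) (n + m)" using A E by simp
 have neg: "X * (- (B * U)) = - (X * (B * U))" if "dim_col X = n" for X :: "real mat"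
 using that B by (intro uminus_mult_right_mat) simp
 have "A * (- (B * U)) + U = 0\<^sub>m n m"
 proof -
 have "A * (B * U) = U" using assoc_mult_mat[OF A B U] AB U by simp
 then show ?thesis using U neg[of A] A by (simp add: uminus_l_inv_mat)
 qed
 moreover have "V * (- (B * U)) + E = E - V * (B * U)"
 using V BU E neg[of V] by (intro eq_matI) auto
 ultimately have "four_block_mat A U V E * ?T = four_block_mat A (0\<^sub>m n m) V (E - V * (B * U))"
 using A U V E BU by (subst mult_four_block_mat[of _ n n _ m _ m _ _ n _ m]) auto
 then have "det (four_block_mat A U V E) * det ?T = det (four_block_mat A (0\<^sub>m n m) V (E - V * (B * U)))"
 using det_mult[OF F T] by simp
 also have "... = det A * det (E - V * (B * U))"
 by (rule det_four_block_mat_upper_right_zero[OF A refl V]) (use mult_carrier_mat[OF V BU] in "rule minus_carrier_mat")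
 also have "det ?T = 1"
 by (subst det_four_block_mat_lower_left_zero[of _ n _ m]) (use BU in auto)
 finally show ?thesis by simp
qed

lemma det_two:
 fixes A :: "real mat" assumes A: "A : carrier_mat 2 2"
 shows "det A = A $$ (0,0) * A $$ (1,1) - A $$ (0,1) * A $$ (1,0)"
proof -
 have "mat_delete A 0 0 : carrier_mat 1 1" "mat_delete A 1 0 : carrier_mat 1 1"
 using A by (auto simp: mat_delete_def)
 then have "det (mat_delete A 0 0) = A $$ (1,1)" "det (mat_delete A 1 0) = A $$ (0,1)"
 using A by (auto simp: det_single) (auto simp: mat_delete_def)
 then show ?thesis
 using laplace_expansion_column[OF A, of 0] by (simp add: cofactor_def numeral_2_eq_2 lessThan_Suc)
qed

definition gram :: "('v => 'v => real) => 'v list => real mat" where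
 "gram e xs = mat (length xs) (length xs) (%(i, j). e (xs ! i) (xs ! j))"

lemma gram_carrier [simp]: "gram e xs : carrier_mat (length xs) (length xs)"
 by (simp add: gram_def)

lemma gram_append:
 assumes sym: "!!x y. e x y = e y x"
 shows "gram e (xs @ ys) = four_block_mat (gram e xs)
 (mat (length xs) (length ys) (%(i, j). e (xs ! i) (ys ! j)))
 (mat (length ys) (length xs) (%(i, j). e (ys ! i) (xs ! j))) (gram e ys)"
 by (rule eq_matI) (auto simp: gram_def nth_append)

text \<open>\<open>q\<close> is the form \<open>e\<close> after projecting both arguments
  orthogonally to \<open>xs\<close>. The last claim says that \<open>q y y\<close> is the value of
  the form at \<open>y\<close> minus a real combination of \<open>xs\<close>; it is written out in
  values of \<open>e\<close>, because the type of \<open>y\<close> has no real scalars.\<close>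

lemma det_gram_append:
 assumes sym: "!!x y. e x y = e y x" and nz: "det (gram e xs) ~= 0"
 obtains q where "!!ys. det (gram e (xs @ ys)) =
 det (gram e xs) * det (mat (length ys) (length ys) (%(i, j). q (ys ! i) (ys ! j)))"
 "!!x y. q x y = q y x"
 "!!y. EX c. q y y = e y y - 2 * (SUM i<length xs. c i * e (xs ! i) y) + (SUM i<length xs. SUM j<length xs. c i * c j * e (xs ! i) (xs ! j))"
proof -
 let ?n = "length xs" and ?A = "gram e xs"
 obtain B where B: "B : carrier_mat ?n ?n" "?A * B = 1\<^sub>m ?n" "B * ?A = 1\<^sub>m ?n"
 using det_non_zero_imp_unit[OF gram_carrier nz, of "()"] by (auto simp: Units_def ring_mat_simps)
 have At: "?A\<^sup>T = ?A" using sym by (intro eq_matI) (auto simp: gram_def)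
 have Bt: "B\<^sup>T = B"
 proof -
 have "?A * B\<^sup>T = (B * ?A)\<^sup>T" using B by (subst transpose_mult[of _ ?n ?n _ ?n]) (auto simp: At)
 then have "?A * B\<^sup>T = 1\<^sub>m ?n" using B by simp
 then have "B * (?A * B\<^sup>T) = B" using B by simp
 moreover have "B * (?A * B\<^sup>T) = (B * ?A) * B\<^sup>T" using B by (subst assoc_mult_mat[of _ ?n ?n _ ?n _ ?n]) auto
 ultimately show ?thesis using B by simp
 qed
 have Bsym: "B $$ (i, j) = B $$ (j, i)" if "i < ?n" "j < ?n" for i j
 using arg_cong[OF Bt, of "%M. M $$ (j, i)"] that B by simp
 define q where "q x y = e x y - (SUM i<?n. SUM j<?n. e x (xs ! i) * (B $$ (i, j) * e (xs ! j) y))" for x y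
 have 1: "det (gram e (xs @ ys)) = det ?A * det (mat (length ys) (length ys) (%(i, j). q (ys ! i) (ys ! j)))" for ys
 proof -
 let ?m = "length ys"
 let ?U = "mat ?n ?m (%(i, j). e (xs ! i) (ys ! j))" and ?V = "mat ?m ?n (%(i, j). e (ys ! i) (xs ! j))"
 have "gram e ys - ?V * (B * ?U) = mat ?m ?m (%(i, j). q (ys ! i) (ys ! j))"
 using B by (intro eq_matI) (auto simp: gram_def q_def scalar_prod_def lessThan_atLeast0 sum_distrib_left)
 then show ?thesis
 unfolding gram_append[OF sym] using det_schur[OF gram_carrier B(1,2), of ?U ?m ?V "gram e ys"] by simp
 qed
 have 2: "q x y = q y x" for x y
 unfolding q_def
 by (subst sum.swap) (auto simp: sym[of x] sym[of _ y] Bsym mult_ac intro!: sum.cong)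
 have 3: "EX c. q y y = e y y - 2 * (SUM i<?n. c i * e (xs ! i) y) + (SUM i<?n. SUM j<?n. c i * c j * e (xs ! i) (xs ! j))" for y
 proof -
 \<comment> \<open>The coordinates of the orthogonal projection of \<open>y\<close> to the span of
   \<open>xs\<close>; \<open>Ac\<close> below states the normal equations.\<close>
 define c where "c i = (SUM j<?n. B $$ (i, j) * e (xs ! j) y)" for i
 have Ac: "(SUM j<?n. e (xs ! i) (xs ! j) * c j) = e (xs ! i) y" if i: "i < ?n" for i
 proof -
 have "(SUM j<?n. e (xs ! i) (xs ! j) * c j) = (SUM k<?n. (SUM j<?n. e (xs ! i) (xs ! j) * B $$ (j, k)) * e (xs ! k) y)"
 unfolding c_def sum_distrib_left sum_distrib_right by (subst sum.swap) (simp add: mult_ac)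
 also have "... = (SUM k<?n. (if k = i then 1 else 0) * e (xs ! k) y)"
 proof (intro sum.cong refl arg_cong2[of _ _ _ _ "(*)"])
 fix k assume "k : {..<?n}"
 then have "(?A * B) $$ (i, k) = (SUM j<?n. e (xs ! i) (xs ! j) * B $$ (j, k))"
 using i B(1) by (simp add: scalar_prod_def gram_def lessThan_atLeast0)
 then show "(SUM j<?n. e (xs ! i) (xs ! j) * B $$ (j, k)) = (if k = i then 1 else 0)"
 unfolding B(2) using i \<open>k : _\<close> by auto
 qed
 also have "... = e (xs ! i) y" using i by (simp add: if_distribR if_distrib sum.delta' cong: if_cong)
 finally show ?thesis .
 qed
 have "q y y = e y y - (SUM i<?n. c i * e (xs ! i) y)"
 proof -
 have "(SUM i<?n. SUM j<?n. e y (xs ! i) * (B $$ (i, j) * e (xs ! j) y)) = (SUM i<?n. c i * e (xs ! i) y)"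
 unfolding c_def sum_distrib_right
 proof (intro sum.cong refl)
 fix i j show "e y (xs ! i) * (B $$ (i, j) * e (xs ! j) y) = B $$ (i, j) * e (xs ! j) y * e (xs ! i) y"
 using sym[of y "xs ! i"] by simp
 qed
 then show ?thesis unfolding q_def by simp
 qed
 moreover have "(SUM i<?n. SUM j<?n. c i * c j * e (xs ! i) (xs ! j)) = (SUM i<?n. c i * e (xs ! i) y)"
 proof (intro sum.cong refl)
 fix i assume "i : {..<?n}"
 then show "(SUM j<?n. c i * c j * e (xs ! i) (xs ! j)) = c i * e (xs ! i) y"
 using Ac[of i] by (simp add: sum_distrib_left mult_ac flip: Ac)
 qed
 ultimately show ?thesis by (intro exI[of _ c]) simp
 qed
 show thesis by (rule that[OF 1 2 3])
qed

text \<open>Smallest case of Fischer's inequality: once the factor of \<open>xs\<close> is split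
  off, a symmetric 2 by 2 determinant remains, and it is at most the product of its diagonal
  entries.\<close>

lemma det_gram_log_submodular:
 assumes sym: "!!x y. e x y = e y x" and pos: "det (gram e xs) > 0"
 shows "det (gram e (xs @ [y, v])) * det (gram e xs) <= det (gram e (xs @ [y])) * det (gram e (xs @ [v]))"
proof -
 let ?G = "det (gram e xs)"
 obtain q where q: "!!ys. det (gram e (xs @ ys)) = ?G * det (mat (length ys) (length ys) (%(i, j). q (ys ! i) (ys ! j)))"
 and qs: "!!x y. q x y = q y x"
 by (rule det_gram_append[where e = e and xs = xs, OF sym]) (use pos in auto)
 have 1: "det (gram e (xs @ [x])) = ?G * q x x" for x
 unfolding q by (subst det_single[of _, OF mat_carrier, simplified] | simp add: det_single)+
 have "det (gram e (xs @ [y, v])) = ?G * (q y y * q v v - q y v * q v y)"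
 unfolding q by (subst det_two) auto
 moreover have "q y v * q v y >= 0" using qs[of y v] by simp
 ultimately have "det (gram e (xs @ [y, v])) * ?G = ?G * ?G * (q y y * q v v - q y v * q v y)" by simp
 also have "... <= ?G * ?G * (q y y * q v v)" using \<open>q y v * q v y >= 0\<close> pos by (intro mult_left_mono) auto
 also have "... = det (gram e (xs @ [y])) * det (gram e (xs @ [v]))" unfolding 1 by simp
 finally show ?thesis .
qed

section \<open>Volumes of pure sublattices\<close>

text \<open>Positivity is stated through Gram determinants of families that are independent over the
  integers. This says at once that the form is definite on the real span of \<open>M\<close> and
  that independence over the integers persists over the reals.\<close>

locale gram_lattice =
 fixes e :: "'v::comm_ring_1 => 'v => real" and M :: "'v set"
 assumes e_add: "e (x + y) z = e x z + e y z"
 and e_sym: "e x y = e y x"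
 and M: "zsub M"
 and torsion_free: "x : M ==> of_int c * x = 0 ==> c = 0 \<or> x = 0"
 and gram_pos: "set xs <= M ==> zindep xs ==> det (gram e xs) > 0"
 and generated: "EX S. zspan S = M"
begin

abbreviation "G xs \<equiv> det (gram e xs)"

lemma e_zero [simp]: "e 0 x = 0" "e x 0 = 0"
 using e_add[of 0 0 x] e_sym[of x 0] by auto

lemma e_minus: "e (- x) y = - e x y"
 using e_add[of x "- x" y] by simp

lemma e_of_nat: "e (of_nat n * x) y = of_nat n * e x y"
 by (induction n) (auto simp: algebra_simps e_add)

lemma e_of_int: "e (of_int c * x) y = of_int c * e x y"
proof (cases "c >= 0")
 case True
 then show ?thesis using e_of_nat[of "nat c" x y] by (simp add: of_nat_nat)
next
 case False
 then show ?thesis using e_of_nat[of "nat (- c)" x y] e_minus[of "of_nat (nat (- c)) * x" y]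
 by (simp add: of_nat_nat)
qed

lemma e_sum: "e (sum f I) y = (SUM i:I. e (f i) y)"
 by (induction I rule: infinite_finite_induct) (auto simp: e_add)

lemma e_zcomb: "e (zcomb c xs) (zcomb d xs) =
 (SUM i<length xs. SUM j<length xs. of_int (c i) * of_int (d j) * e (xs ! i) (xs ! j))"
proof -
 have "e (xs ! i) (zcomb d xs) = (SUM j<length xs. of_int (d j) * e (xs ! i) (xs ! j))" for i
 proof -
 have "e (xs ! i) (zcomb d xs) = e (zcomb d xs) (xs ! i)" by (rule e_sym)
 also have "... = (SUM j<length xs. of_int (d j) * e (xs ! j) (xs ! i))"
 unfolding zcomb_def by (simp add: e_sum e_of_int)
 finally show ?thesis using e_sym[of _ "xs ! i"] by simp
 qed
 then show ?thesis
 by (subst (1) zcomb_def) (simp add: e_sum e_of_int sum_distrib_left mult.assoc)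
qed

lemma G_transform:
 assumes len: "length ys = length xs" and ys: "!!i. i < length xs ==> ys ! i = zcomb (a i) xs"
 shows "G ys = (of_int (det (mat (length xs) (length xs) (%(i, j). a i j))))\<^sup>2 * G xs"
proof -
 let ?n = "length xs"
 let ?A = "mat ?n ?n (%(i, j). of_int (a i j)) :: real mat"
 have "gram e ys = ?A * gram e xs * ?A\<^sup>T"
 proof (rule eq_matI)
 fix i j assume "i < dim_row (?A * gram e xs * ?A\<^sup>T)" "j < dim_col (?A * gram e xs * ?A\<^sup>T)"
 then have ij: "i < ?n" "j < ?n" by auto
 have "(?A * gram e xs * ?A\<^sup>T) $$ (i, j) = (SUM l<?n. (SUM k<?n. of_int (a i k) * e (xs ! k) (xs ! l)) * of_int (a j l))"
 using ij by (simp add: scalar_prod_def gram_def lessThan_atLeast0)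
 also have "... = (SUM k<?n. SUM l<?n. of_int (a i k) * of_int (a j l) * e (xs ! k) (xs ! l))"
 unfolding sum_distrib_right by (subst sum.swap) (simp add: mult_ac)
 also have "... = gram e ys $$ (i, j)" using ij len by (simp add: gram_def ys e_zcomb)
 finally show "gram e ys $$ (i, j) = (?A * gram e xs * ?A\<^sup>T) $$ (i, j)" by simp
 qed (auto simp: gram_def len)
 also have "det ... = det ?A * G xs * det ?A"
 using det_mult[of "?A * gram e xs" ?n "?A\<^sup>T"] det_mult[of ?A ?n "gram e xs"] det_transpose[of ?A ?n]
 mult_carrier_mat[of ?A ?n ?n "gram e xs" ?n] by simp
 also have "det ?A = of_int (det (mat ?n ?n (%(i, j). a i j)))"
 proof -
 have "?A = map_mat of_int (mat ?n ?n (%(i, j). a i j))" by (intro eq_matI) auto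
 then show ?thesis by (simp add: of_int_hom.hom_det)
 qed
 finally show ?thesis by (simp add: power2_eq_square mult_ac)
qed

lemma G_sublattice:
 assumes len: "length ys = length xs" and sub: "set ys <= zspan xs"
 obtains d :: int where "G ys = (of_int d)\<^sup>2 * G xs"
proof -
 have "EX c. ys ! i = zcomb c xs" if "i < length xs" for i
 proof -
 have "ys ! i : zspan xs" using sub that len by (intro subsetD[OF sub] nth_mem) simp
 then show ?thesis by (auto simp: zspan_def)
 qed
 then obtain a where "!!i. i < length xs ==> ys ! i = zcomb (a i) xs" by metis
 from G_transform[OF len this] show thesis by (rule that)
qed

text \<open>If \<open>ys\<close> were longer, pad \<open>xs\<close> with zeros to the same length.
  The Gram matrix of the padded list has a zero row, so the Gram determinant of \<open>ys\<close>,
  an integer square times that of the padded list, would vanish.\<close>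

lemma zindep_length_le:
 assumes ys: "zindep ys" "set ys <= M" and sub: "set ys <= zspan xs"
 shows "length ys <= length xs"
proof (rule ccontr)
 assume l: "~ ?thesis"
 define zs where "zs = xs @ replicate (length ys - length xs) 0"
 have len: "length ys = length zs" using l by (simp add: zs_def)
 have "set ys <= zspan zs" using sub zspan_set_mono[of xs zs] by (auto simp: zs_def)
 from G_sublattice[OF len this] obtain d where d: "G ys = (of_int d)\<^sup>2 * G zs" .
 let ?n = "length zs"
 have "gram e zs = mat\<^sub>r ?n ?n (%i. if i = ?n - 1 then 0\<^sub>v ?n else row (gram e zs) i)"
 proof (rule eq_matI)
 fix i j assume "i < dim_row (mat\<^sub>r ?n ?n (%i. if i = ?n - 1 then 0\<^sub>v ?n else row (gram e zs) i))"
 "j < dim_col (mat\<^sub>r ?n ?n (%i. if i = ?n - 1 then 0\<^sub>v ?n else row (gram e zs) i))"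
 then have ij: "i < ?n" "j < ?n" by auto
 have "zs ! (?n - 1) = 0" using l by (simp add: zs_def nth_append)
 then show "gram e zs $$ (i, j) = mat\<^sub>r ?n ?n (%i. if i = ?n - 1 then 0\<^sub>v ?n else row (gram e zs) i) $$ (i, j)"
 using ij by (auto simp: gram_def)
 qed (auto simp: gram_def)
 also have "det ... = 0" by (rule det_row_0) (use l len in "auto simp: gram_def")
 finally have "G ys = 0" using d by simp
 then show False using gram_pos[OF ys(2,1)] by simp
qed

text \<open>The two determinants differ by the square of an integer, the index up to sign; it is
  nonzero because both are positive.\<close>

lemma G_le_sublattice:
 assumes "zindep xs" "set xs <= M" "zindep ys" "length ys = length xs" "set ys <= zspan xs"
 shows "G xs <= G ys"
proof -
 obtain d where d: "G ys = (of_int d)\<^sup>2 * G xs" using G_sublattice assms(4,5) by blast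
 have xs: "G xs > 0" using gram_pos assms by blast
 have "set ys <= M" using assms zspan_least[OF M assms(2)] by blast
 then have "G ys > 0" using gram_pos assms by blast
 then have "d ~= 0" using d by auto
 then have "1 <= d\<^sup>2" by (simp add: power2_eq_square) (metis linorder_not_le mult_eq_0_iff not_square_less_zero order_less_le zless_imp_add1_zle add_0)
 then have "1 <= (of_int d :: real)\<^sup>2" by (metis of_int_1_le_iff of_int_power)
 then show ?thesis using d xs by simp
qed

definition zbasis :: "'v set => 'v list => bool" where
 "zbasis H xs \<longleftrightarrow> zspan xs = H & zindep xs"

lemma zbasis_subset: "zbasis H xs ==> set xs <= H"
 using set_subset_zspan by (auto simp: zbasis_def)

lemma zbasis_unique:
 assumes "zbasis H xs" "zbasis H ys" "H <= M"
 shows "length xs = length ys" "G xs = G ys"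
proof -
 have s: "set xs <= H" "set ys <= H" using assms zbasis_subset by auto
 then have sM: "set xs <= M" "set ys <= M" using assms(3) by auto
 have z: "zspan xs = H" "zspan ys = H" "zindep xs" "zindep ys" using assms by (auto simp: zbasis_def)
 show l: "length xs = length ys"
 using zindep_length_le[of xs ys] zindep_length_le[of ys xs] s sM z by simp
 have "G xs <= G ys" "G ys <= G xs"
 by (rule G_le_sublattice; use assms s sM l in "auto simp: zbasis_def")+
 then show "G xs = G ys" by simp
qed

lemma zindep_length_le_multiples:
 assumes ys: "zindep ys" "set ys <= M" and sub: "!!y. y : set ys ==> EX k~=0. of_int k * y : zspan xs"
 shows "length ys <= length xs"
proof -
 obtain k where k: "k ~= 0" "ALL y:set ys. of_int k * y : zspan xs"
 using common_multiplier[of "set ys" xs] sub by auto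
 have "set (map (%x. of_int k * x) ys) <= zspan xs" "set (map (%x. of_int k * x) ys) <= M"
 using k(2) ys(2) zsub_of_int_mult[OF M] by auto
 from zindep_length_le[OF zindep_map_mult[OF k(1) ys(1)] this(2,1)] show ?thesis by simp
qed

lemma zspan_subset_M: "set xs <= M ==> zspan xs <= M"
 by (rule zspan_least[OF M])

lemma G_perm:
 assumes "zindep xs" "zindep ys" "set xs = set ys" "set xs <= M"
 shows "G xs = G ys"
 using assms zspan_set_mono[of xs ys] zspan_set_mono[of ys xs] zspan_subset_M[of xs]
 by (intro zbasis_unique(2)[of "zspan xs"]) (auto simp: zbasis_def)

text \<open>Appending \<open>v\<close> to \<open>xs @ ys\<close> multiplies the determinant by at
  most the factor it contributes directly after \<open>xs\<close>, since a larger family leaves a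
  shorter orthogonal component. The induction on \<open>ys\<close> chains the case of a single
  additional vector.\<close>

lemma G_fischer_one:
 assumes "zindep (xs @ ys @ [v])" "set (xs @ ys @ [v]) <= M"
 shows "G (xs @ ys @ [v]) * G xs <= G (xs @ ys) * G (xs @ [v])"
 using assms
proof (induction ys rule: rev_induct)
 case (snoc y ys)
 have i1: "zindep ((xs @ ys) @ [y] @ [v])" using snoc.prems by simp
 have i2: "zindep (xs @ ys @ [v])" using zindep_appendD(1)[OF zindep_swap_right[OF i1, simplified append_assoc[symmetric]]] by simp
 have i3: "zindep (xs @ ys)" using zindep_appendD(1)[OF i1] .
 have p: "G (xs @ ys) > 0" "G (xs @ ys @ [v]) > 0" using i2 i3 snoc.prems by (auto intro!: gram_pos)
 have xs: "G xs > 0" using zindep_appendD(1)[OF i3] snoc.prems by (auto intro!: gram_pos)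
 have "zindep (xs @ ys @ [y])" using i1 zindep_appendD(1)[of "xs @ ys @ [y]" "[v]"] by simp
 then have y: "G (xs @ ys @ [y]) > 0" using snoc.prems by (auto intro!: gram_pos)
 have 1: "G (xs @ ys @ [y, v]) * G (xs @ ys) <= G (xs @ ys @ [y]) * G (xs @ ys @ [v])"
 using det_gram_log_submodular[where e = e and xs = "xs @ ys", OF e_sym p(1), of y v] by simp
 have 2: "G (xs @ ys @ [v]) * G xs <= G (xs @ ys) * G (xs @ [v])" using snoc.IH i2 snoc.prems by simp
 have "G (xs @ ys) * (G (xs @ ys @ [y, v]) * G xs) <= G (xs @ ys @ [y]) * (G (xs @ ys @ [v]) * G xs)"
 using mult_right_mono[OF 1, of "G xs"] xs by (simp add: mult_ac)
 also have "... <= G (xs @ ys @ [y]) * (G (xs @ ys) * G (xs @ [v]))"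
 using 2 y by (intro mult_left_mono) auto
 finally show ?case using p(1) by (simp add: mult.left_commute[of _ "G (xs @ ys)"])
qed (simp add: mult.commute)

text \<open>Fischer's inequality, that is, submodularity of the logarithm of \<open>G\<close>. The
  vectors of \<open>zs\<close> are added one at a time; \<open>G_perm\<close> rearranges the family
  so that the new vector stands where \<open>G_fischer_one\<close> expects it.\<close>

lemma G_fischer:
 assumes "zindep (xs @ ys @ zs)" "set (xs @ ys @ zs) <= M"
 shows "G (xs @ ys @ zs) * G xs <= G (xs @ ys) * G (xs @ zs)"
 using assms
proof (induction zs rule: rev_induct)
 case (snoc v zs)
 have i1: "zindep (xs @ ys @ zs)" using snoc.prems zindep_appendD(1)[of "xs @ ys @ zs" "[v]"] by simp
 have "zindep (xs @ (zs @ [v]) @ ys)" using zindep_swap_right snoc.prems(1) by blast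
 then have "zindep ((xs @ zs) @ [v] @ ys)" by simp
 then have i2: "zindep ((xs @ zs) @ ys @ [v])" by (rule zindep_swap_right)
 have i3: "zindep ((xs @ zs) @ ys)" using i2 zindep_appendD(1)[of "(xs @ zs) @ ys" "[v]"] by simp
 have i4: "zindep ((xs @ zs) @ [v])" using zindep_appendD(1)[of "(xs @ zs) @ [v]" ys] zindep_swap_right[OF i2] by simp
 have i5: "zindep xs" "zindep (xs @ zs)" using i3 zindep_appendD(1)[of xs "zs @ ys"] zindep_appendD(1)[of "xs @ zs" ys] by simp_all
 have IH: "G (xs @ ys @ zs) * G xs <= G (xs @ ys) * G (xs @ zs)" using snoc.IH i1 snoc.prems by simp
 have 1: "G ((xs @ zs) @ ys @ [v]) * G (xs @ zs) <= G ((xs @ zs) @ ys) * G ((xs @ zs) @ [v])"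
 by (rule G_fischer_one) (use i2 snoc.prems in auto)
 have e1: "G ((xs @ zs) @ ys @ [v]) = G (xs @ ys @ zs @ [v])"
 by (rule G_perm) (use i2 snoc.prems in auto)
 have e2: "G ((xs @ zs) @ ys) = G (xs @ ys @ zs)"
 by (rule G_perm) (use i3 i1 snoc.prems in auto)
 have p: "G xs > 0" "G (xs @ zs) > 0" "G (xs @ zs @ [v]) > 0"
 using i5 i4 snoc.prems by (auto intro!: gram_pos)
 have "G (xs @ zs) * (G (xs @ ys @ zs @ [v]) * G xs) <= (G (xs @ ys @ zs) * G xs) * G (xs @ zs @ [v])"
 using mult_right_mono[OF 1[unfolded e1 e2], of "G xs"] p by (simp add: mult_ac)
 also have "... <= (G (xs @ ys) * G (xs @ zs)) * G (xs @ zs @ [v])"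
 using IH p by (intro mult_right_mono) auto
 also have "... = G (xs @ zs) * (G (xs @ ys) * G (xs @ zs @ [v]))" by (simp add: mult_ac)
 finally show ?case using p(2) by simp
qed (simp add: mult.commute)

end

context gram_lattice
begin

text \<open>Saturated sublattices. These are the traces on \<open>M\<close> of rational subspaces,
  and the ones for which a basis extends to larger pure lattices.\<close>

definition pure :: "'v set => bool" where
 "pure L \<longleftrightarrow> zsub L & L <= M & (ALL x:M. ALL c. c ~= 0 --> of_int c * x : L --> x : L)"

lemma pureD: "pure L ==> zsub L" "pure L ==> L <= M"
 "pure L ==> x : M ==> c ~= 0 ==> of_int c * x : L ==> x : L"
 by (auto simp: pure_def)

lemma pure_Int: "pure L ==> pure L' ==> pure (L Int L')"
 by (auto simp: pure_def zsub_def)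

lemma pure_M: "pure M"
 using M by (auto simp: pure_def)

lemma pure_zero: "pure {0}"
 using M torsion_free by (auto simp: pure_def zsub_def)

text \<open>Modulo \<open>L\<close> the lattice \<open>M\<close> has a basis lifted by
  \<open>cs\<close>, so \<open>M\<close> is the direct sum of \<open>L\<close> and the span of
  \<open>cs\<close>. Subtracting from each generator of \<open>M\<close> its component in that span
  yields generators of \<open>L\<close>.\<close>

lemma pure_generated:
 assumes "pure L" obtains S where "zspan S = L"
proof -
 obtain S0 where S0: "zspan S0 = M" using generated by blast
 obtain cs where cs: "set cs <= M" "!!x. x : M ==> EX y:zspan cs. x - y : L"
 "!!c i. zcomb c cs : L ==> i < length cs ==> c i = 0"
 proof (rule basis_modulo_exists[of L M S0])
 show "set S0 <= M" using set_subset_zspan S0 by blast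
 show "EX y:zspan S0. x - y : L" if "x : M" for x
 using that S0 zsubD(1)[OF pureD(1)[OF assms]] by (intro bexI[of _ x]) auto
 show "x : L" if "x : M" "c ~= 0" "of_int c * x : L" for x c
 by (rule pureD(3)[OF assms that])
 show "zsub L" by (rule pureD(1)[OF assms])
 show "zsub M" by (rule M)
 qed (rule that)
 have S0M: "S0 ! i : M" if "i < length S0" for i
 using nth_mem[OF that] set_subset_zspan[of S0] unfolding S0 by blast
 then obtain y where y: "!!i. i < length S0 ==> y i : zspan cs" "!!i. i < length S0 ==> S0 ! i - y i : L"
 proof -
 have "ALL i. EX y. i < length S0 --> y : zspan cs & S0 ! i - y : L" using cs(2)[OF S0M] by blast
 then obtain y where "ALL i. i < length S0 --> y i : zspan cs & S0 ! i - y i : L" by (rule choice[THEN exE])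
 then show thesis using that by blast
 qed
 define S where "S = map (%i. S0 ! i - y i) [0..<length S0]"
 have SL: "zspan S <= L" by (rule zspan_least[OF pureD(1)[OF assms]]) (use y(2) in "auto simp: S_def")
 have LS: "x : zspan S" if x: "x : L" for x
 proof -
 obtain c where c: "x = zcomb c S0" using S0 x pureD(2)[OF assms] by (auto simp: zspan_def)
 define z where "z = (SUM i<length S0. of_int (c i) * y i)"
 have xz: "x = zcomb c S + z"
 unfolding c z_def zcomb_def S_def by (simp add: sum.distrib[symmetric] right_diff_distrib)
 have "z : zspan cs" unfolding z_def using y(1) by (intro zsub_sum zsub_of_int_mult zsub_zspan) auto
 then obtain d where d: "z = zcomb d cs" by (rule zspanE)
 have "zcomb c S : L" using SL by auto
 then have "z : L" using x xz zsubD(2)[OF pureD(1)[OF assms], of x "zcomb c S"] by simp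
 then have "zcomb d cs : L" unfolding d .
 then have "d i = 0" if "i < length cs" for i using that by (rule cs(3))
 then have "z = 0" unfolding d by (simp add: zcomb_def)
 then show ?thesis using xz by simp
 qed
 have "zspan S = L" using SL by (rule subset_antisym) (rule subsetI, rule LS)
 then show thesis by (rule that)
qed

text \<open>Purity of \<open>L0\<close> makes the quotient of \<open>L\<close> by \<open>L0\<close>
  torsion-free; a lift of a basis of the quotient completes \<open>b\<close>.\<close>

lemma pure_adapted_basis:
 assumes L0: "pure L0" and L: "pure L" and sub: "L0 <= L" and b: "zbasis L0 b"
 obtains cs where "zbasis L (b @ cs)"
proof -
 obtain S where S: "zspan S = L" using pure_generated[OF L] .
 obtain cs where cs: "set cs <= L" "!!x. x : L ==> EX y:zspan cs. x - y : L0"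
 "!!c i. zcomb c cs : L0 ==> i < length cs ==> c i = 0"
 proof (rule basis_modulo_exists[of L0 L S])
 show "set S <= L" using set_subset_zspan S by blast
 show "EX y:zspan S. x - y : L0" if "x : L" for x
 using that S zsubD(1)[OF pureD(1)[OF L0]] by (intro bexI[of _ x]) auto
 show "x : L0" if "x : L" "c ~= 0" "of_int c * x : L0" for x c
 by (rule pureD(3)[OF L0 subsetD[OF pureD(2)[OF L] that(1)] that(2,3)])
 show "zsub L0" by (rule pureD(1)[OF L0])
 show "zsub L" by (rule pureD(1)[OF L])
 qed (rule that)
 have "zspan (b @ cs) = L"
 proof
 show "zspan (b @ cs) <= L"
 by (rule zspan_least[OF pureD(1)[OF L]]) (use zbasis_subset[OF b] sub cs(1) in auto)
 show "L <= zspan (b @ cs)"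
 proof
 fix x assume "x : L"
 then obtain y where y: "y : zspan cs" "x - y : L0" using cs(2) by blast
 have "x - y : zspan (b @ cs)" "y : zspan (b @ cs)"
 using y b zspan_set_mono[of b "b @ cs"] zspan_set_mono[of cs "b @ cs"] by (auto simp: zbasis_def)
 then have "x - y + y : zspan (b @ cs)" by (rule zsubD(4)[OF zsub_zspan])
 then show "x : zspan (b @ cs)" by simp
 qed
 qed
 moreover have "zindep (b @ cs)"
 proof (rule zindep_appendI)
 fix c d assume 0: "zcomb c b + zcomb d cs = 0"
 then have "zcomb d cs = - zcomb c b" by (simp add: eq_neg_iff_add_eq_0 add.commute)
 also have "... : L0" using b by (auto simp: zbasis_def zcomb_uminus)
 finally have d: "ALL i<length cs. d i = 0" using cs(3) by blast
 then have "zcomb c b = 0" using 0 by (simp add: zcomb_def)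
 then show "(ALL i<length b. c i = 0) & (ALL i<length cs. d i = 0)"
 using d b by (auto simp: zbasis_def zindep_def)
 qed
 ultimately show thesis using that by (auto simp: zbasis_def)
qed

lemma zbasis_Nil: "zbasis {0} []"
 by (auto simp: zbasis_def zspan_def zindep_def)

lemma pure_basis: assumes "pure L" obtains b where "zbasis L b"
proof -
 have "{0} <= L" using zsubD(1)[OF pureD(1)[OF assms]] by simp
 then obtain b where "zbasis L ([] @ b)" by (rule pure_adapted_basis[OF pure_zero assms _ zbasis_Nil])
 then show thesis using that by simp
qed

text \<open>By \<open>zbasis_unique\<close> neither length nor Gram determinant depends on the basis
  chosen. \<open>vol2\<close> is the square of the covolume.\<close>

definition basis_of :: "'v set => 'v list" where "basis_of L = (SOME b. zbasis L b)"
definition rk :: "'v set => nat" where "rk L = length (basis_of L)"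
definition vol2 :: "'v set => real" where "vol2 L = G (basis_of L)"

lemma basis_of: "pure L ==> zbasis L (basis_of L)"
 unfolding basis_of_def by (rule someI_ex) (rule pure_basis, auto)

lemma rk_eq: "pure L ==> zbasis L b ==> rk L = length b"
 and vol2_eq: "pure L ==> zbasis L b ==> vol2 L = G b"
 unfolding rk_def vol2_def
 using zbasis_unique[of L "basis_of L" b] basis_of[of L] pureD(2)[of L] by simp_all

lemma vol2_pos: "pure L ==> vol2 L > 0"
 unfolding vol2_def using basis_of[of L] zbasis_subset[of L] pureD(2)[of L]
 by (intro gram_pos) (auto simp: zbasis_def)

lemma vol2_zero: "vol2 {0} = 1" and rk_zero: "rk {0} = 0"
 using vol2_eq[OF pure_zero zbasis_Nil] rk_eq[OF pure_zero zbasis_Nil] by (simp_all add: gram_def)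

text \<open>Two bases \<open>b @ c\<close> and \<open>b @ d\<close> extending one basis
  \<open>b\<close> of the intersection combine to an independent family \<open>b @ c @ d\<close>. By
  \<open>gen\<close> it has finite index in \<open>J\<close>, so passing to \<open>J\<close> can
  only lower the determinant; Fischer's inequality for \<open>b\<close>, \<open>c\<close>,
  \<open>d\<close> gives the rest.\<close>

lemma vol2_submodular:
 assumes L1: "pure L1" and L2: "pure L2" and J: "pure J" "L1 <= J" "L2 <= J"
 and gen: "!!x. x : J ==> EX k~=0. EX y:L1. EX z:L2. of_int k * x = y + z"
 shows "vol2 J * vol2 (L1 Int L2) <= vol2 L1 * vol2 L2" "rk J + rk (L1 Int L2) = rk L1 + rk L2"
proof -
 let ?L0 = "L1 Int L2"
 have L0: "pure ?L0" by (rule pure_Int[OF L1 L2])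
 obtain b where b: "zbasis ?L0 b" using pure_basis[OF L0] .
 obtain c where c: "zbasis L1 (b @ c)" by (rule pure_adapted_basis[OF L0 L1 Int_lower1 b])
 obtain d where d: "zbasis L2 (b @ d)" by (rule pure_adapted_basis[OF L0 L2 Int_lower2 b])
 obtain j where j: "zbasis J j" using pure_basis[OF J(1)] .
 note Ds = pureD(2)[OF L1] pureD(2)[OF L2] pureD(2)[OF J(1)]
 have sub: "set (b @ c) <= L1" "set (b @ d) <= L2" "set j <= J"
 using zbasis_subset[OF c] zbasis_subset[OF d] zbasis_subset[OF j] by blast+
 have subJ: "set (b @ c @ d) <= J" using sub J by auto
 have "zindep ((b @ c) @ d)"
 proof (rule zindep_appendI)
 fix f g assume 0: "zcomb f (b @ c) + zcomb g d = 0"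
 have 1: "zcomb g d = - zcomb f (b @ c)" using 0 by (simp add: eq_neg_iff_add_eq_0 add.commute)
 have "zcomb f (b @ c) : L1"
 using zcomb_in_zspan[of f "b @ c"] c unfolding zbasis_def by blast
 then have "zcomb g d : L1" unfolding 1 using zsubD(3)[OF pureD(1)[OF L1]] by blast
 moreover have "zcomb g d : L2"
 using d zspan_set_mono[of d "b @ d"] by (auto simp: zbasis_def)
 ultimately have "zcomb g d : zspan b" using b by (auto simp: zbasis_def)
 then obtain h where "zcomb g d = zcomb h b" by (rule zspanE)
 then have "zcomb (%i. - h i) b + zcomb g d = 0" by (simp add: zcomb_uminus[symmetric])
 then have g: "ALL i<length d. g i = 0" using zindep_appendD(4)[of b d] d unfolding zbasis_def by blast
 then have "zcomb f (b @ c) = 0" using 0 by (simp add: zcomb_def)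
 then show "(ALL i<length (b @ c). f i = 0) & (ALL i<length d. g i = 0)"
 using g c by (auto simp: zbasis_def zindep_def)
 qed
 then have ind: "zindep (b @ c @ d)" by simp
 have bcd_j: "set (b @ c @ d) <= zspan j" using subJ j by (simp add: zbasis_def)
 have "EX k~=0. of_int k * x : zspan (b @ c @ d)" if "x : J" for x
 proof -
 obtain k y z where k: "k ~= 0" "y : L1" "z : L2" "of_int k * x = y + z"
 using gen[OF \<open>x : J\<close>] by auto
 have "y : zspan (b @ c @ d)" using k(2) c zspan_set_mono[of "b @ c" "b @ c @ d"] by (auto simp: zbasis_def)
 moreover have "z : zspan (b @ c @ d)" using k(3) d zspan_set_mono[of "b @ d" "b @ c @ d"] by (auto simp: zbasis_def)
 ultimately have "of_int k * x : zspan (b @ c @ d)" unfolding k(4) by (rule zsubD(4)[OF zsub_zspan])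
 then show ?thesis using k(1) by blast
 qed
 moreover have "zindep j" "set j <= M" "set (b @ c @ d) <= M"
 using j subJ sub Ds by (auto simp: zbasis_def)
 ultimately have "length j <= length (b @ c @ d)"
 by (intro zindep_length_le_multiples) (use sub(3) in auto)
 moreover have "length (b @ c @ d) <= length j"
 by (rule zindep_length_le[OF ind \<open>set (b @ c @ d) <= M\<close> bcd_j])
 ultimately have len: "length (b @ c @ d) = length j" by simp
 have "vol2 J <= G (b @ c @ d)"
 unfolding vol2_eq[OF J(1) j]
 by (rule G_le_sublattice) (use j sub(3) Ds ind len bcd_j in "auto simp: zbasis_def")
 then have "vol2 J * vol2 ?L0 <= G (b @ c @ d) * G b"
 using vol2_pos[OF L0] vol2_eq[OF L0 b] by simp
 also have "... <= vol2 L1 * vol2 L2"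
 unfolding vol2_eq[OF L1 c] vol2_eq[OF L2 d] by (rule G_fischer[OF ind]) (use subJ Ds in auto)
 finally show "vol2 J * vol2 ?L0 <= vol2 L1 * vol2 L2" .
 show "rk J + rk ?L0 = rk L1 + rk L2"
 unfolding rk_eq[OF J(1) j] rk_eq[OF L0 b] rk_eq[OF L1 c] rk_eq[OF L2 d] using len by simp
qed

end

section \<open>Finiteness of pure sublattices of bounded volume\<close>

context gram_lattice
begin

text \<open>Greedy choice: a generator that cannot be appended satisfies a relation in which its own
  coefficient is nonzero, so a nonzero multiple of it already lies in the span.\<close>

lemma extend_by_generators:
 assumes "zindep bs"
 shows "EX js. set js <= set ws & length js <= length ws & zindep (bs @ js) &
 (ALL w:set ws. EX k~=0. of_int k * w : zspan (bs @ js))"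
proof (induction ws rule: rev_induct)
 case Nil
 show ?case by (rule exI[of _ "[]"]) (use assms in auto)
next
 case (snoc w ws)
 then obtain js where js: "set js <= set ws" "length js <= length ws" "zindep (bs @ js)"
 and mult: "ALL w:set ws. EX k~=0. of_int k * w : zspan (bs @ js)" by (elim exE conjE)
 have js4: "EX k~=0. of_int k * w : zspan (bs @ js)" if "w : set ws" for w
 using mult that by (rule bspec)
 show ?case
 proof (cases "zindep (bs @ js @ [w])")
 case True
 show ?thesis
 proof (intro exI[of _ "js @ [w]"] conjI ballI)
 fix v assume v: "v : set (ws @ [w])"
 show "EX k~=0. of_int k * v : zspan (bs @ (js @ [w]))"
 proof (cases "v = w")
 case True
 then have "v : zspan (bs @ js @ [w])" using set_subset_zspan[of "bs @ js @ [w]"] by auto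
 then show ?thesis by (intro exI[of _ 1]) simp
 next
 case False
 then have "v : set ws" using v by simp
 from js4[OF this] obtain k where "k ~= 0" "of_int k * v : zspan (bs @ js)" by auto
 moreover have "zspan (bs @ js) <= zspan (bs @ js @ [w])" by (rule zspan_set_mono) auto
 ultimately show ?thesis by auto
 qed
 qed (use js True in auto)
 next
 case False
 then obtain c i where c: "zcomb c ((bs @ js) @ [w]) = 0" and i: "i < length ((bs @ js) @ [w])" "c i ~= 0"
 by (auto simp: zindep_def)
 let ?n = "length (bs @ js)"
 have eq: "zcomb c (bs @ js) + of_int (c ?n) * w = 0" using c unfolding zcomb_append by simp
 have "c ?n ~= 0"
 proof
 assume 0: "c ?n = 0"
 then have "zcomb c (bs @ js) = 0" using eq by simp
 then have "ALL i<?n. c i = 0" using js(3) unfolding zindep_def by blast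
 moreover have "i < ?n \<or> i = ?n" using i(1) by auto
 ultimately show False using i(2) 0 by blast
 qed
 moreover have "of_int (c ?n) * w = - zcomb c (bs @ js)" using eq by (simp add: eq_neg_iff_add_eq_0 add.commute)
 then have "of_int (c ?n) * w : zspan (bs @ js)" by (simp add: zcomb_uminus)
 ultimately have w: "EX k~=0. of_int k * w : zspan (bs @ js)" by blast
 show ?thesis
 proof (intro exI[of _ js] conjI ballI)
 fix v assume "v : set (ws @ [w])"
 then consider "v = w" | "v : set ws" by auto
 then show "EX k~=0. of_int k * v : zspan (bs @ js)" using w js4 by cases auto
 qed (use js in auto)
 qed
qed

text \<open>The transition matrix is lower triangular with diagonal \<open>1, ..., 1, m\<close>.
  Adding a combination of \<open>xs\<close> to the last vector has no effect on the
  determinant.\<close>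

lemma G_last_multiple:
 assumes "v' = of_int m * v + zcomb c xs"
 shows "G (xs @ [v']) = (of_int m)\<^sup>2 * G (xs @ [v])"
proof -
 let ?n = "length xs"
 define a where "a i j = (if i < ?n then (if j = i then 1 else 0) else if j = ?n then m else c j)" for i j
 have "G (xs @ [v']) = (of_int (det (mat (length (xs @ [v])) (length (xs @ [v])) (%(i, j). a i j))))\<^sup>2 * G (xs @ [v])"
 proof (rule G_transform)
 fix i assume i: "i < length (xs @ [v])"
 show "(xs @ [v']) ! i = zcomb (a i) (xs @ [v])"
 proof (cases "i < ?n")
 case True
 have "zcomb (a i) (xs @ [v]) = of_int 1 * (xs @ [v]) ! i"
 using True by (subst zcomb_unit[symmetric]) (auto intro!: zcomb_cong simp: a_def)
 then show ?thesis using True by (simp add: nth_append)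
 next
 case False
 then have "i = ?n" using i by simp
 have "zcomb (a ?n) xs = zcomb c xs" by (rule zcomb_cong) (simp add: a_def)
 then show ?thesis using \<open>i = ?n\<close> assms by (simp add: zcomb_append a_def)
 qed
 qed simp
 also have "det (mat (length (xs @ [v])) (length (xs @ [v])) (%(i, j). a i j)) = m"
 proof -
 let ?A = "mat (Suc ?n) (Suc ?n) (%(i, j). a i j)"
 have "det ?A = prod_list (diag_mat ?A)"
 by (rule det_lower_triangular[of "Suc ?n"]) (auto simp: a_def)
 also have "diag_mat ?A = map (%i. a i i) [0..<Suc ?n]" by (auto simp: diag_mat_def)
 also have "... = map (%i. 1) [0..<?n] @ [m]" by (simp add: a_def)
 also have "prod_list ... = m" by (simp add: map_replicate_const)
 finally show ?thesis by simp
 qed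
 finally show ?thesis .
qed

text \<open>Equality of squares gives \<open>m / k = d' / d\<close> up to sign, and
  \<open>d\<close>, \<open>d'\<close> are bounded because an integer is at most its square in
  absolute value.\<close>

lemma ratio_of_bounded_ints:
 fixes k m d d' :: int
 assumes "k ~= 0" "d ~= 0" "m\<^sup>2 * d\<^sup>2 = k\<^sup>2 * d'\<^sup>2" "d\<^sup>2 <= B" "d'\<^sup>2 <= B"
 shows "(of_int m / of_int k :: real) : (%(p, q). of_int p / of_int q) ` ({-B..B} \<times> {-B..B})"
proof -
 have bd: "x : {-B..B}" if "x\<^sup>2 <= B" for x :: int
 proof -
 have "\<bar>x\<bar> <= x\<^sup>2" using self_le_power[of "\<bar>x\<bar>" 2] by (cases "x = 0") auto
 then show ?thesis using that by auto
 qed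
 have "(m * d)\<^sup>2 = (k * d')\<^sup>2" using assms(3) by (simp add: power_mult_distrib)
 then have "m * d = k * d' \<or> m * d = - (k * d')" by (simp add: power2_eq_iff)
 then have "(of_int m * of_int d :: real) = of_int k * of_int d' \<or> (of_int m * of_int d :: real) = - (of_int k * of_int d')"
 by (metis of_int_minus of_int_mult)
 then have "(of_int m / of_int k :: real) = of_int d' / of_int d \<or> (of_int m / of_int k :: real) = of_int (- d') / of_int d"
 proof (elim disjE)
 assume "(of_int m * of_int d :: real) = of_int k * of_int d'"
 then show ?thesis using assms(1,2) by (simp add: frac_eq_eq mult.commute)
 next
 assume "(of_int m * of_int d :: real) = - (of_int k * of_int d')"
 then have "(of_int m * of_int d :: real) = of_int (- d') * of_int k" by simp
 then show ?thesis using assms(1,2) by (simp only: frac_eq_eq of_int_eq_0_iff not_False_eq_True simp_thms)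
 qed
 moreover have "d : {-B..B}" "d' : {-B..B}" using bd assms by auto
 moreover have "- d' : {-B..B}" using \<open>d' : {-B..B}\<close> by auto
 ultimately show ?thesis
 by (elim disjE) (rule image_eqI[of _ _ "(d', d)"], simp, simp, rule image_eqI[of _ _ "(- d', d)"], simp_all)
qed

text \<open>Complete a basis of \<open>L\<close> by members \<open>js\<close> of the fixed basis \<open>ws\<close> of \<open>M\<close>. The coefficients along
 \<open>js\<close> of the projections of the \<open>ws\<close> determine \<open>L\<close>; by Cramer's rule they are quotients of
 integers whose squares are quotients of Gram determinants, bounded by Fischer's inequality.\<close>

lemma finite_pure_vol2_le: "finite {L. pure L & vol2 L <= C}"
proof -
 obtain ws where ws: "zbasis M ws" using pure_basis[OF pure_M] .
 let ?N = "length ws"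
 have wsM: "set ws <= M" using zbasis_subset[OF ws] .
 define \<J> where "\<J> = {js. set js <= set ws & length js <= ?N}"
 have finJ: "finite \<J>" unfolding \<J>_def by (rule finite_lists_length_le) simp
 have Gw: "G ws > 0" using gram_pos wsM ws by (auto simp: zbasis_def)
 define K where "K = Max (insert 1 (G ` \<J>))"
 have K: "G js <= K" if "js : \<J>" for js unfolding K_def using finJ that by auto
 have K1: "1 <= K" unfolding K_def using finJ by simp
 define B :: int where "B = \<lceil>\<bar>C\<bar> * K / G ws\<rceil>"
 define A :: "real set" where "A = insert 0 ((%(p, q). of_int p / of_int q) ` ({-B..B} \<times> {-B..B}))"
 \<comment> \<open>\<open>\<Psi>\<close> rebuilds a sublattice from its data: the members of
   \<open>M\<close> whose coefficients along \<open>js\<close> vanish, where \<open>a (i, j)\<close>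
   is the coefficient of \<open>ws ! i\<close> along \<open>js ! j\<close> in the rational basis
   formed by a basis of the sublattice and \<open>js\<close>.\<close>
 define \<Psi> where "\<Psi> = (%(js, a). {x : M. EX c. x = zcomb c ws &
 (ALL j<length (js :: 'v list). (SUM i<?N. of_int (c i) * a (i, j)) = (0::real))})"
 have "finite A" by (simp add: A_def)
 then have fin: "finite (\<Psi> ` (\<J> \<times> (({..<?N} \<times> {..<?N}) \<rightarrow>\<^sub>E A)))"
 using finJ by (intro finite_imageI finite_cartesian_product finite_PiE) auto
 have "L : \<Psi> ` (\<J> \<times> (({..<?N} \<times> {..<?N}) \<rightarrow>\<^sub>E A))" if L: "pure L" "vol2 L <= C" for L
 proof -
 obtain bs where bs: "zbasis L bs" using pure_basis[OF L(1)] .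
 have bsL: "set bs <= L" using zbasis_subset[OF bs] .
 have bsM: "set bs <= M" using bsL pureD(2)[OF L(1)] by blast
 have bsi: "zindep bs" using bs by (simp add: zbasis_def)
 obtain js where js: "set js <= set ws" "length js <= ?N" "zindep (bs @ js)"
 "!!w. w : set ws ==> EX k~=0. of_int k * w : zspan (bs @ js)"
 using extend_by_generators[OF bsi, of ws] by blast
 have jsM: "set js <= M" using js(1) wsM by blast
 obtain k where k: "k ~= 0" "ALL w:set ws. of_int k * w : zspan (bs @ js)"
 using common_multiplier[of "set ws" "bs @ js"] js(4) by auto
 have "EX f. of_int k * ws ! i = zcomb f (bs @ js)" if "i < ?N" for i
 using k(2) nth_mem[OF that] by (auto simp: zspan_def)
 then obtain f where f: "!!i. i < ?N ==> of_int k * ws ! i = zcomb (f i) (bs @ js)" by metis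
 let ?b = "length bs"
 \<comment> \<open>Positions from \<open>?b\<close> on belong to \<open>js\<close>, so
   \<open>m i j / k\<close> is the coefficient of \<open>ws ! i\<close> along
   \<open>js ! j\<close>.\<close>
 define m where "m = (%i j. f i (?b + j))"
 define l where "l i = zcomb (f i) bs" for i
 have lm: "of_int k * ws ! i = l i + zcomb (m i) js" if "i < ?N" for i
 using f[OF that] by (simp add: zcomb_append l_def m_def)
 have lL: "l i : L" for i using bs by (auto simp: l_def zbasis_def)
 have len: "length (bs @ js) = ?N"
 proof (rule antisym)
 show "length (bs @ js) <= ?N"
 by (rule zindep_length_le) (use js(3) bsM jsM ws in "auto simp: zbasis_def")
 show "?N <= length (bs @ js)"
 by (rule zindep_length_le_multiples) (use ws wsM js(4) in "auto simp: zbasis_def")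
 qed
 have "set (bs @ js) <= zspan ws" using bsM jsM ws by (auto simp: zbasis_def)
 then obtain d where d: "G (bs @ js) = (of_int d)\<^sup>2 * G ws" by (rule G_sublattice[OF len])
 have Gpos: "G (bs @ js) > 0" using gram_pos js(3) bsM jsM by simp
 then have d0: "d ~= 0" using d by auto
 \<comment> \<open>Fischer's inequality with empty common part bounds the determinant by a product.
   The first factor is at most \<open>C\<close>, the second at most \<open>K\<close>, since
   \<open>zs\<close> comes from the finite set of lists over \<open>ws\<close>.\<close>
 have bound: "e\<^sup>2 <= B" if "(of_int e)\<^sup>2 * G ws = G (bs @ zs)" "zindep (bs @ zs)" "zs : \<J>" for e zs
 proof -
 have zsM: "set zs <= M" using that(3) wsM by (auto simp: \<J>_def)
 then have "G zs > 0" using gram_pos zindep_appendD(2)[OF that(2)] by blast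
 then have "G (bs @ zs) <= G bs * G zs"
 using G_fischer[of "[]" bs zs] that(2) bsM zsM by (simp add: gram_def)
 also have "... <= \<bar>C\<bar> * K"
 using L(2) vol2_eq[OF L(1) bs] vol2_pos[OF L(1)] K[OF that(3)] K1 \<open>G zs > 0\<close> by (intro mult_mono') auto
 finally have "(of_int e)\<^sup>2 <= \<bar>C\<bar> * K / G ws" using that(1) Gw by (simp add: field_simps)
 then have "of_int (e\<^sup>2) <= \<bar>C\<bar> * K / G ws" by simp
 then show ?thesis unfolding B_def by linarith
 qed
 have jsJ: "js : \<J>" using js by (simp add: \<J>_def)
 have coeff: "of_int (m i j) / of_int k : A" if i: "i < ?N" and j: "j < length js" for i j
 proof (cases "m i j = 0")
 case True then show ?thesis by (simp add: A_def)
 next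
 case False
 define js' where "js' = take j js @ drop (Suc j) js"
 have jsplit: "js = take j js @ [js ! j] @ drop (Suc j) js" using j id_take_nth_drop by simp
 have ji: "zindep (bs @ js' @ [js ! j])"
 proof -
 have "zindep ((bs @ take j js) @ [js ! j] @ drop (Suc j) js)"
 using js(3) jsplit by (metis append_assoc)
 then have "zindep ((bs @ take j js) @ drop (Suc j) js @ [js ! j])" by (rule zindep_swap_right)
 then show ?thesis by (simp add: js'_def)
 qed
 have sets: "set (bs @ js' @ [js ! j]) = set (bs @ js)"
 using arg_cong[OF jsplit, of set] by (auto simp: js'_def)
 have Gj: "G (bs @ js' @ [js ! j]) = G (bs @ js)"
 by (rule G_perm[OF ji js(3) sets]) (unfold sets, use bsM jsM in auto)
 let ?w = "ws ! i" and ?v = "js ! j" and ?xs = "bs @ js'"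
 have "EX c. of_int k * ?w = of_int (m i j) * ?v + zcomb c ?xs"
 proof -
 have "zcomb (m i) js = zcomb (m i) (take j js) + (of_int (m i j) * ?v + zcomb (%t. m i (Suc j + t)) (drop (Suc j) js))"
 using j by (subst jsplit) (simp add: zcomb_append del: append.simps)
 moreover have "l i + zcomb (m i) (take j js) + zcomb (%t. m i (Suc j + t)) (drop (Suc j) js) : zspan ?xs"
 proof (intro zsubD(4)[OF zsub_zspan])
 show "l i : zspan ?xs" using zspan_set_mono[of bs ?xs] by (auto simp: l_def)
 show "zcomb (m i) (take j js) : zspan ?xs"
 by (rule subsetD[OF zspan_set_mono zcomb_in_zspan]) (auto simp: js'_def)
 show "zcomb (%t. m i (Suc j + t)) (drop (Suc j) js) : zspan ?xs"
 by (rule subsetD[OF zspan_set_mono zcomb_in_zspan]) (auto simp: js'_def)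
 qed
 ultimately have "of_int k * ?w - of_int (m i j) * ?v : zspan ?xs"
 unfolding lm[OF i] by (simp add: algebra_simps)
 then obtain c where "of_int k * ?w - of_int (m i j) * ?v = zcomb c ?xs" by (rule zspanE)
 then show ?thesis by (intro exI[of _ c]) (simp add: algebra_simps)
 qed
 then obtain c where c: "of_int k * ?w = of_int (m i j) * ?v + zcomb c ?xs" ..
 \<comment> \<open>One determinant computed in two ways: modulo \<open>?xs\<close> the vector
   \<open>k * ?w\<close> equals \<open>m i j * ?v\<close>. Comparing expresses the square of
   \<open>m i j / k\<close> as a quotient of two Gram determinants, both integer squares times
   \<open>G ws\<close>.\<close>
 have g1: "G (?xs @ [of_int k * ?w]) = (of_int (m i j))\<^sup>2 * G (?xs @ [?v])" by (rule G_last_multiple[OF c])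
 have g2: "G (?xs @ [of_int k * ?w]) = (of_int k)\<^sup>2 * G (?xs @ [?w])"
 by (rule G_last_multiple[of _ k _ "%_. 0"]) simp
 have wi: "zindep (?xs @ [?w])"
 proof (rule zindep_appendI)
 fix a b assume "zcomb a ?xs + zcomb b [?w] = 0"
 then have 0: "zcomb a ?xs + of_int (b 0) * ?w = 0" by simp
 have "of_int k * (zcomb a ?xs + of_int (b 0) * ?w) = zcomb (%t. k * a t) ?xs + of_int (b 0) * (of_int k * ?w)"
 by (simp add: algebra_simps zcomb_mult[symmetric])
 also have "... = zcomb (%t. k * a t + b 0 * c t) ?xs + zcomb (%_. b 0 * m i j) [?v]"
 unfolding c by (simp add: algebra_simps zcomb_mult[symmetric] zcomb_add[symmetric])
 finally have 1: "zcomb (%t. k * a t + b 0 * c t) ?xs + zcomb (%_. b 0 * m i j) [?v] = 0" using 0 by simp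
 have ji': "zindep (?xs @ [?v])" using ji by simp
 have "b 0 * m i j = 0" using zindep_appendD(4)[OF ji' 1, of 0] by simp
 then have b0: "b 0 = 0" using False by simp
 then have "zcomb a ?xs = 0" using 0 by simp
 then show "(ALL t<length ?xs. a t = 0) & (ALL t<length [?w]. b t = 0)"
 using zindep_appendD(1)[OF ji'] b0 by (auto simp: zindep_def)
 qed
 have wM: "?w : set ws" using i by simp
 have lenw: "length (?xs @ [?w]) = ?N" using len j by (simp add: js'_def)
 have "set js' <= set js" by (auto simp: js'_def dest: in_set_takeD in_set_dropD)
 then have setw: "set (js' @ [?w]) <= set ws" using js(1) wM by auto
 have "set (?xs @ [?w]) <= zspan ws" using bsM setw wsM ws by (auto simp: zbasis_def)
 then obtain d' where d': "G (?xs @ [?w]) = (of_int d')\<^sup>2 * G ws" by (rule G_sublattice[OF lenw])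
 have "(of_int (m i j))\<^sup>2 * ((of_int d)\<^sup>2 * G ws) = (of_int k)\<^sup>2 * ((of_int d')\<^sup>2 * G ws)"
 using g1 g2 d d' Gj by simp
 then have "(of_int ((m i j)\<^sup>2 * d\<^sup>2) :: real) = of_int (k\<^sup>2 * d'\<^sup>2)" using Gw by simp
 then have e: "(m i j)\<^sup>2 * d\<^sup>2 = k\<^sup>2 * d'\<^sup>2" by (simp only: of_int_eq_iff)
 have "d\<^sup>2 <= B" by (rule bound[of d js]) (use d js(3) jsJ in auto)
 moreover have "d'\<^sup>2 <= B"
 by (rule bound[of d' "js' @ [?w]"]) (use d' wi setw lenw in "auto simp: \<J>_def")
 ultimately show ?thesis unfolding A_def using ratio_of_bounded_ints[OF k(1) d0 e] by blast
 qed
 define a where "a = (%(i, j). if j < length js then of_int (m i j) / of_int k else (0::real))"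
 define a' where "a' = restrict a ({..<?N} \<times> {..<?N})"
 have "a (i, j) : A" if "i < ?N" for i j using coeff[OF that] by (auto simp: a_def A_def)
 then have a': "a' : ({..<?N} \<times> {..<?N}) \<rightarrow>\<^sub>E A" by (auto simp: a'_def)
 have kx: "of_int k * zcomb c ws = (SUM i<?N. of_int (c i) * l i) + zcomb (%j. SUM i<?N. c i * m i j) js" for c
 proof -
 have "of_int k * zcomb c ws = (SUM i<?N. of_int (c i) * (of_int k * ws ! i))"
 by (simp add: zcomb_def sum_distrib_left mult_ac)
 also have "... = (SUM i<?N. of_int (c i) * l i) + (SUM i<?N. of_int (c i) * zcomb (m i) js)"
 by (simp add: lm sum.distrib distrib_left)
 also have "(SUM i<?N. of_int (c i) * zcomb (m i) js) = zcomb (%j. SUM i<?N. c i * m i j) js"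
 unfolding zcomb_def by (simp add: sum_distrib_left sum_distrib_right mult.assoc) (rule sum.swap)
 finally show ?thesis .
 qed
 have sa: "(SUM i<?N. of_int (c i) * a' (i, j)) = 0 \<longleftrightarrow> (SUM i<?N. c i * m i j) = 0" if "j < length js" for c j
 proof -
 have jN: "j < ?N" using that js(2) by simp
 have "(SUM i<?N. of_int (c i) * a' (i, j)) = of_int (SUM i<?N. c i * m i j) / of_int k"
 using that jN by (simp add: a'_def a_def sum_divide_distrib)
 then show ?thesis using k(1) by (simp only: divide_eq_0_iff of_int_eq_0_iff simp_thms)
 qed
 have "L = \<Psi> (js, a')"
 proof (rule Set.set_eqI)
 fix x
 have sumL: "(SUM i<?N. of_int (c i) * l i) : L" for c :: "nat => int"
 using lL by (intro zsub_sum zsub_of_int_mult pureD(1)[OF L(1)])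
 show "x : L \<longleftrightarrow> x : \<Psi> (js, a')"
 proof
 assume x: "x : L"
 then have xM: "x : M" using pureD(2)[OF L(1)] by blast
 then obtain c where c: "x = zcomb c ws" using ws by (auto simp: zbasis_def zspan_def)
 have "of_int k * x : L" using x zsub_of_int_mult pureD(1)[OF L(1)] by blast
 then have "of_int k * x - (SUM i<?N. of_int (c i) * l i) : L"
 using zsubD(2)[OF pureD(1)[OF L(1)]] sumL by blast
 then have "zcomb (%j. SUM i<?N. c i * m i j) js : zspan bs"
 using bs unfolding c kx by (simp add: zbasis_def)
 then obtain h where "zcomb (%j. SUM i<?N. c i * m i j) js = zcomb h bs" by (rule zspanE)
 then have "zcomb (%i. - h i) bs + zcomb (%j. SUM i<?N. c i * m i j) js = 0"
 by (simp add: zcomb_uminus[symmetric])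
 from zindep_appendD(4)[OF js(3) this]
 have "(SUM i<?N. of_int (c i) * a' (i, j)) = 0" if "j < length js" for j
 using that by (subst sa) auto
 then show "x : \<Psi> (js, a')" using xM c by (auto simp: \<Psi>_def)
 next
 assume "x : \<Psi> (js, a')"
 then obtain c where x: "x : M" "x = zcomb c ws"
 and 0: "!!j. j < length js ==> (SUM i<?N. of_int (c i) * a' (i, j)) = 0" by (auto simp: \<Psi>_def)
 have "zcomb (%j. SUM i<?N. c i * m i j) js = zcomb (%j. 0) js"
 by (rule zcomb_cong) (use 0 sa in blast)
 then have "of_int k * x = (SUM i<?N. of_int (c i) * l i)" unfolding x(2) kx by simp
 then have "of_int k * x : L" using sumL by simp
 then show "x : L" using pureD(3)[OF L(1) x(1) k(1)] by blast
 qed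
 qed
 moreover have "(js, a') : \<J> \<times> (({..<?N} \<times> {..<?N}) \<rightarrow>\<^sub>E A)" using jsJ a' by blast
 ultimately show ?thesis by (rule image_eqI)
 qed
 then show ?thesis by (intro finite_subset[OF _ fin] subsetI) blast
qed

end

section \<open>Algebraic integers\<close>

text \<open>The list \<open>hs\<close> is an eigenvector, with eigenvalue \<open>y\<close>, of the
  integer matrix describing multiplication by \<open>y\<close>; so \<open>y\<close> is a root of a
  monic integral characteristic polynomial.\<close>

lemma algebraic_int_if_stable:
 fixes y :: "'a::field_char_0"
 assumes st: "!!h. h : set hs ==> y * h : zspan hs" and nz: "EX h:set hs. h ~= 0"
 shows "aint y"
proof -
 let ?n = "length hs"
 have "EX c. y * hs ! i = zcomb c hs" if "i < ?n" for i
 using st[OF nth_mem[OF that]] by (auto simp: zspan_def)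
 then have "ALL i:{..<?n}. EX c. y * hs ! i = zcomb c hs" by simp
 then obtain a where "ALL i:{..<?n}. y * hs ! i = zcomb (a i) hs" by (rule bchoice[THEN exE])
 then have a: "y * hs ! i = zcomb (a i) hs" if "i < ?n" for i using that by simp
 define A :: "int mat" where "A = mat ?n ?n (%(i, j). a i j)"
 have A: "A : carrier_mat ?n ?n" by (simp add: A_def)
 let ?A = "map_mat of_int A :: 'a mat"
 have "eigenvector ?A (vec_of_list hs) y"
 unfolding eigenvector_def
 proof (intro conjI)
 show "vec_of_list hs ~= 0\<^sub>v (dim_row ?A)"
 proof
 assume 0: "vec_of_list hs = 0\<^sub>v (dim_row ?A)"
 obtain h where h: "h : set hs" "h ~= 0" using nz by (rule bexE)
 then obtain i where i: "i < ?n" "hs ! i = h" unfolding in_set_conv_nth by (elim exE conjE)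
 then show False using arg_cong[OF 0, of "%v. v $ i"] A h by (simp add: vec_of_list_index)
 qed
 show "?A *v vec_of_list hs = y \<cdot>\<^sub>v vec_of_list hs"
 by (rule eq_vecI) (auto simp: A_def a zcomb_def scalar_prod_def vec_of_list_index lessThan_atLeast0)
 show "vec_of_list hs : carrier_vec (dim_row ?A)" by (rule carrier_vecI) (simp add: A_def)
 qed
 then have "eigenvalue ?A y" by (auto simp: eigenvalue_def)
 then have "poly (char_poly ?A) y = 0" using eigenvalue_root_char_poly[of ?A ?n y] A by simp
 also have "char_poly ?A = map_poly of_int (char_poly A)" by (rule of_int_hom.char_poly_hom[OF A])
 finally show ?thesis using degree_monic_char_poly[OF A] unfolding algebraic_int_altdef_ipoly
 by (intro exI[of _ "char_poly A"]) simp
qed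

lemma algebraic_int_power_reduces:
 fixes y :: "'a::field_char_0"
 assumes "aint y"
 obtains d c where "d >= 1" "y ^ d = (SUM i<d. of_int (c i) * y ^ i)"
proof -
 obtain p where p: "poly (map_poly of_int p) y = 0" "lead_coeff p = (1::int)"
 using assms unfolding algebraic_int_altdef_ipoly by blast
 define d where "d = degree p"
 have "degree p ~= 0"
 proof
 assume "degree p = 0"
 then obtain q where "p = [:q:]" by (rule degree_eq_zeroE)
 then show False using p by simp
 qed
 then have "d >= 1" by (simp add: d_def)
 have "0 = (SUM i<=degree (map_poly of_int p :: 'a poly). coeff (map_poly of_int p) i * y ^ i)"
 using p(1) by (simp add: poly_altdef)
 also have "degree (map_poly of_int p :: 'a poly) = d" by (simp add: d_def degree_map_poly)
 also have "(SUM i<=d. coeff (map_poly of_int p) i * y ^ i) = (SUM i<d. of_int (coeff p i) * y ^ i) + y ^ d"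
 using p(2) by (simp add: lessThan_Suc_atMost[symmetric] coeff_map_poly d_def)
 finally have "y ^ d = (SUM i<d. of_int (- coeff p i) * y ^ i)"
 by (simp add: sum_negf eq_neg_iff_add_eq_0 add.commute)
 with \<open>d >= 1\<close> show thesis by (rule that)
qed

lemma zspan_power_stable:
 fixes y :: "'a::comm_ring_1"
 assumes y: "y ^ d = (SUM i<d. of_int (c i) * y ^ i)" and H: "zsub H"
 and sp: "!!s i. s : S ==> i < d ==> s * y ^ i : H"
 and s: "s : S" "i < d"
 shows "y * (s * y ^ i) : H"
proof (cases "Suc i < d")
 case True
 then show ?thesis using sp[OF s(1) True] by (simp add: mult_ac)
next
 case False
 then have "d = Suc i" using s(2) by simp
 then have "y * (s * y ^ i) = s * y ^ d" by (simp add: mult_ac)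
 also have "... = (SUM i<d. of_int (c i) * (s * y ^ i))" unfolding y by (simp add: sum_distrib_left mult_ac)
 also have "... : H" using sp s by (intro zsub_sum[OF H] zsub_of_int_mult[OF H]) auto
 finally show ?thesis .
qed

lemma zspan_mult_stable:
 assumes "!!h. h : set hs ==> y * h : zspan hs" "x : zspan hs"
 shows "y * x : zspan hs"
proof -
 have "zsub {x. y * x : zspan hs}" using zsub_zspan[of hs] by (auto simp: zsub_def algebra_simps)
 then have "zspan hs <= {x. y * x : zspan hs}" by (rule zspan_least) (use assms(1) in auto)
 then show ?thesis using assms(2) by auto
qed

text \<open>The finitely many products \<open>a ^ i * b ^ j\<close> with reduced exponents span a
  group stable under \<open>a\<close> and under \<open>b\<close>, hence under their sum and
  product.\<close>

lemma algebraic_int_add: "aint (a + b)" and algebraic_int_mult: "aint (a * b)"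
 if a: "aint a" and b: "aint (b :: 'a::field_char_0)"
proof -
 obtain d c where d: "d >= 1" "a ^ d = (SUM i<d. of_int (c i) * a ^ i)" using algebraic_int_power_reduces[OF a] .
 obtain e f where e: "e >= 1" "b ^ e = (SUM i<e. of_int (f i) * b ^ i)" using algebraic_int_power_reduces[OF b] .
 define hs where "hs = map (%(i, j). a ^ i * b ^ j) (List.product [0..<d] [0..<e])"
 have hs: "set hs = (%(i, j). a ^ i * b ^ j) ` ({..<d} \<times> {..<e})"
 by (simp add: hs_def atLeast0LessThan)
 have mem: "a ^ i * b ^ j : zspan hs" if "i < d" "j < e" for i j
 using that by (intro subsetD[OF set_subset_zspan]) (auto simp: hs)
 have sta: "a * h : zspan hs" if "h : set hs" for h
 proof -
 obtain i j where ij: "h = a ^ i * b ^ j" "i < d" "j < e" using \<open>h : set hs\<close> unfolding hs by auto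
 have "a * (b ^ j * a ^ i) : zspan hs"
 proof (rule zspan_power_stable[OF d(2) zsub_zspan, where S = "{b ^ j}"])
 show "s * a ^ i : zspan hs" if "s : {b ^ j}" "i < d" for s i
 using mem[OF that(2) ij(3)] that(1) by (simp add: mult.commute)
 qed (use ij in simp_all)
 then show ?thesis unfolding ij(1) by (simp only: mult.commute[of "b ^ j"])
 qed
 have stb: "b * h : zspan hs" if "h : set hs" for h
 proof -
 obtain i j where ij: "h = a ^ i * b ^ j" "i < d" "j < e" using \<open>h : set hs\<close> unfolding hs by auto
 show ?thesis unfolding ij(1)
 proof (rule zspan_power_stable[OF e(2) zsub_zspan, where S = "{a ^ i}"])
 show "s * b ^ j : zspan hs" if "s : {a ^ i}" "j < e" for s j
 using mem[OF ij(2) that(2)] that(1) by simp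
 qed (use ij in simp_all)
 qed
 have "1 : set hs" unfolding hs using d(1) e(1) by (intro image_eqI[of _ _ "(0, 0)"]) auto
 then have nz: "EX h:set hs. h ~= 0" by (rule bexI[rotated]) simp
 show "aint (a + b)"
 proof (rule algebraic_int_if_stable[OF _ nz])
 fix h assume h: "h : set hs"
 show "(a + b) * h : zspan hs" unfolding distrib_right by (rule zsubD(4)[OF zsub_zspan sta[OF h] stb[OF h]])
 qed
 show "aint (a * b)"
 proof (rule algebraic_int_if_stable[OF _ nz])
 fix h assume h: "h : set hs"
 show "(a * b) * h : zspan hs" unfolding mult.assoc by (rule zspan_mult_stable[OF sta stb[OF h]])
 qed
qed

lemma algebraic_int_diff: "aint a ==> aint b ==> aint (a - b :: 'a::field_char_0)"
 using algebraic_int_add[of a "- b"] by simp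

lemma algebraic_int_power: "aint a ==> aint (a ^ n :: 'a::field_char_0)"
 by (induction n) (auto intro: algebraic_int_mult)

lemma zsub_algebraic_int: "zsub {x :: 'a::field_char_0. aint x}"
 by (auto simp: zsub_def algebraic_int_diff)

lemma common_denominator:
 assumes "finite A"
 obtains N :: int where "N > 0" "!!a :: rat. a : A ==> of_int N * a : \<int>"
proof -
 have "EX N::int. N > 0 & (ALL a:A. of_int N * a : \<int>)"
 using assms
 proof (induction A rule: finite_induct)
 case (insert a A)
 then obtain N :: int where N: "N > 0" "ALL a:A. of_int N * a : \<int>" by blast
 obtain p q where pq: "quotient_of a = (p, q)" by fastforce
 have q: "q > 0" "a = of_int p / of_int q" using quotient_of_denom_pos[OF pq] quotient_of_div[OF pq] by auto
 have "of_int (N * q) * a : \<int>" using q by simp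
 moreover have "of_int (N * q) * b : \<int>" if "b : A" for b
 proof -
 have "of_int N * b : \<int>" using N(2) that by blast
 then have "of_int q * (of_int N * b) : \<int>" by (rule Ints_mult[OF Ints_of_int])
 then show ?thesis by (simp add: mult_ac)
 qed
 ultimately show ?case using N(1) q(1) by (intro exI[of _ "N * q"]) auto
 qed (auto intro: exI[of _ 1])
 then show thesis using that by blast
qed

section \<open>Rational vector spaces and lattices in number fields\<close>

locale rat_space = vector_space scale for scale :: "rat => 'v::comm_ring_1 => 'v" +
 assumes scale_of_int: "scale (of_int c) x = of_int c * x"
begin

lemma int_mult_eq_0: "of_int c * (x :: 'v) = 0 \<longleftrightarrow> c = 0 \<or> x = 0"
 using scale_eq_0_iff[of "of_int c" x] by (simp add: scale_of_int)

lemma zindep_distinct: "zindep (xs :: 'v list) ==> distinct xs"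
proof (rule ccontr)
 assume z: "zindep xs" and "~ distinct xs"
 then obtain i j where ij: "i < length xs" "j < length xs" "i ~= j" "xs ! i = xs ! j" by (auto simp: distinct_conv_nth)
 have "zcomb (%k. (if k = i then 1 else 0) - (if k = j then 1 else 0)) xs = 0"
 unfolding zcomb_diff[symmetric] using ij by (simp add: zcomb_unit)
 from zindepD[OF z this ij(1)] ij(3) show False by simp
qed

lemma sum_list_set:
 assumes "distinct xs"
 shows "(SUM v:set xs. g v) = (SUM i<length xs. g (xs ! i) :: 'b::comm_monoid_add)"
 by (rule sum.reindex_bij_betw[OF bij_betw_nth[OF assms refl refl], symmetric])

text \<open>A rational relation becomes an integral one after clearing denominators. This opens the
  theory of bases over the rationals to integral combinations.\<close>

lemma zindep_iff: "zindep (xs :: 'v list) \<longleftrightarrow> distinct xs & independent (set xs)"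
proof
 assume z: "zindep xs"
 have d: "distinct xs" by (rule zindep_distinct[OF z])
 have "independent (set xs)"
 proof (rule notI)
 assume "dependent (set xs)"
 then obtain u v where u: "v : set xs" "u v ~= 0" "(SUM v:set xs. scale (u v) v) = 0"
 unfolding dependent_finite[OF finite_set] by blast
 obtain N :: int where N: "N > 0" "!!a. a : u ` set xs ==> of_int N * a : \<int>"
 using common_denominator[of "u ` set xs"] by auto
 then have "EX c. of_int N * u w = of_int c" if "w : set xs" for w using that by (auto elim!: Ints_cases)
 then have "ALL w:set xs. EX c. of_int N * u w = of_int c" by blast
 then obtain c where "ALL w:set xs. of_int N * u w = of_int (c w)" by (rule bchoice[THEN exE])
 then have c: "of_int N * u w = of_int (c w)" if "w : set xs" for w using that by blast
 have "zcomb (%i. c (xs ! i)) xs = (SUM v:set xs. of_int (c v) * v)"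
 unfolding zcomb_def sum_list_set[OF d] ..
 also have "... = (SUM v:set xs. scale (of_int N) (scale (u v) v))"
 by (intro sum.cong refl) (simp add: c scale_of_int[symmetric])
 also have "... = 0" using u(3) by (simp only: scale_sum_right[symmetric] scale_zero_right)
 finally have "zcomb (%i. c (xs ! i)) xs = 0" .
 then have "c (xs ! i) = 0" if "i < length xs" for i using zindepD[OF z _ that] by blast
 then have "c v = 0" using u(1) by (auto simp: in_set_conv_nth)
 then have "of_int N * u v = 0" using c[OF u(1)] by simp
 then show False using N(1) u(2) by simp
 qed
 with d show "distinct xs & independent (set xs)" ..
next
 assume d: "distinct xs & independent (set xs)"
 show "zindep xs"
 unfolding zindep_def
 proof (intro allI impI)
 fix c i assume c: "zcomb c xs = 0" and i: "i < length xs"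
 define u where "u v = (of_int (c (THE i. i < length xs & xs ! i = v)) :: rat)" for v
 have u: "u (xs ! i) = of_int (c i)" if "i < length xs" for i
 proof -
 have "(THE j. j < length xs & xs ! j = xs ! i) = i"
 using that d by (intro the_equality) (auto simp: nth_eq_iff_index_eq)
 then show ?thesis by (simp add: u_def)
 qed
 have "(SUM v:set xs. scale (u v) v) = 0"
 using d c by (simp add: sum_list_set u scale_of_int zcomb_def)
 moreover have "~ (EX u. (EX v:set xs. u v ~= 0) & (SUM v:set xs. scale (u v) v) = 0)"
 using d unfolding dependent_finite[OF finite_set] by (rule conjunct2)
 ultimately have "~ (EX v:set xs. u v ~= 0)" by auto
 then have "u (xs ! i) = 0" using nth_mem[OF i] by blast
 then show "c i = 0" using u[OF i] by simp
 qed
qed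

end

context rat_space
begin

lemma zspan_subset_span: "zspan xs <= span (set xs)"
proof -
 have "zsub (span (set xs))" by (auto simp: zsub_def span_zero span_diff)
 then show ?thesis by (rule zspan_least) (auto intro: span_base)
qed

text \<open>A subgroup squeezed between two lattices is finitely generated: modulo the smaller one there
 are only finitely many elements.\<close>

lemma sandwich_generated:
 assumes H: "zsub H" and N: "N ~= 0" and m: "m ~= 0"
 and lower: "!!e. e : set es ==> of_int m * e : H"
 and upper: "!!x. x : H ==> of_int N * x : zspan (es :: 'v list)"
 obtains S where "zspan S = H"
proof -
 let ?n = "length es"
 let ?P = "\<bar>N * m\<bar>"
 \<comment> \<open>The members of \<open>H\<close> whose coordinates, after scaling by
   \<open>N\<close>, are reduced modulo \<open>?P\<close>. They are finitely many and represent all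
   classes modulo the lattice generated by the multiples \<open>m * e\<close>.\<close>
 define R where "R = {x : H. EX r : {..<?n} \<rightarrow>\<^sub>E {0..<?P}. of_int N * x = zcomb r es}"
 have "(%x. of_int N * x) ` R <= (%r. zcomb r es) ` ({..<?n} \<rightarrow>\<^sub>E {0..<?P})" by (auto simp: R_def)
 moreover have "finite ({..<?n} \<rightarrow>\<^sub>E {0..<?P})" by (intro finite_PiE) auto
 ultimately have "finite ((%x. of_int N * x) ` R)" using finite_surj by (metis finite_imageI finite_subset)
 moreover have "inj_on (%x. of_int N * x) R"
 proof (rule inj_onI)
 fix x y :: 'v assume "of_int N * x = of_int N * y"
 then have "of_int N * (x - y) = 0" by (simp add: right_diff_distrib)
 then show "x = y" using N by (simp add: int_mult_eq_0)
 qed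
 ultimately have "finite R" by (rule finite_imageD)
 then obtain Rs where Rs: "set Rs = R" using finite_list by blast
 define S where "S = map (%e. of_int m * e) es @ Rs"
 have SH: "zspan S <= H" by (rule zspan_least[OF H]) (use lower Rs in "auto simp: S_def R_def")
 have HS: "x : zspan S" if x: "x : H" for x
 proof -
 obtain c where c: "of_int N * x = zcomb c es" using upper[OF x] by (rule zspanE)
 \<comment> \<open>Quotient of the coordinate \<open>c i\<close> by \<open>N * m\<close>. The sign
   is needed because the division is by the absolute value, so that remainders are
   nonnegative.\<close>
 define t where "t i = sgn (N * m) * (c i div ?P)" for i
 have ct: "c i = N * m * t i + c i mod ?P" for i
 proof -
 have "N * m * t i = ?P * (c i div ?P)" by (simp add: t_def abs_if sgn_if)
 then show ?thesis by simp
 qed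
 define y where "y = of_int m * zcomb t es"
 have ym: "y = zcomb t (map (%e. of_int m * e) es)" by (simp add: y_def zcomb_map_mult)
 have yH: "y : H" unfolding ym zcomb_def
 proof (rule zsub_sum[OF H])
 fix i assume "i : {..<length (map (%e. of_int m * e) es)}"
 then have "map (%e. of_int m * e) es ! i : H" using lower by simp
 then show "of_int (t i) * map (%e. of_int m * e) es ! i : H" by (rule zsub_of_int_mult[OF H])
 qed
 have yS: "y : zspan S"
 proof -
 have "y : zspan (map (%e. of_int m * e) es)" unfolding y_def zcomb_map_mult[symmetric] by simp
 then show ?thesis using zspan_set_mono[of "map (%e. of_int m * e) es" S] by (auto simp: S_def)
 qed
 have "of_int N * y = zcomb (%i. N * m * t i) es" unfolding y_def zcomb_mult[symmetric] by (simp add: mult.assoc)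
 then have "of_int N * (x - y) = zcomb (%i. c i - N * m * t i) es"
 unfolding zcomb_diff[symmetric] c[symmetric] by (simp add: right_diff_distrib)
 also have "... = zcomb (\<lambda>i\<in>{..<?n}. c i mod ?P) es"
 by (rule zcomb_cong) (use ct in "simp add: algebra_simps")
 finally have e: "of_int N * (x - y) = zcomb (\<lambda>i\<in>{..<?n}. c i mod ?P) es" .
 have "x - y : R" unfolding R_def
 proof (intro CollectI conjI bexI)
 show "x - y : H" by (rule zsubD(2)[OF H x yH])
 show "(\<lambda>i\<in>{..<?n}. c i mod ?P) : {..<?n} \<rightarrow>\<^sub>E {0..<?P}" using N m by auto
 qed (rule e)
 then have "x - y : zspan S" using set_subset_zspan[of S] Rs by (auto simp: S_def)
 then have "x - y + y : zspan S" using yS by (rule zsubD(4)[OF zsub_zspan])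
 then show ?thesis by simp
 qed
 have "zspan S = H" by (rule subset_antisym[OF SH]) (rule subsetI, rule HS)
 then show thesis by (rule that)
qed

end

interpretation QF: rat_space "%q x. of_rat q * (x :: 'a::number_field)"
 by unfold_locales (auto simp: algebra_simps of_rat_add of_rat_mult)

lemma number_field_basis:
 obtains B :: "'a::number_field set" where "finite B" "QF.independent B" "QF.span B = UNIV"
proof -
 obtain B :: "'a set" where B: "finite B" "ALL x. EX c. x = (SUM b:B. of_rat (c b) * b)"
 using finite_degree by blast
 have sp: "QF.span B = UNIV" unfolding QF.span_finite[OF B(1)] using B(2) by (auto simp: image_iff)
 obtain B' where B': "B' <= B" "QF.independent B'" "B <= QF.span B'"
 by (rule QF.maximal_independent_subset[of B])
 have "QF.span B <= QF.span B'" using B'(3) by (simp add: QF.span_minimal)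
 then have "QF.span B' = UNIV" using sp by auto
 with B' B(1) show thesis using that finite_subset by blast
qed

text \<open>The powers of \<open>x\<close> up to the dimension of the field satisfy an integral
  relation. With leading coefficient \<open>c d\<close>, multiplying the relation by
  \<open>c d ^ (d - 1)\<close> turns it into a monic integral relation for
  \<open>c d * x\<close>.\<close>

lemma integral_multiple_exists:
 obtains m :: int where "m ~= 0" "aint (of_int m * (x :: 'a::number_field))"
proof -
 obtain B :: "'a set" where B: "finite B" "QF.independent B" "QF.span B = UNIV" by (rule number_field_basis)
 define ys where "ys = map (%i. x ^ i) [0..<Suc (card B)]"
 have "~ zindep ys"
 proof
 assume "zindep ys"
 then have d: "distinct ys" "QF.independent (set ys)" unfolding QF.zindep_iff by auto
 then have "card (set ys) <= card B" using QF.independent_span_bound[OF B(1) d(2)] B(3) by auto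
 then show False using distinct_card[OF d(1)] by (simp add: ys_def)
 qed
 then obtain c i0 where c: "zcomb c ys = 0" "i0 < length ys" "c i0 ~= 0" by (auto simp: zindep_def)
 define d where "d = (GREATEST i. i <= card B & c i ~= 0)"
 have ex: "EX i. i <= card B & c i ~= 0" using c by (intro exI[of _ i0]) (auto simp: ys_def)
 have d: "d <= card B" "c d ~= 0" using GreatestI_ex_nat[OF ex, of "card B"] by (auto simp: d_def)
 have gt: "c i = 0" if "d < i" "i <= card B" for i
 proof (rule ccontr)
 assume "c i ~= 0"
 then have "i <= d" unfolding d_def using that(2) by (intro Greatest_le_nat[of _ i "card B"]) auto
 then show False using that by simp
 qed
 have "0 = (SUM i<Suc (card B). of_int (c i) * x ^ i)"
 using c(1) by (simp add: zcomb_def ys_def del: upt_Suc sum.lessThan_Suc)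
 also have "... = (SUM i<Suc d. of_int (c i) * x ^ i)"
 using d(1) gt by (intro sum.mono_neutral_right) auto
 finally have 0: "(SUM i<d. of_int (c i) * x ^ i) + of_int (c d) * x ^ d = 0" by simp
 have "d ~= 0" using 0 d(2) by (cases d) auto
 let ?a = "c d" and ?y = "of_int (c d) * x"
 have "of_int (?a ^ (d - 1)) * ((SUM i<d. of_int (c i) * x ^ i) + of_int ?a * x ^ d) =
 (SUM i<d. of_int (c i * ?a ^ (d - 1 - i)) * ?y ^ i) + ?y ^ d"
 proof -
 have "of_int (?a ^ (d - 1)) * (of_int (c i) * x ^ i) = of_int (c i * ?a ^ (d - 1 - i)) * ?y ^ i" if "i < d" for i
 proof -
 have "?a ^ (d - 1) = ?a ^ (d - 1 - i) * ?a ^ i" using that by (simp flip: power_add)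
 then show ?thesis by (simp add: power_mult_distrib mult_ac)
 qed
 moreover have "of_int (?a ^ (d - 1)) * (of_int ?a * x ^ d) = ?y ^ d"
 using \<open>d ~= 0\<close> by (cases d) (simp_all add: power_mult_distrib mult_ac)
 ultimately show ?thesis by (simp add: distrib_left sum_distrib_left del: of_int_mult of_int_power)
 qed
 then have "?y ^ d = (SUM i<d. of_int (- (c i * ?a ^ (d - 1 - i))) * ?y ^ i)"
 unfolding 0 by (simp add: sum_negf eq_neg_iff_add_eq_0 add.commute)
 note yd = this
 have "aint ?y"
 proof (rule algebraic_int_if_stable[of "map (%i. ?y ^ i) [0..<d]"])
 let ?hs = "map (%i. ?y ^ i) [0..<d]"
 fix h assume "h : set ?hs"
 then obtain i where i: "i < d" "h = 1 * ?y ^ i" by auto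
 show "?y * h : zspan ?hs" unfolding i(2)
 proof (rule zspan_power_stable[OF yd zsub_zspan, where S = "{1}"])
 show "s * ?y ^ i : zspan ?hs" if "s : {1}" "i < d" for s i
 using that by (intro subsetD[OF set_subset_zspan]) auto
 qed (use i in simp_all)
 next
 show "EX h:set (map (%i. ?y ^ i) [0..<d]). h ~= 0"
 by (rule bexI[of _ "?y ^ 0"]) (use \<open>d ~= 0\<close> in "auto intro!: image_eqI[of _ _ 0]")
 qed
 with d(2) show thesis by (rule that)
qed

lemma integral_basis_exists:
 obtains es :: "'a::number_field list" where "zindep es" "QF.span (set es) = UNIV"
 "ALL e:set es. aint e"
proof -
 obtain B :: "'a set" where B: "finite B" "QF.independent B" "QF.span B = UNIV" by (rule number_field_basis)
 obtain bs where bs: "set bs = B" "distinct bs" using finite_distinct_list[OF B(1)] by blast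
 have ibs: "zindep bs" using QF.zindep_iff bs B by blast
 have "EX m::int. m ~= 0 & (ALL b:A. aint (of_int m * b))" if "finite A" for A :: "'a set"
 using that
 proof (induction A rule: finite_induct)
 case (insert a A)
 then obtain m :: int where m: "m ~= 0" "ALL b:A. aint (of_int m * b)" by auto
 obtain k where k: "k ~= 0" "aint (of_int k * a)" by (rule integral_multiple_exists)
 have "aint (of_int (m * k) * b)" if "b : insert a A" for b
 proof (cases "b = a")
 case True
 then show ?thesis using algebraic_int_mult[OF algebraic_int_of_int[of m] k(2)] by (simp add: mult.assoc)
 next
 case False
 then have "aint (of_int m * b)" using m that by auto
 from algebraic_int_mult[OF algebraic_int_of_int[of k] this] show ?thesis by (simp add: mult_ac)
 qed
 then show ?case using m(1) k(1) by (intro exI[of _ "m * k"]) auto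
 qed (auto intro: exI[of _ 1])
 from this[OF B(1)] obtain m :: int where m: "m ~= 0" "ALL b:B. aint (of_int m * b)" by auto
 define es where "es = map (%x. of_int m * x) bs"
 show thesis
 proof (rule that[of es])
 show "zindep es" unfolding es_def by (rule zindep_map_mult[OF m(1) ibs])
 have "b : QF.span (set es)" if "b : B" for b
 proof -
 have "of_int m * b : QF.span (set es)" using that bs by (intro QF.span_base) (auto simp: es_def)
 from QF.span_scale[OF this, of "1 / of_int m"] show ?thesis
 using m(1) by (simp add: of_rat_divide)
 qed
 then have "QF.span B <= QF.span (set es)" by (intro QF.span_minimal) auto
 then show "QF.span (set es) = UNIV" using B(3) by auto
 qed (use m(2) bs in "auto simp: es_def")
qed

section \<open>The trace form and the ring of integers\<close>

definition basis_trace :: "'a::number_field set => 'a => rat" where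
 "basis_trace B y = (SUM b:B. QF.representation B (y * b) b)"

lemma representation_lin:
 assumes "QF.independent B" "QF.span B = UNIV"
 shows "QF.representation B (x + y) b = QF.representation B x b + QF.representation B y b"
 "QF.representation B (of_rat q * x) b = q * QF.representation B x b"
 "QF.representation B (sum f I) b = (SUM i:I. QF.representation B (f i) b)"
proof -
 show add: "QF.representation B (x + y) b = QF.representation B x b + QF.representation B y b" for x y
 using QF.representation_add[OF assms(1)] assms(2) by auto
 show "QF.representation B (of_rat q * x) b = q * QF.representation B x b"
 using QF.representation_scale[OF assms(1)] assms(2) by auto
 show "QF.representation B (sum f I) b = (SUM i:I. QF.representation B (f i) b)"
 by (induction I rule: infinite_finite_induct) (auto simp: add QF.representation_zero)
qed

lemma representation_sum:
 assumes "QF.independent B" "QF.span B = UNIV" "finite B"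
 shows "(SUM b:B. of_rat (QF.representation B x b) * b) = x"
 using QF.sum_representation_eq[OF assms(1) _ assms(3) order_refl, of x] assms(2) by auto

text \<open>The identity that the trace of a product of two matrices does not depend on their order,
  applied to the two base changes.\<close>

lemma basis_trace_invariant:
 assumes B: "QF.independent B" "QF.span B = UNIV" "finite B"
 and H: "QF.independent H" "QF.span H = UNIV" "finite H"
 shows "basis_trace B y = basis_trace H y"
proof -
 let ?b = "QF.representation B" and ?h = "QF.representation H"
 have "basis_trace B y = (SUM b:B. ?b (SUM h:H. of_rat (?h b h) * (y * h)) b)"
 unfolding basis_trace_def
 proof (intro sum.cong refl)
 fix b
 have "y * b = y * (SUM h:H. of_rat (?h b h) * h)" using representation_sum[OF H] by simp
 also have "... = (SUM h:H. of_rat (?h b h) * (y * h))" by (simp add: sum_distrib_left mult_ac)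
 finally show "?b (y * b) b = ?b (SUM h:H. of_rat (?h b h) * (y * h)) b" by simp
 qed
 also have "... = (SUM h:H. SUM b:B. ?b (y * h) b * ?h b h)"
 unfolding representation_lin[OF B(1,2)] by (subst sum.swap) (simp add: mult.commute)
 also have "... = (SUM h:H. ?h (SUM b:B. of_rat (?b (y * h) b) * b) h)"
 unfolding representation_lin[OF H(1,2)] ..
 also have "... = basis_trace H y" unfolding representation_sum[OF B] basis_trace_def ..
 finally show ?thesis .
qed

text \<open>The group generated by the products \<open>b * y ^ i\<close> is stable under
  \<open>y\<close>. An integral basis \<open>hs\<close> of it is also a rational basis of the field,
  in which multiplication by \<open>y\<close> has an integral matrix; the trace may be computed
  there.\<close>

lemma basis_trace_integral:
 assumes B: "QF.independent B" "QF.span B = UNIV" "finite B" and y: "aint y"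
 shows "basis_trace B y : \<int>"
proof -
 obtain d c where d: "d >= 1" "y ^ d = (SUM i<d. of_int (c i) * y ^ i)" using algebraic_int_power_reduces[OF y] .
 obtain bs where bs: "set bs = B" using finite_list[OF B(3)] by blast
 define gs where "gs = map (%(b, i). b * y ^ i) (List.product bs [0..<d])"
 have gs: "set gs = (%(b, i). b * y ^ i) ` (B \<times> {..<d})" by (simp add: gs_def bs atLeast0LessThan)
 have mem: "b * y ^ i : zspan gs" if "b : B" "i < d" for b i
 using that by (intro subsetD[OF set_subset_zspan]) (auto simp: gs)
 have st: "y * h : zspan gs" if "h : set gs" for h
 proof -
 obtain b i where bi: "h = b * y ^ i" "b : B" "i < d" using \<open>h : set gs\<close> unfolding gs by auto
 show ?thesis unfolding bi(1)
 proof (rule zspan_power_stable[OF d(2) zsub_zspan, where S = B])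
 show "s * y ^ i : zspan gs" if "s : B" "i < d" for s i by (rule mem[OF that])
 qed (use bi in simp_all)
 qed
 obtain hs where hs: "set hs <= zspan gs" "!!x. x : zspan gs ==> EX z:zspan hs. x - z : {0}"
 "!!c i. zcomb c hs : {0} ==> i < length hs ==> c i = 0"
 proof (rule basis_modulo_exists[of "{0}" "zspan gs" gs])
 show "x : {0}" if "x : zspan gs" "c ~= 0" "of_int c * x : {0}" for x :: 'a and c
 using that by simp
 show "EX z:zspan gs. x - z : {0}" if "x : zspan gs" for x using that by (intro bexI[of _ x]) auto
 show "zsub {0::'a}" by (simp add: zsub_def)
 show "zsub (zspan gs)" by (rule zsub_zspan)
 show "set gs <= zspan gs" by (rule set_subset_zspan)
 qed (rule that)
 have zi: "zindep hs" unfolding zindep_def using hs(3) by simp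
 have gh: "zspan gs <= zspan hs"
 proof
 fix x assume "x : zspan gs"
 from hs(2)[OF this] obtain z where "z : zspan hs" "x - z : {0}" by (rule bexE)
 then show "x : zspan hs" by simp
 qed
 have dh: "distinct hs" and ih: "QF.independent (set hs)" using zi unfolding QF.zindep_iff by auto
 have "B <= zspan gs"
 proof
 fix b assume "b : B"
 then show "b : zspan gs" using mem[of b 0] d(1) by simp
 qed
 then have "B <= QF.span (set hs)" using gh QF.zspan_subset_span[of hs] by blast
 then have "QF.span B <= QF.span (set hs)" by (simp add: QF.span_minimal)
 then have sh: "QF.span (set hs) = UNIV" using B(2) by auto
 have "QF.representation (set hs) (y * h) h : \<int>" if "h : set hs" for h
 proof -
 have "y * h : zspan hs"
 using zspan_mult_stable[of gs y h, OF st] subsetD[OF hs(1) that] gh by blast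
 then obtain c where c: "y * h = zcomb c hs" by (rule zspanE)
 have "QF.representation (set hs) (y * h) h = (SUM i<length hs. of_int (c i) * QF.representation (set hs) (hs ! i) h)"
 unfolding c zcomb_def representation_lin(3)[OF ih sh]
 using representation_lin(2)[OF ih sh, of "of_int _"] by simp
 also have "... : \<int>"
 using QF.representation_basis[OF ih] by (intro Ints_sum Ints_mult) auto
 finally show ?thesis .
 qed
 then have "basis_trace (set hs) y : \<int>" unfolding basis_trace_def by (intro Ints_sum)
 then show ?thesis using basis_trace_invariant[OF B ih sh finite_set] by simp
qed

lemma basis_trace_one: "QF.independent B ==> finite B ==> basis_trace B 1 = of_nat (card B)"
 by (simp add: basis_trace_def QF.representation_basis)

text \<open>The trace form is nondegenerate because \<open>tr (x * inverse x)\<close> is the degree.\<close>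

lemma integers_in_lattice:
 assumes es: "zindep es" "QF.span (set es) = UNIV" "ALL e:set es. aint e"
 obtains D :: int where "D > 0" "ALL x :: 'a::number_field. aint x --> of_int D * x : zspan es"
proof -
 let ?n = "length es" and ?B = "set es"
 have d: "distinct es" and i: "QF.independent ?B" using es(1) QF.zindep_iff by auto
 note B = i es(2) finite_set[of es]
 define A where "A = mat ?n ?n (%(j, k). basis_trace ?B (es ! j * es ! k))"
 have A: "A : carrier_mat ?n ?n" by (simp add: A_def)
 have tr_sum: "basis_trace ?B (SUM k<?n. of_rat (q k) * (z * es ! k)) = (SUM k<?n. q k * basis_trace ?B (z * es ! k))" for q z
 proof -
 have "basis_trace ?B (SUM k<?n. of_rat (q k) * (z * es ! k))
 = (SUM b:?B. SUM k<?n. q k * QF.representation ?B (z * es ! k * b) b)"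
 unfolding basis_trace_def sum_distrib_right mult.assoc representation_lin[OF B(1,2)] ..
 also have "... = (SUM k<?n. q k * basis_trace ?B (z * es ! k))"
 by (subst sum.swap) (simp add: basis_trace_def sum_distrib_left)
 finally show ?thesis .
 qed
 define co where "co x k = QF.representation ?B x (es ! k)" for x k
 have rep: "x = (SUM k<?n. of_rat (co x k) * es ! k)" for x
 using representation_sum[OF B, of x] unfolding QF.sum_list_set[OF d] co_def by simp
 have rep2: "z * x = (SUM k<?n. of_rat (co x k) * (z * es ! k))" for x z
 by (subst rep[of x]) (simp add: sum_distrib_left mult_ac)
 have "det A ~= 0"
 proof
 assume "det A = 0"
 then obtain v where v: "v : carrier_vec ?n" "v ~= 0\<^sub>v ?n" "A *v v = 0\<^sub>v ?n"
 using det_0_iff_vec_prod_zero_field[OF A] by auto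
 define x where "x = (SUM k<?n. of_rat (v $ k) * es ! k)"
 have "x ~= 0"
 proof
 assume "x = 0"
 then have "(SUM k<?n. v $ k * QF.representation ?B (es ! k) b) = 0" for b
 using representation_lin(3,2)[OF B(1,2)] QF.representation_zero[of ?B] unfolding x_def
 by (metis (no_types, lifting) sum.cong)
 moreover have "(SUM k<?n. v $ k * QF.representation ?B (es ! k) (es ! j)) = v $ j" if "j < ?n" for j
 proof -
 have "(SUM k<?n. v $ k * QF.representation ?B (es ! k) (es ! j)) = (SUM k<?n. if k = j then v $ k else 0)"
 using that d by (intro sum.cong refl) (auto simp: QF.representation_basis[OF i] nth_eq_iff_index_eq)
 then show ?thesis using that by simp
 qed
 ultimately have "v $ j = 0" if "j < ?n" for j using that by metis
 then show False using v(1,2) by (metis eq_vecI carrier_vecD index_zero_vec)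
 qed
 have zero: "basis_trace ?B (es ! j * x) = 0" if "j < ?n" for j
 proof -
 have "basis_trace ?B (es ! j * x) = (SUM k<?n. v $ k * basis_trace ?B (es ! j * es ! k))"
 unfolding x_def sum_distrib_left tr_sum[symmetric] by (simp add: mult_ac)
 also have "... = (A *v v) $ j"
 using that v(1) by (simp add: A_def scalar_prod_def lessThan_atLeast0 mult.commute)
 finally show ?thesis using v(3) that by simp
 qed
 have "basis_trace ?B (x * inverse x) = 0"
 unfolding rep2[of x "inverse x"] tr_sum using zero by (simp add: mult.commute)
 then have "card ?B = 0" using \<open>x ~= 0\<close> basis_trace_one[OF i] by simp
 then have "?B = {}" by simp
 then have "(UNIV :: 'a set) = {0}" using es(2) QF.span_empty by simp
 moreover have "(1 :: 'a) : UNIV" by simp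
 ultimately have "(1 :: 'a) : {0}" by (simp only:)
 then show False by simp
 qed
 then obtain A' where A': "A' : carrier_mat ?n ?n" "A' * A = 1\<^sub>m ?n"
 using det_non_zero_imp_unit[OF A, of "()"] by (auto simp: Units_def ring_mat_simps)
 \<comment> \<open>\<open>D\<close> clears the denominators of the inverse \<open>A'\<close> of the
   trace matrix. The coordinates of an integral \<open>x\<close> are \<open>A'\<close> applied to
   the traces of the products \<open>es ! k * x\<close>, which are integers, so one \<open>D\<close>
   serves all \<open>x\<close>.\<close>
 obtain D :: int where D: "D > 0" "!!a. a : (%(j, k). A' $$ (j, k)) ` ({..<?n} \<times> {..<?n}) ==> of_int D * a : \<int>"
 using common_denominator[of "(%(j, k). A' $$ (j, k)) ` ({..<?n} \<times> {..<?n})"] by auto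
 have "of_int D * x : zspan es" if x: "aint x" for x :: 'a
 proof -
 have "EX z. of_int D * co x j = of_int z" if j: "j < ?n" for j
 proof -
 define w where "w = vec ?n (co x)"
 have w: "w : carrier_vec ?n" by (simp add: w_def)
 have Aw: "(A *v w) $ k = basis_trace ?B (es ! k * x)" if "k < ?n" for k
 using that unfolding rep2[of "es ! k" x] tr_sum
 by (simp add: A_def w_def scalar_prod_def lessThan_atLeast0 mult.commute)
 have "w = A' *v (A *v w)" using assoc_mult_mat_vec[OF A'(1) A w] A'(2) w by simp
 then have "co x j = (A' *v (A *v w)) $ j" using j by (simp add: w_def)
 also have "... = (SUM k<?n. A' $$ (j, k) * basis_trace ?B (es ! k * x))"
 using j A' A Aw by (simp add: scalar_prod_def lessThan_atLeast0)
 finally have "of_int D * co x j = (SUM k<?n. (of_int D * A' $$ (j, k)) * basis_trace ?B (es ! k * x))"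
 by (simp add: sum_distrib_left mult_ac)
 also have "... : \<int>"
 proof (rule Ints_sum)
 fix k assume k: "k : {..<?n}"
 have 1: "basis_trace ?B (es ! k * x) : \<int>"
 by (rule basis_trace_integral[OF B algebraic_int_mult[OF bspec[OF es(3)] x]]) (use k in simp)
 have "of_int D * A' $$ (j, k) : \<int>" by (rule D(2)) (use j k in \<open>auto intro!: image_eqI[of _ _ "(j, k)"]\<close>)
 from this 1 show "rat_of_int D * A' $$ (j, k) * basis_trace ?B (es ! k * x) : \<int>" by (rule Ints_mult)
 qed
 finally show ?thesis by (auto elim: Ints_cases)
 qed
 then have "ALL j:{..<?n}. EX z. of_int D * co x j = of_int z" by simp
 then obtain z where z: "ALL j:{..<?n}. of_int D * co x j = of_int (z j)" by (rule bchoice[THEN exE])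
 have "of_int D * x = (SUM k<?n. of_rat (of_int D * co x k) * es ! k)"
 by (subst rep[of x]) (simp add: sum_distrib_left of_rat_mult mult_ac)
 also have "... = zcomb z es" unfolding zcomb_def using z by (intro sum.cong refl) simp
 finally show ?thesis by simp
 qed
 then have "ALL x :: 'a. aint x --> of_int D * x : zspan es" by blast
 with D(1) show thesis by (rule that)
qed

lemma integers_generated:
 obtains S :: "'a::number_field list" where "zspan S = {x. aint x}"
proof -
 obtain es :: "'a list" where es: "zindep es" "QF.span (set es) = UNIV" "ALL e:set es. aint e"
 by (rule integral_basis_exists)
 obtain D :: int where D: "D > 0" "ALL x :: 'a. aint x --> of_int D * x : zspan es"
 by (rule integers_in_lattice[OF es])
 show thesis
 by (rule QF.sandwich_generated[OF zsub_algebraic_int, of D 1 es])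
 (use D es(3) that in simp_all)
qed

section \<open>Rational functionals and embeddings\<close>

definition Qlinear :: "('a::number_field => complex) => bool" where
 "Qlinear ph \<longleftrightarrow> (ALL x y. ph (x + y) = ph x + ph y) & (ALL q x. ph (of_rat q * x) = of_rat q * ph x)"

lemma Qlinear_sum: "Qlinear ph ==> ph (sum f I) = (SUM i:I. ph (f i))"
proof (induction I rule: infinite_finite_induct)
 case empty
 then have "ph (of_rat 0 * 0) = of_rat 0 * ph 0" unfolding Qlinear_def by blast
 then show ?case by simp
next
 case (infinite A)
 then have "ph (of_rat 0 * 0) = of_rat 0 * ph 0" unfolding Qlinear_def by blast
 then show ?case using infinite by simp
qed (auto simp: Qlinear_def)

text \<open>The polynomial \<open>p\<close> evaluated at the operator that sends \<open>ph\<close>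
  to \<open>ph (b * _)\<close>.\<close>

definition poly_act :: "'a::number_field => complex poly => ('a => complex) => 'a => complex" where
 "poly_act b p ph y = (SUM k<=degree p. coeff p k * ph (b ^ k * y))"

lemma poly_act_bound: "degree p <= N ==> poly_act b p ph y = (SUM k<=N. coeff p k * ph (b ^ k * y))"
 unfolding poly_act_def by (rule sum.mono_neutral_left) (auto simp: coeff_eq_0)

lemma poly_act_linear_factor:
 "poly_act b ([:-l, 1:] * p) ph y = poly_act b p (%y. ph (b * y) - l * ph y) y"
proof -
 let ?N = "degree p"
 have "degree ([:-l, 1:] * p) <= Suc ?N" using degree_mult_le[of "[:-l, 1:]" p] by simp
 then have "poly_act b ([:-l, 1:] * p) ph y = (SUM k<=Suc ?N. coeff ([:-l, 1:] * p) k * ph (b ^ k * y))"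
 by (rule poly_act_bound)
 also have "... = (SUM k<=Suc ?N. coeff (pCons 0 p) k * ph (b ^ k * y)) - l * (SUM k<=Suc ?N. coeff p k * ph (b ^ k * y))"
 proof -
 have "coeff ([:-l, 1:] * p) k = coeff (pCons 0 p) k - l * coeff p k" for k by simp
 then show ?thesis by (simp only: left_diff_distrib sum_subtractf sum_distrib_left mult.assoc)
 qed
 also have "(SUM k<=Suc ?N. coeff (pCons 0 p) k * ph (b ^ k * y)) = (SUM k<=?N. coeff p k * ph (b ^ k * (b * y)))"
 by (subst sum.atMost_Suc_shift) (simp add: mult_ac)
 also have "(SUM k<=Suc ?N. coeff p k * ph (b ^ k * y)) = (SUM k<=?N. coeff p k * ph (b ^ k * y))"
 by (simp add: coeff_eq_0)
 finally show ?thesis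
 by (simp add: poly_act_def sum_distrib_left sum_subtractf right_diff_distrib mult_ac)
qed

interpretation rat_poly: map_poly_comm_ring_hom "of_rat :: rat => 'b::field_char_0" ..

lemma map_poly_of_rat_pderiv:
 "map_poly of_rat (pderiv p) = (pderiv (map_poly of_rat p) :: 'b::field_char_0 poly)"
 by (rule poly_eqI) (simp add: coeff_pderiv of_rat_mult of_rat_add)

text \<open>For a nonzero rational polynomial of least degree vanishing at \<open>b\<close>, a
  nonconstant common divisor with the derivative would leave a polynomial of smaller degree
  vanishing at \<open>b\<close>, either the divisor or its cofactor. The resulting Bezout identity
  persists over the complex numbers and excludes double roots there.\<close>

lemma rational_minimal_polynomial:
 fixes b :: "'a::number_field"
 obtains m :: "rat poly" where "poly (map_poly of_rat m) b = 0" "rsquarefree (map_poly of_rat m :: complex poly)"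
proof -
 let ?ev = "%m. poly (map_poly of_rat m) b"
 obtain a :: int where a: "a ~= 0" "aint (of_int a * b)" by (rule integral_multiple_exists)
 obtain p :: "int poly" where p: "poly (map_poly of_int p) (of_int a * b) = 0" "lead_coeff p = 1"
 using a(2) unfolding algebraic_int_altdef_ipoly by blast
 \<comment> \<open>Substituting \<open>a * X\<close> into the monic integral equation of
   \<open>a * b\<close> gives a nonzero rational polynomial that vanishes at
   \<open>b\<close>.\<close>
 define m0 :: "rat poly" where "m0 = pcompose (map_poly of_int p) [:0, of_int a:]"
 have "m0 ~= 0" unfolding m0_def using p(2) a(1) by (subst pcompose_eq_0_iff) auto
 moreover have "?ev m0 = 0"
 proof -
 have "map_poly of_rat m0 = pcompose (map_poly of_int p) [:0, of_int a :: 'a:]"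
 proof -
 have "map_poly of_rat [:0, rat_of_int a:] = [:0, of_int a :: 'a:]"
 by (rule poly_eqI) (simp add: coeff_map_poly coeff_pCons split: nat.split)
 then show ?thesis unfolding m0_def
 by (subst of_rat_hom.map_poly_pcompose) (simp add: map_poly_map_poly o_def)
 qed
 then show ?thesis using p(1) by (simp add: poly_pcompose mult.commute)
 qed
 ultimately have ex: "EX n m. m ~= 0 & ?ev m = 0 & degree m = n" by blast
 define n where "n = (LEAST n. EX m. m ~= 0 & ?ev m = 0 & degree m = n)"
 obtain m where m: "m ~= 0" "?ev m = 0" "degree m = n" using LeastI_ex[OF ex] unfolding n_def by blast
 have min: "n <= degree q" if "q ~= 0" "?ev q = 0" for q unfolding n_def using that by (intro Least_le) blast
 have "degree m ~= 0"
 proof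
 assume "degree m = 0"
 then obtain c where "m = [:c:]" by (rule degree_eq_zeroE)
 then show False using m by simp
 qed
 let ?g = "gcd m (pderiv m)"
 have pd: "pderiv m ~= 0" using \<open>degree m ~= 0\<close> by (simp add: pderiv_eq_0_iff)
 obtain h where h: "m = ?g * h" by (metis dvdE gcd_dvd1)
 have nz: "?g ~= 0" "h ~= 0" using h m(1) by auto
 have dg: "degree m = degree ?g + degree h" using h nz degree_mult_eq by metis
 have "degree ?g <= degree (pderiv m)" by (rule dvd_imp_degree_le[OF gcd_dvd2 pd])
 then have "degree ?g < degree m" using \<open>degree m ~= 0\<close> by (simp add: degree_pderiv)
 then have "?ev ?g ~= 0" using min[OF nz(1)] m(3) by auto
 moreover have "?ev ?g * ?ev h = 0" using m(2) by (subst (asm) h) (simp add: rat_poly.hom_mult)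
 ultimately have "?ev h = 0" by simp
 then have "degree ?g = 0" using min[OF nz(2)] m(3) dg by simp
 then have g1: "is_unit ?g" using nz by (simp add: is_unit_iff_degree)
 have "fst (bezout_coefficients m (pderiv m)) * m + snd (bezout_coefficients m (pderiv m)) * pderiv m = ?g"
 by (rule bezout_coefficients_fst_snd)
 moreover have "?g = 1" using g1 by (metis gcd_dvd1 is_unit_gcd_iff)
 ultimately obtain u v where uv: "u * m + v * pderiv m = 1" by metis
 let ?C = "map_poly of_rat :: rat poly => complex poly"
 have "?C u * ?C m + ?C v * pderiv (?C m) = 1"
 using arg_cong[OF uv, of ?C] by (simp add: rat_poly.hom_mult rat_poly.hom_add rat_poly.hom_one map_poly_of_rat_pderiv)
 then have "~ (poly (?C m) z = 0 & poly (pderiv (?C m)) z = 0)" for z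
 by (metis add.right_neutral mult_zero_right poly_1 poly_add poly_mult zero_neq_one)
 then have "rsquarefree (?C m)" unfolding rsquarefree_roots by blast
 with m(2) show thesis by (rule that)
qed

lemma field_hom_of_rat:
 fixes sg :: "'a::number_field => complex"
 assumes "field_hom sg" shows "sg (of_rat q) = of_rat q"
proof -
 interpret field_hom sg by (rule assms)
 obtain a b where ab: "quotient_of q = (a, b)" by fastforce
 then have q: "q = of_int a / of_int b" "b > 0" using quotient_of_div quotient_of_denom_pos by auto
 have "of_rat q * of_int b = (of_int a :: 'a)" using q by (simp add: of_rat_divide)
 then have "sg (of_rat q) * of_int b = of_int a" by (metis hom_mult hom_of_int)
 moreover have "of_rat q * of_int b = (of_int a :: complex)" using q by (simp add: of_rat_divide)
 ultimately have "sg (of_rat q) * of_int b = of_rat q * of_int b" by simp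
 then show ?thesis using q(2) by simp
qed

lemma embedding_Qlinear: "sg : embeddings ==> Qlinear sg"
proof -
 assume "sg : embeddings"
 then have f: "field_hom sg" by (simp add: embeddings_def)
 interpret field_hom sg by (rule f)
 show ?thesis by (simp add: Qlinear_def hom_add hom_mult field_hom_of_rat[OF f])
qed

text \<open>The operators \<open>ph \<mapsto> ph (b * _)\<close> on the rational functionals commute and are diagonalizable, and a
 common eigenvector is a multiple of an embedding.\<close>

definition eigen_on :: "'a::number_field set => ('a => complex) => bool" where
 "eigen_on A ph \<longleftrightarrow> (ALL b:A. EX l. ALL y. ph (b * y) = l * ph y)"

lemma Qlinear_poly_act: "Qlinear ph ==> Qlinear (poly_act b p ph)"
 unfolding Qlinear_def poly_act_def
 by (simp add: distrib_left sum.distrib sum_distrib_left mult.left_commute)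

lemma eigen_on_poly_act: "eigen_on A ph ==> eigen_on A (poly_act b p ph)"
 unfolding eigen_on_def
proof
 fix a assume "ALL b:A. EX l. ALL y. ph (b * y) = l * ph y" "a : A"
 then obtain l where l: "!!y. ph (a * y) = l * ph y" by blast
 have "poly_act b p ph (a * y) = l * poly_act b p ph y" for y
 unfolding poly_act_def by (simp add: sum_distrib_left mult.left_commute[of _ a] l mult.left_commute[of _ l])
 then show "EX l. ALL y. poly_act b p ph (a * y) = l * poly_act b p ph y" by blast
qed

text \<open>A functional killed by a product of distinct linear factors in the operator of
  \<open>b\<close> is a sum of eigenfunctionals of that operator. One root is split off at a time,
  and eigenvector properties for the set \<open>A\<close> survive because the operators
  commute.\<close>

lemma functional_step:
 assumes add: "!!ph ps. T ph ==> T ps ==> T (%y. ph y + ps y)" and smult: "!!c ph. T ph ==> T (%y. c * ph y)"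
 and T0: "T (%y. 0)"
 and step: "!!ph. Qlinear ph ==> eigen_on (insert b A) ph ==> T ph"
 and "finite \<Lambda>" "Qlinear ph" "eigen_on A ph" "!!y. poly_act b (\<Prod>l\<in>\<Lambda>. [:-l, 1:]) ph y = 0"
 shows "T ph"
 using assms(5-8)
proof (induction \<Lambda> arbitrary: ph rule: finite_induct)
 case empty
 have "ph y = 0" for y using empty(3)[of y] by (simp add: poly_act_def)
 then have "ph = (%y. 0)" by auto
 then show ?case using T0 by simp
next
 case (insert m \<Lambda>)
 let ?P = "\<Prod>l\<in>\<Lambda>. [:-l, 1:]"
 define ps where "ps = poly_act b ?P ph"
 have "poly_act b ([:-m, 1:] * ?P) ph y = 0" for y using insert.prems(3)[of y] insert.hyps by simp
 then have "poly_act b ?P (%y. ph (b * y) - m * ph y) y = 0" for y by (simp only: poly_act_linear_factor)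
 moreover have "poly_act b ?P (%y. ph (b * y) - m * ph y) y = ps (b * y) - m * ps y" for y
 unfolding ps_def poly_act_def
 by (simp add: sum_distrib_left sum_subtractf right_diff_distrib mult.left_commute)
 ultimately have eb: "ps (b * y) = m * ps y" for y by simp
 have Qps: "Qlinear ps" unfolding ps_def by (rule Qlinear_poly_act[OF insert.prems(1)])
 have "eigen_on A ps" unfolding ps_def by (rule eigen_on_poly_act[OF insert.prems(2)])
 then have "eigen_on (insert b A) ps" using eb unfolding eigen_on_def by blast
 from step[OF Qps this] have Tps: "T ps" .
 have pw: "ps (b ^ k * y) = m ^ k * ps y" for k y
 by (induction k) (simp_all add: mult.assoc eb)
 have actps: "poly_act b ?P ps y = poly ?P m * ps y" for y
 by (simp add: poly_act_def pw poly_altdef sum_distrib_right mult.assoc)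
 \<comment> \<open>\<open>ps\<close> is an eigenfunctional for the eigenvalue \<open>m\<close>, so
   \<open>?P\<close> acts on it by the number \<open>poly ?P m\<close>, nonzero as the roots are
   distinct. With this normalization \<open>?P\<close> kills the difference of \<open>ph\<close> and
   \<open>c\<close> times \<open>ps\<close>.\<close>
 define c where "c = 1 / poly ?P m"
 have pm: "poly ?P m ~= 0" using insert.hyps by (auto simp: poly_prod)
 have "T (%y. ph y - c * ps y)"
 proof (rule insert.IH)
 show "Qlinear (%y. ph y - c * ps y)" using insert.prems(1) Qps unfolding Qlinear_def by (simp add: algebra_simps)
 show "eigen_on A (%y. ph y - c * ps y)" unfolding eigen_on_def
 proof
 fix a assume "a : A"
 then obtain l where l: "!!y. ph (a * y) = l * ph y" using insert.prems(2) unfolding eigen_on_def by blast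
 have "ps (a * y) = l * ps y" for y
 unfolding ps_def poly_act_def by (simp add: sum_distrib_left mult.left_commute[of _ a] l mult.left_commute[of _ l])
 then have "ALL y. ph (a * y) - c * ps (a * y) = l * (ph y - c * ps y)"
 by (simp add: l right_diff_distrib mult.left_commute)
 then show "EX l. ALL y. ph (a * y) - c * ps (a * y) = l * (ph y - c * ps y)" by blast
 qed
 fix y
 have "poly_act b ?P (%y. ph y - c * ps y) y = ps y - c * poly_act b ?P ps y"
 unfolding ps_def by (simp add: poly_act_def[of b ?P] sum_distrib_left sum_subtractf right_diff_distrib mult.left_commute)
 then show "poly_act b ?P (%y. ph y - c * ps y) y = 0" using pm by (simp add: actps c_def)
 qed
 from add[OF this smult[OF Tps, of c]] show ?case by simp
qed

text \<open>The embeddings span the rational functionals over the complex numbers. The statement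
  takes the form of an induction rule for properties closed under complex combinations, so that no
  explicit expansion in embeddings is carried along.\<close>

lemma functional_closure:
 fixes T :: "('a::number_field => complex) => bool"
 assumes add: "!!ph ps. T ph ==> T ps ==> T (%y. ph y + ps y)" and smult: "!!c ph. T ph ==> T (%y. c * ph y)"
 and T0: "T (%y. 0)" and emb: "!!sg. sg : embeddings ==> T sg" and ph: "Qlinear ph"
 shows "T ph"
proof -
 obtain B :: "'a set" where B: "finite B" "QF.independent B" "QF.span B = UNIV" by (rule number_field_basis)
 \<comment> \<open>The elements whose operators act on \<open>ph\<close> by scalars form a rational
   subspace, which therefore is the whole field. Then
   \<open>ph (x * y) * ph 1 = ph x * ph y\<close>, so \<open>ph\<close> is zero or
   \<open>ph 1\<close> times an embedding.\<close>
 have base: "T ph" if Q: "Qlinear ph" and e: "eigen_on B ph" for ph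
 proof -
 let ?V = "{x. EX l. ALL y. ph (x * y) = l * ph y}"
 have "QF.subspace ?V" unfolding QF.subspace_def
 proof (intro conjI ballI allI)
 have "ph 0 = 0" using Qlinear_sum[OF Q, of "%_. 0" "{}"] by simp
 then show "0 : ?V" by (auto intro: exI[of _ 0])
 fix x y assume "x : ?V" "y : ?V"
 then obtain l k where lk: "!!z. ph (x * z) = l * ph z" "!!z. ph (y * z) = k * ph z" by blast
 have "ALL z. ph ((x + y) * z) = (l + k) * ph z" using Q lk by (simp add: Qlinear_def distrib_right)
 then show "x + y : ?V" by blast
 next
 fix q x assume "x : ?V"
 then obtain l where l: "!!z. ph (x * z) = l * ph z" by blast
 have "ALL z. ph ((of_rat q * x) * z) = (of_rat q * l) * ph z" using Q l by (simp add: Qlinear_def mult.assoc)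
 then show "of_rat q * x : ?V" by blast
 qed
 then have "QF.span B <= ?V" using e unfolding eigen_on_def by (intro QF.span_minimal) auto
 then have ex: "EX l. ALL y. ph (x * y) = l * ph y" for x using B(3) by blast
 have mult: "ph (x * y) * ph 1 = ph x * ph y" for x y
 proof -
 obtain l where l: "!!y. ph (x * y) = l * ph y" using ex[of x] by blast
 show ?thesis using l[of y] l[of 1] by simp
 qed
 show "T ph"
 proof (cases "ph 1 = 0")
 case True
 have "ph x = 0" for x
 proof -
 obtain l where l: "!!y. ph (x * y) = l * ph y" using ex[of x] by blast
 show ?thesis using l[of 1] True by simp
 qed
 then have "ph = (%y. 0)" by auto
 then show ?thesis using T0 by simp
 next
 case False
 define sg where "sg x = ph x / ph 1" for x
 have "ph 0 = 0" using Qlinear_sum[OF Q, of "%_. 0" "{}"] by simp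
 have "field_hom sg"
 proof
 show "sg 0 = 0" "sg 1 = 1" using False \<open>ph 0 = 0\<close> by (simp_all add: sg_def)
 show "sg (x + y) = sg x + sg y" for x y using Q by (simp add: sg_def Qlinear_def add_divide_distrib)
 show "sg (x * y) = sg x * sg y" for x y
 using mult[of x y] False by (simp add: sg_def field_simps)
 qed
 then have "T sg" using emb by (simp add: embeddings_def)
 from smult[OF this, of "ph 1"] show ?thesis using False by (simp add: sg_def)
 qed
 qed
 \<comment> \<open>\<open>C\<close> collects the basis elements not yet diagonalized;
   \<open>functional_step\<close> moves one of them into \<open>A\<close>.\<close>
 have "ALL A ph. A Un C = B --> Qlinear ph --> eigen_on A ph --> T ph" if "finite C" for C
 using that
 proof (induction C rule: finite_induct)
 case empty
 then show ?case using base by simp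
 next
 case (insert b C)
 show ?case
 proof (intro allI impI)
 fix A ph assume A: "A Un insert b C = B" and Q: "Qlinear ph" and e: "eigen_on A ph"
 obtain m :: "rat poly" where m: "poly (map_poly of_rat m) b = 0" "rsquarefree (map_poly of_rat m :: complex poly)"
 by (rule rational_minimal_polynomial)
 let ?m = "map_poly of_rat m :: complex poly"
 let ?L = "{z. poly ?m z = 0}"
 have m0: "?m ~= 0" using m(2) by (auto simp: rsquarefree_def)
 have dec: "?m = smult (lead_coeff ?m) (\<Prod>z\<in>?L. [:-z, 1:])"
 using complex_poly_decompose_rsquarefree[OF m(2)] by simp
 show "T ph"
 proof (rule functional_step[of T b A ?L])
 show "T ps" if "Qlinear ps" "eigen_on (insert b A) ps" for ps
 using insert.IH[rule_format, of "insert b A" ps] A that by auto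
 show "finite ?L" using m0 by (rule poly_roots_finite)
 fix y
 have "0 = ph (poly (map_poly of_rat m) b * y)"
 using m(1) Qlinear_sum[OF Q, of "%_. 0" "{}"] by simp
 also have "... = ph (SUM k<=degree m. of_rat (coeff m k) * (b ^ k * y))"
 by (simp add: poly_altdef sum_distrib_right mult.assoc)
 also have "... = (SUM k<=degree m. of_rat (coeff m k) * ph (b ^ k * y))"
 using Q by (simp add: Qlinear_sum Qlinear_def)
 also have "... = poly_act b ?m ph y" by (simp add: poly_act_def)
 also have "... = lead_coeff ?m * poly_act b (\<Prod>z\<in>?L. [:-z, 1:]) ph y"
 proof -
 let ?R = "\<Prod>z\<in>?L. [:-z, 1:]"
 have "poly_act b (smult (lead_coeff ?m) ?R) ph y = lead_coeff ?m * poly_act b ?R ph y"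
 using m0 by (simp add: poly_act_def sum_distrib_left mult.assoc)
 then show ?thesis using dec by simp
 qed
 finally show "poly_act b (\<Prod>z\<in>?L. [:-z, 1:]) ph y = 0" using m0 by simp
 qed (use add smult T0 Q e in auto)
 qed
 qed
 from this[OF B(1)] show ?thesis using ph by (auto simp: eigen_on_def)
qed

lemma finite_embeddings: "finite (embeddings :: ('a::number_field => complex) set)"
proof -
 obtain B :: "'a set" where B: "finite B" "QF.independent B" "QF.span B = UNIV" by (rule number_field_basis)
 have "EX R. finite R & (ALL sg:embeddings. sg b : R)" for b :: 'a
 proof -
 obtain m :: "rat poly" where m: "poly (map_poly of_rat m) b = 0" "rsquarefree (map_poly of_rat m :: complex poly)"
 by (rule rational_minimal_polynomial)
 let ?m = "map_poly of_rat m :: complex poly"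
 have m0: "?m ~= 0" using m(2) by (auto simp: rsquarefree_def)
 have "poly ?m (sg b) = 0" if s: "sg : embeddings" for sg
 proof -
 have f: "field_hom sg" using s by (simp add: embeddings_def)
 interpret field_hom sg by (rule f)
 have "poly ?m (sg b) = sg (poly (map_poly of_rat m) b)"
 by (simp add: poly_altdef hom_sum hom_mult hom_power field_hom_of_rat[OF f])
 then show ?thesis using m(1) by simp
 qed
 then show ?thesis using poly_roots_finite[OF m0] by (intro exI[of _ "{z. poly ?m z = 0}"]) auto
 qed
 then obtain R where R: "!!b. finite (R b)" "!!b sg. sg : embeddings ==> sg b : R (b :: 'a)" by metis
 have "inj_on (%sg. restrict sg B) (embeddings :: ('a => complex) set)"
 proof (rule inj_onI)
 fix sg ta :: "'a => complex" assume st: "sg : embeddings" "ta : embeddings" "restrict sg B = restrict ta B"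
 have "sg x = ta x" for x
 proof -
 have "sg b = ta b" if "b : B" for b using fun_cong[OF st(3), of b] that by simp
 then have "(SUM b:B. of_rat (QF.representation B x b) * sg b) = (SUM b:B. of_rat (QF.representation B x b) * ta b)"
 by simp
 moreover have "\<rho> x = (SUM b:B. of_rat (QF.representation B x b) * \<rho> b)" if "\<rho> : embeddings" for \<rho>
 proof -
 have "\<rho> x = \<rho> (SUM b:B. of_rat (QF.representation B x b) * b)" by (simp only: representation_sum[OF B(2,3,1)])
 also have "... = (SUM b:B. of_rat (QF.representation B x b) * \<rho> b)"
 unfolding Qlinear_sum[OF embedding_Qlinear[OF that]]
 using embedding_Qlinear[OF that] by (simp add: Qlinear_def)
 finally show ?thesis .
 qed
 ultimately show ?thesis using st(1,2) by simp
 qed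
 then show "sg = ta" by auto
 qed
 moreover have "(%sg. restrict sg B) ` embeddings <= Pi\<^sub>E B R" using R(2) by auto
 moreover have "finite (Pi\<^sub>E B R)" using B(1) R(1) by (intro finite_PiE) auto
 ultimately show ?thesis using finite_imageD finite_subset by blast
qed

lemma of_int_fun_apply [simp]: "(of_int c :: 'b => 'a::ring_1) i = of_int c"
proof (cases c rule: int_cases)
 case (neg n)
 then show ?thesis by (simp del: of_nat_Suc)
qed simp

interpretation QV: rat_space "%q (f :: nat => 'a::number_field) i. of_rat q * f i"
 by unfold_locales (auto simp: fun_eq_iff algebra_simps of_rat_add of_rat_mult)

interpretation QVQ: vector_space_pair "%q (f :: nat => 'a::number_field) i. of_rat q * f i" "(*) :: rat => rat => rat"
 by unfold_locales (auto simp: algebra_simps)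

lemma sum_fun_apply: "(SUM i:I. f i) x = (SUM i:I. f i (x :: 'b) :: 'a::comm_monoid_add)"
 by (induction I rule: infinite_finite_induct) auto

text \<open>Independence over the integers survives the passage to real coefficients. A rational
  functional \<open>g\<close> with value 1 at \<open>xs ! k\<close> and 0 at the other vectors
  splits into rational functionals \<open>ph m\<close> of the single coordinates. The relation among
  embeddings passes to each \<open>ph m\<close> by \<open>functional_closure\<close>; summing over
  \<open>m\<close> leaves \<open>c k\<close>.\<close>

lemma embeddings_independent:
 fixes xs :: "(nat => 'a::number_field) list" and c :: "nat => real"
 assumes xs: "zindep xs" and supp: "!!x m. x : set xs ==> m >= r ==> x m = 0"
 and zero: "!!sg m. sg : embeddings ==> m < r ==> (SUM i<length xs. of_real (c i) * sg ((xs ! i) m)) = 0"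
 and k: "k < length xs"
 shows "c k = 0"
proof -
 have ind: "QV.independent (set xs)" and d: "distinct xs" using xs QV.zindep_iff by auto
 obtain g where g: "Vector_Spaces.linear (%q (f :: nat => 'a) i. of_rat q * f i) (*) g"
 "ALL x:set xs. g x = (if x = xs ! k then 1 else 0 :: rat)"
 using QVQ.linear_independent_extend[OF ind, of "%x. if x = xs ! k then 1 else 0"] by blast
 interpret g: Vector_Spaces.linear "%q (f :: nat => 'a) i. of_rat q * f i" "(*)" g by (rule g(1))
 define sg where "sg m y = (%i. if i = m then y else (0 :: 'a))" for m :: nat and y
 define ph where "ph m y = (of_rat (g (sg m y)) :: complex)" for m y
 have Q: "Qlinear (ph m)" for m
 proof -
 have 1: "sg m (x + y) = sg m x + sg m y" for x y by (auto simp: sg_def fun_eq_iff)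
 have 2: "sg m (of_rat q * x) = (%i. of_rat q * sg m x i)" for q x by (auto simp: sg_def fun_eq_iff)
 show ?thesis unfolding Qlinear_def ph_def 1 2 g.add g.scale by (simp add: of_rat_add of_rat_mult)
 qed
 have T: "(SUM i<length xs. of_real (c i) * ph m ((xs ! i) m)) = 0" if m: "m < r" for m
 proof (rule functional_closure[of "%ps. (SUM i<length xs. of_real (c i) * ps ((xs ! i) m)) = 0"])
 show "Qlinear (ph m)" by (rule Q)
 show "(SUM i<length xs. of_real (c i) * sg ((xs ! i) m)) = 0" if "sg : embeddings" for sg
 by (rule zero[OF that m])
 fix ps ps' :: "'a => complex" and a
 assume 1: "(SUM i<length xs. of_real (c i) * ps ((xs ! i) m)) = 0"
 show "(SUM i<length xs. of_real (c i) * (a * ps ((xs ! i) m))) = 0"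
 using arg_cong[OF 1, of "(*) a"] by (simp add: sum_distrib_left mult.left_commute)
 assume "(SUM i<length xs. of_real (c i) * ps' ((xs ! i) m)) = 0"
 with 1 show "(SUM i<length xs. of_real (c i) * (ps ((xs ! i) m) + ps' ((xs ! i) m))) = 0"
 by (simp add: distrib_left sum.distrib)
 qed simp
 have gx: "of_rat (g x) = (SUM m<r. ph m (x m))" if "x : set xs" for x
 proof -
 have "x = (SUM m<r. sg m (x m))"
 using supp[OF that] by (auto simp: fun_eq_iff sum_fun_apply sg_def not_less)
 then have "g x = (SUM m<r. g (sg m (x m)))" using g.sum[of "%m. sg m (x m)" "{..<r}"] by simp
 then show ?thesis by (simp add: ph_def of_rat_sum)
 qed
 have "(SUM i<length xs. of_real (c i) * of_rat (g (xs ! i)) :: complex) = (SUM i<length xs. SUM m<r. of_real (c i) * ph m ((xs ! i) m))"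
 by (intro sum.cong refl) (simp add: gx sum_distrib_left)
 also have "... = (SUM m<r. SUM i<length xs. of_real (c i) * ph m ((xs ! i) m))" by (rule sum.swap)
 also have "... = 0" using T by simp
 finally have 0: "(SUM i<length xs. of_real (c i) * of_rat (g (xs ! i)) :: complex) = 0" .
 have "(SUM i<length xs. of_real (c i) * of_rat (g (xs ! i)) :: complex) = (SUM i<length xs. if i = k then of_real (c i) else 0)"
 using g(2) d k by (intro sum.cong refl) (auto simp: nth_eq_iff_index_eq)
 then have "(of_real (c k) :: complex) = 0" using 0 k by simp
 then show ?thesis by simp
qed

text \<open>Adding \<open>v\<close> multiplies the Gram determinant by \<open>q v v\<close>, the
  value of the form at \<open>v\<close> minus its projection. That is a real combination with
  coefficient 1 at \<open>v\<close>, so positivity of the quadratic form applies.\<close>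

lemma gram_pos_of_quadratic:
 fixes xs :: "'v::comm_ring_1 list"
 assumes sym: "!!x y. e x y = e y x"
 and pos: "!!ys c. set ys <= M ==> zindep ys ==> (EX i<length ys. c i ~= 0) ==>
 (SUM i<length ys. SUM j<length ys. c i * c j * e (ys ! i) (ys ! j)) > (0 :: real)"
 and "set xs <= M" "zindep xs"
 shows "det (gram e xs) > 0"
 using assms(3,4)
proof (induction xs rule: rev_induct)
 case Nil
 show ?case by (simp add: gram_def)
next
 case (snoc v xs)
 let ?n = "length xs"
 have G: "det (gram e xs) > 0" using snoc zindep_appendD(1)[OF snoc.prems(2)] by simp
 then have nz: "det (gram e xs) ~= 0" by simp
 obtain q where q: "!!ys. det (gram e (xs @ ys)) = det (gram e xs) * det (mat (length ys) (length ys) (%(i, j). q (ys ! i) (ys ! j)))"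
 and q2: "!!y. EX c. q y y = e y y - 2 * (SUM i<?n. c i * e (xs ! i) y) + (SUM i<?n. SUM j<?n. c i * c j * e (xs ! i) (xs ! j))"
 by (rule det_gram_append[where e = e and xs = xs, OF sym nz]) blast
 obtain c where c: "q v v = e v v - 2 * (SUM i<?n. c i * e (xs ! i) v) + (SUM i<?n. SUM j<?n. c i * c j * e (xs ! i) (xs ! j))"
 using q2[of v] by blast
 define d where "d i = (if i < ?n then - c i else 1)" for i
 let ?ys = "xs @ [v]"
 have "(SUM i<length ?ys. SUM j<length ?ys. d i * d j * e (?ys ! i) (?ys ! j)) > 0"
 by (rule pos[OF snoc.prems]) (auto simp: d_def intro!: exI[of _ ?n])
 moreover have "(SUM i<length ?ys. SUM j<length ?ys. d i * d j * e (?ys ! i) (?ys ! j)) = q v v"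
 proof -
 have "(SUM i<?n. c i * e (xs ! i) v) = (SUM i<?n. c i * e v (xs ! i))" using sym[of v] by simp
 then show ?thesis
 by (simp add: d_def nth_append c sum.distrib sum_negf sum_subtractf)
 qed
 ultimately have "q v v > 0" by simp
 moreover have "det (gram e ?ys) = det (gram e xs) * q v v" unfolding q by (simp add: det_single)
 ultimately show ?case using G by simp
qed

section \<open>Prime ideals of the ring of integers\<close>

abbreviation int_ring :: "'a::number_field set" where "int_ring \<equiv> {x. aint x}"

lemma roi_simps [simp]:
 "carrier ring_of_integers = {x :: 'a::number_field. aint x}"
 "mult ring_of_integers = (%x y :: 'a. x * y)" "one ring_of_integers = (1 :: 'a)"
 "zero ring_of_integers = (0 :: 'a)" "add ring_of_integers = (%x y :: 'a. x + y)"
 by (auto simp: ring_of_integers_def)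

lemma cring_roi: "cring (ring_of_integers :: 'a::number_field ring)"
proof (rule cringI)
 show "abelian_group (ring_of_integers :: 'a ring)"
 proof (rule abelian_groupI)
 fix x :: 'a assume "x : carrier ring_of_integers"
 then show "EX y:carrier ring_of_integers. y \<oplus>\<^bsub>ring_of_integers\<^esub> x = \<zero>\<^bsub>ring_of_integers\<^esub>"
 by (intro bexI[of _ "- x"]) auto
 qed (auto simp: algebraic_int_add)
 show "Group.comm_monoid (ring_of_integers :: 'a ring)"
 by unfold_locales (auto simp: algebraic_int_mult)
qed (auto simp: algebra_simps)

text \<open>Nonzero prime ideals without algebra records. Nonvanishing appears as containing a
  nonzero rational integer, which gives access to finitely many residues.\<close>

definition prime_id :: "'a::number_field set => bool" where
 "prime_id P \<longleftrightarrow> P <= int_ring & (ALL x:P. ALL y:P. x + y : P) & (ALL a:int_ring. ALL x:P. a * x : P) & 1 ~: P &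
 (ALL a:int_ring. ALL b:int_ring. a * b : P --> a : P \<or> b : P) & (EX m::int. m ~= 0 & of_int m : P)"

lemma integer_multiple_in:
 fixes x :: "'a::number_field"
 assumes "x ~= 0"
 obtains m :: int and y where "m ~= 0" "aint y" "of_int m = y * x"
proof -
 obtain m where m: "m ~= 0" "aint (of_int m * inverse x)" by (rule integral_multiple_exists)
 then show thesis using assms by (intro that[of m "of_int m * inverse x"]) auto
qed

lemma prime_idD:
 assumes "prime_id P"
 shows "x : P ==> aint x" "x : P ==> y : P ==> x + y : P"
 "aint a ==> x : P ==> a * x : P" "1 ~: P" "0 : P" "x : P ==> - x : P"
 "x : P ==> y : P ==> x - y : P"
 "aint a ==> aint b ==> a * b : P ==> a : P \<or> b : P"
proof -
 note p = assms[unfolded prime_id_def]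
 show 1: "x : P ==> aint x" for x using p by blast
 show 2: "x : P ==> y : P ==> x + y : P" for x y using p by blast
 show 3: "aint a ==> x : P ==> a * x : P" for a x using p by blast
 show "1 ~: P" using p by blast
 obtain m :: int where "of_int m : P" using p by blast
 then show "0 : P" using 3[of 0 "of_int m"] by simp
 show 4: "x : P ==> - x : P" for x using 3[of "- 1" x] by simp
 show "x : P ==> y : P ==> x - y : P" using 2[of x "- y"] 4[of y] by simp
 show "aint a ==> aint b ==> a * b : P ==> a : P \<or> b : P" using p by blast
qed

lemma finite_place_iff: "v : FP \<longleftrightarrow> prime_id v"
proof
 assume "v : FP"
 then have p: "primeideal v ring_of_integers" and n: "v ~= {0}" by (auto simp: finite_places_def)
 interpret primeideal v "ring_of_integers :: 'a ring" by (rule p)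
 have sub: "v <= int_ring" using Icarr by auto
 have z: "0 : v" using additive_subgroup.zero_closed[OF is_additive_subgroup] by simp
 have mul: "a * x : v" if "aint a" "x : v" for a x using I_l_closed[OF that(2), of a] that(1) by simp
 obtain x where x: "x : v" "x ~= 0" using n z by blast
 obtain m :: int and y where m: "m ~= 0" "aint y" "of_int m = y * x" by (rule integer_multiple_in[OF x(2)])
 have mv: "of_int m : v" unfolding m(3) by (rule mul[OF m(2) x(1)])
 show "prime_id v" unfolding prime_id_def
 proof (intro conjI ballI impI)
 show "1 ~: v"
 proof
 assume "1 : v"
 then have "x : v" if "aint x" for x using mul[of x 1] that by simp
 then have "v = carrier ring_of_integers" using sub by auto
 then show False using I_notcarr by simp
 qed
 show "EX m::int. m ~= 0 & of_int m : v" using m(1) mv by (intro exI[of _ m] conjI)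
 show "x + y : v" if "x : v" "y : v" for x y
 using additive_subgroup.a_closed[OF is_additive_subgroup that] by simp
 show "a : v \<or> b : v" if "a : int_ring" "b : int_ring" "a * b : v" for a b
 using I_prime[of a b] that by simp
 show "a * x : v" if "a : int_ring" "x : v" for a x using that by (intro mul) simp_all
 qed (rule sub)
next
 assume p: "prime_id v"
 obtain m :: int where m: "m ~= 0" "of_int m : v" using p by (auto simp: prime_id_def)
 have z: "0 : v" by (rule prime_idD(5)[OF p])
 have neg: "- x : v" if "x : v" for x
 proof -
 show ?thesis by (rule prime_idD(6)[OF p that])
 qed
 interpret cring "ring_of_integers :: 'a ring" by (rule cring_roi)
 have "ideal v ring_of_integers"
 proof (rule idealI)
 show "subgroup v (add_monoid ring_of_integers)"
 proof
 show "v <= carrier (add_monoid ring_of_integers)" using p by (simp add: prime_id_def)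
 show "x \<otimes>\<^bsub>add_monoid ring_of_integers\<^esub> y : v" if "x : v" "y : v" for x y using p that by (simp add: prime_id_def)
 show "\<one>\<^bsub>add_monoid ring_of_integers\<^esub> : v" using z by simp
 show "inv\<^bsub>add_monoid ring_of_integers\<^esub> x : v" if x: "x : v" for x
 proof -
 have xc: "x : carrier ring_of_integers" using p x by (auto simp: prime_id_def)
 have "- x : carrier ring_of_integers" using xc by simp
 then have "\<ominus>\<^bsub>ring_of_integers\<^esub> x = - x" using minus_equality[of "- x" x] xc by simp
 then show ?thesis using neg[OF x] by (simp add: a_inv_def)
 qed
 qed
 show "ring (ring_of_integers :: 'a ring)" by (rule ring_axioms)
 show "x \<otimes>\<^bsub>ring_of_integers\<^esub> a : v" "a \<otimes>\<^bsub>ring_of_integers\<^esub> x : v"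
 if "a : v" "x : carrier ring_of_integers" for a x
 using prime_idD(3)[OF p, of x a] that by (simp_all add: mult.commute)
 qed
 moreover have "carrier ring_of_integers ~= v"
 proof
 assume e: "carrier ring_of_integers = v"
 have "1 : carrier (ring_of_integers :: 'a ring)" by simp
 then show False using prime_idD(4)[OF p] unfolding e by simp
 qed
 ultimately have "primeideal v ring_of_integers"
 proof (rule primeidealI[OF _ cring_axioms])
 show "a : v \<or> b : v" if "a : carrier ring_of_integers" "b : carrier ring_of_integers"
 "a \<otimes>\<^bsub>ring_of_integers\<^esub> b : v" for a b
 using prime_idD(8)[OF p, of a b] that by simp
 qed
 moreover have "v ~= {0}" using m by auto
 ultimately show "v : FP" by (simp add: finite_places_def)
qed

lemma finite_residues:
 assumes "m ~= (0::int)"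
 obtains R :: "'a::number_field set" where "finite R" "R <= int_ring"
 "ALL x. aint x --> (EX r:R. EX y. aint y & x - r = of_int m * y)"
proof -
 obtain S :: "'a list" where S: "zspan S = int_ring" by (rule integers_generated)
 define R where "R = (%c. zcomb c S) ` ({..<length S} \<rightarrow>\<^sub>E {0..<\<bar>m\<bar>})"
 have fin: "finite R" unfolding R_def by (intro finite_imageI finite_PiE) auto
 have sub: "R <= int_ring" using S by (auto simp: R_def zspan_def)
 have "EX r:R. EX y. aint y & x - r = of_int m * y" if "aint x" for x
 proof -
 have "x : zspan S" using S that by simp
 then obtain c where c: "x = zcomb c S" by (rule zspanE)
 define r where "r = (\<lambda>i\<in>{..<length S}. c i mod \<bar>m\<bar>)"
 define t where "t i = sgn m * (c i div \<bar>m\<bar>)" for i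
 have "c i - c i mod \<bar>m\<bar> = m * t i" for i
 proof -
 have "m * t i = \<bar>m\<bar> * (c i div \<bar>m\<bar>)" by (simp add: t_def abs_if sgn_if)
 then show ?thesis by (simp add: minus_mod_eq_mult_div)
 qed
 then have "x - zcomb r S = zcomb (%i. m * t i) S"
 unfolding c zcomb_diff by (intro zcomb_cong) (simp add: r_def)
 then have "x - zcomb r S = of_int m * zcomb t S" by (simp add: zcomb_mult)
 moreover have "aint (zcomb t S)" using S zcomb_in_zspan[of t S] by auto
 moreover have "r : {..<length S} \<rightarrow>\<^sub>E {0..<\<bar>m\<bar>}"
 proof (rule PiE_I)
 fix i assume "i : {..<length S}"
 then show "r i : {0..<\<bar>m\<bar>}" using assms by (simp add: r_def)
 qed (simp add: r_def)
 then have "zcomb r S : R" unfolding R_def by (rule imageI)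
 ultimately show ?thesis by blast
 qed
 then show thesis using that[OF fin sub] by blast
qed

text \<open>There are finitely many residues modulo an integer in \<open>P\<close>, so two powers of
  \<open>x\<close> agree modulo \<open>P\<close>. Cancelling the smaller one, which is outside
  \<open>P\<close>, makes a positive power of \<open>x\<close> congruent to 1.\<close>

lemma inverse_mod_prime:
 assumes P: "prime_id P" and x: "aint x" "x ~: P"
 obtains w where "aint w" "w * x - 1 : P"
proof -
 obtain m :: int where m: "m ~= 0" "of_int m : P" using P by (auto simp: prime_id_def)
 obtain R :: "'a set" where R: "finite R" "R <= int_ring"
 "ALL x. aint x --> (EX r:R. EX y. aint y & x - r = of_int m * y)"
 by (rule finite_residues[OF m(1)])
 have pw: "aint (x ^ i)" for i by (rule algebraic_int_power[OF x(1)])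
 have "EX r. r : R & x ^ i - r : P" for i
 proof -
 obtain r y where ry: "r : R" "aint y" "x ^ i - r = of_int m * y" using R(3) pw[of i] by blast
 have "y * of_int m : P" by (rule prime_idD(3)[OF P ry(2) m(2)])
 then have "x ^ i - r : P" using ry(3) by (simp add: mult.commute)
 then show ?thesis using ry(1) by blast
 qed
 then obtain r where r: "ALL i. r i : R & x ^ i - r i : P" by (rule choice[THEN exE, OF allI])
 have "~ inj r"
 proof
 assume "inj r"
 then have "infinite (range r)" by (rule range_inj_infinite)
 moreover have "range r <= R" using r by auto
 ultimately show False using R(1) finite_subset by blast
 qed
 then obtain i0 j0 where ij0: "i0 ~= j0" "r i0 = r j0" unfolding inj_def by blast
 have "EX i j. i < j & r i = r j"
 proof (cases "i0 < j0")
 case True then show ?thesis using ij0(2) by blast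
 next
 case False
 then have "j0 < i0" using ij0(1) by simp
 then show ?thesis using ij0(2) by (intro exI[of _ j0] exI[of _ i0]) simp
 qed
 then obtain i j where ij: "i < j" "r i = r j" by blast
 have "x ^ j - x ^ i : P"
 proof -
 have "x ^ j - r j : P" "x ^ i - r i : P" using r by blast+
 from prime_idD(7)[OF P this] show ?thesis using ij(2) by simp
 qed
 also have "x ^ j - x ^ i = x ^ i * (x ^ (j - i) - 1)" using ij(1) by (simp add: right_diff_distrib flip: power_add)
 finally have "x ^ i : P \<or> x ^ (j - i) - 1 : P"
 by (rule prime_idD(8)[OF P pw algebraic_int_diff[OF pw algebraic_int_1]])
 moreover have "x ^ i ~: P" for i
 proof (induction i)
 case 0 then show ?case using prime_idD(4)[OF P] by simp
 next
 case (Suc i) then show ?case using prime_idD(8)[OF P x(1) pw[of i]] x(2) by auto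
 qed
 ultimately have 1: "x ^ (j - i) - 1 : P" by blast
 have "x ^ (j - i) = x ^ (j - i - 1) * x" using ij(1) by (metis Suc_diff_1 mult.commute power_Suc zero_less_diff)
 then show thesis using that[OF pw[of "j - i - 1"]] 1 by simp
qed

lemma prime_id_maximal:
 assumes P: "prime_id P" and v: "prime_id v" and sub: "P <= v" shows "P = v"
proof (rule ccontr)
 assume "P ~= v"
 then obtain x where x: "x : v" "x ~: P" using sub by blast
 have ax: "aint x" by (rule prime_idD(1)[OF v x(1)])
 obtain w where w: "aint w" "w * x - 1 : P" by (rule inverse_mod_prime[OF P ax x(2)])
 have "w * x - (w * x - 1) : v"
 by (rule prime_idD(7)[OF v prime_idD(3)[OF v w(1) x(1)] subsetD[OF sub w(2)]])
 then show False using prime_idD(4)[OF v] by simp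
qed

lemma finite_maximizer:
 fixes f :: "'b => nat"
 assumes "Q a" "!!x. Q x ==> f x <= N"
 obtains x where "Q x" "!!y. Q y ==> f y <= f x"
proof -
 have "ALL y. Q y --> f y < Suc N" using assms(2) by (simp add: less_Suc_eq_le)
 from ex_has_greatest_nat[OF assms(1) this] obtain x where "Q x" "ALL y. Q y --> f y <= f x"
 by (elim exE conjE)
 then show thesis using that[of x] by simp
qed

lemma stable_imp_algebraic_int:
 fixes t :: "'a::number_field"
 assumes H: "zsub H" "H <= int_ring" "of_int m : H" "m ~= 0" "!!a x. aint a ==> x : H ==> a * x : H"
 and st: "!!x. x : H ==> t * x : H"
 shows "aint t"
proof -
 obtain S :: "'a list" where S: "zspan S = int_ring" by (rule integers_generated)
 obtain hs where hs: "zspan hs = H"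
 proof (rule QF.sandwich_generated[OF H(1), of 1 m S])
 show "of_int m * e : H" if "e : set S" for e
 proof -
 have "aint e" using that S set_subset_zspan[of S] by auto
 then show ?thesis using H(5)[OF _ H(3)] by (simp add: mult.commute)
 qed
 show "of_int 1 * x : zspan S" if "x : H" for x using that H(2) S by auto
 qed (use H(4) that in auto)
 show ?thesis
 proof (rule algebraic_int_if_stable[of hs])
 fix h assume "h : set hs"
 then have "h : H" using set_subset_zspan[of hs] hs by blast
 then show "t * h : zspan hs" unfolding hs by (rule st)
 next
 show "EX h:set hs. h ~= 0"
 proof (rule ccontr)
 assume "~ ?thesis"
 then have "set hs <= {0}" by blast
 then have "zspan hs <= {0}" by (intro zspan_least) (auto simp: zsub_def)
 then show False using hs H(3,4) by auto
 qed
 qed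
qed

text \<open>\<open>t\<close> is an inverse uniformizer: \<open>c\<close> is chosen such that its annihilator modulo \<open>m\<close> is maximal
 among those contained in \<open>v\<close>; such an annihilator is prime, hence equal to \<open>v\<close>, and \<open>t = c / m\<close>.\<close>

lemma inverse_uniformizer:
 assumes v: "prime_id (v :: 'a::number_field set)"
 obtains t b where "ALL x. aint x --> (aint (t * x) \<longleftrightarrow> x : v)"
 "b : v" "t * b ~: v" "aint (t * b)" "~ aint t"
proof -
 obtain m :: int where m: "m ~= 0" "of_int m : v" using v by (auto simp: prime_id_def)
 obtain R :: "'a set" where R: "finite R" "R <= int_ring"
 "ALL x. aint x --> (EX r:R. EX y. aint y & x - r = of_int m * y)"
 by (rule finite_residues[OF m(1)])
 define I where "I c = {x. aint x & (EX y. aint y & x * c = of_int m * y)}" for c :: 'a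
 have I_add: "x + y : I c" if xy: "x : I c" "y : I c" for x y c
 proof -
 obtain x' y' where "aint x'" "aint y'" "x * c = of_int m * x'" "y * c = of_int m * y'"
 using xy by (auto simp: I_def)
 moreover from this have "(x + y) * c = of_int m * (x' + y')" by (simp add: algebra_simps)
 ultimately show ?thesis using that by (auto simp: I_def intro!: algebraic_int_add exI[of _ "x' + y'"])
 qed
 have I_mult: "a * x : I c" if ax: "aint a" "x : I c" for a x c
 proof -
 obtain x' where "aint x'" "x * c = of_int m * x'" using ax(2) by (auto simp: I_def)
 moreover from this have "(a * x) * c = of_int m * (a * x')" by (simp add: mult.assoc mult.left_commute)
 ultimately show ?thesis using that by (auto simp: I_def intro!: algebraic_int_mult exI[of _ "a * x'"])
 qed
 have I_m: "of_int m * y : I c" if "aint c" "aint y" for c y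
 using that by (auto simp: I_def algebraic_int_mult mult.assoc intro!: exI[of _ "y * c"])
 \<comment> \<open>An annihilator contains all integral multiples of \<open>m\<close>, so it is
   determined by its members in the finite set \<open>R\<close>. This allows maximality to be
   measured by counting.\<close>
 have I_res: "I c <= I d" if c: "aint c" "aint d" and R': "I c Int R <= I d" for c d
 proof
 fix x assume x: "x : I c"
 then obtain r y where ry: "r : R" "aint y" "x - r = of_int m * y" using R(3) by (auto simp: I_def)
 have "(- 1) * (of_int m * y) : I c" by (rule I_mult[OF _ I_m[OF c(1) ry(2)]]) simp
 from I_add[OF x this] have "r : I c" unfolding ry(3)[symmetric] by simp
 then have "r : I d" using R' ry(1) by blast
 from I_add[OF this I_m[OF c(2) ry(2)]] show "x : I d" unfolding ry(3)[symmetric] by simp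
 qed
 define Q where "Q c \<longleftrightarrow> aint c & I c <= v" for c
 have "Q 1"
 proof -
 have "y * of_int m : v" if "aint y" for y by (rule prime_idD(3)[OF v that m(2)])
 then show ?thesis by (auto simp: Q_def I_def mult.commute)
 qed
 moreover have "card (I c Int R) <= card R" for c using R(1) by (intro card_mono) auto
 ultimately obtain c where c: "Q c" and cmax: "!!d. Q d ==> card (I d Int R) <= card (I c Int R)"
 using finite_maximizer[of Q 1 "%c. card (I c Int R)" "card R"] by blast
 have ac: "aint c" and Ic: "I c <= v" using c by (auto simp: Q_def)
 have sup_eq: "I d = I c" if "Q d" "I c <= I d" for d
 proof -
 have "I c Int R = I d Int R" using cmax[OF that(1)] that(2) R(1) by (intro card_seteq) auto
 then have "I d <= I c" using that(1) ac by (intro I_res) (auto simp: Q_def)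
 with that(2) show ?thesis by (intro subset_antisym)
 qed
 have sub_s: "I c <= I (c * s)" if s: "aint s" for s
 proof
 fix x assume "x : I c"
 then obtain y where "aint x" "aint y" "x * c = of_int m * y" by (auto simp: I_def)
 moreover from this have "x * (c * s) = of_int m * (y * s)" by (simp add: mult.assoc[symmetric])
 ultimately show "x : I (c * s)" using s by (auto simp: I_def intro!: algebraic_int_mult exI[of _ "y * s"])
 qed
 have I_shift: "x * s : I c \<longleftrightarrow> x : I (c * s)" if "aint s" "aint x" for x s
 using that by (auto simp: I_def algebraic_int_mult mult_ac)
 \<comment> \<open>For \<open>s\<close> outside \<open>v\<close> the annihilator of
   \<open>c * s\<close> is still contained in \<open>v\<close>, since \<open>z * s\<close> in
   \<open>v\<close> forces \<open>z\<close> into \<open>v\<close>. Maximality then leaves no room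
   for growth.\<close>
 have outside: "I (c * s) = I c" if s: "aint s" "s ~: v" for s
 proof (rule sup_eq)
 show "Q (c * s)" unfolding Q_def
 proof
 show "I (c * s) <= v"
 proof
 fix z assume z: "z : I (c * s)"
 then have az: "aint z" by (simp add: I_def)
 then have "z * s : v" using I_shift[OF s(1) az] z Ic by blast
 then show "z : v" using prime_idD(8)[OF v az s(1)] s(2) by blast
 qed
 qed (rule algebraic_int_mult[OF ac s(1)])
 qed (rule sub_s[OF s(1)])
 have "prime_id (I c)" unfolding prime_id_def
 proof (intro conjI ballI impI)
 show "1 ~: I c" using Ic prime_idD(4)[OF v] by blast
 show "EX k::int. k ~= 0 & of_int k : I c" using I_m[OF ac algebraic_int_1] m(1) by (intro exI[of _ m]) simp
 fix x y :: 'a assume x: "x : int_ring" and y: "y : int_ring" and xy: "x * y : I c"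
 show "x : I c \<or> y : I c"
 proof (cases "I (c * x) <= v")
 case True
 then have "Q (c * x)" using ac x by (simp add: Q_def algebraic_int_mult)
 then have "I (c * x) = I c" using sub_s[of x] x by (intro sup_eq) auto
 moreover have "y : I (c * x)" using I_shift[of x y] x y xy by (simp add: mult.commute)
 ultimately show ?thesis by blast
 next
 case False
 then obtain s where s: "s : I (c * x)" "s ~: v" by blast
 then have as: "aint s" by (simp add: I_def)
 have "s * x : I c" using I_shift[of x s] x as s(1) by simp
 then have "x : I (c * s)" using I_shift[of s x] as x by (simp add: mult.commute)
 then show ?thesis using outside[OF as s(2)] by blast
 qed
 next
 show "I c <= int_ring" by (auto simp: I_def)
 show "x + y : I c" if "x : I c" "y : I c" for x y by (rule I_add[OF that])
 show "a * x : I c" if "a : int_ring" "x : I c" for a x using that by (intro I_mult) simp_all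
 qed
 then have Icv: "I c = v" using v Ic by (rule prime_id_maximal)
 define t where "t = c / of_int m"
 have tv: "aint (t * x) \<longleftrightarrow> x : v" if x: "aint x" for x
 proof -
 have "x : v \<longleftrightarrow> (EX y. aint y & x * c = of_int m * y)" unfolding Icv[symmetric] using x by (simp add: I_def)
 also have "... \<longleftrightarrow> (EX y. aint y & t * x = y)" using m(1) by (auto simp: t_def field_simps)
 finally show ?thesis by simp
 qed
 have nt: "~ aint t" using tv[of 1] prime_idD(4)[OF v] by simp
 \<comment> \<open>If \<open>t\<close> mapped \<open>v\<close> into itself, the finitely generated
   group \<open>v\<close> would be stable under \<open>t\<close>, and \<open>t\<close> would be
   integral.\<close>
 have "EX b:v. t * b ~: v"
 proof (rule ccontr)
 assume "~ ?thesis"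
 then have "aint t"
 using prime_idD[OF v] m by (intro stable_imp_algebraic_int[of v m t]) (auto simp: zsub_def)
 then show False using nt by simp
 qed
 then obtain b where b: "b : v" "t * b ~: v" by blast
 have "aint (t * b)" using tv[OF prime_idD(1)[OF v b(1)]] b(1) by simp
 then show thesis using that[of t b] tv b nt by blast
qed

section \<open>The valuation of a prime ideal\<close>

text \<open>\<open>b\<close> plays the part of a local parameter and \<open>t\<close> that of its
  inverse: \<open>t * b\<close> is a unit at \<open>v\<close>. Divisibility by powers of
  \<open>v\<close> becomes integrality after multiplication by powers of \<open>t\<close>, which
  yields the valuation without factoring ideals.\<close>

locale uniformizer =
 fixes v :: "'a::number_field set" and t b :: 'a
 assumes v: "prime_id v"
 and tv: "aint x ==> aint (t * x) \<longleftrightarrow> x : v"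
 and b: "b : v" "t * b ~: v" "aint (t * b)"
 and nt: "~ aint t"
begin

lemma t0: "t ~= 0" using nt by auto

text \<open>As \<open>t\<close> is not integral, smaller exponents are not obvious. If
  \<open>t ^ k * x\<close> were outside \<open>v\<close> for some \<open>k < n\<close>, its product
  with \<open>(t * b) ^ (n - k)\<close> would be outside \<open>v\<close> as well; but this product
  is \<open>b ^ (n - k)\<close> times the integral \<open>t ^ n * x\<close>, so it lies in
  \<open>v\<close>.\<close>

lemma powers_stay_integral:
 assumes x: "aint x" and n: "aint (t ^ n * x)"
 shows "k <= n ==> aint (t ^ k * x)"
proof (induction k)
 case (Suc k)
 then have zk: "aint (t ^ k * x)" by simp
 have "t ^ k * x : v"
 proof (rule ccontr)
 assume nk: "t ^ k * x ~: v"
 define j where "j = n - k - 1"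
 have nj: "n = Suc j + k" using Suc.prems by (simp add: j_def)
 have u: "aint ((t * b) ^ i)" "(t * b) ^ i ~: v" for i
 proof -
 show "aint ((t * b) ^ i)" for i by (rule algebraic_int_power[OF b(3)])
 then show "(t * b) ^ i ~: v"
 by (induction i) (use prime_idD(4,8)[OF v] b in auto)
 qed
 have ab: "aint b" by (rule prime_idD(1)[OF v b(1)])
 have "(b ^ j * (t ^ n * x)) * b : v"
 by (rule prime_idD(3)[OF v algebraic_int_mult[OF algebraic_int_power[OF ab] n] b(1)])
 also have "(b ^ j * (t ^ n * x)) * b = (t * b) ^ Suc j * (t ^ k * x)"
 unfolding nj by (simp add: power_add power_mult_distrib mult_ac)
 finally show False using prime_idD(8)[OF v u(1) zk] u(2) nk by blast
 qed
 then show ?case using tv[OF zk] by (simp add: mult.assoc)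
qed (use x in simp)

text \<open>For the harder inclusion \<open>x\<close> has to be decomposed in the product ideal. If
  \<open>w\<close> inverts \<open>t * b\<close> modulo \<open>v\<close> and
  \<open>e = w * (t * b) - 1\<close>, then \<open>x = (w * (t * x)) * b + x * (- e)\<close>, where
  \<open>b\<close> and \<open>e\<close> lie in \<open>v\<close> and the other factors in the lower
  power.\<close>

lemma ideal_power_iff:
 "x : v [^]\<^bsub>ideals_set ring_of_integers\<^esub> (n::nat) \<longleftrightarrow> aint x & aint (t ^ n * x)"
proof (induction n arbitrary: x)
 case 0
 show ?case by (simp add: nat_pow_def ideals_set_def)
next
 case (Suc n)
 let ?V = "v [^]\<^bsub>ideals_set ring_of_integers\<^esub> n"
 have V: "v [^]\<^bsub>ideals_set ring_of_integers\<^esub> Suc n = ideal_prod ring_of_integers ?V v"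
 by (simp add: nat_pow_def ideals_set_def)
 show ?case
 proof
 assume "x : v [^]\<^bsub>ideals_set ring_of_integers\<^esub> Suc n"
 then have "x : ideal_prod ring_of_integers ?V v" unfolding V .
 then show "aint x & aint (t ^ Suc n * x)"
 proof (induction rule: ideal_prod.induct)
 case (prod i j)
 have i: "aint i" "aint (t ^ n * i)" using Suc.IH prod(1) by auto
 have j: "aint j" "aint (t * j)" using prime_idD(1)[OF v prod(2)] tv prod(2) by auto
 have "aint ((t ^ n * i) * (t * j))" by (rule algebraic_int_mult[OF i(2) j(2)])
 moreover have "(t ^ n * i) * (t * j) = t ^ Suc n * (i * j)" by simp
 ultimately show ?case using algebraic_int_mult[OF i(1) j(1)] by (simp only: roi_simps simp_thms)
 next
 case (sum s1 s2)
 then show ?case by (auto simp: distrib_left intro!: algebraic_int_add)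
 qed
 next
 assume x: "aint x & aint (t ^ Suc n * x)"
 obtain w where w: "aint w" "w * (t * b) - 1 : v" by (rule inverse_mod_prime[OF v b(3,2)])
 let ?e = "w * (t * b) - 1"
 have pw: "aint (t ^ k * x)" if "k <= Suc n" for k
 using powers_stay_integral[of x "Suc n" k] x that by blast
 have 1: "w * (t * x) : ?V"
 proof -
 have "aint (w * (t * x))" using pw[of 1] by (simp add: algebraic_int_mult[OF w(1)])
 moreover have "aint (w * (t ^ Suc n * x))" using x by (simp only: algebraic_int_mult[OF w(1)])
 then have "aint (t ^ n * (w * (t * x)))" by (simp add: mult_ac)
 ultimately show ?thesis using Suc.IH by blast
 qed
 have 2: "x : ?V" using Suc.IH x pw[of n] by auto
 have "(w * (t * x)) \<otimes>\<^bsub>ring_of_integers\<^esub> b : ideal_prod ring_of_integers ?V v"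
 by (rule ideal_prod.prod[OF 1 b(1)])
 moreover have "x \<otimes>\<^bsub>ring_of_integers\<^esub> (- ?e) : ideal_prod ring_of_integers ?V v"
 by (rule ideal_prod.prod[OF 2 prime_idD(6)[OF v w(2)]])
 ultimately have "(w * (t * x)) \<otimes>\<^bsub>ring_of_integers\<^esub> b \<oplus>\<^bsub>ring_of_integers\<^esub> x \<otimes>\<^bsub>ring_of_integers\<^esub> (- ?e)
 : ideal_prod ring_of_integers ?V v" by (rule ideal_prod.sum)
 then show "x : v [^]\<^bsub>ideals_set ring_of_integers\<^esub> Suc n" unfolding V by (simp add: algebra_simps)
 qed
qed

text \<open>Otherwise the elements that stay integral under all powers of \<open>t\<close> would
  form a nonzero ideal stable under \<open>t\<close>, and \<open>t\<close> would be
  integral.\<close>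

lemma powers_leave:
 assumes x: "aint x" "x ~= 0" shows "EX n. ~ aint (t ^ n * x)"
proof (rule ccontr)
 assume "\<nexists>n. ~ aint (t ^ n * x)"
 then have all: "aint (t ^ n * x)" for n by blast
 define H where "H = {y. ALL n. aint (t ^ n * y)}"
 obtain m :: int and y where m: "m ~= 0" "aint y" "of_int m = y * x" by (rule integer_multiple_in[OF x(2)])
 have mult: "a * y : H" if a: "aint a" and y: "y : H" for a y
 proof -
 have "aint (t ^ n * (a * y))" for n
 proof -
 have "aint (a * (t ^ n * y))" using y by (intro algebraic_int_mult[OF a]) (simp add: H_def)
 then show ?thesis by (simp add: mult.left_commute)
 qed
 then show ?thesis by (simp add: H_def)
 qed
 have "aint t"
 proof (rule stable_imp_algebraic_int[of H m])
 show "zsub H" by (auto simp: zsub_def H_def right_diff_distrib algebraic_int_diff)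
 show "H <= int_ring"
 proof
 fix y assume "y : H"
 then have "aint (t ^ 0 * y)" unfolding H_def by blast
 then show "y : int_ring" by simp
 qed
 have "x : H" using all by (simp add: H_def)
 then show "of_int m : H" unfolding m(3) by (rule mult[OF m(2)])
 show "t * y : H" if "y : H" for y
 proof -
 have "aint (t ^ n * (t * y))" for n
 proof -
 have "aint (t ^ Suc n * y)" using that unfolding H_def by blast
 then show ?thesis by (simp add: mult_ac)
 qed
 then show ?thesis by (simp add: H_def)
 qed
 qed (use m(1) mult in auto)
 then show False using nt by simp
qed

lemma ord_int_exists:
 assumes x: "aint x" "x ~= 0"
 shows "aint (t ^ place_ord_int v x * x)" "t ^ place_ord_int v x * x ~: v"
 and "aint (t ^ n * x) ==> n <= place_ord_int v x"
proof -
 let ?Q = "%n. aint (t ^ n * x)"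
 have def: "place_ord_int v x = (GREATEST n. ?Q n)"
 unfolding place_ord_int_def ideal_power_iff using x(1) by simp
 obtain N where N: "~ ?Q N" using powers_leave[OF x] by blast
 have bd: "n <= N" if "?Q n" for n
 using powers_stay_integral[OF x(1) that, of N] N by (cases "N <= n") auto
 have "?Q 0" using x by simp
 then have Q: "?Q (place_ord_int v x)" unfolding def by (rule GreatestI_nat) (rule bd)
 have le: "n <= place_ord_int v x" if "?Q n" for n unfolding def using that by (rule Greatest_le_nat) (rule bd)
 show "?Q (place_ord_int v x)" by (rule Q)
 show "?Q n ==> n <= place_ord_int v x" by (rule le)
 show "t ^ place_ord_int v x * x ~: v"
 proof
 assume "t ^ place_ord_int v x * x : v"
 then have "aint (t * (t ^ place_ord_int v x * x))" using tv[OF Q] by simp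
 then have "?Q (Suc (place_ord_int v x))" by (simp add: mult.assoc)
 then show False using le by fastforce
 qed
qed

lemma ord_int_eqI:
 assumes x: "aint x" "x ~= 0" and n: "aint (t ^ n * x)" "t ^ n * x ~: v"
 shows "place_ord_int v x = n"
proof (rule antisym)
 show "n <= place_ord_int v x" by (rule ord_int_exists(3)[OF x n(1)])
 show "place_ord_int v x <= n"
 proof (rule ccontr)
 assume "~ place_ord_int v x <= n"
 then have "aint (t ^ Suc n * x)"
 by (intro powers_stay_integral[OF x(1) ord_int_exists(1)[OF x]]) simp
 then show False using tv[OF n(1)] n(2) by (simp add: mult.assoc)
 qed
qed

lemma ord_int_mult:
 assumes "aint x" "x ~= 0" "aint y" "y ~= 0"
 shows "place_ord_int v (x * y) = place_ord_int v x + place_ord_int v y"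
proof -
 let ?m = "place_ord_int v x" and ?n = "place_ord_int v y"
 have eq: "t ^ (?m + ?n) * (x * y) = (t ^ ?m * x) * (t ^ ?n * y)" by (simp add: power_add mult_ac)
 show ?thesis
 proof (rule ord_int_eqI)
 show "aint (t ^ (?m + ?n) * (x * y))" "t ^ (?m + ?n) * (x * y) ~: v"
 unfolding eq using ord_int_exists(1,2)[OF assms(1,2)] ord_int_exists(1,2)[OF assms(3,4)] prime_idD(8)[OF v]
 by (auto intro: algebraic_int_mult)
 qed (use assms in "auto intro: algebraic_int_mult")
qed

lemma place_ord_quotient:
 assumes "aint a" "aint c" "a ~= 0" "c ~= 0"
 shows "place_ord v (a / c) = int (place_ord_int v a) - int (place_ord_int v c)"
 unfolding place_ord_def
proof (rule the_equality)
 show "EX a' c'. aint a' & aint c' & a' ~= 0 & c' ~= 0 & a / c = a' / c' &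
 int (place_ord_int v a) - int (place_ord_int v c) = int (place_ord_int v a') - int (place_ord_int v c')"
 using assms by blast
 fix k assume "EX a' c'. aint a' & aint c' & a' ~= 0 & c' ~= 0 & a / c = a' / c' &
 k = int (place_ord_int v a') - int (place_ord_int v c')"
 then obtain a' c' where h: "aint a'" "aint c'" "a' ~= 0" "c' ~= 0" "a / c = a' / c'"
 "k = int (place_ord_int v a') - int (place_ord_int v c')" by blast
 have "a * c' = a' * c" using h(3-5) assms(3,4) by (simp add: field_simps)
 then have "place_ord_int v a + place_ord_int v c' = place_ord_int v a' + place_ord_int v c"
 using ord_int_mult[of a c'] ord_int_mult[of a' c] assms h by simp
 then show "k = int (place_ord_int v a) - int (place_ord_int v c)" using h(6) by simp
qed

lemma fraction_exists:
 obtains a c where "aint a" "aint c" "c ~= 0" "(x :: 'a) = a / c"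
proof -
 obtain m :: int where m: "m ~= 0" "aint (of_int m * x)" by (rule integral_multiple_exists)
 then show thesis by (intro that[of "of_int m * x" "of_int m"]) auto
qed

lemma place_ord_mult:
 assumes "x ~= 0" "y ~= 0" shows "place_ord v (x * y) = place_ord v x + place_ord v y"
proof -
 obtain a c where x: "aint a" "aint c" "c ~= 0" "x = a / c" by (rule fraction_exists)
 obtain a' c' where y: "aint a'" "aint c'" "c' ~= 0" "y = a' / c'" by (rule fraction_exists)
 have nz: "a ~= 0" "a' ~= 0" using assms x y by auto
 have "x * y = (a * a') / (c * c')" using x y by simp
 then have "place_ord v (x * y) = int (place_ord_int v (a * a')) - int (place_ord_int v (c * c'))"
 using x y nz by (simp add: place_ord_quotient algebraic_int_mult)
 then show ?thesis using x y nz by (simp add: place_ord_quotient ord_int_mult)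
qed

lemma place_ord_int: "aint a ==> a ~= 0 ==> place_ord v a = int (place_ord_int v a)"
proof -
 assume a: "aint a" "a ~= 0"
 have "place_ord_int v 1 = 0" using prime_idD(4)[OF v] by (intro ord_int_eqI) auto
 then show ?thesis using place_ord_quotient[of a 1] a by simp
qed

definition qv :: real where "qv = real (card (carrier (ring_of_integers Quot v)))"

text \<open>The residue ring must be shown finite, because \<open>card\<close> of an infinite set is
  0 and \<open>qv\<close> could not serve as a base. The classes of 0 and 1 differ since 1 is not in
  \<open>v\<close>.\<close>

lemma qv_gt_1: "qv > 1"
proof -
 have "v : FP" using v finite_place_iff by blast
 then have p: "primeideal v ring_of_integers" by (auto simp: finite_places_def)
 interpret primeideal v "ring_of_integers :: 'a ring" by (rule p)
 let ?R = "ring_of_integers :: 'a ring"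
 obtain m :: int where m: "m ~= 0" "of_int m : v" using v by (auto simp: prime_id_def)
 obtain R :: "'a set" where R: "finite R" "R <= int_ring"
 "ALL x. aint x --> (EX r:R. EX y. aint y & x - r = of_int m * y)"
 by (rule finite_residues[OF m(1)])
 have eq: "v +>\<^bsub>?R\<^esub> x = v +>\<^bsub>?R\<^esub> y" if "x : carrier ?R" "y : carrier ?R" "x - y : v" for x y
 proof -
 have "v +>\<^bsub>?R\<^esub> z = {h + z |h. h : v}" for z by (auto simp: a_r_coset_def')
 moreover have "{h + x |h. h : v} = {h + y |h. h : v}"
 proof (intro subset_antisym subsetI)
 fix z assume "z : {h + x |h. h : v}"
 then obtain h where "h : v" "z = h + x" by blast
 then have "h + (x - y) : v" "z = h + (x - y) + y" using prime_idD(2)[OF v _ that(3)] by auto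
 then show "z : {h + y |h. h : v}" by blast
 next
 fix z assume "z : {h + y |h. h : v}"
 then obtain h where "h : v" "z = h + y" by blast
 then have "h - (x - y) : v" "z = h - (x - y) + x" using prime_idD(7)[OF v _ that(3)] by auto
 then show "z : {h + x |h. h : v}" by blast
 qed
 ultimately show ?thesis by simp
 qed
 have car: "carrier (?R Quot v) = (%x. v +>\<^bsub>?R\<^esub> x) ` int_ring"
 by (auto simp: FactRing_def A_RCOSETS_def')
 also have "... <= (%x. v +>\<^bsub>?R\<^esub> x) ` R"
 proof
 fix c assume "c : (%x. v +>\<^bsub>?R\<^esub> x) ` int_ring"
 then obtain x where x: "aint x" "c = v +>\<^bsub>?R\<^esub> x" by auto
 then obtain r y where r: "r : R" "aint y" "x - r = of_int m * y" using R(3) by blast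
 have "x - r : v" unfolding r(3) using prime_idD(3)[OF v r(2) m(2)] by (simp add: mult.commute)
 then have "c = v +>\<^bsub>?R\<^esub> r" unfolding x(2) using x(1) r(1) R(2) by (intro eq) auto
 then show "c : (%x. v +>\<^bsub>?R\<^esub> x) ` R" using r(1) by blast
 qed
 finally have fin: "finite (carrier (?R Quot v))" using R(1) finite_surj by (metis finite_imageI finite_subset)
 have "v +>\<^bsub>?R\<^esub> 0 ~= v +>\<^bsub>?R\<^esub> 1"
 proof
 assume e: "v +>\<^bsub>?R\<^esub> 0 = v +>\<^bsub>?R\<^esub> 1"
 have "1 : v +>\<^bsub>?R\<^esub> 1" using prime_idD(5)[OF v] by (auto simp: a_r_coset_def' intro!: exI[of _ 0])
 then have "1 : v +>\<^bsub>?R\<^esub> 0" using e by simp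
 then have "1 : v" by (auto simp: a_r_coset_def')
 then show False using prime_idD(4)[OF v] by simp
 qed
 then have "card {v +>\<^bsub>?R\<^esub> 0, v +>\<^bsub>?R\<^esub> 1} = 2" by simp
 moreover have "{v +>\<^bsub>?R\<^esub> 0, v +>\<^bsub>?R\<^esub> 1} <= carrier (?R Quot v)" unfolding car by auto
 ultimately have "2 <= card (carrier (?R Quot v))" using card_mono[OF fin] by metis
 then show ?thesis by (simp add: qv_def)
qed

lemma place_abs_def': "place_abs v x = (if x = 0 then 0 else qv powi (- place_ord v x))"
 by (simp add: place_abs_def qv_def)

lemma place_abs_nonneg: "place_abs v x >= 0" and place_abs_eq_0: "place_abs v x = 0 \<longleftrightarrow> x = 0"
 using qv_gt_1 by (auto simp: place_abs_def' zero_le_power_int)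

lemma place_abs_mult: "place_abs v (x * y) = place_abs v x * place_abs v y"
 using qv_gt_1 by (auto simp: place_abs_def' place_ord_mult power_int_add[symmetric])

lemma place_abs_one: "place_abs v 1 = 1"
 using place_abs_mult[of 1 1] place_abs_eq_0[of 1] by simp

lemma place_abs_power: "place_abs v (x ^ n) = place_abs v x ^ n"
 by (induction n) (simp_all add: place_abs_one place_abs_mult)

lemma place_abs_le_1_iff: "x ~= 0 ==> place_abs v x <= 1 \<longleftrightarrow> place_ord v x >= 0"
 and place_abs_less_1: "x ~= 0 ==> place_ord v x > 0 ==> place_abs v x < 1"
proof -
 assume x: "x ~= 0"
 show "place_abs v x <= 1 \<longleftrightarrow> place_ord v x >= 0"
 proof (cases "place_ord v x >= 0")
 case True
 then have "qv powi (- place_ord v x) <= qv powi 0" using qv_gt_1 by (intro power_int_increasing) auto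
 then show ?thesis using True x by (simp add: place_abs_def')
 next
 case False
 then have "qv powi 0 < qv powi (- place_ord v x)" using qv_gt_1 by (intro power_int_strict_increasing) auto
 then show ?thesis using False x by (simp add: place_abs_def')
 qed
 show "place_ord v x > 0 ==> place_abs v x < 1"
 proof -
 assume "place_ord v x > 0"
 then have "qv powi (- place_ord v x) < qv powi 0" using qv_gt_1 by (intro power_int_strict_increasing) auto
 then show ?thesis using x by (simp add: place_abs_def')
 qed
qed

lemma place_abs_integral: "aint x ==> place_abs v x <= 1"
 using place_abs_le_1_iff[of x] place_ord_int[of x] by (cases "x = 0") (auto simp: place_abs_def)

lemma place_abs_in_v: "x : v ==> place_abs v x < 1"
proof (cases "x = 0")
 case False
 assume x: "x : v"
 then have ax: "aint x" by (rule prime_idD(1)[OF v])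
 have "place_ord_int v x ~= 0" using ord_int_exists(2)[OF ax False] x by (intro notI) simp
 then show ?thesis using place_abs_less_1[OF False] place_ord_int[OF ax False] by simp
qed (simp add: place_abs_def)

text \<open>The valuation ring is the localization at \<open>v\<close>: multiplying numerator and
  denominator by \<open>t ^ k\<close>, with \<open>k\<close> the order of the denominator, moves the
  denominator out of \<open>v\<close> and keeps the numerator integral.\<close>

lemma place_abs_le_1_fraction:
 assumes "place_abs v x <= 1"
 obtains a s where "aint a" "aint s" "s ~: v" "x = a / s"
proof (cases "x = 0")
 case True
 then show ?thesis using prime_idD(4)[OF v] by (intro that[of 0 1]) auto
next
 case False
 obtain a c where x: "aint a" "aint c" "c ~= 0" "x = a / c" by (rule fraction_exists)
 have a0: "a ~= 0" using False x by auto
 let ?k = "place_ord_int v c"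
 have "?k <= place_ord_int v a"
 using place_abs_le_1_iff[OF False] assms place_ord_quotient[OF x(1,2) a0 x(3)] x(4) by simp
 then have "aint (t ^ ?k * a)"
 by (rule powers_stay_integral[OF x(1) ord_int_exists(1)[OF x(1) a0]])
 then show ?thesis using ord_int_exists(1,2)[OF x(2,3)] x(4) t0 by (intro that[of "t ^ ?k * a" "t ^ ?k * c"]) auto
qed

lemma place_abs_fraction_le_1:
 assumes "aint a" "aint s" "s ~: v" shows "place_abs v (a / s) <= 1"
proof (cases "a = 0")
 case False
 have s0: "s ~= 0" using assms(3) prime_idD(5)[OF v] by auto
 have "place_ord_int v s = 0" by (rule ord_int_eqI) (use assms s0 in auto)
 then show ?thesis using place_ord_quotient[OF assms(1,2) False s0] place_abs_le_1_iff[of "a / s"] False s0 by simp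
qed (simp add: place_abs_def)

text \<open>After division by the larger term it remains to bound \<open>1 + z\<close> for
  \<open>z\<close> of absolute value at most 1. Such a \<open>z\<close> is a fraction with
  denominator outside \<open>v\<close>, and so is \<open>1 + z\<close>.\<close>

lemma place_abs_add: "place_abs v (x + y) <= max (place_abs v x) (place_abs v y)"
proof -
 have *: "place_abs v (x + y) <= place_abs v x" if le: "place_abs v y <= place_abs v x" for x y
 proof (cases "x = 0")
 case True
 then have "y = 0" using le place_abs_nonneg[of y] place_abs_eq_0[of y] place_abs_eq_0[of x] by simp
 then show ?thesis using True by simp
 next
 case False
 let ?z = "y / x"
 have ax: "place_abs v x > 0" using False place_abs_nonneg[of x] place_abs_eq_0[of x] by simp
 have "place_abs v x * place_abs v ?z = place_abs v y" using False by (simp flip: place_abs_mult)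
 then have "place_abs v x * place_abs v ?z <= place_abs v x * 1" using le by simp
 then have "place_abs v ?z <= 1" using ax by (simp only: mult_le_cancel_left_pos)
 then obtain a s where as: "aint a" "aint s" "s ~: v" "?z = a / s" by (rule place_abs_le_1_fraction)
 have s0: "s ~= 0" using as(3) prime_idD(5)[OF v] by auto
 have "1 + ?z = (s + a) / s" using as(4) s0 by (simp add: field_simps)
 then have 1: "place_abs v (1 + ?z) <= 1" using place_abs_fraction_le_1[OF algebraic_int_add[OF as(2,1)] as(2,3)] by simp
 have "x + y = x * (1 + ?z)" using False by (simp add: field_simps)
 then have "place_abs v (x + y) = place_abs v x * place_abs v (1 + ?z)" by (simp only: place_abs_mult)
 also have "... <= place_abs v x * 1" using 1 ax by (intro mult_left_mono) auto
 finally show ?thesis by simp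
 qed
 show ?thesis
 proof (cases "place_abs v y <= place_abs v x")
 case True
 from *[OF True] show ?thesis by simp
 next
 case False
 then have "place_abs v x <= place_abs v y" by simp
 from *[OF this] show ?thesis by (simp add: add.commute)
 qed
qed

end

lemma uniformizer_exists:
 assumes "v : FP" obtains t b where "uniformizer v t b"
proof -
 have v: "prime_id v" using assms finite_place_iff by blast
 obtain t b where "ALL x. aint x --> (aint (t * x) \<longleftrightarrow> x : v)"
 "b : v" "t * b ~: v" "aint (t * b)" "~ aint t" by (rule inverse_uniformizer[OF v])
 then have "uniformizer v t b" using v by (simp add: uniformizer_def)
 then show thesis by (rule that)
qed

section \<open>Integrality and finiteness across all finite places\<close>

text \<open>The denominators of \<open>x\<close> form an ideal containing a rational integer, proper
  if \<open>x\<close> is not integral. Counting residues finds a maximal ideal \<open>P\<close>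
  above it. At \<open>P\<close> the bound gives \<open>x = a / s\<close> with \<open>s\<close>
  outside \<open>P\<close>, although \<open>s\<close> is a denominator.\<close>

lemma algebraic_int_if_all_places:
 assumes all: "!!v. v : FP ==> place_abs v x <= 1"
 shows "aint (x :: 'a::number_field)"
proof (rule ccontr)
 assume nx: "~ aint x"
 obtain m :: int where m: "m ~= 0" "aint (of_int m * x)" by (rule integral_multiple_exists)
 obtain R :: "'a set" where R: "finite R" "R <= int_ring"
 "ALL y. aint y --> (EX r:R. EX z. aint z & y - r = of_int m * z)"
 by (rule finite_residues[OF m(1)])
 define I where "I = {y. aint y & aint (y * x)}"
 define Q where "Q J \<longleftrightarrow> I <= J & J <= int_ring & (ALL x:J. ALL y:J. x + y : J) & (ALL a:int_ring. ALL x:J. a * x : J) & 1 ~: J" for J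
 have mI: "of_int m : I" using m by (simp add: I_def)
 have "Q I" unfolding Q_def I_def using nx by (auto simp: distrib_right algebraic_int_add algebraic_int_mult mult.assoc)
 moreover have "card (J Int R) <= card R" for J using R(1) by (intro card_mono) auto
 ultimately obtain P where P: "Q P" and Pmax: "!!J. Q J ==> card (J Int R) <= card (P Int R)"
 using finite_maximizer[of Q I "%J. card (J Int R)" "card R"] by blast
 note p = P[unfolded Q_def]
 have mP: "of_int m : P" using mI p by blast
 have P2: "x + y : P" if "x : P" "y : P" for x y using p that by blast
 have P3: "a * x : P" if "aint a" "x : P" for a x using p that by blast
 have "prime_id P" unfolding prime_id_def
 proof (intro conjI ballI impI)
 fix a c :: 'a assume a: "a : int_ring" and c: "c : int_ring" and ac: "a * c : P"
 show "a : P \<or> c : P"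
 proof (rule ccontr)
 assume n: "~ ?thesis"
 \<comment> \<open>The ideal generated by \<open>P\<close> and \<open>a\<close>, proper because
   \<open>c\<close> is outside \<open>P\<close>. Maximality of the count gives
   \<open>J Int R = P Int R\<close>, so the residue of \<open>a\<close> lies in \<open>P\<close>,
   and with it \<open>a\<close>.\<close>
 define J where "J = {y + a * z |y z. y : P & aint z}"
 have PJ: "P <= J"
 proof
 fix y assume "y : P"
 then have "y = y + a * 0 & y : P & aint (0::'a)" by simp
 then show "y : J" unfolding J_def by blast
 qed
 have aJ: "a : J"
 proof -
 have "0 * of_int m : P" by (rule P3[OF _ mP]) simp
 then have "a = 0 + a * 1 & 0 : P & aint (1::'a)" by simp
 then show ?thesis unfolding J_def by blast
 qed
 have "1 ~: J"
 proof
 assume "1 : J"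
 then obtain y z where yz: "1 = y + a * z" "y : P" "aint z" unfolding J_def by blast
 have "c * y : P" by (rule P3[OF _ yz(2)]) (use c in simp)
 then have "c * y + z * (a * c) : P" by (rule P2) (rule P3[OF yz(3) ac])
 also have "c * y + z * (a * c) = c * (y + a * z)" by (simp add: algebra_simps)
 finally show False using n yz(1) by simp
 qed
 moreover have "J <= int_ring"
 proof
 fix w assume "w : J"
 then obtain y z where "w = y + a * z" "y : P" "aint z" unfolding J_def by blast
 then show "w : int_ring" using p a by (auto intro!: algebraic_int_add algebraic_int_mult)
 qed
 moreover have "w + w' : J" if ww: "w : J" "w' : J" for w w'
 proof -
 obtain y z y' z' where h: "w = y + a * z" "y : P" "aint z" "w' = y' + a * z'" "y' : P" "aint z'"
 using ww unfolding J_def by blast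
 have "w + w' = (y + y') + a * (z + z') & y + y' : P & aint (z + z')"
 using h P2 by (auto simp: algebra_simps algebraic_int_add)
 then show ?thesis unfolding J_def by blast
 qed
 moreover have "k * w : J" if kw: "k : int_ring" "w : J" for k w
 proof -
 obtain y z where h: "w = y + a * z" "y : P" "aint z" using kw(2) unfolding J_def by blast
 have "k * w = k * y + a * (k * z) & k * y : P & aint (k * z)"
 using h kw(1) P3 by (auto simp: algebra_simps algebraic_int_mult)
 then show ?thesis unfolding J_def by blast
 qed
 ultimately have "Q J" unfolding Q_def using p PJ by blast
 then have "P Int R = J Int R" using Pmax[of J] PJ R(1) by (intro card_seteq) auto
 moreover obtain r z where r: "r : R" "aint z" "a - r = of_int m * z" using R(3) a by auto
 have mz: "of_int m * z : P" using P3[OF r(2) mP] by (simp add: mult.commute)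
 have "(- 1) * (of_int m * z) : P" by (rule P3[OF _ mz]) simp
 then have "a + (- 1) * (of_int m * z) : J" using aJ PJ \<open>Q J\<close> unfolding Q_def by blast
 then have "r : J" unfolding r(3)[symmetric] by simp
 ultimately have "r : P" using r(1) by blast
 from P2[OF this mz] show False using n unfolding r(3)[symmetric] by simp
 qed
 qed (use p mP m(1) in auto)
 then have Pf: "P : FP" using finite_place_iff by blast
 obtain t b where "uniformizer P t b" by (rule uniformizer_exists[OF Pf])
 then interpret uniformizer P t b .
 obtain a s where as: "aint a" "aint s" "s ~: P" "x = a / s"
 by (rule place_abs_le_1_fraction[OF all[OF Pf]])
 have "s ~= 0" using as(3) prime_idD(5)[OF v] by auto
 then have "s * x = a" using as(4) by simp
 then have "s : I" using as by (simp add: I_def)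
 then show False using p as(3) by blast
qed

text \<open>A prime containing \<open>m\<close> is determined by the residues modulo
  \<open>m\<close> that it contains.\<close>

lemma finite_places_containing:
 assumes m: "m ~= (0::int)" shows "finite {v :: 'a::number_field set. v : FP & of_int m : v}"
proof -
 obtain R :: "'a set" where R: "finite R" "R <= int_ring"
 "ALL y. aint y --> (EX r:R. EX z. aint z & y - r = of_int m * z)"
 by (rule finite_residues[OF m])
 let ?S = "{v :: 'a set. v : FP & of_int m : v}"
 have sub: "v <= w" if v: "v : ?S" and w: "w : ?S" and e: "v Int R = w Int R" for v w
 proof
 fix x assume x: "x : v"
 have pv: "prime_id v" and pw: "prime_id w" using v w finite_place_iff by blast+
 obtain r z where r: "r : R" "aint z" "x - r = of_int m * z" using R(3) prime_idD(1)[OF pv x] by blast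
 have "z * of_int m : v" "z * of_int m : w" using v w prime_idD(3)[OF pv r(2)] prime_idD(3)[OF pw r(2)] by auto
 then have mz: "x - r : v" "x - r : w" unfolding r(3) by (simp_all add: mult.commute)
 have "r : v" using prime_idD(7)[OF pv x mz(1)] by simp
 then have "r : w" using e r(1) by blast
 from prime_idD(2)[OF pw this mz(2)] show "x : w" by simp
 qed
 have "inj_on (%v. v Int R) ?S"
 proof (rule inj_onI)
 fix v w assume "v : ?S" "w : ?S" "v Int R = w Int R"
 then show "v = w" using sub[of v w] sub[of w v] by (intro subset_antisym) simp_all
 qed
 moreover have "(%v. v Int R) ` ?S <= Pow R" by auto
 ultimately show ?thesis using R(1) finite_imageD[of "%v. v Int R" ?S] finite_subset by blast
qed

lemma finite_place_abs_gt_1: "finite {v : finite_places. place_abs v (x :: 'a::number_field) > 1}"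
proof -
 obtain m :: int where m: "m ~= 0" "aint (of_int m * x)" by (rule integral_multiple_exists)
 have "of_int m : v" if hv: "v : FP" "place_abs v x > 1" for v
 proof (rule ccontr)
 assume nm: "of_int m ~: v"
 obtain t b where "uniformizer v t b" by (rule uniformizer_exists[OF hv(1)])
 then interpret uniformizer v t b .
 have "place_abs v ((of_int m * x) / of_int m) <= 1"
 by (rule place_abs_fraction_le_1[OF m(2) _ nm]) simp
 then show False using hv(2) m(1) by simp
 qed
 then have "{v : finite_places. place_abs v x > 1} <= {v. v : FP & of_int m : v}" by blast
 then show ?thesis using finite_places_containing[OF m(1)] finite_subset by blast
qed

text \<open>A high power of an integer in \<open>v\<close> is small at \<open>v\<close> and has
  absolute value at most 1 elsewhere, so the factors chosen for different places do not disturb each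
  other.\<close>

lemma small_integer_exists:
 assumes "finite S" "S <= (FP :: 'a::number_field set set)" "e > 0"
 shows "EX m::int. m ~= 0 & (ALL v:S. place_abs v (of_int m :: 'a) < e)"
 using assms
proof (induction S rule: finite_induct)
 case (insert v S)
 then obtain m :: int where m: "m ~= 0" "ALL v:S. place_abs v (of_int m :: 'a) < e" by auto
 have v: "v : FP" using insert.prems by simp
 obtain t b where "uniformizer v t b" by (rule uniformizer_exists[OF v])
 then interpret uniformizer v t b .
 obtain p :: int where p: "p ~= 0" "of_int p : v" using uniformizer.v[OF \<open>uniformizer v t b\<close>] by (auto simp: prime_id_def)
 have lt: "place_abs v (of_int p) < 1" by (rule place_abs_in_v[OF p(2)])
 obtain n where n: "place_abs v (of_int p) ^ n < e" using real_arch_pow_inv[OF insert.prems(2) lt] by blast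
 have pw: "place_abs v (of_int p ^ n) = place_abs v (of_int p) ^ n"
 by (rule place_abs_power)
 have "place_abs w (of_int (m * p ^ n) :: 'a) < e" if w: "w : insert v S" for w
 proof -
 have wf: "w : FP" using w insert.prems by auto
 obtain t' b' where "uniformizer w t' b'" by (rule uniformizer_exists[OF wf])
 then interpret w: uniformizer w t' b' .
 have le: "place_abs w (of_int k :: 'a) <= 1" for k by (rule w.place_abs_integral) simp
 have eq: "place_abs w (of_int (m * p ^ n) :: 'a) = place_abs w (of_int m) * place_abs w (of_int (p ^ n))"
 by (simp add: w.place_abs_mult)
 show ?thesis
 proof (cases "w = v")
 case True
 have "place_abs w (of_int (p ^ n) :: 'a) < e" using n pw True by simp
 moreover have "place_abs w (of_int m :: 'a) * place_abs w (of_int (p ^ n)) <= 1 * place_abs w (of_int (p ^ n) :: 'a)"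
 by (rule mult_right_mono[OF le w.place_abs_nonneg])
 ultimately show ?thesis using eq by simp
 next
 case False
 then have "place_abs w (of_int m :: 'a) < e" using m(2) w by simp
 moreover have "place_abs w (of_int m :: 'a) * place_abs w (of_int (p ^ n)) <= place_abs w (of_int m :: 'a) * 1"
 by (rule mult_left_mono[OF le w.place_abs_nonneg])
 ultimately show ?thesis using eq by simp
 qed
 qed
 then show ?case using m(1) p(1) by (intro exI[of _ "m * p ^ n"]) auto
qed (auto intro: exI[of _ 1])

section \<open>Completions\<close>

text \<open>The properties of \<open>place_abs\<close> on which the completion rests, separated from
  its construction through ideals.\<close>

locale nonarch =
 fixes v :: "'a::number_field set"
 assumes A_nonneg: "place_abs v x >= 0" and A_eq_0: "place_abs v x = 0 \<longleftrightarrow> x = 0"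
 and A_mult: "place_abs v (x * y) = place_abs v x * place_abs v y"
 and A_add: "place_abs v (x + y) <= max (place_abs v x) (place_abs v y)"
begin

abbreviation "A \<equiv> place_abs v"

lemma A_minus: "A (- x) = A x"
proof -
 have "A (- 1) * A (- 1) = A 1" "A 1 * A 1 = A 1" using A_mult[of "- 1" "- 1"] A_mult[of 1 1] by simp_all
 then have "A 1 = 1" using A_eq_0[of 1] by simp
 then have "(A (- 1))\<^sup>2 = 1" using \<open>A (- 1) * A (- 1) = A 1\<close> by (simp add: power2_eq_square)
 then have "A (- 1) = 1" using A_nonneg[of "- 1"] by (simp add: power2_eq_1_iff)
 then show ?thesis using A_mult[of "- 1" x] by simp
qed

lemma A_zero [simp]: "A 0 = 0" using A_eq_0 by simp

lemma A_diff: "A (x - y) <= max (A x) (A y)"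
 using A_add[of x "- y"] by (simp add: A_minus)

lemma A_add_le: "A (x + y) <= A x + A y"
 using A_add[of x y] A_nonneg[of x] A_nonneg[of y] by linarith

lemma A_abs_diff: "\<bar>A x - A y\<bar> <= A (x - y)"
 using A_add_le[of "x - y" y] A_add_le[of "y - x" x] A_minus[of "x - y"] by simp

definition CS :: "(nat => 'a) set" where
 "CS = {x. ALL e>0. EX N. ALL m>=N. ALL n>=N. A (x m - x n) < e}"

abbreviation "CR \<equiv> cauchy_ring v"
abbreviation "NS \<equiv> null_seqs v"
abbreviation "LF \<equiv> local_field v"
abbreviation local_mult (infixl "**" 70) where "x ** y \<equiv> x \<otimes>\<^bsub>LF\<^esub> y"

lemma CR_simps [simp]: "carrier CR = CS" "mult CR = (%x y n. x n * y n)" "one CR = (%_. 1)"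
 "zero CR = (%_. 0)" "add CR = (%x y n. x n + y n)"
 by (simp_all add: cauchy_ring_def CS_def)

lemma CS_abs_convergent: assumes "x : CS" shows "EX L. (%n. A (x n)) \<longlonglongrightarrow> L"
proof -
 have "Cauchy (%n. A (x n))"
 proof (rule metric_CauchyI)
 fix e :: real assume "e > 0"
 then obtain N where "ALL m>=N. ALL n>=N. A (x m - x n) < e" using assms by (auto simp: CS_def)
 then have "ALL m>=N. ALL n>=N. dist (A (x m)) (A (x n)) < e"
 unfolding dist_real_def using le_less_trans[OF A_abs_diff] by simp
 then show "EX M. ALL m>=M. ALL n>=M. dist (A (x m)) (A (x n)) < e" by blast
 qed
 then have "convergent (%n. A (x n))" by (simp add: Cauchy_convergent_iff)
 then show ?thesis unfolding convergent_def .
qed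

lemma CS_bounded: assumes "x : CS" shows "EX K>0. ALL n. A (x n) <= K"
proof -
 obtain L where "(%n. A (x n)) \<longlonglongrightarrow> L" using CS_abs_convergent[OF assms] by blast
 then have "Bseq (%n. A (x n))" by (intro convergent_imp_Bseq) (auto simp: convergent_def)
 then show ?thesis using A_nonneg by (auto simp: Bseq_def)
qed

lemma CS_const: "(%_. a) : CS" by (auto simp: CS_def)

lemma CS_add: assumes "x : CS" "y : CS" shows "(%n. x n + y n) : CS"
 unfolding CS_def
proof (intro CollectI allI impI)
 fix e :: real assume e: "e > 0"
 obtain N where N: "ALL m>=N. ALL n>=N. A (x m - x n) < e" using assms(1) e by (auto simp: CS_def)
 obtain N' where N': "ALL m>=N'. ALL n>=N'. A (y m - y n) < e" using assms(2) e by (auto simp: CS_def)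
 have "A (x m + y m - (x n + y n)) < e" if "m >= max N N'" "n >= max N N'" for m n
 proof -
 have "A ((x m - x n) + (y m - y n)) <= max (A (x m - x n)) (A (y m - y n))" by (rule A_add)
 also have "... < e" using N N' that by simp
 finally show ?thesis by (simp add: algebra_simps)
 qed
 then show "EX N. ALL m>=N. ALL n>=N. A (x m + y m - (x n + y n)) < e" by blast
qed

lemma CS_minus: assumes "x : CS" shows "(%n. - x n) : CS"
proof -
 have "A (- x m - - x n) = A (x m - x n)" for m n using A_minus[of "x m - x n"] by (simp add: algebra_simps)
 then show ?thesis using assms by (simp add: CS_def)
qed

lemma CS_mult: assumes "x : CS" "y : CS" shows "(%n. x n * y n) : CS"
 unfolding CS_def
proof (intro CollectI allI impI)
 fix e :: real assume e: "e > 0"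
 obtain K where K: "K > 0" "ALL n. A (x n) <= K" using CS_bounded[OF assms(1)] by blast
 obtain K' where K': "K' > 0" "ALL n. A (y n) <= K'" using CS_bounded[OF assms(2)] by blast
 obtain N where N: "ALL m>=N. ALL n>=N. A (x m - x n) < e / K'" using assms(1) e K' by (force simp: CS_def)
 obtain N' where N': "ALL m>=N'. ALL n>=N'. A (y m - y n) < e / K" using assms(2) e K by (force simp: CS_def)
 have "A (x m * y m - x n * y n) < e" if mn: "m >= max N N'" "n >= max N N'" for m n
 proof -
 have 1: "A (x m * (y m - y n)) < e"
 proof -
 have "A (x m * (y m - y n)) <= K * A (y m - y n)" unfolding A_mult using K A_nonneg by (intro mult_right_mono) auto
 also have "... < K * (e / K)" using N' mn K by (intro mult_strict_left_mono) auto
 finally show ?thesis using K by simp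
 qed
 have 2: "A ((x m - x n) * y n) < e"
 proof -
 have "A ((x m - x n) * y n) <= A (x m - x n) * K'" unfolding A_mult using K' A_nonneg by (intro mult_left_mono) auto
 also have "... < (e / K') * K'" using N mn K' by (intro mult_strict_right_mono) auto
 finally show ?thesis using K' by simp
 qed
 have "x m * y m - x n * y n = x m * (y m - y n) + (x m - x n) * y n" by (simp add: algebra_simps)
 then show ?thesis using A_add[of "x m * (y m - y n)" "(x m - x n) * y n"] 1 2 by simp
 qed
 then show "EX N. ALL m>=N. ALL n>=N. A (x m * y m - x n * y n) < e" by blast
qed

lemma cring_CR: "cring CR"
proof (rule cringI)
 show "abelian_group CR"
 proof (rule abelian_groupI)
 fix x assume "x : carrier CR"
 then show "EX y:carrier CR. y \<oplus>\<^bsub>CR\<^esub> x = \<zero>\<^bsub>CR\<^esub>" using CS_minus by (intro bexI[of _ "%n. - x n"]) auto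
 qed (auto simp: CS_add CS_const algebra_simps)
 show "Group.comm_monoid CR"
 by unfold_locales (auto simp: CS_mult CS_const algebra_simps)
qed (auto simp: algebra_simps)

lemma NS_iff: "x : NS \<longleftrightarrow> (%n. A (x n)) \<longlonglongrightarrow> 0"
 by (simp add: null_seqs_def)

lemma NS_add: assumes "x : NS" "y : NS" shows "(%n. x n + y n) : NS"
proof -
 have "(%n. A (x n) + A (y n)) \<longlonglongrightarrow> 0 + 0" using assms unfolding NS_iff by (intro tendsto_add)
 then have "(%n. A (x n) + A (y n)) \<longlonglongrightarrow> 0" by simp
 from tendsto_sandwich[OF _ _ tendsto_const this, of "%n. A (x n + y n)"]
 have "(%n. A (x n + y n)) \<longlonglongrightarrow> 0" by (simp add: A_nonneg A_add_le)
 then show ?thesis unfolding NS_iff .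
qed

lemma NS_mult: assumes "x : CS" "y : NS" shows "(%n. x n * y n) : NS"
proof -
 obtain L where "(%n. A (x n)) \<longlonglongrightarrow> L" using CS_abs_convergent[OF assms(1)] by blast
 then have "(%n. A (x n) * A (y n)) \<longlonglongrightarrow> L * 0" using assms(2) unfolding NS_iff by (intro tendsto_mult)
 then show ?thesis by (simp add: NS_iff A_mult)
qed

lemma NS_subset: "NS <= CS"
proof
 fix x assume x: "x : NS"
 show "x : CS" unfolding CS_def
 proof (intro CollectI allI impI)
 fix e :: real assume "e > 0"
 then obtain N where N: "ALL n>=N. norm (A (x n) - 0) < e" using x LIMSEQ_D[of "%n. A (x n)" 0 e] unfolding NS_iff by blast
 have "A (x m - x n) < e" if "m >= N" "n >= N" for m n
 using A_diff[of "x m" "x n"] N that by (auto simp: A_nonneg intro: le_less_trans)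
 then show "EX N. ALL m>=N. ALL n>=N. A (x m - x n) < e" by blast
 qed
qed

lemma ideal_NS: "ideal NS CR"
proof (rule idealI)
 interpret cring CR by (rule cring_CR)
 show "ring CR" by (rule ring_axioms)
 show "subgroup NS (add_monoid CR)"
 proof
 show "NS <= carrier (add_monoid CR)" using NS_subset by simp
 show "x \<otimes>\<^bsub>add_monoid CR\<^esub> y : NS" if "x : NS" "y : NS" for x y using NS_add[OF that] by simp
 show "\<one>\<^bsub>add_monoid CR\<^esub> : NS" by (simp add: NS_iff)
 show "inv\<^bsub>add_monoid CR\<^esub> x : NS" if x: "x : NS" for x
 proof -
 have xc: "x : carrier CR" using NS_subset x by auto
 then have "(%n. - x n) : carrier CR" using CS_minus by simp
 then have "\<ominus>\<^bsub>CR\<^esub> x = (%n. - x n)" using minus_equality[of "%n. - x n" x] xc by simp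
 moreover have "(%n. - x n) : NS" using x by (simp add: NS_iff A_minus)
 ultimately show ?thesis by (simp add: a_inv_def)
 qed
 qed
 show "x \<otimes>\<^bsub>CR\<^esub> a : NS" "a \<otimes>\<^bsub>CR\<^esub> x : NS" if "a : NS" "x : carrier CR" for a x
 using NS_mult[of x a] that by (simp_all add: mult.commute)
qed

sublocale I: ideal NS CR by (rule ideal_NS)
sublocale LF: cring LF
 unfolding local_field_def by (rule I.quotient_is_cring[OF cring_CR])

definition cls :: "(nat => 'a) => (nat => 'a) set" where "cls x = NS +>\<^bsub>CR\<^esub> x"

lemma carrier_LF: "carrier LF = cls ` CS"
 by (auto simp: local_field_def FactRing_def A_RCOSETS_def' cls_def)

lemma cls_add: "x : CS ==> y : CS ==> cls x \<oplus>\<^bsub>LF\<^esub> cls y = cls (%n. x n + y n)"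
 and cls_mult: "x : CS ==> y : CS ==> cls x ** cls y = cls (%n. x n * y n)"
 and cls_one: "\<one>\<^bsub>LF\<^esub> = cls (%_. 1)"
 using ring_hom_add[OF I.rcos_ring_hom, of x y] ring_hom_mult[OF I.rcos_ring_hom, of x y] ring_hom_one[OF I.rcos_ring_hom]
 by (simp_all add: cls_def local_field_def)

lemma cls_zero: "\<zero>\<^bsub>LF\<^esub> = cls (%_. 0)"
proof -
 have z: "cls (%_. 0) : carrier LF" using carrier_LF CS_const by auto
 have "cls (%_. 0) \<oplus>\<^bsub>LF\<^esub> cls (%_. 0) = cls (%_. 0)" using cls_add[of "%_. 0" "%_. 0"] CS_const by simp
 then show ?thesis using LF.add.r_cancel_one'[OF z z] by simp
qed

lemma mem_cls: "y : cls x \<longleftrightarrow> (%n. y n - x n) : NS"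
proof
 assume "y : cls x"
 then obtain h where "h : NS" "y = (%n. h n + x n)" by (auto simp: cls_def a_r_coset_def')
 then show "(%n. y n - x n) : NS" by simp
next
 assume h: "(%n. y n - x n) : NS"
 have "EX h:NS. y = (%n. h n + x n)" by (rule bexI[OF _ h]) simp
 then show "y : cls x" by (auto simp: cls_def a_r_coset_def')
qed

lemma abs_tendsto_cls:
 assumes x: "x : CS" "(%n. A (x n)) \<longlonglongrightarrow> L" and y: "y : cls x"
 shows "(%n. A (y n)) \<longlonglongrightarrow> L"
proof -
 have "(%n. A (y n - x n)) \<longlonglongrightarrow> 0" using y by (simp add: mem_cls NS_iff)
 from tendsto_sandwich[OF _ _ tendsto_const this, of "%n. \<bar>A (y n) - A (x n)\<bar>"]
 have "(%n. \<bar>A (y n) - A (x n)\<bar>) \<longlonglongrightarrow> 0" by (simp add: A_abs_diff)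
 then have "(%n. A (y n) - A (x n)) \<longlonglongrightarrow> 0" by (rule tendsto_rabs_zero_cancel)
 from tendsto_add[OF this x(2)] show ?thesis by simp
qed

text \<open>The absolute value on the completion; \<open>lv_cls\<close> shows the chosen
  representative to be immaterial.\<close>

definition lv :: "(nat => 'a) set => real" where "lv c = lim (%n. A ((SOME x. x : c) n))"

lemma lv_cls: assumes x: "x : CS" shows "(%n. A (x n)) \<longlonglongrightarrow> lv (cls x)"
proof -
 obtain L where L: "(%n. A (x n)) \<longlonglongrightarrow> L" using CS_abs_convergent[OF x] by blast
 have "x : cls x" by (simp add: mem_cls NS_iff)
 then have "(SOME y. y : cls x) : cls x" by (rule someI[of "%y. y : cls x"])
 from abs_tendsto_cls[OF x L this] have "lv (cls x) = L" unfolding lv_def by (rule limI)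
 then show ?thesis using L by simp
qed

lemma lv_eqI: "x : CS ==> (%n. A (x n)) \<longlonglongrightarrow> L ==> lv (cls x) = L"
 by (rule LIMSEQ_unique[OF lv_cls])

lemma local_int_iff: "c : local_integers v \<longleftrightarrow> c : carrier LF & lv c <= 1"
proof -
 have "(EX x:c. lim (%n. A (x n)) <= 1) \<longleftrightarrow> lv c <= 1" if c: "c : carrier LF"
 proof -
 obtain z where z: "z : CS" "c = cls z" using c carrier_LF by auto
 have "lim (%n. A (x n)) = lv c" if "x : c" for x
 using abs_tendsto_cls[OF z(1) lv_cls[OF z(1)], of x] that z(2) by (auto intro: limI)
 moreover have "z : c" unfolding z(2) by (simp add: mem_cls NS_iff)
 ultimately show ?thesis by auto
 qed
 then show ?thesis by (auto simp: local_integers_def)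
qed

lemma lv_nonneg: "c : carrier LF ==> lv c >= 0"
proof -
 assume "c : carrier LF"
 then obtain z where z: "z : CS" "c = cls z" using carrier_LF by auto
 show ?thesis unfolding z(2) by (rule LIMSEQ_le_const[OF lv_cls[OF z(1)]]) (simp add: A_nonneg)
qed

lemma lv_mult: "c : carrier LF ==> d : carrier LF ==> lv (c ** d) = lv c * lv d"
proof -
 assume "c : carrier LF" "d : carrier LF"
 then obtain x y where xy: "x : CS" "c = cls x" "y : CS" "d = cls y" using carrier_LF by auto
 show ?thesis unfolding xy cls_mult[OF xy(1,3)]
 by (rule lv_eqI[OF CS_mult[OF xy(1,3)]]) (unfold A_mult, intro tendsto_mult lv_cls xy)
qed

lemma lv_add: "c : carrier LF ==> d : carrier LF ==> lv (c \<oplus>\<^bsub>LF\<^esub> d) <= max (lv c) (lv d)"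
proof -
 assume "c : carrier LF" "d : carrier LF"
 then obtain x y where xy: "x : CS" "c = cls x" "y : CS" "d = cls y" using carrier_LF by auto
 have a: "(%n. max (A (x n)) (A (y n))) \<longlonglongrightarrow> max (lv c) (lv d)"
 unfolding xy by (intro tendsto_max lv_cls xy)
 have b: "(%n. A (x n + y n)) \<longlonglongrightarrow> lv (c \<oplus>\<^bsub>LF\<^esub> d)"
 unfolding xy cls_add[OF xy(1,3)] by (rule lv_cls[OF CS_add[OF xy(1,3)]])
 show ?thesis by (rule LIMSEQ_le[OF b a]) (simp add: A_add)
qed

lemma local_emb_cls: "local_emb v x = cls (%_. x)"
 by (simp add: local_emb_def cls_def)

lemma local_emb_carrier [simp]: "local_emb v x : carrier LF"
 using carrier_LF CS_const local_emb_cls by auto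

lemma lv_local_emb: "lv (local_emb v x) = A x"
 unfolding local_emb_cls by (rule lv_eqI[OF CS_const tendsto_const])

lemma local_emb_hom: "local_emb v (x + y) = local_emb v x \<oplus>\<^bsub>LF\<^esub> local_emb v y"
 "local_emb v (x * y) = local_emb v x ** local_emb v y"
 "local_emb v 1 = \<one>\<^bsub>LF\<^esub>" "local_emb v 0 = \<zero>\<^bsub>LF\<^esub>"
 unfolding local_emb_cls cls_one cls_zero by (simp_all add: cls_add cls_mult CS_const)

lemma lv_zero: "lv \<zero>\<^bsub>LF\<^esub> = 0"
 using lv_local_emb[of 0] local_emb_hom(4) by simp

lemma lv_finsum:
 assumes "finite I" "!!i. i : I ==> f i : carrier LF" "!!i. i : I ==> lv (f i) <= K" "K >= 0"
 shows "lv (finsum LF f I) <= K"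
 using assms
proof (induction I rule: finite_induct)
 case (insert i I)
 have "lv (f i \<oplus>\<^bsub>LF\<^esub> finsum LF f I) <= max (lv (f i)) (lv (finsum LF f I))"
 by (rule lv_add) (use insert.prems in "auto intro: LF.finsum_closed")
 also have "... <= K" using insert by simp
 finally show ?case using insert by (subst LF.finsum_insert) auto
qed (simp add: lv_zero)

lemma local_emb_sum: "finite I ==> local_emb v (sum f I) = finsum LF (%i. local_emb v (f i)) I"
 by (induction I rule: finite_induct) (auto simp: local_emb_hom LF.finsum_insert)

end

lemma nonarch_place: "v : FP ==> nonarch v"
proof -
 assume "v : FP"
 then obtain t b where "uniformizer v t b" by (rule uniformizer_exists)
 then interpret uniformizer v t b .
 show ?thesis
 by (rule nonarch.intro) (rule place_abs_nonneg, rule place_abs_eq_0, rule place_abs_mult, rule place_abs_add)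
qed

section \<open>Matrices over commutative rings and the adele ring\<close>

lemma (in abelian_monoid) finsum_swap_finite:
 assumes "finite I" "finite K" "!!i k. i : I ==> k : K ==> f i k : carrier G"
 shows "(\<Oplus>i\<in>I. \<Oplus>k\<in>K. f i k) = (\<Oplus>k\<in>K. \<Oplus>i\<in>I. f i k)"
 using assms(1,3)
proof (induction I rule: finite_induct)
 case empty
 show ?case by (simp add: finsum_zero)
next
 case (insert i I)
 have c1: "(%i. \<Oplus>k\<in>K. f i k) : insert i I \<rightarrow> carrier G" using insert.prems by (intro Pi_I finsum_closed) auto
 have c2: "(%k. f i k) : K \<rightarrow> carrier G" "(%k. \<Oplus>i\<in>I. f i k) : K \<rightarrow> carrier G"
 using insert.prems by (auto intro!: finsum_closed)
 have "(\<Oplus>i\<in>insert i I. \<Oplus>k\<in>K. f i k) = (\<Oplus>k\<in>K. f i k) \<oplus> (\<Oplus>i\<in>I. \<Oplus>k\<in>K. f i k)"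
 using insert.hyps c1 by (intro finsum_insert) auto
 also have "... = (\<Oplus>k\<in>K. f i k) \<oplus> (\<Oplus>k\<in>K. \<Oplus>i\<in>I. f i k)" using insert by simp
 also have "... = (\<Oplus>k\<in>K. f i k \<oplus> (\<Oplus>i\<in>I. f i k))" by (rule finsum_addf[symmetric, OF c2])
 also have "... = (\<Oplus>k\<in>K. \<Oplus>i\<in>insert i I. f i k)"
 using insert.hyps insert.prems c2 by (intro finsum_cong' refl finsum_insert[symmetric]) auto
 finally show ?case .
qed

lemma (in cring) matrix_vector_assoc:
 fixes n :: nat
 assumes A: "!!j. j < n ==> A j : carrier R" and B: "!!j k. j < n ==> k < n ==> B j k : carrier R"
 and y: "!!k. k < n ==> y k : carrier R"
 shows "(\<Oplus>j\<in>{..<n}. A j \<otimes> (\<Oplus>k\<in>{..<n}. B j k \<otimes> y k)) = (\<Oplus>k\<in>{..<n}. (\<Oplus>j\<in>{..<n}. A j \<otimes> B j k) \<otimes> y k)"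
proof -
 have "(\<Oplus>j\<in>{..<n}. A j \<otimes> (\<Oplus>k\<in>{..<n}. B j k \<otimes> y k)) = (\<Oplus>j\<in>{..<n}. \<Oplus>k\<in>{..<n}. (A j \<otimes> B j k) \<otimes> y k)"
 proof (rule finsum_cong'[OF refl])
 show "(%j. \<Oplus>k\<in>{..<n}. (A j \<otimes> B j k) \<otimes> y k) : {..<n} \<rightarrow> carrier R"
 using A B y by (intro Pi_I finsum_closed) auto
 fix j assume j: "j : {..<n}"
 have "A j \<otimes> (\<Oplus>k\<in>{..<n}. B j k \<otimes> y k) = (\<Oplus>k\<in>{..<n}. A j \<otimes> (B j k \<otimes> y k))"
 using A B y j by (intro finsum_rdistr) auto
 also have "... = (\<Oplus>k\<in>{..<n}. (A j \<otimes> B j k) \<otimes> y k)"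
 using A B y j by (intro finsum_cong' refl) (auto simp: m_assoc)
 finally show "A j \<otimes> (\<Oplus>k\<in>{..<n}. B j k \<otimes> y k) = (\<Oplus>k\<in>{..<n}. (A j \<otimes> B j k) \<otimes> y k)" .
 qed
 also have "... = (\<Oplus>k\<in>{..<n}. \<Oplus>j\<in>{..<n}. (A j \<otimes> B j k) \<otimes> y k)"
 using A B y by (intro finsum_swap_finite) auto
 also have "... = (\<Oplus>k\<in>{..<n}. (\<Oplus>j\<in>{..<n}. A j \<otimes> B j k) \<otimes> y k)"
 using A B y by (intro finsum_cong' refl finsum_ldistr[symmetric]) auto
 finally show ?thesis .
qed

lemma (in cring) matrix_vector_cancel:
 fixes n :: nat
 assumes A: "!!i j. i < n ==> j < n ==> A i j : carrier R" and B: "!!i j. i < n ==> j < n ==> B i j : carrier R"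
 and AB: "!!i k. i < n ==> k < n ==> (\<Oplus>j\<in>{..<n}. A i j \<otimes> B j k) = (if i = k then \<one> else \<zero>)"
 and y: "!!k. k < n ==> y k : carrier R" and i: "i < n"
 shows "(\<Oplus>j\<in>{..<n}. A i j \<otimes> (\<Oplus>k\<in>{..<n}. B j k \<otimes> y k)) = y i"
proof -
 have "(\<Oplus>j\<in>{..<n}. A i j \<otimes> (\<Oplus>k\<in>{..<n}. B j k \<otimes> y k)) = (\<Oplus>k\<in>{..<n}. (\<Oplus>j\<in>{..<n}. A i j \<otimes> B j k) \<otimes> y k)"
 by (rule matrix_vector_assoc) (use A B y i in auto)
 also have "... = (\<Oplus>k\<in>{..<n}. if i = k then y k else \<zero>)"
 proof (rule finsum_cong'[OF refl])
 show "(%k. if i = k then y k else \<zero>) : {..<n} \<rightarrow> carrier R" using y by auto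
 fix k assume k: "k : {..<n}"
 show "(\<Oplus>j\<in>{..<n}. A i j \<otimes> B j k) \<otimes> y k = (if i = k then y k else \<zero>)" using AB[of i k] i k y[of k] by simp
 qed
 also have "... = y i" using y i by (intro finsum_singleton) auto
 finally show ?thesis .
qed

abbreviation (input) "AR \<equiv> adele_ring"
abbreviation (input) "Lf \<equiv> local_field"

lemma adele_add: "a \<oplus>\<^bsub>AR\<^esub> b = (\<lambda>v\<in>finite_places. fst a v \<oplus>\<^bsub>Lf v\<^esub> fst b v, \<lambda>w\<in>arch_places. snd a w + snd b w)"
 and adele_mult: "a \<otimes>\<^bsub>AR\<^esub> b = (\<lambda>v\<in>finite_places. fst a v \<otimes>\<^bsub>Lf v\<^esub> fst b v, \<lambda>w\<in>arch_places. snd a w * snd b w)"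
 and adele_zero: "\<zero>\<^bsub>AR\<^esub> = (\<lambda>v\<in>finite_places. \<zero>\<^bsub>Lf v\<^esub>, \<lambda>w\<in>arch_places. 0)"
 and adele_one: "\<one>\<^bsub>AR\<^esub> = (\<lambda>v\<in>finite_places. \<one>\<^bsub>Lf v\<^esub>, \<lambda>w\<in>arch_places. 1)"
 by (cases a; cases b; simp add: adele_ring_def RDirProd_def monoid.defs DirProd_def finite_adele_ring_def product_ring_def arch_field_def)+

lemma adele_carrier: "a : carrier AR \<longleftrightarrow> fst a : (\<Pi>\<^sub>E v\<in>finite_places. carrier (Lf v)) &
 finite {v : finite_places. fst a v ~: local_integers v} & snd a : (\<Pi>\<^sub>E w\<in>arch_places. carrier (arch_field w))"
 by (cases a) (simp add: adele_ring_def RDirProd_def monoid.defs DirProd_def finite_adele_ring_def product_ring_def)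

lemma arch_field_carrier: "carrier (arch_field w) = (if real_place w then \<real> else UNIV)"
 by (simp add: arch_field_def)

lemma adele_fst_mem: "a : carrier AR ==> v : FP ==> fst a v : carrier (Lf v)"
 unfolding adele_carrier by (blast dest: PiE_mem)

lemma cring_local_field: "v : FP ==> cring (Lf v)"
proof -
 assume "v : FP"
 then interpret nonarch v by (rule nonarch_place)
 show ?thesis by (rule LF.is_cring)
qed

lemma local_integers_add:
 assumes "v : FP" "c : local_integers v" "d : local_integers v"
 shows "c \<oplus>\<^bsub>Lf v\<^esub> d : local_integers v"
proof -
 interpret nonarch v using assms(1) by (rule nonarch_place)
 show ?thesis using assms(2,3) lv_add[of c d] by (auto simp: local_int_iff)
qed

lemma adele_abelian_monoid: "abelian_monoid (AR :: 'a::number_field adele ring)"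
proof (rule abelian_monoidI)
 note cr = cring.cring_simprules[OF cring_local_field]
 fix a b c :: "'a adele" assume a: "a : carrier AR" and b: "b : carrier AR"
 note fc = adele_fst_mem[OF a] adele_fst_mem[OF b]
 have sc: "!!w. w : arch_places ==> snd a w : carrier (arch_field w)" "!!w. w : arch_places ==> snd b w : carrier (arch_field w)"
 using a b unfolding adele_carrier by (blast dest: PiE_mem)+
 have s: "{v : finite_places. (\<lambda>v\<in>finite_places. fst a v \<oplus>\<^bsub>Lf v\<^esub> fst b v) v ~: local_integers v} <=
 {v : finite_places. fst a v ~: local_integers v} Un {v : finite_places. fst b v ~: local_integers v}"
 using local_integers_add by auto
 have f: "finite ({v : finite_places. fst a v ~: local_integers v} Un {v : finite_places. fst b v ~: local_integers v})"
 using a b unfolding adele_carrier by simp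
 show "a \<oplus>\<^bsub>AR\<^esub> b : carrier AR" unfolding adele_carrier adele_add fst_conv snd_conv
 proof (intro conjI)
 show "(\<lambda>v\<in>finite_places. fst a v \<oplus>\<^bsub>Lf v\<^esub> fst b v) : (\<Pi>\<^sub>E v\<in>finite_places. carrier (Lf v))"
 using fc by (simp add: restrict_PiE_iff cr)
 show "(\<lambda>w\<in>arch_places. snd a w + snd b w) : (\<Pi>\<^sub>E w\<in>arch_places. carrier (arch_field w))"
 unfolding restrict_PiE_iff
 proof
 fix w :: "('a => complex) set" assume "w : arch_places"
 from sc(1)[OF this] sc(2)[OF this] show "snd a w + snd b w : carrier (arch_field w)"
 by (simp add: arch_field_carrier split: if_splits)
 qed
 qed (rule finite_subset[OF s f])
 show "a \<oplus>\<^bsub>AR\<^esub> b = b \<oplus>\<^bsub>AR\<^esub> a" unfolding adele_add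
 using fc by (intro restrict_ext arg_cong2[where f = Pair]) (simp_all add: cr)
 show "\<zero>\<^bsub>AR\<^esub> \<oplus>\<^bsub>AR\<^esub> a = a"
 proof (rule prod_eqI)
 show "fst (\<zero>\<^bsub>AR\<^esub> \<oplus>\<^bsub>AR\<^esub> a) = fst a"
 proof (rule ext)
 fix v show "fst (\<zero>\<^bsub>AR\<^esub> \<oplus>\<^bsub>AR\<^esub> a) v = fst a v"
 using fc(1)[of v] a[unfolded adele_carrier, THEN conjunct1, THEN PiE_arb, of v]
 by (cases "v : FP") (simp_all add: adele_add adele_zero cr)
 qed
 show "snd (\<zero>\<^bsub>AR\<^esub> \<oplus>\<^bsub>AR\<^esub> a) = snd a"
 proof (rule ext)
 fix v show "snd (\<zero>\<^bsub>AR\<^esub> \<oplus>\<^bsub>AR\<^esub> a) v = snd a v"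
 using a[unfolded adele_carrier, THEN conjunct2, THEN conjunct2, THEN PiE_arb, of v]
 by (cases "v : arch_places") (simp_all add: adele_add adele_zero)
 qed
 qed
 assume c: "c : carrier AR"
 show "a \<oplus>\<^bsub>AR\<^esub> b \<oplus>\<^bsub>AR\<^esub> c = a \<oplus>\<^bsub>AR\<^esub> (b \<oplus>\<^bsub>AR\<^esub> c)" unfolding adele_add
 using fc adele_fst_mem[OF c] by (intro restrict_ext arg_cong2[where f = Pair]) (simp_all add: cr add.assoc)
next
 have z: "\<zero>\<^bsub>Lf v\<^esub> : carrier (Lf v) & \<zero>\<^bsub>Lf v\<^esub> : local_integers v"
 if v: "v : FP" for v :: "'a set"
 proof -
 interpret nonarch v using v by (rule nonarch_place)
 show ?thesis by (simp add: local_int_iff lv_zero)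
 qed
 then have "ALL v:finite_places. \<zero>\<^bsub>Lf v\<^esub> : local_integers (v :: 'a set)" by blast
 then have e: "{v : finite_places. (\<lambda>v\<in>finite_places. \<zero>\<^bsub>Lf v\<^esub>) v ~: local_integers (v :: 'a set)} = {}" by auto
 show "\<zero>\<^bsub>AR\<^esub> : carrier (AR :: 'a adele ring)"
 unfolding adele_carrier adele_zero fst_conv snd_conv e restrict_PiE_iff using z by (simp add: arch_field_carrier)
qed

interpretation AR: abelian_monoid AR by (rule adele_abelian_monoid)

lemma fst_adele_finsum:
 assumes "finite I" "f : I \<rightarrow> carrier AR" "v : FP"
 shows "fst (finsum AR f I) v = finsum (Lf v) (%i. fst (f i) v) I"
proof -
 interpret cring "Lf v" using assms(3) by (rule cring_local_field)
 show ?thesis using assms(1,2)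
 proof (induction I rule: finite_induct)
 case empty
 then show ?case using assms(3) by (simp add: adele_zero)
 next
 case (insert i I)
 have "finsum (Lf v) (%i. fst (f i) v) (insert i I) = fst (f i) v \<oplus>\<^bsub>Lf v\<^esub> finsum (Lf v) (%i. fst (f i) v) I"
 using insert.hyps insert.prems by (intro finsum_insert) (auto intro!: adele_fst_mem[OF _ assms(3)])
 moreover have "finsum AR f (insert i I) = f i \<oplus>\<^bsub>AR\<^esub> finsum AR f I" using insert by (intro AR.finsum_insert) auto
 ultimately show ?case using insert assms(3) by (simp add: adele_add)
 qed
qed

lemma snd_adele_finsum:
 assumes "finite I" "f : I \<rightarrow> carrier AR" "w : arch_places"
 shows "snd (finsum AR f I) w = (SUM i:I. snd (f i) w)"
 using assms(1,2)
proof (induction I rule: finite_induct)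
 case empty
 then show ?case using assms(3) by (simp add: adele_zero)
next
 case (insert i I)
 have "finsum AR f (insert i I) = f i \<oplus>\<^bsub>AR\<^esub> finsum AR f I" using insert by (intro AR.finsum_insert) auto
 then show ?case using insert assms(3) by (simp add: adele_add)
qed

lemma adele_mult_mem: assumes a: "a : carrier AR" and b: "b : carrier AR"
 shows "a \<otimes>\<^bsub>AR\<^esub> b : carrier (AR :: 'a::number_field adele ring)"
proof -
 note fc = adele_fst_mem[OF a] adele_fst_mem[OF b]
 have sc: "!!w. w : arch_places ==> snd a w : carrier (arch_field w)" "!!w. w : arch_places ==> snd b w : carrier (arch_field w)"
 using a b unfolding adele_carrier by (blast dest: PiE_mem)+
 have i: "c \<otimes>\<^bsub>Lf v\<^esub> d : local_integers v"
 if v: "v : FP" and cd: "c : local_integers v" "d : local_integers v" for v :: "'a set" and c d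
 proof -
 interpret nonarch v using v by (rule nonarch_place)
 have "lv c * lv d <= 1 * 1" using cd lv_nonneg by (intro mult_mono) (auto simp: local_int_iff)
 then show ?thesis using cd by (simp add: local_int_iff lv_mult)
 qed
 have s: "{v : finite_places. (\<lambda>v\<in>finite_places. fst a v \<otimes>\<^bsub>Lf v\<^esub> fst b v) v ~: local_integers v} <=
 {v : finite_places. fst a v ~: local_integers v} Un {v : finite_places. fst b v ~: local_integers v}"
 using i by auto
 have f: "finite ({v : finite_places. fst a v ~: local_integers v} Un {v : finite_places. fst b v ~: local_integers v})"
 using a b unfolding adele_carrier by simp
 show ?thesis unfolding adele_carrier adele_mult fst_conv snd_conv
 proof (intro conjI)
 show "(\<lambda>v\<in>finite_places. fst a v \<otimes>\<^bsub>Lf v\<^esub> fst b v) : (\<Pi>\<^sub>E v\<in>finite_places. carrier (Lf v))"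
 using fc by (simp add: restrict_PiE_iff cring.cring_simprules[OF cring_local_field])
 show "(\<lambda>w\<in>arch_places. snd a w * snd b w) : (\<Pi>\<^sub>E w\<in>arch_places. carrier (arch_field w))"
 unfolding restrict_PiE_iff
 proof
 fix w :: "('a => complex) set" assume "w : arch_places"
 from sc(1)[OF this] sc(2)[OF this] show "snd a w * snd b w : carrier (arch_field w)"
 by (simp add: arch_field_carrier split: if_splits)
 qed
 qed (rule finite_subset[OF s f])
qed

section \<open>The module of an adelic matrix\<close>

text \<open>\<open>ph\<close> exceeds 1 only on the finite set \<open>S\<close>. There an integer of
  absolute value below \<open>1 / K\<close> compensates the common bound \<open>K\<close>; at the
  other places integers have absolute value at most 1.\<close>

lemma bounding_integer_exists:
 fixes ph :: "'a::number_field set => real"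
 assumes "finite {v : finite_places. ph v > 1}"
 shows "EX m::int. m ~= 0 & (ALL v:finite_places. place_abs v (of_int m) * ph v <= 1)"
proof -
 define S where "S = {v : finite_places. ph v > 1}"
 define K where "K = (SUM v:S. ph v) + 1"
 have S: "finite S" "S <= FP" using assms by (auto simp: S_def)
 have K0: "K > 0" using sum_nonneg[of S ph] by (force simp: K_def S_def)
 have K: "ph v <= K" if "v : S" for v
 using member_le_sum[of v S ph] that S(1) by (force simp: K_def S_def)
 have "EX m::int. m ~= 0 & (ALL v:S. place_abs v (of_int m) < 1 / K)"
 using small_integer_exists[OF S, of "1 / K"] K0 by simp
 then obtain m :: int where m: "m ~= 0" "ALL v:S. place_abs v (of_int m) < 1 / K" by blast
 have "place_abs v (of_int m) * ph v <= 1" if v: "v : FP" for v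
 proof -
 obtain t b where "uniformizer v t b" using v by (rule uniformizer_exists)
 then interpret uniformizer v t b .
 have a0: "0 <= place_abs v (of_int m)" by (rule place_abs_nonneg)
 show ?thesis
 proof (cases "v : S")
 case True
 have "place_abs v (of_int m) * ph v <= 1 / K * K" using True m(2) K[OF True] a0 K0
 by (intro mult_mono) (auto simp: S_def)
 then show ?thesis using K0 by simp
 next
 case False
 have "aint (of_int m :: 'a)" by simp
 then have a1: "place_abs v (of_int m) <= 1" by (rule place_abs_integral)
 have "place_abs v (of_int m) * ph v <= place_abs v (of_int m) * 1"
 using False \<open>v : FP\<close> a0 by (intro mult_left_mono) (simp_all add: S_def del: finite_place_iff)
 then show ?thesis using a1 by simp
 qed
 qed
 then show ?thesis using m(1) by blast
qed

text \<open>Vectors of length \<open>r\<close> as functions vanishing from \<open>r\<close> on.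
  Functions form a commutative ring, so that \<open>zspan\<close> and \<open>gram_lattice\<close>
  apply to them.\<close>

definition vf :: "nat => 'a::zero vec => nat => 'a" where
 "vf r x = (%i. if i < r then x $ i else 0)"

locale adelic_matrix =
 fixes r :: nat and g :: "'a::number_field adele mat"
 assumes g: "g : carrier (GL_adele r)"
begin

definition gi :: "'a adele mat" where
 "gi = (SOME h. h : carrier (mat_monoid r AR) & mat_times AR h g = one (mat_monoid r AR) &
 mat_times AR g h = one (mat_monoid r AR))"

lemma gi: "gi : carrier (mat_monoid r AR)" "mat_times AR gi g = one (mat_monoid r AR)"
 "mat_times AR g gi = one (mat_monoid r AR)"
 and gM: "g : carrier (mat_monoid r AR)"
proof -
 have "g : Units (mat_monoid r AR)" using g by (simp add: GL_adele_def units_of_carrier)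
 then have "EX h. h : carrier (mat_monoid r AR) & mat_times AR h g = one (mat_monoid r AR) &
 mat_times AR g h = one (mat_monoid r AR)" and gc: "g : carrier (mat_monoid r AR)"
 by (auto simp: Units_def mat_monoid_def)
 from someI_ex[OF this(1)] show "gi : carrier (mat_monoid r AR)" "mat_times AR gi g = one (mat_monoid r AR)"
 "mat_times AR g gi = one (mat_monoid r AR)" unfolding gi_def by simp_all
 show "g : carrier (mat_monoid r AR)" by (rule gc)
qed

lemma dims: "dim_row g = r" "dim_col g = r" "dim_row gi = r" "dim_col gi = r"
 using gM gi(1) by (auto simp: mat_monoid_def)

lemma entries: "i < r ==> j < r ==> g $$ (i, j) : carrier AR" "i < r ==> j < r ==> gi $$ (i, j) : carrier AR"
 using gM gi(1) by (auto simp: mat_monoid_def)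

abbreviation "GG v i j \<equiv> fst (g $$ (i, j)) v"
abbreviation "GI v i j \<equiv> fst (gi $$ (i, j)) v"

lemma inv_entries:
 assumes "i < r" "k < r"
 shows "finsum AR (%j. gi $$ (i, j) \<otimes>\<^bsub>AR\<^esub> g $$ (j, k)) {..<r} = (if i = k then \<one>\<^bsub>AR\<^esub> else \<zero>\<^bsub>AR\<^esub>)"
 "finsum AR (%j. g $$ (i, j) \<otimes>\<^bsub>AR\<^esub> gi $$ (j, k)) {..<r} = (if i = k then \<one>\<^bsub>AR\<^esub> else \<zero>\<^bsub>AR\<^esub>)"
proof -
 have "mat_times AR gi g $$ (i, k) = one (mat_monoid r AR) $$ (i, k)" by (simp only: gi)
 then show "finsum AR (%j. gi $$ (i, j) \<otimes>\<^bsub>AR\<^esub> g $$ (j, k)) {..<r} = (if i = k then \<one>\<^bsub>AR\<^esub> else \<zero>\<^bsub>AR\<^esub>)"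
 using assms by (simp add: mat_times_def mat_monoid_def dims)
 have "mat_times AR g gi $$ (i, k) = one (mat_monoid r AR) $$ (i, k)" by (simp only: gi)
 then show "finsum AR (%j. g $$ (i, j) \<otimes>\<^bsub>AR\<^esub> gi $$ (j, k)) {..<r} = (if i = k then \<one>\<^bsub>AR\<^esub> else \<zero>\<^bsub>AR\<^esub>)"
 using assms by (simp add: mat_times_def mat_monoid_def dims)
qed

lemma fin_inv:
 assumes v: "v : FP" and ik: "i < r" "k < r"
 shows "finsum (Lf v) (%j. GI v i j \<otimes>\<^bsub>Lf v\<^esub> GG v j k) {..<r} =
 (if i = k then \<one>\<^bsub>Lf v\<^esub> else \<zero>\<^bsub>Lf v\<^esub>)"
 "finsum (Lf v) (%j. GG v i j \<otimes>\<^bsub>Lf v\<^esub> GI v j k) {..<r} =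
 (if i = k then \<one>\<^bsub>Lf v\<^esub> else \<zero>\<^bsub>Lf v\<^esub>)"
proof -
 have "fst (finsum AR (%j. gi $$ (i, j) \<otimes>\<^bsub>AR\<^esub> g $$ (j, k)) {..<r}) v =
 finsum (Lf v) (%j. fst (gi $$ (i, j) \<otimes>\<^bsub>AR\<^esub> g $$ (j, k)) v) {..<r}"
 by (rule fst_adele_finsum[OF _ _ v]) (use ik in "auto intro!: adele_mult_mem entries")
 then show "finsum (Lf v) (%j. GI v i j \<otimes>\<^bsub>Lf v\<^esub> GG v j k) {..<r} =
 (if i = k then \<one>\<^bsub>Lf v\<^esub> else \<zero>\<^bsub>Lf v\<^esub>)"
 unfolding inv_entries(1)[OF ik] using v by (simp add: adele_mult adele_one adele_zero split: if_splits)
 have "fst (finsum AR (%j. g $$ (i, j) \<otimes>\<^bsub>AR\<^esub> gi $$ (j, k)) {..<r}) v =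
 finsum (Lf v) (%j. fst (g $$ (i, j) \<otimes>\<^bsub>AR\<^esub> gi $$ (j, k)) v) {..<r}"
 by (rule fst_adele_finsum[OF _ _ v]) (use ik in "auto intro!: adele_mult_mem entries")
 then show "finsum (Lf v) (%j. GG v i j \<otimes>\<^bsub>Lf v\<^esub> GI v j k) {..<r} =
 (if i = k then \<one>\<^bsub>Lf v\<^esub> else \<zero>\<^bsub>Lf v\<^esub>)"
 unfolding inv_entries(2)[OF ik] using v by (simp add: adele_mult adele_one adele_zero split: if_splits)
qed

lemma arch_inv:
 assumes w: "w : arch_places" and ik: "i < r" "k < r"
 shows "(SUM j<r. snd (gi $$ (i, j)) w * snd (g $$ (j, k)) w) = (if i = k then 1 else 0)"
 "(SUM j<r. snd (g $$ (i, j)) w * snd (gi $$ (j, k)) w) = (if i = k then 1 else 0)"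
proof -
 have "snd (finsum AR (%j. gi $$ (i, j) \<otimes>\<^bsub>AR\<^esub> g $$ (j, k)) {..<r}) w =
 (SUM j<r. snd (gi $$ (i, j) \<otimes>\<^bsub>AR\<^esub> g $$ (j, k)) w)"
 by (rule snd_adele_finsum[OF _ _ w]) (use ik in "auto intro!: adele_mult_mem entries")
 then show "(SUM j<r. snd (gi $$ (i, j)) w * snd (g $$ (j, k)) w) = (if i = k then 1 else 0)"
 unfolding inv_entries(1)[OF ik] using w by (simp add: adele_mult adele_one adele_zero split: if_splits)
 have "snd (finsum AR (%j. g $$ (i, j) \<otimes>\<^bsub>AR\<^esub> gi $$ (j, k)) {..<r}) w =
 (SUM j<r. snd (g $$ (i, j) \<otimes>\<^bsub>AR\<^esub> gi $$ (j, k)) w)"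
 by (rule snd_adele_finsum[OF _ _ w]) (use ik in "auto intro!: adele_mult_mem entries")
 then show "(SUM j<r. snd (g $$ (i, j)) w * snd (gi $$ (j, k)) w) = (if i = k then 1 else 0)"
 unfolding inv_entries(2)[OF ik] using w by (simp add: adele_mult adele_one adele_zero split: if_splits)
qed

text \<open>Coordinate \<open>i\<close> at \<open>v\<close> of the inverse of \<open>g\<close>
  applied to \<open>f\<close>. Membership in the adelic module turns into integrality of these
  coordinates, with no local vector to be guessed.\<close>

definition T :: "'a set => nat => (nat => 'a) => (nat => 'a) set" where
 "T v i f = finsum (Lf v) (%j. GI v i j \<otimes>\<^bsub>Lf v\<^esub> local_emb v (f j)) {..<r}"

definition Mf :: "(nat => 'a) set" where
 "Mf = {f. (ALL i>=r. f i = 0) & (ALL v:finite_places. ALL i<r. T v i f : local_integers v)}"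

lemma GI_carrier: "v : FP ==> i < r ==> j < r ==> GI v i j : carrier (Lf v)"
 and GG_carrier: "v : FP ==> i < r ==> j < r ==> GG v i j : carrier (Lf v)"
 by (simp_all add: adele_fst_mem entries)

lemma fin_comp_times_vec:
 assumes v: "v : FP" and y: "ALL i<r. y $ i : local_integers v"
 shows "mat_times_vec (Lf v) (fin_comp g v) y =
 vec r (%i. finsum (Lf v) (%k. GG v i k \<otimes>\<^bsub>Lf v\<^esub> y $ k) {..<r})"
proof -
 interpret nonarch v using v by (rule nonarch_place)
 have yc: "y $ k : carrier LF" if "k < r" for k using y that by (simp add: local_int_iff)
 have "finsum LF (%k. fin_comp g v $$ (i, k) ** y $ k) {..<r} = finsum LF (%k. GG v i k ** y $ k) {..<r}"
 if i: "i < r" for i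
 by (rule LF.finsum_cong') (use i GG_carrier[OF v] yc in "simp_all add: fin_comp_def dims")
 moreover have "dim_row (fin_comp g v) = r" "dim_col (fin_comp g v) = r" by (simp_all add: fin_comp_def dims)
 ultimately show ?thesis unfolding mat_times_vec_def by (intro eq_vecI) simp_all
qed

lemma module_iff: "x : adelic_module r g \<longleftrightarrow> x : carrier_vec r & vf r x : Mf"
proof -
 have "(EX y:carrier_vec r. (ALL i<r. y $ i : local_integers v) &
 map_vec (local_emb v) x = mat_times_vec (Lf v) (fin_comp g v) y) \<longleftrightarrow>
 (ALL i<r. T v i (vf r x) : local_integers v)" if x: "x : carrier_vec r" and v: "v : FP" for v
 proof -
 interpret nonarch v using v by (rule nonarch_place)
 note GIc = GI_carrier[OF v] and GGc = GG_carrier[OF v]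
 note mt = fin_comp_times_vec[OF v]
 have Tx: "T v i (vf r x) = finsum LF (%j. GI v i j \<otimes>\<^bsub>LF\<^esub> local_emb v (x $ j)) {..<r}" if "i < r" for i
 unfolding T_def by (rule LF.finsum_cong') (use that in "auto simp: vf_def intro!: LF.m_closed GIc")
 show ?thesis
 proof
 assume "EX y:carrier_vec r. (ALL i<r. y $ i : local_integers v) &
 map_vec (local_emb v) x = mat_times_vec (Lf v) (fin_comp g v) y"
 then obtain y where y0: "y : carrier_vec r" and y2: "ALL i<r. y $ i : local_integers v"
 and y3: "map_vec (local_emb v) x = mat_times_vec (Lf v) (fin_comp g v) y" by blast
 note y = y0 y2 y3[unfolded mt[OF y2]]
 have yc: "y $ k : carrier LF" if "k < r" for k using y(2) that by (simp add: local_int_iff)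
 have ex: "local_emb v (x $ j) = finsum LF (%k. GG v j k \<otimes>\<^bsub>LF\<^esub> y $ k) {..<r}" if "j < r" for j
 using arg_cong[OF y(3), of "%z. z $ j"] that x by simp
 have "T v i (vf r x) = y $ i" if i: "i < r" for i
 proof -
 have "T v i (vf r x) = finsum LF (%j. GI v i j \<otimes>\<^bsub>LF\<^esub> finsum LF (%k. GG v j k \<otimes>\<^bsub>LF\<^esub> y $ k) {..<r}) {..<r}"
 unfolding Tx[OF i]
 by (rule LF.finsum_cong') (use i in "auto simp: ex intro!: LF.m_closed LF.finsum_closed GIc GGc yc")
 also have "... = y $ i"
 by (rule LF.matrix_vector_cancel) (use i fin_inv(1)[OF v] GIc GGc yc in simp_all)
 finally show ?thesis .
 qed
 then show "ALL i<r. T v i (vf r x) : local_integers v" using y(2) by simp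
 next
 assume T: "ALL i<r. T v i (vf r x) : local_integers v"
 have "map_vec (local_emb v) x = mat_times_vec (Lf v) (fin_comp g v) (vec r (%i. T v i (vf r x)))"
 proof (subst mt)
 show "ALL i<r. vec r (%i. T v i (vf r x)) $ i : local_integers v" using T by simp
 show "map_vec (local_emb v) x = vec r (%i. finsum LF (%k. GG v i k \<otimes>\<^bsub>LF\<^esub> vec r (%i. T v i (vf r x)) $ k) {..<r})"
 proof (rule eq_vecI)
 fix i assume "i < dim_vec (vec r (%i. finsum LF (%k. GG v i k \<otimes>\<^bsub>LF\<^esub> vec r (%i. T v i (vf r x)) $ k) {..<r}))"
 then have i: "i < r" by simp
 have "finsum LF (%k. GG v i k \<otimes>\<^bsub>LF\<^esub> vec r (%i. T v i (vf r x)) $ k) {..<r} =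
 finsum LF (%k. GG v i k \<otimes>\<^bsub>LF\<^esub> finsum LF (%j. GI v k j \<otimes>\<^bsub>LF\<^esub> local_emb v (x $ j)) {..<r}) {..<r}"
 by (rule LF.finsum_cong') (use i in "auto simp: Tx intro!: LF.m_closed LF.finsum_closed GIc GGc")
 also have "... = local_emb v (x $ i)"
 by (rule LF.matrix_vector_cancel) (use i fin_inv(2)[OF v] GIc GGc in simp_all)
 finally show "map_vec (local_emb v) x $ i = vec r (%i. finsum LF (%k. GG v i k \<otimes>\<^bsub>LF\<^esub> vec r (%i. T v i (vf r x)) $ k) {..<r}) $ i"
 using i x by simp
 qed (use x in simp)
 qed
 with T show "EX y:carrier_vec r. (ALL i<r. y $ i : local_integers v) &
 map_vec (local_emb v) x = mat_times_vec (Lf v) (fin_comp g v) y"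
 by (intro bexI[of _ "vec r (%i. T v i (vf r x))"]) simp_all
 qed
 qed
 then show ?thesis unfolding adelic_module_def Mf_def by (auto simp: vf_def)
qed

lemma T_carrier: "v : FP ==> i < r ==> T v i f : carrier (Lf v)"
proof -
 assume v: "v : FP" and i: "i < r"
 interpret nonarch v using v by (rule nonarch_place)
 show ?thesis unfolding T_def by (rule LF.finsum_closed) (use i GI_carrier[OF v] in auto)
qed

lemma T_add: assumes v: "v : FP" and i: "i < r"
 shows "T v i (f + f') = T v i f \<oplus>\<^bsub>Lf v\<^esub> T v i f'"
proof -
 interpret nonarch v using v by (rule nonarch_place)
 note c = GI_carrier[OF v i]
 have "T v i (f + f') = finsum LF (%j. GI v i j ** local_emb v (f j) \<oplus>\<^bsub>LF\<^esub> GI v i j ** local_emb v (f' j)) {..<r}"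
 unfolding T_def by (rule LF.finsum_cong') (use c in "auto simp: local_emb_hom LF.r_distr")
 also have "... = T v i f \<oplus>\<^bsub>LF\<^esub> T v i f'" unfolding T_def by (rule LF.finsum_addf) (use c in auto)
 finally show ?thesis .
qed

lemma T_mult: assumes v: "v : FP" and i: "i < r"
 shows "T v i (%j. c * f j) = local_emb v c \<otimes>\<^bsub>Lf v\<^esub> T v i f"
proof -
 interpret nonarch v using v by (rule nonarch_place)
 note gc = GI_carrier[OF v i]
 have "local_emb v c \<otimes>\<^bsub>Lf v\<^esub> T v i f = finsum LF (%j. local_emb v c ** (GI v i j ** local_emb v (f j))) {..<r}"
 unfolding T_def by (rule LF.finsum_rdistr) (use gc in auto)
 also have "... = T v i (%j. c * f j)"
 unfolding T_def by (rule LF.finsum_cong') (use gc in "auto simp: local_emb_hom LF.m_lcomm")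
 finally show ?thesis by simp
qed

lemma Mf_mult: assumes f: "f : Mf" and c: "!!v. v : FP ==> place_abs v c <= 1"
 shows "(%j. c * f j) : Mf"
proof -
 have "T v i (%j. c * f j) : local_integers v" if v: "v : FP" and i: "i < r" for v i
 proof -
 interpret nonarch v using v by (rule nonarch_place)
 have "T v i f : local_integers v" using f v i by (simp add: Mf_def)
 then have "A c * lv (T v i f) <= 1 * 1" using c[OF v] A_nonneg lv_nonneg
 by (intro mult_mono) (simp_all add: local_int_iff)
 then show ?thesis using T_carrier[OF v i]
 by (simp add: T_mult[OF v i] local_int_iff lv_mult lv_local_emb)
 qed
 then show ?thesis using f by (simp add: Mf_def)
qed

lemma Mf_zsub: "zsub Mf"
proof -
 have 0: "0 : Mf"
 proof -
 have "T v i 0 : local_integers v" if v: "v : FP" and i: "i < r" for v i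
 proof -
 interpret nonarch v using v by (rule nonarch_place)
 have "T v i 0 = \<zero>\<^bsub>LF\<^esub>" using T_mult[OF v i, of 0 0] T_carrier[OF v i] by (simp add: local_emb_hom zero_fun_def)
 then show ?thesis by (simp add: local_int_iff lv_zero)
 qed
 then show ?thesis by (simp add: Mf_def)
 qed
 have a1: "place_abs v (-1) <= 1" if v: "v : FP" for v :: "'a set"
 proof -
 obtain t b where "uniformizer v t b" using v by (rule uniformizer_exists)
 then interpret uniformizer v t b .
 show ?thesis by (rule place_abs_integral) simp
 qed
 have "x - y : Mf" if xy: "x : Mf" "y : Mf" for x y
 proof -
 have m: "(%j. (-1) * y j) : Mf" by (rule Mf_mult[OF xy(2) a1])
 have e: "x - y = x + (%j. (-1) * y j)" by (simp add: fun_eq_iff)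
 show ?thesis unfolding e using xy(1) m
 by (simp add: Mf_def T_add local_integers_add)
 qed
 with 0 show ?thesis by (simp add: zsub_def)
qed

text \<open>At each place a member is \<open>g\<close> applied to an integral vector, so its
  coordinates are bounded by the entries of \<open>g\<close>, which are integral at almost all
  places. An integer absorbing the remaining bounds makes all members integral at once.\<close>

lemma Mf_integral_multiple:
 obtains N :: int where "N ~= 0" "ALL f:Mf. ALL j. aint (of_int N * f j)"
proof -
 define P where "P v \<longleftrightarrow> (ALL i<r. ALL j<r. GG v i j : local_integers v)" for v
 \<comment> \<open>The sum stands in for a maximum of local absolute values. The value 1 at the
   places where all entries are integral ensures that \<open>ph\<close> exceeds 1 only finitely
   often.\<close>
 define ph where "ph v = (if P v then 1 else 1 + (SUM i<r. SUM j<r. \<bar>nonarch.lv v (GG v i j)\<bar>))" for v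
 have bound: "nonarch.lv v (GG v i j) <= ph v" if v: "v : FP" and ij: "i < r" "j < r" for v i j
 proof -
 interpret nonarch v using v by (rule nonarch_place)
 show ?thesis
 proof (cases "P v")
 case True
 then show ?thesis using ij by (simp add: ph_def P_def local_int_iff)
 next
 case False
 have "\<bar>lv (GG v i j)\<bar> <= (SUM j<r. \<bar>lv (GG v i j)\<bar>)" using ij by (intro member_le_sum) auto
 also have "... <= (SUM i<r. SUM j<r. \<bar>lv (GG v i j)\<bar>)" using ij by (intro member_le_sum[of i _ "%i. SUM j<r. \<bar>lv (GG v i j)\<bar>"]) (auto intro: sum_nonneg)
 finally show ?thesis using False by (simp add: ph_def)
 qed
 qed
 have "{v : finite_places. ph v > 1} <= (\<Union>i<r. \<Union>j<r. {v : finite_places. GG v i j ~: local_integers v})"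
 by (auto simp: ph_def P_def split: if_splits)
 moreover have "finite (\<Union>i<r. \<Union>j<r. {v : finite_places. GG v i j ~: local_integers v})"
 using entries(1) by (simp add: adele_carrier)
 ultimately have "finite {v : finite_places. ph v > 1}" by (rule finite_subset)
 from bounding_integer_exists[OF this] obtain N :: int where N: "N ~= 0"
 "ALL v:finite_places. place_abs v (of_int N :: 'a) * ph v <= 1" by blast
 have "aint (of_int N * f j)" if f: "f : Mf" for f j
 proof (cases "j < r")
 case False
 then show ?thesis using f by (simp add: Mf_def)
 next
 case j: True
 show ?thesis
 proof (rule algebraic_int_if_all_places)
 fix v :: "'a set" assume v: "v : FP"
 interpret nonarch v using v by (rule nonarch_place)
 note GIc = GI_carrier[OF v] and GGc = GG_carrier[OF v]
 have T1: "lv (T v k f) <= 1" if "k < r" for k using f[unfolded Mf_def, THEN CollectD, THEN conjunct2, rule_format, OF v that] unfolding local_int_iff by simp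
 have phi0: "ph v >= 0" unfolding ph_def by (auto intro!: add_nonneg_nonneg sum_nonneg)
 have "finsum LF (%k. GG v j k \<otimes>\<^bsub>LF\<^esub> T v k f) {..<r} = local_emb v (f j)"
 unfolding T_def by (rule LF.matrix_vector_cancel) (use j fin_inv(2)[OF v] GIc GGc in simp_all)
 moreover have "lv (finsum LF (%k. GG v j k \<otimes>\<^bsub>LF\<^esub> T v k f) {..<r}) <= ph v"
 proof (rule lv_finsum)
 fix k assume k: "k : {..<r}"
 have "lv (GG v j k) * lv (T v k f) <= ph v * 1"
 using bound[OF v j] T1 k phi0 lv_nonneg T_carrier[OF v] by (intro mult_mono) auto
 then show "lv (GG v j k \<otimes>\<^bsub>LF\<^esub> T v k f) <= ph v"
 using k j GGc T_carrier[OF v] by (simp add: lv_mult)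
 show "GG v j k \<otimes>\<^bsub>LF\<^esub> T v k f : carrier LF" using k j GGc T_carrier[OF v] by simp
 qed (use phi0 in simp_all)
 ultimately have "A (f j) <= ph v" by (simp add: lv_local_emb)
 then have "A (of_int N) * A (f j) <= A (of_int N) * ph v" by (intro mult_left_mono A_nonneg)
 then show "place_abs v (of_int N * f j) <= 1" using N(2) v by (force simp: A_mult)
 qed
 qed
 then show thesis using that N(1) by blast
qed

text \<open>Counterpart of \<open>Mf_integral_multiple\<close> with the inverse of \<open>g\<close>:
  the local coordinates of \<open>f\<close> are integral unless an entry of the inverse or of
  \<open>f\<close> is not, which happens at finitely many places. Together the two make
  \<open>Mf\<close> commensurable with the integral vectors.\<close>

lemma Mf_multiple_in:
 assumes f: "ALL i>=r. f i = 0"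
 obtains N :: int where "N ~= 0" "of_int N * f : Mf"
proof -
 define ph where "ph v = (if ALL i<r. T v i f : local_integers v then 1 else 1 + (SUM i<r. \<bar>nonarch.lv v (T v i f)\<bar>))" for v
 have "{v : finite_places. ph v > 1} <=
 (\<Union>i<r. \<Union>j<r. {v : finite_places. GI v i j ~: local_integers v}) Un (\<Union>j<r. {v : finite_places. place_abs v (f j) > 1})"
 proof
 fix v assume "v : {v : finite_places. ph v > 1}"
 then have v: "v : FP" and p: "ph v > 1" by simp_all
 interpret nonarch v using v by (rule nonarch_place)
 note GIc = GI_carrier[OF v]
 show "v : (\<Union>i<r. \<Union>j<r. {v : finite_places. GI v i j ~: local_integers v}) Un (\<Union>j<r. {v : finite_places. place_abs v (f j) > 1})"
 proof (rule ccontr)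
 assume n: "~ ?thesis"
 then have G1: "lv (GI v i j) <= 1" if "i < r" "j < r" for i j using v that GIc[OF that] by (simp add: local_int_iff)
 have f1: "A (f j) <= 1" if "j < r" for j using n v that by (simp add: not_less)
 have "T v i f : local_integers v" if i: "i < r" for i
 proof -
 have "lv (T v i f) <= 1" unfolding T_def
 proof (rule lv_finsum)
 fix j assume j: "j : {..<r}"
 have "lv (GI v i j) * A (f j) <= 1 * 1" using G1 f1 i j A_nonneg by (intro mult_mono) auto
 then show "lv (GI v i j \<otimes>\<^bsub>LF\<^esub> local_emb v (f j)) <= 1" using i j GIc by (simp add: lv_mult lv_local_emb)
 show "GI v i j \<otimes>\<^bsub>LF\<^esub> local_emb v (f j) : carrier LF" using i j GIc by simp
 qed simp_all
 then show ?thesis using T_carrier[OF v i] by (simp add: local_int_iff)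
 qed
 then show False using p by (simp add: ph_def)
 qed
 qed
 moreover have "finite ((\<Union>i<r. \<Union>j<r. {v : finite_places. GI v i j ~: local_integers v}) Un (\<Union>j<r. {v : finite_places. place_abs v (f j) > 1}))"
 proof -
 have "finite {v : finite_places. GI v i j ~: local_integers v}" if "i < r" "j < r" for i j
 using entries(2)[OF that] unfolding adele_carrier by simp
 moreover have "finite {v : finite_places. place_abs v (f j) > 1}" for j by (rule finite_place_abs_gt_1)
 ultimately show ?thesis by (intro finite_UnI finite_UN_I) auto
 qed
 ultimately have "finite {v : finite_places. ph v > 1}" by (rule finite_subset)
 from bounding_integer_exists[OF this] obtain N :: int where N: "N ~= 0"
 "ALL v:finite_places. place_abs v (of_int N :: 'a) * ph v <= 1" by blast
 have "T v i (%j. of_int N * f j) : local_integers v" if v: "v : FP" and i: "i < r" for v i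
 proof -
 interpret nonarch v using v by (rule nonarch_place)
 have "lv (T v i f) <= ph v"
 proof (cases "ALL i<r. T v i f : local_integers v")
 case True
 then show ?thesis using i by (simp add: ph_def local_int_iff)
 next
 case False
 have "\<bar>lv (T v i f)\<bar> <= (SUM i<r. \<bar>lv (T v i f)\<bar>)" using i by (intro member_le_sum) auto
 then have "lv (T v i f) <= 1 + (SUM i<r. \<bar>lv (T v i f)\<bar>)" by linarith
 with False show ?thesis unfolding ph_def by auto
 qed
 then have "A (of_int N) * lv (T v i f) <= A (of_int N) * ph v" by (intro mult_left_mono A_nonneg)
 also have "... <= 1" using N(2) v by blast
 finally show ?thesis unfolding T_mult[OF v i] using T_carrier[OF v i] by (simp add: local_int_iff lv_mult lv_local_emb)
 qed
 moreover have "of_int N * f = (%j. of_int N * f j)" by (simp add: fun_eq_iff)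
 ultimately have "of_int N * f : Mf" using f by (simp add: Mf_def)
 then show thesis using that N(1) by blast
qed

end

section \<open>Dimensions of sums and intersections\<close>

context vector_space begin

lemma dim_strict_mono:
 assumes U: "subspace U" and V: "V <= span T" "finite T" "U \<subset> V"
 shows "dim U < dim V"
proof -
 obtain B where B: "B <= U" "independent B" "U <= span B" by (rule maximal_independent_subset)
 obtain C where C: "B <= C" "C <= V" "independent C" "V <= span C"
 proof -
 have "B <= V" using B(1) V(3) by auto
 then show thesis using maximal_independent_subset_extend[of B V] B(2) that by blast
 qed
 have fC: "finite C" using independent_span_bound[OF V(2) C(3)] C(2) V(1) by auto
 have "B ~= C"
 proof
 assume "B = C"
 then have "V <= span B" using C(4) by simp
 moreover have "span B <= U" using B(1) U by (rule span_minimal)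
 ultimately show False using V(3) by auto
 qed
 then have "card B < card C" using C(1) fC by (intro psubset_card_mono) auto
 moreover have "card B = dim U" using basis_card_eq_dim[OF B(1,3,2)] .
 moreover have "card C = dim V" using basis_card_eq_dim[OF C(2,4,3)] .
 ultimately show ?thesis by simp
qed

lemma dim_sum_plus_dim_Int:
 assumes U: "subspace U" "U <= span T" and V: "subspace V" "V <= span T" and T: "finite T"
 shows "dim {x + y |x y. x : U & y : V} + dim (U Int V) = dim U + dim V"
proof -
 obtain B where B: "B <= U Int V" "independent B" "U Int V <= span B" by (rule maximal_independent_subset)
 obtain C where C: "B <= C" "C <= U" "independent C" "U <= span C"
 using maximal_independent_subset_extend[of B U] B by auto
 obtain D where D: "B <= D" "D <= V" "independent D" "V <= span D"
 using maximal_independent_subset_extend[of B V] B by auto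
 have fC: "finite C" using independent_span_bound[OF T C(3)] C(2) U(2) by auto
 have fD: "finite D" using independent_span_bound[OF T D(3)] D(2) V(2) by auto
 have fB: "finite B" using fC C(1) by (rule finite_subset[rotated])
 have disj: "C Int (D - B) = {}"
 proof (rule ccontr)
 assume "C Int (D - B) ~= {}"
 then obtain x where x: "x : C" "x : D" "x ~: B" by auto
 then have "x : span B" using B(3) C(2) D(2) by auto
 moreover have "B <= D - {x}" using D(1) x(3) by auto
 ultimately have "x : span (D - {x})" using span_mono by blast
 then show False using D(3) x(2) unfolding dependent_def by auto
 qed
 let ?E = "C Un (D - B)"
 have fE: "finite ?E" using fC fD by simp
 have ind: "independent ?E"
 proof
 assume "dependent ?E"
 then obtain u where u: "EX v:?E. u v ~= 0" "(SUM v:?E. u v *s v) = 0" unfolding dependent_finite[OF fE] by blast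
 let ?s = "SUM v:D - B. u v *s v"
 have s12: "(SUM v:C. u v *s v) + ?s = 0"
 using u(2) disj fC fD by (subst (asm) sum.union_disjoint) auto
 have "?s : V" using D(2) V(1) by (intro subspace_sum subspace_scale) auto
 moreover have "(SUM v:C. u v *s v) : U" using C(2) U(1) by (intro subspace_sum subspace_scale) auto
 then have "?s : U" using s12 U(1) subspace_neg[of U] by (metis add_eq_0_iff)
 ultimately have "?s : span B" using B(3) by auto
 then obtain w where w: "?s = (SUM v:B. w v *s v)" unfolding span_finite[OF fB] by auto
 define u' where "u' v = (if v : B then - w v else u v)" for v
 have "(SUM v:D. u' v *s v) = (SUM v:D - B. u' v *s v) + (SUM v:B. u' v *s v)"
 using fD D(1) by (intro sum.subset_diff) auto
 also have "(SUM v:D - B. u' v *s v) = ?s" by (intro sum.cong) (auto simp: u'_def)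
 also have "(SUM v:B. u' v *s v) = - (SUM v:B. w v *s v)"
 unfolding sum_negf[symmetric] by (intro sum.cong) (auto simp: u'_def)
 finally have z: "(SUM v:D. u' v *s v) = 0" using w by simp
 have "ALL v:D. u' v = 0"
 proof (rule ccontr)
 assume "~ ?thesis"
 then have "dependent D" unfolding dependent_finite[OF fD] using z by blast
 then show False using D(3) by simp
 qed
 then have uD: "u v = 0" if "v : D - B" for v using that unfolding u'_def by (metis DiffD1 DiffD2)
 then have "?s = 0" by (intro sum.neutral) simp
 then have "(SUM v:C. u v *s v) = 0" using s12 by simp
 then have "ALL v:C. u v = 0" using C(3) unfolding dependent_finite[OF fC] by blast
 then show False using u(1) uD by blast
 qed
 have "?E <= {x + y |x y. x : U & y : V}"
 proof
 fix x assume "x : ?E"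
 then have "(x : U & 0 : V) \<or> (0 : U & x : V)" using C(2) D(2) subspace_0[OF U(1)] subspace_0[OF V(1)] by auto
 then show "x : {x + y |x y. x : U & y : V}"
 by (elim disjE) (force intro: exI[of _ x] exI[of _ 0])+
 qed
 moreover have "{x + y |x y. x : U & y : V} <= span ?E"
 proof -
 have "U <= span ?E" using C(4) span_mono[of C ?E] by auto
 moreover have "D <= ?E" using C(1) by auto
 then have "V <= span ?E" using D(4) span_mono[of D ?E] by auto
 ultimately show ?thesis by (auto intro!: span_add)
 qed
 ultimately have "card ?E = dim {x + y |x y. x : U & y : V}" using ind by (rule basis_card_eq_dim)
 moreover have "card ?E = card C + (card D - card B)"
 using fC fD disj D(1) fB by (simp add: card_Un_disjoint card_Diff_subset)
 moreover have "card B <= card D" using D(1) fD by (rule card_mono[rotated])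
 moreover have "card C = dim U" using basis_card_eq_dim[OF C(2,4,3)] .
 moreover have "card D = dim V" using basis_card_eq_dim[OF D(2,4,3)] .
 moreover have "card B = dim (U Int V)" using basis_card_eq_dim[OF B(1,3,2)] .
 ultimately show ?thesis by simp
qed

end

section \<open>The lattice of subspaces\<close>

interpretation FV: vector_space "%c (f :: nat => 'a::field) i. c * f i"
 by unfold_locales (auto simp: fun_eq_iff algebra_simps)

definition subspaces :: "nat => 'a::field vec set set" where
 "subspaces r = {W. subspace class_ring W (module_vec TYPE('a) r)}"

lemma subspaces_iff: "W : subspaces r \<longleftrightarrow> W <= carrier_vec r & 0\<^sub>v r : W & (ALL x:W. ALL y:W. x + y : W) &
 (ALL c. ALL x:W. c \<cdot>\<^sub>v x : W)"
proof -
 interpret V: vec_space "TYPE('a)" r .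
 have v: "vectorspace class_ring (module_vec TYPE('a) r)" "module class_ring (module_vec TYPE('a) r)"
 using V.vectorspace_axioms V.module_axioms by auto
 show ?thesis unfolding subspaces_def subspace_def submodule_def mem_Collect_eq
 using v by (simp add: module_vec_simps) blast
qed

lemma subspacesD: assumes "W : subspaces r"
 shows "W <= carrier_vec r" "0\<^sub>v r : W" "!!x y. x : W ==> y : W ==> x + y : W" "!!c x. x : W ==> c \<cdot>\<^sub>v x : W"
 "!!x. x : W ==> x : carrier_vec r"
 using assms unfolding subspaces_iff by auto

lemma vf_vec: "(!!i. i >= r ==> f i = 0) ==> vf r (vec r f) = f"
 by (auto simp: vf_def fun_eq_iff not_less)

lemma vec_vf: "x : carrier_vec r ==> vec r (vf r x) = x"
 by (auto simp: vf_def)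

lemma vf_inj: "inj_on (vf r) (carrier_vec r)"
 by (rule inj_on_inverseI[of _ "vec r"]) (rule vec_vf)

lemma vf_supp: "i >= r ==> vf r x i = 0" by (simp add: vf_def)

lemma vf_add: "(x :: 'a::field vec) : carrier_vec r ==> y : carrier_vec r ==> vf r (x + y) = vf r x + vf r y"
 and vf_smult: "(x :: 'a::field vec) : carrier_vec r ==> vf r (c \<cdot>\<^sub>v x) = (%i. c * vf r x i)"
 and vf_zero: "vf r (0\<^sub>v r) = 0"
 by (auto simp: vf_def fun_eq_iff)

lemma vf_subspace: assumes "W : subspaces r" shows "FV.subspace (vf r ` W)"
proof (rule FV.subspaceI)
 note W = subspacesD[OF assms]
 show "0 : vf r ` W" using W(2) vf_zero by (metis imageI)
 show "x + y : vf r ` W" if xy: "x : vf r ` W" "y : vf r ` W" for x y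
 proof -
 obtain a b where ab: "a : W" "x = vf r a" "b : W" "y = vf r b" using xy by auto
 then have "x + y = vf r (a + b)" using vf_add[OF W(5)[OF ab(1)] W(5)[OF ab(3)]] by simp
 then show ?thesis using W(3)[OF ab(1,3)] by simp
 qed
 show "(%i. c * x i) : vf r ` W" if x: "x : vf r ` W" for c x
 proof -
 obtain a where a: "a : W" "x = vf r a" using x by auto
 then have "(%i. c * x i) = vf r (c \<cdot>\<^sub>v a)" using vf_smult[OF W(5)[OF a(1)], of c] by simp
 then show ?thesis using W(4)[OF a(1)] by simp
 qed
qed

definition unit_funs :: "nat => (nat => 'a::field) set" where
 "unit_funs r = (%j i. if i = j then 1 else 0) ` {..<r}"

lemma fin_unit_funs: "finite (unit_funs r)" by (simp add: unit_funs_def)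

lemma supp_in_span: assumes "!!i. i >= r ==> f i = 0" shows "f : FV.span (unit_funs r)"
proof -
 have "f = (SUM j<r. (%i. f j * (if i = j then 1 else 0)))"
 using assms by (auto simp: fun_eq_iff sum_fun_apply if_distrib not_less cong: if_cong)
 also have "... : FV.span (unit_funs r)"
 by (intro FV.span_sum FV.span_scale FV.span_base) (simp add: unit_funs_def)
 finally show ?thesis .
qed

lemma vf_in_span: "vf r ` W <= FV.span (unit_funs r)"
 using supp_in_span vf_supp by blast

lemma vf_span:
 assumes W: "W : subspaces r" and A: "A <= W"
 shows "vf r ` LinearCombinations.module.span class_ring ((module_vec TYPE('a::field) r)\<lparr>carrier := W\<rparr>) A = FV.span (vf r ` A)"
 and "LinearCombinations.module.span class_ring ((module_vec TYPE('a) r)\<lparr>carrier := W\<rparr>) A <= W"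
proof -
 interpret V: vec_space "TYPE('a)" r .
 have s: "subspace class_ring W (module_vec TYPE('a) r)" using W by (simp add: subspaces_def)
 have "vectorspace class_ring ((module_vec TYPE('a) r)\<lparr>carrier := W\<rparr>)" by (rule V.subspace_is_vs[OF s])
 then interpret N: vectorspace class_ring "(module_vec TYPE('a) r)\<lparr>carrier := W\<rparr>" .
 note Wc = subspacesD(5)[OF W]
 have lc: "N.lincomb a B : W & vf r (N.lincomb a B) = (SUM x:B. (%i. a x * vf r x i))"
 if "finite B" "B <= W" for a B
 using that
 proof (induction B rule: finite_induct)
 case empty
 then show ?case using subspacesD(2)[OF W] by (simp add: N.lincomb_def module_vec_simps vf_zero)
 next
 case (insert x B)
 have "N.lincomb a (insert x B) = a x \<cdot>\<^sub>v x + N.lincomb a B"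
 unfolding N.lincomb_def using insert.hyps insert.prems subspacesD(4)[OF W]
 by (subst N.finsum_insert) (auto simp: module_vec_simps)
 moreover have "a x \<cdot>\<^sub>v x : W" using insert.prems subspacesD(4)[OF W] by auto
 moreover have "x : carrier_vec r" using insert.prems Wc by auto
 ultimately show ?case using insert Wc subspacesD(3)[OF W] by (simp add: vf_add vf_smult)
 qed
 show "N.span A <= W"
 proof
 fix x assume "x : N.span A"
 then obtain a B where "x = N.lincomb a B" "finite B" "B <= A" unfolding N.span_def by auto
 then show "x : W" using lc[of B a] A by auto
 qed
 show "vf r ` N.span A = FV.span (vf r ` A)"
 proof
 show "vf r ` N.span A <= FV.span (vf r ` A)"
 proof (rule image_subsetI)
 fix x assume "x : N.span A"
 then obtain a B where x: "x = N.lincomb a B" "finite B" "B <= A" unfolding N.span_def by auto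
 have "vf r x = (SUM x:B. (%i. a x * vf r x i))" using lc[of B a] A x by auto
 also have "... : FV.span (vf r ` A)" using x(3) by (intro FV.span_sum FV.span_scale FV.span_base) auto
 finally show "vf r x : FV.span (vf r ` A)" .
 qed
 show "FV.span (vf r ` A) <= vf r ` N.span A"
 proof
 fix f assume "f : FV.span (vf r ` A)"
 then obtain t u where t: "finite t" "t <= vf r ` A" "f = (SUM a:t. (%i. u a * a i))"
 unfolding FV.span_explicit by auto
 from finite_subset_image[OF t(1,2)] obtain B where B: "B <= A" "finite B" "t = vf r ` B" by blast
 have inj: "inj_on (vf r) B" using vf_inj by (rule inj_on_subset) (use B A Wc in auto)
 have "f = (SUM x:B. (%i. u (vf r x) * vf r x i))" unfolding t(3) B(3) by (simp add: sum.reindex[OF inj])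
 also have "... = vf r (N.lincomb (%x. u (vf r x)) B)" using lc[of B "%x. u (vf r x)"] B A by auto
 finally have f: "f = vf r (N.lincomb (%x. u (vf r x)) B)" .
 have "N.lincomb (%x. u (vf r x)) B : N.span A" unfolding N.span_def using B by auto
 then show "f : vf r ` N.span A" using f by auto
 qed
 qed
qed

text \<open>Dimensions of modules given as records are moved to the vector space of functions, where
  the exchange arguments are carried out. \<open>vf\<close> matches generating sets on both sides
  and is injective on vectors of length \<open>r\<close>.\<close>

lemma dim_eq_FV: assumes W: "W : subspaces r" shows "subspace_dim r W = FV.dim (vf r ` (W :: 'a::field vec set))"
proof -
 interpret V: vec_space "TYPE('a)" r .
 have s: "subspace class_ring W (module_vec TYPE('a) r)" using W by (simp add: subspaces_def)
 have "vectorspace class_ring ((module_vec TYPE('a) r)\<lparr>carrier := W\<rparr>)" by (rule V.subspace_is_vs[OF s])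
 then interpret N: vectorspace class_ring "(module_vec TYPE('a) r)\<lparr>carrier := W\<rparr>" .
 note Wc = subspacesD(5)[OF W]
 show ?thesis unfolding subspace_dim_def N.dim_def
 proof (rule Least_equality)
 obtain B where B: "B <= vf r ` W" "FV.independent B" "vf r ` W <= FV.span B" "card B = FV.dim (vf r ` W)"
 by (rule FV.basis_exists)
 have fB: "finite B" using FV.independent_span_bound[OF fin_unit_funs B(2), of r] B(1) vf_in_span[of r W] by auto
 from finite_subset_image[OF fB B(1)] obtain A where A: "A <= W" "finite A" "B = vf r ` A" by blast
 have inj: "inj_on (vf r) A" using vf_inj by (rule inj_on_subset) (use A Wc in auto)
 have cA: "card A = FV.dim (vf r ` W)" using B(4) A(3) card_image[OF inj] by simp
 have "FV.span B <= vf r ` W" using B(1) vf_subspace[OF W] by (rule FV.span_minimal)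
 then have "vf r ` N.span A = vf r ` W" using vf_span(1)[OF W A(1)] A(3) B(3) by auto
 then have "N.span A = W"
 by (rule inj_on_image_eq_iff[OF vf_inj, THEN iffD1, rotated 2])
 (use vf_span(2)[OF W A(1)] Wc in auto)
 then show "EX A. finite A & card A = FV.dim (vf r ` W) &
 A <= carrier ((module_vec TYPE('a) r)\<lparr>carrier := W\<rparr>) & N.gen_set A"
 using A cA by (intro exI[of _ A]) simp
 next
 fix n assume "EX A. finite A & card A = n &
 A <= carrier ((module_vec TYPE('a) r)\<lparr>carrier := W\<rparr>) & N.gen_set A"
 then obtain A where A: "finite A" "card A = n" "A <= W" "N.span A = W" by auto
 have "vf r ` W = FV.span (vf r ` A)" using vf_span(1)[OF W A(3)] A(4) by simp
 then have "FV.dim (vf r ` W) <= card (vf r ` A)" using A(1) by (intro FV.dim_le_card) auto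
 also have "... <= n" using A(1,2) card_image_le by auto
 finally show "FV.dim (vf r ` W) <= n" .
 qed
qed

definition subspace_join :: "'a::field vec set => 'a vec set => 'a vec set" where
 "subspace_join A B = {a + b |a b. a : A & b : B}"

lemma vf_join: assumes "A : subspaces r" "B : subspaces r"
 shows "vf r ` subspace_join A B = {x + y |x y. x : vf r ` A & y : vf r ` B}"
proof -
 have "vf r (a + b) = vf r a + vf r b" if "a : A" "b : B" for a b
 using vf_add subspacesD(5)[OF assms(1) that(1)] subspacesD(5)[OF assms(2) that(2)] by blast
 then show ?thesis unfolding subspace_join_def by (auto simp: image_iff) metis+
qed

lemma subspaces_lattice:
 assumes A: "A : subspaces r" and B: "B : subspaces r"
 shows "A Int B : subspaces r" "subspace_join A B : subspaces r" "A <= subspace_join A B" "B <= subspace_join A B"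
 "subspace_dim r (subspace_join A B) + subspace_dim r (A Int B) = subspace_dim r A + subspace_dim r (B :: 'a::field vec set)"
 "A \<subset> B ==> subspace_dim r A < subspace_dim r B"
proof -
 note a = subspacesD[OF A] and b = subspacesD[OF B]
 show i: "A Int B : subspaces r" using a b unfolding subspaces_iff by auto
 show j: "subspace_join A B : subspaces r" unfolding subspaces_iff
 proof (intro conjI ballI allI)
 show "subspace_join A B <= carrier_vec r" unfolding subspace_join_def using a(5) b(5) by auto
 have "0\<^sub>v r = 0\<^sub>v r + (0\<^sub>v r :: 'a vec)" by simp
 then show "0\<^sub>v r : subspace_join A B" unfolding subspace_join_def using a(2) b(2) by blast
 fix x assume "x : subspace_join A B"
 then obtain x1 x2 where x: "x = x1 + x2" "x1 : A" "x2 : B" unfolding subspace_join_def by auto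
 note xc = a(5)[OF x(2)] b(5)[OF x(3)]
 { fix y assume "y : subspace_join A B"
 then obtain y1 y2 where y: "y = y1 + y2" "y1 : A" "y2 : B" unfolding subspace_join_def by auto
 note yc = a(5)[OF y(2)] b(5)[OF y(3)]
 have "x + y = (x1 + y1) + (x2 + y2)" unfolding x(1) y(1) using xc yc by (intro eq_vecI) auto
 then show "x + y : subspace_join A B" unfolding subspace_join_def using a(3)[OF x(2) y(2)] b(3)[OF x(3) y(3)] by blast }
 fix c
 have "c \<cdot>\<^sub>v x = c \<cdot>\<^sub>v x1 + c \<cdot>\<^sub>v x2" unfolding x(1) using xc by (rule smult_add_distrib_vec)
 then show "c \<cdot>\<^sub>v x : subspace_join A B" unfolding subspace_join_def using a(4)[OF x(2)] b(4)[OF x(3)] by blast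
 qed
 show "A <= subspace_join A B"
 proof
 fix x assume x: "x : A"
 have "x = x + 0\<^sub>v r" using a(5)[OF x] by simp
 then show "x : subspace_join A B" unfolding subspace_join_def using x b(2) by blast
 qed
 show "B <= subspace_join A B"
 proof
 fix x assume x: "x : B"
 have "x = 0\<^sub>v r + x" using b(5)[OF x] by simp
 then show "x : subspace_join A B" unfolding subspace_join_def using x a(2) by blast
 qed
 have int: "vf r ` (A Int B) = vf r ` A Int vf r ` B" using vf_inj a(1) b(1) by (rule inj_on_image_Int)
 show "subspace_dim r (subspace_join A B) + subspace_dim r (A Int B) = subspace_dim r A + subspace_dim r B"
 unfolding dim_eq_FV[OF i] dim_eq_FV[OF j] dim_eq_FV[OF A] dim_eq_FV[OF B] vf_join[OF A B] int
 by (rule FV.dim_sum_plus_dim_Int[OF vf_subspace[OF A] vf_in_span vf_subspace[OF B] vf_in_span fin_unit_funs])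
 assume AB: "A \<subset> B"
 have "vf r ` A \<subset> vf r ` B"
 using AB inj_on_image_eq_iff[OF vf_inj a(1) b(1)] image_mono[of A B "vf r"] by blast
 then show "subspace_dim r A < subspace_dim r B"
 unfolding dim_eq_FV[OF A] dim_eq_FV[OF B]
 by (rule FV.dim_strict_mono[OF vf_subspace[OF A] vf_in_span fin_unit_funs])
qed

lemma unit_funs_independent: "FV.independent (unit_funs r :: (nat => 'a::field) set)"
proof
 assume "FV.dependent (unit_funs r :: (nat => 'a) set)"
 then obtain u v where u: "v : unit_funs r" "u v ~= 0" "(SUM v:unit_funs r. (%i. u v * v i)) = (0 :: nat => 'a)"
 unfolding FV.dependent_finite[OF fin_unit_funs] by blast
 obtain j where j: "j < r" "v = (%i. if i = j then 1 else 0)" using u(1) by (auto simp: unit_funs_def)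
 have "(SUM v:unit_funs r. u v * v j) = 0" using fun_cong[OF u(3), of j] by (simp add: sum_fun_apply)
 moreover have "(SUM w:unit_funs r. u w * w j) = u v * v j + (SUM w:unit_funs r - {v}. u w * w j)"
 by (rule sum.remove[OF fin_unit_funs u(1)])
 moreover have "(SUM w:unit_funs r - {v}. u w * w j) = 0"
 proof (rule sum.neutral, rule ballI)
 fix w assume "w : unit_funs r - {v}"
 then obtain k where "w = (%i. if i = k then 1 else 0)" "w ~= v" by (auto simp: unit_funs_def)
 then show "u w * w j = 0" using j(2) by (cases "k = j") auto
 qed
 ultimately show False using u(2) j(2) by simp
 qed

lemma unit_funs_card: "card (unit_funs r :: (nat => 'a::field) set) = r"
proof -
 have "inj_on (%j i. if i = j then 1 else (0 :: 'a)) {..<r}"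
 by (rule inj_onI) (metis zero_neq_one)
 then show ?thesis unfolding unit_funs_def by (simp add: card_image)
qed

lemma subspaces_ends:
 "{0\<^sub>v r} : subspaces r" "carrier_vec r : subspaces r" "subspace_dim r {0\<^sub>v r :: 'a::field vec} = 0"
 "subspace_dim r (carrier_vec r :: 'a vec set) = r"
proof -
 show z: "{0\<^sub>v r} : subspaces r" and c: "carrier_vec r : subspaces r" by (auto simp: subspaces_iff)
 show "subspace_dim r {0\<^sub>v r :: 'a::field vec} = 0"
 unfolding dim_eq_FV[OF z] using FV.dim_le_card[of "{0}" "{}"] by (simp add: vf_zero)
 have sub: "unit_funs r <= vf r ` (carrier_vec r :: 'a vec set)"
 proof
 fix f :: "nat => 'a" assume "f : unit_funs r"
 then have "f = vf r (vec r f)" by (intro vf_vec[symmetric]) (auto simp: unit_funs_def)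
 then show "f : vf r ` carrier_vec r" by (metis imageI vec_carrier)
 qed
 show "subspace_dim r (carrier_vec r :: 'a vec set) = r"
 unfolding dim_eq_FV[OF c] using FV.basis_card_eq_dim[OF sub vf_in_span unit_funs_independent] unit_funs_card by metis
qed

section \<open>Invertible matrices and Archimedean places\<close>

abbreviation GLinv :: "nat => 'b::field mat => 'b mat" where
 "GLinv r A \<equiv> inv\<^bsub>GL_field r\<^esub> A"

lemma inv_GL_field:
 assumes "x : carrier_mat r r" "y : carrier_mat r r" "x * y = 1\<^sub>m r" "y * x = 1\<^sub>m r"
 shows "GLinv r x = (y :: 'b::field mat)" "x : carrier (GL_field r)"
proof -
 interpret R: ring "ring_mat TYPE('b) r ()" by (rule ring_mat)
 have u: "x : Units (ring_mat TYPE('b) r ())" unfolding Units_def using assms by (auto simp: ring_mat_simps)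
 then show "x : carrier (GL_field r)" by (simp add: GL_field_def units_of_carrier)
 have "GLinv r x = inv\<^bsub>ring_mat TYPE('b) r ()\<^esub> x" unfolding GL_field_def by (rule R.units_of_inv[OF u])
 also have "... = y" by (rule R.inv_unique'[symmetric]) (use assms in "auto simp: ring_mat_simps")
 finally show "GLinv r x = y" .
qed

lemma mat_mult_index:
 assumes "A : carrier_mat r r" "B : carrier_mat r r" "i < r" "k < r"
 shows "(A * B) $$ (i, k) = (SUM j<r. A $$ (i, j) * B $$ (j, k))"
 using assms by (simp add: scalar_prod_def lessThan_atLeast0)

lemma sum_swap_pairs: "(SUM i:I. SUM j:J. SUM w:W. SUM m:N. F i j w m) = (SUM w:W. SUM m:N. SUM i:I. SUM j:J. F i j w m)"
proof -
 have "(SUM i:I. SUM j:J. SUM w:W. SUM m:N. F i j w m) = (SUM i:I. SUM w:W. SUM j:J. SUM m:N. F i j w m)"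
 by (rule sum.cong[OF refl]) (rule sum.swap)
 also have "... = (SUM w:W. SUM i:I. SUM j:J. SUM m:N. F i j w m)" by (rule sum.swap)
 also have "... = (SUM w:W. SUM i:I. SUM m:N. SUM j:J. F i j w m)"
 by (rule sum.cong[OF refl], rule sum.cong[OF refl], rule sum.swap)
 also have "... = (SUM w:W. SUM m:N. SUM i:I. SUM j:J. F i j w m)"
 by (rule sum.cong[OF refl]) (rule sum.swap)
 finally show ?thesis .
qed

lemma embeddings_cnj: "sg : embeddings ==> cnj \<circ> sg : embeddings"
proof -
 assume "sg : embeddings"
 then interpret field_hom sg by (simp add: embeddings_def)
 have "field_hom (cnj \<circ> sg)" by unfold_locales (simp_all add: hom_add hom_mult)
 then show ?thesis by (simp add: embeddings_def)
qed

lemma arch_emb: assumes "w : arch_places" shows "arch_emb w : w" "arch_emb w : embeddings"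
proof -
 obtain sg where s: "sg : embeddings" "w = {sg, cnj \<circ> sg}" using assms unfolding arch_places_def by blast
 have "EX ta. ta : w" using s(2) by blast
 then show "arch_emb w : w" unfolding arch_emb_def by (rule someI_ex)
 then show "arch_emb w : embeddings" using s embeddings_cnj[OF s(1)] by auto
qed

lemma arch_emb_hom: assumes "w : arch_places"
 shows "arch_emb w (x + y) = arch_emb w x + arch_emb w y" "arch_emb w (x * y) = arch_emb w x * arch_emb w y"
 "arch_emb w 0 = 0" "arch_emb w 1 = 1"
 "arch_emb w (sum f I) = (SUM i:I. arch_emb w (f i))"
proof -
 interpret field_hom "arch_emb w" using arch_emb(2)[OF assms] by (simp add: embeddings_def)
 show "arch_emb w (x + y) = arch_emb w x + arch_emb w y" "arch_emb w (x * y) = arch_emb w x * arch_emb w y"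
 "arch_emb w 0 = 0" "arch_emb w 1 = 1" by (simp_all add: hom_add hom_mult)
 show "arch_emb w (sum f I) = (SUM i:I. arch_emb w (f i))"
 by (induction I rule: infinite_finite_induct) (simp_all add: hom_add)
qed

lemma finite_arch_places: "finite (arch_places :: ('a::number_field => complex) set set)"
proof -
 have eq: "arch_places = (%sg. {sg, cnj \<circ> sg}) ` (embeddings :: ('a => complex) set)" unfolding arch_places_def by auto
 show ?thesis unfolding eq by (rule finite_imageI[OF finite_embeddings])
qed

section \<open>Integral bases of modules of vectors\<close>

lemma add_pow_vec:
 fixes x :: "'a::field vec" assumes x: "x : carrier_vec r"
 shows "add_pow (module_vec TYPE('a) r) (k :: int) x = of_int k \<cdot>\<^sub>v x"
proof -
 interpret V: vec_space "TYPE('a)" r .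
 have n: "add_pow (module_vec TYPE('a) r) (n :: nat) x = of_nat n \<cdot>\<^sub>v x" for n
 proof (induction n)
 case 0
 then show ?case using x by (simp add: add_pow_def module_vec_simps)
 next
 case (Suc n)
 then show ?case using x by (simp add: add_pow_def module_vec_simps algebra_simps) (intro eq_vecI, auto simp: algebra_simps)
 qed
 show ?thesis
 proof (cases "k >= 0")
 case True
 then obtain m where k: "k = int m" by (metis zero_le_imp_eq_int)
 show ?thesis unfolding k add_pow_def int_pow_int using n[of m, unfolded add_pow_def] by (simp only: of_int_of_nat_eq)
 next
 case False
 have c: "- of_int k \<cdot>\<^sub>v x : carrier_vec r" "of_int k \<cdot>\<^sub>v x : carrier_vec r"
 using x by simp_all
 have z: "of_int k \<cdot>\<^sub>v x + (- of_int k \<cdot>\<^sub>v x) = 0\<^sub>v r"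
 using x by (intro eq_vecI) auto
 define m where "m = nat (- k)"
 have m: "of_nat m = (- of_int k :: 'a)" "k < 0" using False by (simp_all add: m_def)
 have "pow (add_monoid (module_vec TYPE('a) r)) x k = inv\<^bsub>add_monoid (module_vec TYPE('a) r)\<^esub> (pow (add_monoid (module_vec TYPE('a) r)) x m)"
 unfolding m_def int_pow_def2 using m(2) by (simp only: if_True)
 then have "add_pow (module_vec TYPE('a) r) k x = \<ominus>\<^bsub>module_vec TYPE('a) r\<^esub> (- of_int k \<cdot>\<^sub>v x)"
 using n[of m] unfolding add_pow_def a_inv_def m(1) by (simp only:)
 also have "... = of_int k \<cdot>\<^sub>v x" by (rule V.minus_equality[OF z c(1) c(2)])
 finally show ?thesis .
 qed
qed

text \<open>Transfers the bases quantified over in \<open>covolume\<close> to functions. As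
  \<open>int_basis\<close> ranges over arbitrary lists, membership of the entries in
  \<open>carrier_vec r\<close> has to be extracted from bijectivity.\<close>

lemma int_basis_iff:
 fixes L :: "'a::number_field vec set"
 assumes L: "L <= carrier_vec r"
 shows "int_basis (module_vec TYPE('a) r) L bs \<longleftrightarrow>
 set bs <= carrier_vec r & zspan (map (vf r) bs) = vf r ` L & zindep (map (vf r) bs)"
proof -
 interpret V: vec_space "TYPE('a)" r .
 let ?V = "module_vec TYPE('a) r" and ?n = "length bs"
 let ?F = "%c :: nat => int. finsum ?V (%i. add_pow ?V (c i) (bs ! i)) {..<?n}"
 let ?P = "{..<?n} \<rightarrow>\<^sub>E (UNIV :: int set)"
 have main: "bij_betw ?F ?P L \<longleftrightarrow> zspan (map (vf r) bs) = vf r ` L & zindep (map (vf r) bs)"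
 if bs: "set bs <= carrier_vec r"
 proof -
 have bc: "bs ! i : carrier_vec r" if "i < ?n" for i using bs that by auto
 have cl: "?F c : carrier_vec r" for c
 using V.finsum_closed[of "%i. add_pow ?V (c i) (bs ! i)" "{..<?n}"] bc by (simp add: add_pow_vec module_vec_simps Pi_iff)
 have "vf r (finsum ?V (%i. add_pow ?V (c i) (bs ! i)) {..<k}) = (SUM i<k. (of_int (c i) :: nat => 'a) * vf r (bs ! i)) &
 finsum ?V (%i. add_pow ?V (c i) (bs ! i)) {..<k} : carrier_vec r" if "k <= ?n" for c :: "nat => int" and k
 using that
 proof (induction k)
 case 0
 then show ?case by (simp add: module_vec_simps vf_zero)
 next
 case (Suc k)
 have f: "(%i. add_pow ?V (c i) (bs ! i)) : {..<k} \<rightarrow> carrier ?V" "add_pow ?V (c k) (bs ! k) : carrier ?V"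
 using Suc.prems bc by (auto simp: add_pow_vec module_vec_simps)
 have e: "finsum ?V (%i. add_pow ?V (c i) (bs ! i)) {..<Suc k} =
 of_int (c k) \<cdot>\<^sub>v bs ! k + finsum ?V (%i. add_pow ?V (c i) (bs ! i)) {..<k}"
 unfolding lessThan_Suc using V.finsum_insert[of "{..<k}" k "%i. add_pow ?V (c i) (bs ! i)"] f Suc.prems bc[of k]
 by (simp add: add_pow_vec module_vec_simps)
 have kn: "k <= ?n" using Suc.prems by simp
 note ih = Suc.IH[OF kn, THEN conjunct1] Suc.IH[OF kn, THEN conjunct2]
 have bk: "bs ! k : carrier_vec r" using Suc.prems bc[of k] by simp
 then have sc: "of_int (c k) \<cdot>\<^sub>v bs ! k : carrier_vec r" by simp
 have "vf r (of_int (c k) \<cdot>\<^sub>v bs ! k) = (of_int (c k) :: nat => 'a) * vf r (bs ! k)"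
 unfolding vf_smult[OF bk] by (rule ext) simp
 then show ?case unfolding e vf_add[OF sc ih(2)] ih(1) sum.lessThan_Suc
 using sc ih(2) by (simp only: add.commute add_carrier_vec simp_thms)
 qed
 from this[of ?n] have vF: "vf r (?F c) = zcomb c (map (vf r) bs)" for c by (simp add: zcomb_def)
 have span: "vf r ` ?F ` ?P = zspan (map (vf r) bs)"
 proof -
 have "zcomb c (map (vf r) bs) : vf r ` ?F ` ?P" for c
 proof -
 have 1: "zcomb c (map (vf r) bs) = vf r (?F (restrict c {..<?n}))"
 unfolding vF by (rule zcomb_cong) simp
 have 2: "restrict c {..<?n} : ?P" for c :: "nat => int" by simp
 show ?thesis unfolding 1 by (rule imageI[OF imageI[OF 2]])
 qed
 then have "zspan (map (vf r) bs) <= vf r ` ?F ` ?P" unfolding zspan_def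
 by (intro image_subsetI)
 moreover have "vf r ` ?F ` ?P <= zspan (map (vf r) bs)"
 proof
 fix x assume "x : vf r ` ?F ` ?P"
 then obtain c where "x = vf r (?F c)" by blast
 then show "x : zspan (map (vf r) bs)" unfolding vF by (simp only: zcomb_in_zspan)
 qed
 ultimately show ?thesis by (intro equalityI)
 qed
 have "?F ` ?P = L \<longleftrightarrow> vf r ` ?F ` ?P = vf r ` L"
 proof -
 have "?F ` ?P <= carrier_vec r" by (rule image_subsetI) (rule cl)
 from inj_on_image_eq_iff[OF vf_inj this L] show ?thesis by (rule sym)
 qed
 moreover have "inj_on ?F ?P \<longleftrightarrow> zindep (map (vf r) bs)"
 proof
 assume inj: "inj_on ?F ?P"
 show "zindep (map (vf r) bs)" unfolding zindep_def
 proof (intro allI impI)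
 fix c i assume c: "zcomb c (map (vf r) bs) = 0" and i: "i < length (map (vf r) bs)"
 have "vf r (?F (restrict c {..<?n})) = vf r (?F (restrict (%_. 0) {..<?n}))"
 proof -
 have 1: "zcomb (restrict c {..<?n}) (map (vf r) bs) = zcomb c (map (vf r) bs)" by (rule zcomb_cong) simp
 have 2: "zcomb (restrict (%_. 0) {..<?n}) (map (vf r) bs) = zcomb (%_. 0) (map (vf r) bs)" by (rule zcomb_cong) simp
 show ?thesis unfolding vF 1 2 c zcomb_zero ..
 qed
 then have "?F (restrict c {..<?n}) = ?F (restrict (%_. 0) {..<?n})" by (rule inj_onD[OF vf_inj _ cl cl])
 then have "restrict c {..<?n} = restrict (%_. 0) {..<?n}"
 proof (rule inj_onD[OF inj])
 show "restrict c {..<?n} : ?P" "restrict (%_. 0) {..<?n} : ?P" unfolding restrict_PiE_iff by simp_all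
 qed
 from fun_cong[OF this, of i] show "c i = 0" using i by simp
 qed
 next
 assume z: "zindep (map (vf r) bs)"
 show "inj_on ?F ?P"
 proof (rule inj_onI)
 fix c d assume cd: "c : ?P" "d : ?P" "?F c = ?F d"
 from arg_cong[OF cd(3), of "vf r", unfolded vF] have "zcomb c (map (vf r) bs) = zcomb d (map (vf r) bs)" .
 then have "c i = d i" if "i < ?n" for i using zindep_unique[OF z] that by simp
 then show "c = d" using cd(1,2) by (intro PiE_ext[of c _ _ d]) auto
 qed
 qed
 ultimately show ?thesis unfolding bij_betw_def span by blast
 qed
 have "set bs <= carrier_vec r" if b: "bij_betw ?F ?P L"
 proof (rule ccontr)
 assume "~ set bs <= carrier_vec r"
 then obtain x where x: "x : set bs" "x ~: carrier_vec r" by blast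
 from x(1) obtain i where "i < ?n" "bs ! i = x" unfolding in_set_conv_nth by blast
 then have i: "i < ?n" "bs ! i ~: carrier_vec r" using x(2) by simp_all
 let ?x = "bs ! i"
 have d: "dim_vec ?x ~= r" using i(2) carrier_vecI[of ?x r] by fast
 \<comment> \<open>A vector of the wrong dimension has no additive inverse, so all its negative multiples are the same junk value.\<close>
 have np: "dim_vec (add_pow ?V (Suc n) ?x) = dim_vec ?x" for n :: nat
 by (simp add: add_pow_def module_vec_simps)
 have inv: "inv\<^bsub>add_monoid ?V\<^esub> y = (THE z. False)" if y: "dim_vec y ~= r" for y
 proof -
 have "(%z. z : carrier (add_monoid ?V) & y \<otimes>\<^bsub>add_monoid ?V\<^esub> z = \<one>\<^bsub>add_monoid ?V\<^esub> &
 z \<otimes>\<^bsub>add_monoid ?V\<^esub> y = \<one>\<^bsub>add_monoid ?V\<^esub>) = (%z. False)"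
 proof
 fix z show "(z : carrier (add_monoid ?V) & y \<otimes>\<^bsub>add_monoid ?V\<^esub> z = \<one>\<^bsub>add_monoid ?V\<^esub> &
 z \<otimes>\<^bsub>add_monoid ?V\<^esub> y = \<one>\<^bsub>add_monoid ?V\<^esub>) = False"
 proof -
 have "z + y ~= 0\<^sub>v r"
 proof
 assume "z + y = 0\<^sub>v r"
 from arg_cong[OF this, of dim_vec] show False using y by simp
 qed
 then show ?thesis by (simp add: module_vec_simps)
 qed
 qed
 then show ?thesis unfolding m_inv_def by simp
 qed
 have "add_pow ?V (-1 :: int) ?x = add_pow ?V (-2 :: int) ?x"
 using inv[of "add_pow ?V (Suc 0) ?x"] inv[of "add_pow ?V (Suc (Suc 0)) ?x"] np[of 0] np[of 1] d
 by (simp add: add_pow_def int_pow_def2 numeral_2_eq_2)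
 then have "(%j. add_pow ?V (((\<lambda>_\<in>{..<?n}. 0)(i := -1)) j :: int) (bs ! j)) = (%j. add_pow ?V (((\<lambda>_\<in>{..<?n}. 0)(i := -2)) j :: int) (bs ! j))"
 by auto
 then have "?F ((\<lambda>_\<in>{..<?n}. 0)(i := -1)) = ?F ((\<lambda>_\<in>{..<?n}. 0)(i := -2))" by (rule arg_cong)
 moreover have "(\<lambda>_\<in>{..<?n}. 0)(i := -1) : ?P" "(\<lambda>_\<in>{..<?n}. 0)(i := -2) : ?P" using i(1) by (auto simp: PiE_iff extensional_def)
 ultimately have "(\<lambda>_\<in>{..<?n}. 0 :: int)(i := -1) = (\<lambda>_\<in>{..<?n}. 0)(i := -2)"
 using b[unfolded bij_betw_def, THEN conjunct1] by (rule inj_onD[rotated])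
 from fun_cong[OF this, of i] show False by simp
 qed
 then show ?thesis unfolding int_basis_def using main by blast
qed

section \<open>The Euclidean form of an adelic matrix\<close>

context adelic_matrix begin

text \<open>Coordinates at \<open>w\<close> of the inverse of \<open>g\<close> applied to
  \<open>f\<close>, in which the metric at \<open>w\<close> is the standard one.\<close>

definition L :: "('a => complex) set => nat => (nat => 'a) => complex" where
 "L w i f = (SUM j<r. snd (gi $$ (i, j)) w * arch_emb w (f j))"

definition e :: "(nat => 'a) => (nat => 'a) => real" where
 "e f f' = euclid_ip (adelic_metric r g) (vec r f) (vec r f')"

lemma arch_comp_mult:
 assumes w: "w : arch_places"
 shows "arch_comp g w * arch_comp gi w = 1\<^sub>m r" "arch_comp gi w * arch_comp g w = 1\<^sub>m r"
 "arch_comp g w : carrier_mat r r" "arch_comp gi w : carrier_mat r r"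
proof -
 show c: "arch_comp g w : carrier_mat r r" "arch_comp gi w : carrier_mat r r"
 unfolding arch_comp_def by (rule carrier_matI; use dims in simp)+
 have i1: "(arch_comp g w * arch_comp gi w) $$ (i, k) = (SUM j<r. snd (g $$ (i, j)) w * snd (gi $$ (j, k)) w)"
 and i2: "(arch_comp gi w * arch_comp g w) $$ (i, k) = (SUM j<r. snd (gi $$ (i, j)) w * snd (g $$ (j, k)) w)"
 if "i < r" "k < r" for i k
 unfolding mat_mult_index[OF c that] mat_mult_index[OF c(2,1) that]
 by (rule sum.cong[OF refl], use that dims in "simp add: arch_comp_def")+
 show "arch_comp g w * arch_comp gi w = 1\<^sub>m r" "arch_comp gi w * arch_comp g w = 1\<^sub>m r"
 by (rule eq_matI; use c in "simp add: i1 i2 arch_inv[OF w] del: index_mult_mat(1)")+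
qed

lemma metric_formula:
 assumes w: "w : arch_places" and xy: "x : carrier_vec r" "y : carrier_vec r"
 shows "adelic_metric r g w (map_vec (arch_emb w) x) (map_vec (arch_emb w) y) = (SUM i<r. L w i (vf r x) * cnj (L w i (vf r y)))"
proof -
 note m = arch_comp_mult[OF w]
 have i: "GLinv r (arch_comp g w) = arch_comp gi w"
 by (rule inv_GL_field(1)) (use m in auto)
 have r: "(arch_comp gi w *v map_vec (arch_emb w) z) $ k = L w k (vf r z)" if "z : carrier_vec r" "k < r" for z k
 using that dims by (simp add: arch_comp_def scalar_prod_def L_def vf_def lessThan_atLeast0)
 show ?thesis unfolding adelic_metric_def i Let_def scalar_prod_def
 using r[OF xy(1)] r[OF xy(2)] dims by (simp add: arch_comp_def lessThan_atLeast0)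
qed

lemma L_cong: "(!!j. j < r ==> f j = f' j) ==> L w i f = L w i f'"
 unfolding L_def by (intro sum.cong) auto

lemma e_formula: "e f f' = (SUM w:arch_places. SUM i<r. Re (L w i f * cnj (L w i f')))"
proof -
 have "L w i (vf r (vec r f)) = L w i f" for w i f by (rule L_cong) (simp add: vf_def)
 then show ?thesis unfolding e_def euclid_ip_def
 by (intro sum.cong refl) (simp only: metric_formula vec_carrier Re_sum)
qed

lemma L_add: "w : arch_places ==> L w i (f + f') = L w i f + L w i f'"
 unfolding L_def by (simp add: arch_emb_hom sum.distrib distrib_left)

lemma e_quadratic:
 "(SUM i<n. SUM j<n. c i * c j * e (ys i) (ys j)) =
 (SUM w:arch_places. SUM m<r. (cmod (SUM i<n. of_real (c i) * L w m (ys i)))\<^sup>2)"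
proof -
 have sq: "(cmod (SUM i<n. of_real (c i) * L w m (ys i)))\<^sup>2 = (SUM i<n. SUM j<n. c i * c j * Re (L w m (ys i) * cnj (L w m (ys j))))" for w m
 proof -
 have "(cmod (SUM i<n. of_real (c i) * L w m (ys i)))\<^sup>2 = Re ((SUM i<n. of_real (c i) * L w m (ys i)) * cnj (SUM i<n. of_real (c i) * L w m (ys i)))"
 by (simp only: complex_norm_square[symmetric] of_real_power[symmetric] Re_complex_of_real)
 also have "... = (SUM i<n. SUM j<n. Re ((of_real (c i) * L w m (ys i)) * cnj (of_real (c j) * L w m (ys j))))"
 by (simp only: cnj_sum sum_product Re_sum)
 also have "... = (SUM i<n. SUM j<n. c i * c j * Re (L w m (ys i) * cnj (L w m (ys j))))"
 by (intro sum.cong refl) (simp add: algebra_simps)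
 finally show ?thesis .
 qed
 show ?thesis unfolding e_formula sq sum_distrib_left by (rule sum_swap_pairs)
qed

text \<open>If the sum of squares vanished, so would all coordinates \<open>Z w m\<close>. Applying
  \<open>g\<close> at \<open>w\<close> undoes its inverse and leaves a real relation among the
  images of \<open>ys\<close> under the embedding chosen at each place. It extends to all
  embeddings, and \<open>embeddings_independent\<close> excludes it.\<close>

lemma e_pos:
 assumes ys: "set ys <= Mf" "zindep ys" "EX i<length ys. c i ~= 0"
 shows "(SUM i<length ys. SUM j<length ys. c i * c j * e (ys ! i) (ys ! j)) > 0"
proof (rule ccontr)
 assume n: "~ ?thesis"
 define Z where "Z w m = (SUM i<length ys. of_real (c i) * L w m (ys ! i))" for w m
 have "(SUM w:arch_places. SUM m<r. (cmod (Z w m))\<^sup>2) <= 0" using n by (simp add: e_quadratic Z_def)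
 then have "(SUM w:arch_places. SUM m<r. (cmod (Z w m))\<^sup>2) = 0" by (intro antisym sum_nonneg) simp_all
 then have "(SUM m<r. (cmod (Z w m))\<^sup>2) = 0" if "w : arch_places" for w
 using sum_nonneg_eq_0_iff[OF finite_arch_places, of "%w. SUM m<r. (cmod (Z w m))\<^sup>2"] that by (simp add: sum_nonneg)
 then have Z0: "Z w m = 0" if "w : arch_places" "m < r" for w m
 using sum_nonneg_eq_0_iff[of "{..<r}" "%m. (cmod (Z w m))\<^sup>2"] that by simp
 have emb: "(SUM i<length ys. of_real (c i) * arch_emb w ((ys ! i) k)) = 0" if w: "w : arch_places" and k: "k < r" for w k
 proof -
 have inv: "(SUM m<r. snd (g $$ (k, m)) w * L w m f) = arch_emb w (f k)" for f
 proof -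
 have "(SUM m<r. snd (g $$ (k, m)) w * L w m f) = (SUM m<r. SUM j<r. snd (g $$ (k, m)) w * snd (gi $$ (m, j)) w * arch_emb w (f j))"
 unfolding L_def sum_distrib_left by (simp add: mult.assoc)
 also have "... = (SUM j<r. (SUM m<r. snd (g $$ (k, m)) w * snd (gi $$ (m, j)) w) * arch_emb w (f j))"
 by (subst sum.swap) (simp add: sum_distrib_right)
 also have "... = (SUM j<r. if k = j then arch_emb w (f j) else 0)" using arch_inv(2)[OF w k] by (intro sum.cong) auto
 also have "... = arch_emb w (f k)" using k by simp
 finally show ?thesis .
 qed
 have "0 = (SUM m<r. snd (g $$ (k, m)) w * Z w m)" using Z0[OF w] by simp
 also have "... = (SUM m<r. SUM i<length ys. of_real (c i) * (snd (g $$ (k, m)) w * L w m (ys ! i)))"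
 unfolding Z_def sum_distrib_left by (simp add: mult_ac)
 also have "... = (SUM i<length ys. of_real (c i) * (SUM m<r. snd (g $$ (k, m)) w * L w m (ys ! i)))"
 by (subst sum.swap) (simp add: sum_distrib_left)
 finally show ?thesis unfolding inv by simp
 qed
 \<comment> \<open>Every embedding is the chosen one of its place or the conjugate of that one;
   since the coefficients \<open>c i\<close> are real, conjugation carries the relation
   over.\<close>
 have all: "(SUM i<length ys. of_real (c i) * sg ((ys ! i) k)) = 0" if s: "sg : embeddings" and k: "k < r" for sg k
 proof -
 have w: "{sg, cnj \<circ> sg} : arch_places" using s unfolding arch_places_def by blast
 from arch_emb(1)[OF w] consider "arch_emb {sg, cnj \<circ> sg} = sg" | "arch_emb {sg, cnj \<circ> sg} = cnj \<circ> sg" by blast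
 then show ?thesis
 proof cases
 case 1
 then show ?thesis using emb[OF w k] by simp
 next
 case 2
 have "cnj (SUM i<length ys. of_real (c i) * sg ((ys ! i) k)) = (SUM i<length ys. of_real (c i) * (cnj \<circ> sg) ((ys ! i) k))"
 by (simp add: cnj_sum)
 then show ?thesis using emb[OF w k] unfolding 2 by (metis complex_cnj_zero_iff)
 qed
 qed
 obtain k where k: "k < length ys" "c k ~= 0" using ys(3) by blast
 have "c k = 0"
 proof (rule embeddings_independent[OF ys(2) _ _ k(1), of r])
 show "x m = 0" if "x : set ys" "r <= m" for x m using that ys(1) by (auto simp: Mf_def)
 qed (rule all)
 then show False using k(2) by simp
qed

text \<open>\<open>fs\<close> consists of the integral basis \<open>es\<close> placed at each of the
  \<open>r\<close> positions. A multiple of every member of \<open>fs\<close> lies in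
  \<open>Mf\<close>; conversely \<open>N\<close> makes the coordinates of members of
  \<open>Mf\<close> integral and \<open>D\<close> carries integers into the span of
  \<open>es\<close>. So \<open>Mf\<close> is squeezed between two lattices.\<close>

lemma Mf_generated: "EX S. zspan S = Mf"
proof -
 obtain es :: "'a list" where es: "zindep es" "QF.span (set es) = UNIV" "ALL e:set es. aint e"
 by (rule integral_basis_exists)
 obtain D :: int where D: "D > 0" "ALL x :: 'a. aint x --> of_int D * x : zspan es"
 by (rule integers_in_lattice[OF es])
 obtain N :: int where N: "N ~= 0" "ALL f:Mf. ALL j. aint (of_int N * f j)" by (rule Mf_integral_multiple)
 define s where "s j x = (%k. if k = j then x else 0 :: 'a)" for j :: nat and x
 define fs where "fs = map (%(j, x). s j x) (List.product [0..<r] es)"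
 have lower: "EX m~=0. ALL f:A. of_int m * f : Mf" if "finite A" "ALL f:A. ALL i>=r. f i = 0" for A :: "(nat => 'a) set"
 using that
 proof (induction A rule: finite_induct)
 case empty
 show ?case by (intro exI[of _ 1]) simp
 next
 case (insert f A)
 have "ALL f:A. ALL i>=r. f i = 0" using insert.prems by blast
 from insert.IH[OF this] obtain m where m: "m ~= 0" "ALL f:A. of_int m * f : Mf" by blast
 have "ALL i>=r. f i = 0" using insert.prems by blast
 then obtain k :: int where k: "k ~= 0" "of_int k * f : Mf" by (rule Mf_multiple_in)
 have "of_int (k * m) * h : Mf" if h: "h : insert f A" for h
 proof (cases "h = f")
 case True
 have "of_int m * (of_int k * f) : Mf" using zsub_of_int_mult[OF Mf_zsub k(2)] .
 then show ?thesis using True by (simp add: algebra_simps)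
 next
 case False
 then have "of_int m * h : Mf" using h m(2) by blast
 then have "of_int k * (of_int m * h) : Mf" using zsub_of_int_mult[OF Mf_zsub] by blast
 then show ?thesis by (simp add: algebra_simps)
 qed
 moreover have "k * m ~= 0" using m(1) k(1) by simp
 ultimately show ?case by blast
 qed
 have "ALL f:set fs. ALL i>=r. f i = 0" by (auto simp: fs_def s_def)
 then obtain m where m: "m ~= 0" "ALL f:set fs. of_int m * f : Mf" using lower[of "set fs"] by auto
 have sing: "s j x : zspan fs" if j: "j < r" and x: "x : zspan es" for j x
 proof -
 obtain c where c: "x = zcomb c es" using x by (rule zspanE)
 have "s j x = (SUM i<length es. of_int (c i) * s j (es ! i))"
 unfolding c zcomb_def by (auto simp: fun_eq_iff s_def sum_fun_apply)
 also have "... : zspan fs"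
 proof (intro zsub_sum[OF zsub_zspan] zsub_of_int_mult[OF zsub_zspan])
 fix i assume "i : {..<length es}"
 then have "s j (es ! i) : set fs" using j unfolding fs_def by (auto intro!: image_eqI[of _ _ "(j, es ! i)"])
 then show "s j (es ! i) : zspan fs" using set_subset_zspan by blast
 qed
 finally show ?thesis .
 qed
 have upper: "of_int (D * N) * x : zspan fs" if x: "x : Mf" for x
 proof -
 have "of_int (D * N) * x = (SUM j<r. s j (of_int D * (of_int N * x j)))"
 proof
 fix k show "(of_int (D * N) * x) k = (SUM j<r. s j (of_int D * (of_int N * x j))) k"
 using x by (cases "k < r") (simp_all add: sum_fun_apply s_def Mf_def mult.assoc)
 qed
 also have "... : zspan fs"
 using D(2) N(2) x by (intro zsub_sum[OF zsub_zspan] sing) auto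
 finally show ?thesis .
 qed
 have DN: "D * N ~= 0" using D N by simp
 obtain S where "zspan S = Mf"
 by (rule QV.sandwich_generated[OF Mf_zsub DN m(1)]) (use m(2) upper in auto)
 then show ?thesis by blast
qed

sublocale GL: gram_lattice e Mf
proof
 show "e (x + y) z = e x z + e y z" for x y z
 unfolding e_formula by (simp add: L_add distrib_right sum.distrib cong: sum.cong)
 show sym: "e x y = e y x" for x y
 unfolding e_formula by (intro sum.cong refl) (simp add: mult.commute)
 show "zsub Mf" by (rule Mf_zsub)
 show "c = 0 \<or> x = 0" if "x : Mf" "of_int c * x = 0" for c x
 by (rule QV.int_mult_eq_0[THEN iffD1, OF that(2)])
 show "EX S. zspan S = Mf" by (rule Mf_generated)
 show "det (gram e xs) > 0" if "set xs <= Mf" "zindep xs" for xs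
 by (rule gram_pos_of_quadratic[of e Mf xs, OF sym e_pos that])
qed

end

section \<open>Ranks, covolumes and the ordinates of subspaces\<close>

lemma lattice_rank_eq:
 fixes M :: "'a::number_field vec set"
 assumes W: "W : subspaces r" and M: "M <= W" and mult: "!!x. x : W ==> EX k::int. k ~= 0 & of_int k \<cdot>\<^sub>v x : M"
 shows "lattice_rank r M = subspace_dim r W"
proof -
 note Wc = subspacesD(5)[OF W]
 have Mc: "M <= carrier_vec r" using M Wc by blast
 have ce: "(module_vec TYPE('a) r)\<lparr>carrier := carrier_vec r\<rparr> = module_vec TYPE('a) r" by (simp add: module_vec_def)
 note sp = vf_span[OF subspaces_ends(2) Mc, unfolded ce]
 have "FV.span (vf r ` M) = vf r ` W"
 proof
 show "FV.span (vf r ` M) <= vf r ` W" by (rule FV.span_minimal[OF image_mono[OF M] vf_subspace[OF W]])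
 show "vf r ` W <= FV.span (vf r ` M)"
 proof (rule image_subsetI)
 fix x assume x: "x : W"
 then obtain k :: int where k: "k ~= 0" "of_int k \<cdot>\<^sub>v x : M" using mult by blast
 have "(%i. (1 / of_int k) * vf r (of_int k \<cdot>\<^sub>v x) i) : FV.span (vf r ` M)"
 by (rule FV.span_scale[OF FV.span_base[OF imageI[OF k(2)]]])
 moreover have "(%i. (1 / of_int k) * vf r (of_int k \<cdot>\<^sub>v x) i) = vf r x"
 unfolding vf_smult[OF Wc[OF x]] using k(1) by (intro ext) simp
 ultimately show "vf r x : FV.span (vf r ` M)" by simp
 qed
 qed
 then have "vf r ` LinearCombinations.module.span class_ring (module_vec TYPE('a) r) M = vf r ` W" unfolding sp(1) .
 then have "LinearCombinations.module.span class_ring (module_vec TYPE('a) r) M = W"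
 using inj_on_image_eq_iff[OF vf_inj sp(2) subspacesD(1)[OF W]] by blast
 then show ?thesis by (simp add: lattice_rank_def)
qed

lemma zsub_FV_subspace: "FV.subspace U ==> zsub U"
 unfolding zsub_def using FV.subspace_0 FV.subspace_diff by blast

lemma of_int_fun_mult: "of_int k * f = (%i. of_int k * f i :: 'a::number_field)"
 by (rule ext) simp

context adelic_matrix begin

abbreviation "AM \<equiv> adelic_module r g"
abbreviation "AH \<equiv> adelic_metric r g"

definition LW :: "'a vec set => (nat => 'a) set" where "LW W = vf r ` (AM Int W)"

lemma AM_carrier: "AM <= carrier_vec r" by (auto simp: module_iff)

lemma LW_eq: assumes "W : subspaces r" shows "LW W = Mf Int vf r ` W"
 unfolding LW_def using module_iff subspacesD(5)[OF assms] by blast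

lemma LW_pure: assumes W: "W : subspaces r" shows "GL.pure (LW W)"
proof -
 note s = vf_subspace[OF W]
 have "x : vf r ` W" if c: "c ~= 0" "of_int c * x : vf r ` W" for x c
 proof -
 have "(%i. (1 / of_int c) * (of_int c * x i)) : vf r ` W"
 using FV.subspace_scale[OF s c(2)[unfolded of_int_fun_mult], of "1 / of_int c"] .
 moreover have "(%i. (1 / of_int c) * (of_int c * x i)) = x" using c(1) by (intro ext) simp
 ultimately show ?thesis by simp
 qed
 moreover have "zsub (Mf Int vf r ` W)"
 using Mf_zsub zsub_FV_subspace[OF s] unfolding zsub_def by blast
 ultimately show ?thesis unfolding GL.pure_def LW_eq[OF W] by blast
qed

lemma LW_multiple: assumes W: "W : subspaces r" and x: "x : vf r ` W"
 shows "EX k::int. k ~= 0 & of_int k * x : LW W"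
proof -
 have "ALL i>=r. x i = 0" using x vf_supp by blast
 then obtain N :: int where N: "N ~= 0" "of_int N * x : Mf" by (rule Mf_multiple_in)
 have "of_int N * x : vf r ` W" unfolding of_int_fun_mult by (rule FV.subspace_scale[OF vf_subspace[OF W] x])
 with N show ?thesis unfolding LW_eq[OF W] by blast
qed

lemma AM_multiple: assumes W: "W : subspaces r" and x: "x : W"
 shows "EX k::int. k ~= 0 & of_int k \<cdot>\<^sub>v x : AM Int W"
proof -
 note xc = subspacesD(5)[OF W x]
 obtain k :: int where k: "k ~= 0" "of_int k * vf r x : LW W" using LW_multiple[OF W imageI[OF x]] by blast
 have "vf r (of_int k \<cdot>\<^sub>v x) = of_int k * vf r x" unfolding vf_smult[OF xc] of_int_fun_mult ..
 then have "vf r (of_int k \<cdot>\<^sub>v x) : Mf" using k(2) LW_eq[OF W] by simp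
 moreover have "of_int k \<cdot>\<^sub>v x : carrier_vec r" using xc by simp
 ultimately show ?thesis using k(1) module_iff subspacesD(4)[OF W x] by blast
qed

lemma rank_AM: "W : subspaces r ==> lattice_rank r (AM Int W) = subspace_dim r W"
 by (rule lattice_rank_eq) (use AM_multiple in auto)

lemma covolume_AM: assumes W: "W : subspaces r" shows "covolume r (AM Int W) AH = sqrt (GL.vol2 (LW W))"
proof -
 have sub: "AM Int W <= carrier_vec r" using AM_carrier by blast
 note ib = int_basis_iff[OF sub]
 have gr: "mat (length bs) (length bs) (%(i, j). euclid_ip AH (bs ! i) (bs ! j)) = gram e (map (vf r) bs)"
 if "set bs <= carrier_vec r" for bs
 proof -
 have "euclid_ip AH (bs ! i) (bs ! j) = e (map (vf r) bs ! i) (map (vf r) bs ! j)" if "i < length bs" "j < length bs" for i j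
 using that \<open>set bs <= carrier_vec r\<close> by (simp add: e_def vec_vf subset_code(1))
 then show ?thesis unfolding gram_def by (intro eq_matI) simp_all
 qed
 show ?thesis unfolding covolume_def
 proof (rule the_equality)
 obtain b where b: "GL.zbasis (LW W) b" using GL.pure_basis[OF LW_pure[OF W]] by blast
 have "ALL i>=r. f i = 0" if "f : set b" for f
 proof -
 have "f : LW W" using GL.zbasis_subset[OF b] that by blast
 then show ?thesis unfolding LW_def using vf_supp by blast
 qed
 then have mb: "map (vf r) (map (vec r) b) = b" unfolding map_map by (intro map_idI) (simp add: vf_vec)
 have c: "set (map (vec r) b) <= carrier_vec r" by auto
 have "int_basis (module_vec TYPE('a) r) (AM Int W) (map (vec r) b)"
 unfolding ib mb using b c unfolding GL.zbasis_def LW_def by blast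
 moreover have "sqrt (GL.vol2 (LW W)) = sqrt (det (gram e b))" using GL.vol2_eq[OF LW_pure[OF W] b] by simp
 ultimately show "EX bs. int_basis (module_vec TYPE('a) r) (AM Int W) bs & sqrt (GL.vol2 (LW W)) =
 sqrt (det (mat (length bs) (length bs) (%(i, j). euclid_ip AH (bs ! i) (bs ! j))))"
 using gr[OF c, unfolded mb] by metis
 next
 fix V assume "EX bs. int_basis (module_vec TYPE('a) r) (AM Int W) bs & V =
 sqrt (det (mat (length bs) (length bs) (%(i, j). euclid_ip AH (bs ! i) (bs ! j))))"
 then obtain bs where bs: "set bs <= carrier_vec r" "zspan (map (vf r) bs) = LW W" "zindep (map (vf r) bs)"
 and V: "V = sqrt (det (mat (length bs) (length bs) (%(i, j). euclid_ip AH (bs ! i) (bs ! j))))"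
 unfolding ib LW_def by blast
 have "GL.zbasis (LW W) (map (vf r) bs)" unfolding GL.zbasis_def using bs by blast
 then show "V = sqrt (GL.vol2 (LW W))" using GL.vol2_eq[OF LW_pure[OF W]] V gr[OF bs(1)] by simp
 qed
qed

definition node :: "'a vec set => real" where
 "node W = lattice_deg r (AM Int W) AH - real (subspace_dim r W) * (lattice_deg r AM AH / real r)"

text \<open>The power of 2 and the discriminant contribute linearly in the rank. The factor
  \<open>kp\<close> is left existential because it cancels in \<open>node\<close>.\<close>

lemma deg_AM: "EX kp. ALL W:subspaces r. lattice_deg r (AM Int W) AH = - ln (GL.vol2 (LW W)) / 2 + real (subspace_dim r W) * kp"
proof (intro exI ballI)
 fix W :: "'a vec set" assume W: "W : subspaces r"
 let ?k = "card (complex_places :: ('a => complex) set set)" and ?d = "subspace_dim r W" and ?v = "GL.vol2 (LW W)"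
 have v: "?v > 0" by (rule GL.vol2_pos[OF LW_pure[OF W]])
 have "ln (2 ^ (?k * ?d) * sqrt ?v) = real (?k * ?d) * ln 2 + ln ?v / 2"
 using v by (simp add: ln_mult ln_realpow ln_sqrt)
 then show "lattice_deg r (AM Int W) AH = - ln ?v / 2 + real ?d * (ln (abs_discriminant TYPE('a)) / 2 - real ?k * ln 2)"
 unfolding lattice_deg_def lattice_volume_def rank_AM[OF W] covolume_AM[OF W] by (simp add: algebra_simps)
qed

lemma node_eq:
 assumes r: "r >= 1" and W: "W : subspaces r"
 shows "node W = - ln (GL.vol2 (LW W)) / 2 + real (subspace_dim r W) * (ln (GL.vol2 (LW (carrier_vec r))) / (2 * real r))"
proof -
 obtain kp where k: "ALL W:subspaces r. lattice_deg r (AM Int W) AH = - ln (GL.vol2 (LW W)) / 2 + real (subspace_dim r W) * kp"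
 using deg_AM by blast
 have t: "lattice_deg r AM AH = - ln (GL.vol2 (LW (carrier_vec r))) / 2 + real r * kp"
 using bspec[OF k subspaces_ends(2)] AM_carrier by (simp add: Int_absorb2 subspaces_ends(4))
 show ?thesis unfolding node_def t bspec[OF k W] using r by (simp add: field_simps)
qed

lemma subspace_dim_le: "W : subspaces r ==> subspace_dim r W <= r"
proof -
 assume W: "W : subspaces r"
 show ?thesis
 proof (cases "W = carrier_vec r")
 case True
 then show ?thesis by (simp add: subspaces_ends(4))
 next
 case False
 then have "W \<subset> carrier_vec r" using subspacesD(1)[OF W] by blast
 from subspaces_lattice(6)[OF W subspaces_ends(2) this] show ?thesis by (simp add: subspaces_ends(4))
 qed
qed

text \<open>Supermodularity is \<open>vol2_submodular\<close> after taking logarithms, the terms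
  linear in the dimension being modular. The lattice of a sum of subspaces may properly contain the
  sum of the lattices, hence the multiples in \<open>ex\<close>. For finiteness, a lower bound on
  \<open>node\<close> bounds \<open>vol2\<close>, the linear term being at most
  \<open>r * \<bar>c\<bar>\<close>.\<close>

lemma node_lattice:
 assumes r: "r >= 1"
 shows "supermodular_lattice (subspaces r) subspace_join (subspace_dim r) {0\<^sub>v r} (carrier_vec r) r node"
proof (rule supermodular_lattice.intro)
 fix A B :: "'a vec set" assume A: "A : subspaces r"
 show "{0\<^sub>v r} <= A" using subspacesD(2)[OF A] by simp
 show "A <= carrier_vec r" by (rule subspacesD(1)[OF A])
 assume B: "B : subspaces r"
 note l = subspaces_lattice[OF A B]
 show "A Int B : subspaces r" "subspace_join A B : subspaces r" "A <= subspace_join A B" "B <= subspace_join A B"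
 "subspace_dim r (subspace_join A B) + subspace_dim r (A Int B) = subspace_dim r A + subspace_dim r B" using l by blast+
 show "subspace_dim r A < subspace_dim r B" if "A \<subset> B" using l(6)[OF that] .
 let ?J = "subspace_join A B" and ?v = "%W. GL.vol2 (LW W)"
 have int: "LW (A Int B) = LW A Int LW B"
 unfolding LW_eq[OF A] LW_eq[OF B] LW_eq[OF l(1)] using inj_on_image_Int[OF vf_inj subspacesD(1)[OF A] subspacesD(1)[OF B]] by blast
 have sub: "LW A <= LW ?J" "LW B <= LW ?J" unfolding LW_def using l(3,4) by blast+
 have ex: "EX k::int. k ~= 0 & (EX y:LW A. EX z:LW B. of_int k * x = y + z)" if x: "x : LW ?J" for x
 proof -
 have "x : vf r ` ?J" using x unfolding LW_eq[OF l(2)] by blast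
 then obtain a b where ab: "a : vf r ` A" "b : vf r ` B" "x = a + b" unfolding vf_join[OF A B] by blast
 obtain k :: int where k: "k ~= 0" "of_int k * a : LW A" using LW_multiple[OF A ab(1)] by blast
 obtain m :: int where m: "m ~= 0" "of_int m * b : LW B" using LW_multiple[OF B ab(2)] by blast
 have "of_int m * (of_int k * a) : LW A" by (rule zsub_of_int_mult[OF GL.pureD(1)[OF LW_pure[OF A]] k(2)])
 moreover have "of_int k * (of_int m * b) : LW B" by (rule zsub_of_int_mult[OF GL.pureD(1)[OF LW_pure[OF B]] m(2)])
 moreover have "of_int (k * m) * x = of_int m * (of_int k * a) + of_int k * (of_int m * b)"
 unfolding ab(3) by (rule ext) (simp add: algebra_simps)
 moreover have "k * m ~= 0" using k(1) m(1) by simp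
 ultimately show ?thesis by blast
 qed
 have "?v ?J * ?v (A Int B) <= ?v A * ?v B" unfolding int
 by (rule GL.vol2_submodular(1)[OF LW_pure[OF A] LW_pure[OF B] LW_pure[OF l(2)] sub]) (use ex in blast)
 moreover have v: "?v ?J > 0" "?v (A Int B) > 0" "?v A > 0" "?v B > 0"
 using GL.vol2_pos LW_pure A B l(1,2) by simp_all
 ultimately have "ln (?v ?J * ?v (A Int B)) <= ln (?v A * ?v B)" by simp
 then have ln: "ln (?v ?J) + ln (?v (A Int B)) <= ln (?v A) + ln (?v B)" using v by (simp add: ln_mult)
 define c where "c = ln (GL.vol2 (LW (carrier_vec r))) / (2 * real r)"
 have "real (subspace_dim r ?J) + real (subspace_dim r (A Int B)) = real (subspace_dim r A) + real (subspace_dim r B)"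
 using l(5) by linarith
 then have "real (subspace_dim r ?J) * c + real (subspace_dim r (A Int B)) * c = real (subspace_dim r A) * c + real (subspace_dim r B) * c"
 unfolding distrib_right[symmetric] by simp
 then show "node A + node B <= node ?J + node (A Int B)"
 using ln unfolding node_eq[OF r A] node_eq[OF r B] node_eq[OF r l(1)] node_eq[OF r l(2)] c_def[symmetric] by linarith
next
 show z: "{0\<^sub>v r} : subspaces r" by (rule subspaces_ends(1))
 show t: "carrier_vec r : subspaces r" by (rule subspaces_ends(2))
 show "subspace_dim r {0\<^sub>v r :: 'a vec} = 0" "subspace_dim r (carrier_vec r :: 'a vec set) = r" by (rule subspaces_ends)+
 have "LW {0\<^sub>v r} = {0}"
 unfolding LW_eq[OF z] using zsubD(1)[OF Mf_zsub] by (auto simp: vf_zero)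
 then show "node {0\<^sub>v r} = 0" unfolding node_eq[OF r z] by (simp add: GL.vol2_zero subspaces_ends(3))
 show "node (carrier_vec r) = 0" unfolding node_eq[OF r t] subspaces_ends(4) using r by (simp add: field_simps)
next
 fix C :: real
 define c where "c = ln (GL.vol2 (LW (carrier_vec r))) / (2 * real r)"
 let ?S = "{A : subspaces r. C <= node A}"
 have "LW ` ?S <= {L. GL.pure L & GL.vol2 L <= exp (2 * (real r * \<bar>c\<bar> - C))}"
 proof (rule image_subsetI)
 fix A assume A0: "A : ?S"
 then have A: "A : subspaces r" and C: "C <= node A" by blast+
 have "real (subspace_dim r A) * c <= real (subspace_dim r A) * \<bar>c\<bar>" by (intro mult_left_mono) simp_all
 also have "... <= real r * \<bar>c\<bar>" using subspace_dim_le[OF A] by (intro mult_right_mono) simp_all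
 finally have fin: "real (subspace_dim r A) * c <= real r * \<bar>c\<bar>" .
 have aux: "l <= 2 * (s - C)" if "t <= s" "C <= - l / 2 + t" for t s l :: real using that by simp
 have "ln (GL.vol2 (LW A)) <= 2 * (real r * \<bar>c\<bar> - C)"
 by (rule aux[OF fin C[unfolded node_eq[OF r A] c_def[symmetric]]])
 then have "GL.vol2 (LW A) <= exp (2 * (real r * \<bar>c\<bar> - C))"
 using GL.vol2_pos[OF LW_pure[OF A]] by (metis exp_le_cancel_iff exp_ln)
 then show "LW A : {L. GL.pure L & GL.vol2 L <= exp (2 * (real r * \<bar>c\<bar> - C))}" using LW_pure[OF A] by blast
 qed
 then have fin: "finite (LW ` ?S)" by (rule finite_subset[OF _ GL.finite_pure_vol2_le])
 \<comment> \<open>A subspace is recovered from its lattice, because every vector of it has a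
   nonzero integer multiple there.\<close>
 have "inj_on LW ?S"
 proof (rule inj_onI)
 fix A B assume "A : ?S" "B : ?S" and eq: "LW A = LW B"
 then have A: "A : subspaces r" and B: "B : subspaces r" by blast+
 have half: "X <= Y" if X: "X : subspaces r" and Y: "Y : subspaces r" and XY: "LW X = LW Y" for X Y
 proof
 fix x assume x: "x : X"
 obtain k :: int where k: "k ~= 0" "of_int k * vf r x : LW X" using LW_multiple[OF X imageI[OF x]] by blast
 then have "of_int k * vf r x : vf r ` Y" using XY LW_eq[OF Y] by blast
 from FV.subspace_scale[OF vf_subspace[OF Y] this[unfolded of_int_fun_mult], of "1 / of_int k"]
 have "vf r x : vf r ` Y" using k(1) by simp
 then show "x : Y" using inj_onD[OF vf_inj _ subspacesD(5)[OF X x]] subspacesD(5)[OF Y] by blast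
 qed
 show "A = B" using half[OF A B eq] half[OF B A eq[symmetric]] by blast
 qed
 with fin show "finite ?S" by (rule finite_imageD)
qed

end

text \<open>Left multiplication by a rational matrix is an isometry of the lattices, compatible with subspaces.\<close>

lemma adele_diag_mem: "adele_diag (x :: 'a::number_field) : carrier AR"
proof -
 have "local_emb v x : local_integers v" if "v : FP" "~ place_abs v x > 1" for v
 proof -
 interpret nonarch v using that(1) by (rule nonarch_place)
 show ?thesis using that(2) by (simp add: local_int_iff lv_local_emb)
 qed
 then have "{v : finite_places. fst (adele_diag x) v ~: local_integers v} <= {v : finite_places. place_abs v x > 1}"
 by (auto simp: adele_diag_def)
 then have "finite {v : finite_places. fst (adele_diag x) v ~: local_integers v}" by (rule finite_subset[OF _ finite_place_abs_gt_1])
 moreover have "local_emb v x : carrier (Lf v)" if "v : FP" for v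
 proof -
 interpret nonarch v using that by (rule nonarch_place)
 show ?thesis by simp
 qed
 moreover have "arch_emb w x : carrier (arch_field w)" if w: "w : arch_places" for w
 proof (cases "real_place w")
 case True
 obtain sg where s: "sg : embeddings" "w = {sg, cnj \<circ> sg}" using w unfolding arch_places_def by blast
 have "sg = cnj \<circ> sg" using True s(2) unfolding real_place_def by (metis card_1_singletonE insertCI singletonD)
 moreover have "arch_emb w = sg" using arch_emb(1)[OF w] s(2) calculation by auto
 ultimately have "cnj (arch_emb w x) = arch_emb w x" by (metis comp_apply)
 then show ?thesis using True by (simp add: arch_field_carrier Reals_cnj_iff)
 next
 case False
 then show ?thesis by (simp add: arch_field_carrier)
 qed
 ultimately show ?thesis unfolding adele_carrier adele_diag_def fst_conv snd_conv restrict_PiE_iff by simp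
qed

section \<open>Transport of lattices by rational matrices\<close>

abbreviation act :: "'a::field mat => 'a vec set => 'a vec set" where
 "act A W \<equiv> (%x. A *v x) ` W"

locale inverse_pair =
 fixes r :: nat and dl ep :: "'a::field mat"
 assumes dl: "dl : carrier_mat r r" and ep: "ep : carrier_mat r r" and dlep: "dl * ep = 1\<^sub>m r" and epdl: "ep * dl = 1\<^sub>m r"
begin

lemma inverse_pair_sym: "inverse_pair r ep dl"
 by unfold_locales (rule ep dl dlep epdl)+

lemma cancel: "x : carrier_vec r ==> dl *v (ep *v x) = x" "x : carrier_vec r ==> ep *v (dl *v x) = x"
 using assoc_mult_mat_vec[OF dl ep, of x, symmetric] assoc_mult_mat_vec[OF ep dl, of x, symmetric] dlep epdl by simp_all

lemma mult_closed: "x : carrier_vec r ==> dl *v x : carrier_vec r"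
 using dl by simp

lemma image_cancel: "W <= carrier_vec r ==> (%x. ep *v x) ` act dl W = W"
 by (force simp: image_image cancel(2) subset_iff)

lemma inj: "inj_on (%x. dl *v x) (carrier_vec r)"
 by (rule inj_on_inverseI[of _ "%x. ep *v x"]) (rule cancel(2))

definition Dl :: "(nat => 'a) => nat => 'a" where
 "Dl f = (%i. if i < r then SUM j<r. dl $$ (i, j) * f j else 0)"

lemma mult_vec_index: "x : carrier_vec r ==> i < r ==> (dl *v x) $ i = (SUM j<r. dl $$ (i, j) * x $ j)"
 using dl by (simp add: scalar_prod_def lessThan_atLeast0)

lemma vf_mult: "x : carrier_vec r ==> vf r (dl *v x) = Dl (vf r x)"
 unfolding Dl_def vf_def by (intro ext) (simp add: mult_vec_index)

lemma Dl_add: "Dl (f + f') = Dl f + Dl f'"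
 unfolding Dl_def by (rule ext) (simp add: distrib_left sum.distrib)

lemma Dl_scale: "Dl (%i. c * f i) = (%i. c * Dl f i)"
 unfolding Dl_def by (rule ext) (simp add: sum_distrib_left mult_ac)

lemma Dl_zero: "Dl 0 = 0"
 unfolding Dl_def by (rule ext) simp

lemma Dl_zcomb: "zcomb c (map Dl fs) = Dl (zcomb c fs)"
proof -
 have s: "Dl (of_int k * f) = of_int k * Dl f" for k :: int and f
 proof -
 have e: "of_int k * f = (%i. of_int k * f i)" for f :: "nat => 'a" by (rule ext) simp
 show ?thesis unfolding e by (rule Dl_scale)
 qed
 have "Dl (SUM i:I. F i) = (SUM i:I. Dl (F i))" for F and I :: "nat set"
 by (induction I rule: infinite_finite_induct) (simp_all only: sum.infinite sum.empty sum.insert Dl_zero Dl_add not_False_eq_True)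
 then show ?thesis unfolding zcomb_def by (simp only: s length_map) (intro sum.cong refl, simp only: nth_map lessThan_iff s)
qed

lemma image_subspaces: assumes W: "W : subspaces r" shows "act dl W : subspaces r"
 unfolding subspaces_iff
proof (intro conjI ballI allI)
 note w = subspacesD[OF W]
 show "act dl W <= carrier_vec r" using mult_closed w(5) by blast
 have "dl *v 0\<^sub>v r = 0\<^sub>v r"
 by (rule eq_vecI) (use dl in "simp_all add: mult_vec_index del: index_mult_mat_vec")
 then show "0\<^sub>v r : act dl W" using w(2) by (metis imageI)
 fix x assume "x : act dl W"
 then obtain a where a: "a : W" "x = dl *v a" by blast
 show "c \<cdot>\<^sub>v x : act dl W" for c
 unfolding a(2) using mult_mat_vec[OF dl w(5)[OF a(1)], of c, symmetric] w(4)[OF a(1)] by (metis imageI)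
 fix y assume "y : act dl W"
 then obtain b where b: "b : W" "y = dl *v b" by blast
 show "x + y : act dl W"
 unfolding a(2) b(2) using mult_add_distrib_mat_vec[OF dl w(5)[OF a(1)] w(5)[OF b(1)], symmetric] w(3)[OF a(1) b(1)]
 by (metis imageI)
qed

lemma dim_image_le: assumes W: "W : subspaces r"
 shows "subspace_dim r (act dl W) <= subspace_dim r W"
proof -
 have im: "vf r ` act dl W = Dl ` vf r ` W"
 unfolding image_image by (rule image_cong[OF refl]) (rule vf_mult[OF subspacesD(5)[OF W]])
 obtain B where B: "B <= vf r ` W" "FV.independent B" "vf r ` W <= FV.span B" "card B = FV.dim (vf r ` W)"
 by (rule FV.basis_exists)
 have "B <= FV.span (unit_funs r)" using B(1) vf_in_span[of r W] by (rule subset_trans)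
 from FV.independent_span_bound[OF fin_unit_funs B(2) this] have fB: "finite B" by (rule conjunct1)
 have "FV.span B <= {f. Dl f : FV.span (Dl ` B)}"
 proof (rule FV.span_minimal)
 show "B <= {f. Dl f : FV.span (Dl ` B)}" by (intro subsetI CollectI FV.span_base imageI)
 show "FV.subspace {f. Dl f : FV.span (Dl ` B)}"
 proof (rule FV.subspaceI)
 show "0 : {f. Dl f : FV.span (Dl ` B)}" unfolding mem_Collect_eq Dl_zero by (rule FV.span_zero)
 show "x + y : {f. Dl f : FV.span (Dl ` B)}" if "x : {f. Dl f : FV.span (Dl ` B)}" "y : {f. Dl f : FV.span (Dl ` B)}" for x y
 using that unfolding mem_Collect_eq Dl_add by (rule FV.span_add)
 show "(%i. c * x i) : {f. Dl f : FV.span (Dl ` B)}" if "x : {f. Dl f : FV.span (Dl ` B)}" for c x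
 using that unfolding mem_Collect_eq Dl_scale by (rule FV.span_scale)
 qed
 qed
 then have "Dl ` vf r ` W <= FV.span (Dl ` B)" using B(3) by blast
 then have "FV.dim (Dl ` vf r ` W) <= card (Dl ` B)" using fB by (intro FV.dim_le_card) simp_all
 also have "... <= card B" by (rule card_image_le[OF fB])
 finally show ?thesis unfolding dim_eq_FV[OF W] dim_eq_FV[OF image_subspaces[OF W]] im B(4) .
qed

end

context inverse_pair begin

interpretation inv: inverse_pair r ep dl by (rule inverse_pair_sym)

lemma dim_image: assumes W: "W : subspaces r"
 shows "subspace_dim r (act dl W) = subspace_dim r W"
 using dim_image_le[OF W] inv.dim_image_le[OF image_subspaces[OF W]] image_cancel[OF subspacesD(1)[OF W]] by simp

lemma Dl_inverse: assumes "!!i. i >= r ==> f i = 0" shows "inv.Dl (Dl f) = f"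
proof -
 have v: "vec r f : carrier_vec r" by simp
 have "inv.Dl (Dl (vf r (vec r f))) = vf r (vec r f)"
 unfolding vf_mult[OF v, symmetric] inv.vf_mult[OF mult_closed[OF v], symmetric] cancel(2)[OF v] ..
 then show ?thesis using vf_vec[of r f] assms by simp
qed

end

lemma inverse_pair_GL:
 assumes "dl : carrier (GL_field r)" obtains ep where "inverse_pair r dl (ep :: 'b::field mat)"
proof -
 have "dl : Units (ring_mat TYPE('b) r ())" using assms by (simp add: GL_field_def units_of_carrier)
 then obtain ep where "dl : carrier_mat r r" "ep : carrier_mat r r" "ep * dl = 1\<^sub>m r" "dl * ep = 1\<^sub>m r"
 unfolding Units_def by (auto simp: ring_mat_simps)
 then show thesis by (intro that inverse_pair.intro)
qed

lemma int_basis_image: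
 fixes dl :: "'a::number_field mat"
 assumes inv: "inverse_pair r dl ep" and M: "M <= carrier_vec r" and b: "int_basis (module_vec TYPE('a) r) M bs"
 shows "int_basis (module_vec TYPE('a) r) (act dl M) (map (%x. dl *v x) bs)"
proof -
 interpret inverse_pair r dl ep by (rule inv)
 interpret i: inverse_pair r ep dl by (rule inverse_pair_sym)
 have bs: "set bs <= carrier_vec r" "zspan (map (vf r) bs) = vf r ` M" "zindep (map (vf r) bs)"
 using b unfolding int_basis_iff[OF M] by blast+
 have dM: "act dl M <= carrier_vec r" using M mult_closed by blast
 have map: "map (vf r) (map (%x. dl *v x) bs) = map Dl (map (vf r) bs)"
 unfolding map_map by (rule map_cong[OF refl]) (use bs(1) vf_mult in auto)
 have im: "vf r ` act dl M = Dl ` vf r ` M"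
 unfolding image_image by (rule image_cong[OF refl]) (rule vf_mult[OF subsetD[OF M]])
 have sp: "zspan (map Dl (map (vf r) bs)) = Dl ` vf r ` M"
 unfolding bs(2)[symmetric] zspan_def image_image Dl_zcomb ..
 have zi: "zindep (map Dl (map (vf r) bs))" unfolding zindep_def
 proof (intro allI impI)
 fix c i assume c: "zcomb c (map Dl (map (vf r) bs)) = 0" and i: "i < length (map Dl (map (vf r) bs))"
 have "zcomb c (map (vf r) bs) : vf r ` M" unfolding bs(2)[symmetric] by (rule zcomb_in_zspan)
 then obtain a where a: "zcomb c (map (vf r) bs) = vf r a" by (rule imageE)
 have supp: "zcomb c (map (vf r) bs) k = 0" if "k >= r" for k unfolding a by (rule vf_supp[OF that])
 have "i.Dl (Dl (zcomb c (map (vf r) bs))) = i.Dl 0" using c unfolding Dl_zcomb by simp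
 then have "zcomb c (map (vf r) bs) = 0" unfolding i.Dl_zero using Dl_inverse[OF supp] by simp
 then show "c i = 0" using zindepD[OF bs(3)] i by simp
 qed
 have s: "set (map (%x. dl *v x) bs) <= carrier_vec r" using bs(1) mult_closed by auto
 show ?thesis unfolding int_basis_iff[OF dM] map im by (intro conjI s sp zi)
qed

text \<open>The descriptions defining the two covolumes have the same predicate, since
  \<open>dl\<close> and \<open>ep\<close> carry integral bases to integral bases with the same Gram
  matrix. No uniqueness has to be invoked for the metric \<open>h'\<close>.\<close>

lemma covolume_image:
 fixes dl :: "'a::number_field mat"
 assumes inv: "inverse_pair r dl ep" and M: "M <= carrier_vec r"
 and h: "!!x y. x : carrier_vec r ==> y : carrier_vec r ==> euclid_ip h' (dl *v x) (dl *v y) = euclid_ip h x y"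
 shows "covolume r (act dl M) h' = covolume r M h"
proof -
 interpret inverse_pair r dl ep by (rule inv)
 have dM: "act dl M <= carrier_vec r" using M mult_closed by blast
 let ?V = "module_vec TYPE('a) r" and ?G = "%h bs. sqrt (det (mat (length bs) (length bs) (%(i, j). euclid_ip h (bs ! i) (bs ! j))))"
 have G: "?G h' (map (%x. dl *v x) bs) = ?G h bs" if "set bs <= carrier_vec r" for bs
 proof -
 have "mat (length bs) (length bs) (%(i, j). euclid_ip h' (map (%x. dl *v x) bs ! i) (map (%x. dl *v x) bs ! j)) =
 mat (length bs) (length bs) (%(i, j). euclid_ip h (bs ! i) (bs ! j))"
 by (rule eq_matI) (use that in "simp_all add: h subset_code(1)")
 then show ?thesis by simp
 qed
 have "(EX bs. int_basis ?V (act dl M) bs & V = ?G h' bs) = (EX bs. int_basis ?V M bs & V = ?G h bs)" for V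
 proof
 assume "EX bs. int_basis ?V M bs & V = ?G h bs"
 then obtain bs where bs: "int_basis ?V M bs" "V = ?G h bs" by blast
 have "set bs <= carrier_vec r" using bs(1) unfolding int_basis_iff[OF M] by blast
 then have "V = ?G h' (map (%x. dl *v x) bs)" using G bs(2) by simp
 then show "EX bs. int_basis ?V (act dl M) bs & V = ?G h' bs" using int_basis_image[OF inv M bs(1)] by blast
 next
 assume "EX bs. int_basis ?V (act dl M) bs & V = ?G h' bs"
 then obtain bs where bs: "int_basis ?V (act dl M) bs" "V = ?G h' bs" by blast
 have bc: "set bs <= carrier_vec r" using bs(1) unfolding int_basis_iff[OF dM] by blast
 let ?bs = "map (%x. ep *v x) bs"
 have "int_basis ?V M ?bs" using int_basis_image[OF inverse_pair_sym dM bs(1)] image_cancel[OF M] by simp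
 moreover have "map (%x. dl *v x) ?bs = bs" unfolding map_map by (rule map_idI) (use bc cancel(1) in auto)
 moreover have "set ?bs <= carrier_vec r" using bc inverse_pair.mult_closed[OF inverse_pair_sym] by auto
 ultimately show "EX bs. int_basis ?V M bs & V = ?G h bs" using G[of ?bs] bs(2) by metis
 qed
 then show ?thesis unfolding covolume_def by simp
qed

text \<open>The ordinate \<open>node\<close> as a function of the matrix, in order to compare
  \<open>g\<close> with its translates.\<close>

definition lattice_node :: "nat => 'a::number_field adele mat => 'a vec set => real" where
 "lattice_node r g W = lattice_deg r (adelic_module r g Int W) (adelic_metric r g) -
 real (subspace_dim r W) * (lattice_deg r (adelic_module r g) (adelic_metric r g) / real r)"

text \<open>Module and metric of the translate are computed from those of \<open>g\<close>, so the
  lattice theory is developed for \<open>g\<close> alone.\<close>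

locale rational_translate = adelic_matrix r g + inverse_pair r dl ep
 for r and g :: "'a::number_field adele mat" and dl ep :: "'a mat"
begin

definition h :: "'a adele mat" where "h = rational_mult r dl g"

lemma h_eq: "h = mat_times AR (map_mat adele_diag dl) g"
 by (simp add: h_def rational_mult_def GL_adele_def units_of_def mat_monoid_def)

lemma h_dims: "dim_row h = r" "dim_col h = r"
 using dl dims by (simp_all add: h_eq mat_times_def)

lemma h_entry: "i < r ==> j < r ==> h $$ (i, j) = finsum AR (%k. adele_diag (dl $$ (i, k)) \<otimes>\<^bsub>AR\<^esub> g $$ (k, j)) {..<r}"
 unfolding h_eq mat_times_def using dl dims
 by (simp, intro AR.finsum_cong') (auto intro!: adele_mult_mem adele_diag_mem entries)

lemma h_fst: assumes v: "v : FP" and ij: "i < r" "j < r"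
 shows "fst (h $$ (i, j)) v = finsum (Lf v) (%k. local_emb v (dl $$ (i, k)) \<otimes>\<^bsub>Lf v\<^esub> GG v k j) {..<r}"
proof -
 have "fst (h $$ (i, j)) v = finsum (Lf v) (%k. fst (adele_diag (dl $$ (i, k)) \<otimes>\<^bsub>AR\<^esub> g $$ (k, j)) v) {..<r}"
 unfolding h_entry[OF ij] by (rule fst_adele_finsum[OF _ _ v]) (use ij in "auto intro!: adele_mult_mem adele_diag_mem entries")
 then show ?thesis using v by (simp add: adele_mult adele_diag_def)
qed

lemma h_snd: assumes w: "w : arch_places" and ij: "i < r" "j < r"
 shows "snd (h $$ (i, j)) w = (SUM k<r. arch_emb w (dl $$ (i, k)) * snd (g $$ (k, j)) w)"
proof -
 have "snd (h $$ (i, j)) w = (SUM k<r. snd (adele_diag (dl $$ (i, k)) \<otimes>\<^bsub>AR\<^esub> g $$ (k, j)) w)"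
 unfolding h_entry[OF ij] by (rule snd_adele_finsum[OF _ _ w]) (use ij in "auto intro!: adele_mult_mem adele_diag_mem entries")
 then show ?thesis using w by (simp add: adele_mult adele_diag_def)
qed

lemma h_times_vec:
 assumes v: "v : FP" and y: "ALL i<r. y $ i : local_integers v"
 shows "mat_times_vec (Lf v) (fin_comp h v) y = vec r (%i. finsum (Lf v) (%j. local_emb v (dl $$ (i, j)) \<otimes>\<^bsub>Lf v\<^esub>
 finsum (Lf v) (%k. GG v j k \<otimes>\<^bsub>Lf v\<^esub> y $ k) {..<r}) {..<r})"
proof -
 interpret nonarch v using v by (rule nonarch_place)
 note GGc = GG_carrier[OF v]
 have yc: "y $ k : carrier LF" if "k < r" for k using y that by (simp add: local_int_iff)
 have "finsum LF (%k. fin_comp h v $$ (i, k) ** y $ k) {..<r} =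
 finsum LF (%j. local_emb v (dl $$ (i, j)) ** finsum LF (%k. GG v j k ** y $ k) {..<r}) {..<r}"
 if i: "i < r" for i
 proof -
 have "finsum LF (%k. fin_comp h v $$ (i, k) ** y $ k) {..<r} =
 finsum LF (%k. finsum LF (%j. local_emb v (dl $$ (i, j)) ** GG v j k) {..<r} ** y $ k) {..<r}"
 by (rule LF.finsum_cong') (use i GGc yc in "auto simp: fin_comp_def h_dims h_fst[OF v] intro!: LF.m_closed LF.finsum_closed")
 also have "... = finsum LF (%j. local_emb v (dl $$ (i, j)) ** finsum LF (%k. GG v j k ** y $ k) {..<r}) {..<r}"
 by (rule LF.matrix_vector_assoc[symmetric]) (use i GGc yc in simp_all)
 finally show ?thesis .
 qed
 moreover have "dim_row (fin_comp h v) = r" "dim_col (fin_comp h v) = r" by (simp_all add: fin_comp_def h_dims)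
 ultimately show "mat_times_vec LF (fin_comp h v) y = vec r (%i. finsum LF (%j. local_emb v (dl $$ (i, j)) **
 finsum LF (%k. GG v j k ** y $ k) {..<r}) {..<r})"
 unfolding mat_times_vec_def by (intro eq_vecI) simp_all
qed

text \<open>One local vector \<open>y\<close> witnesses both \<open>x\<close> for \<open>g\<close>
  and \<open>dl\<close> applied to \<open>x\<close> for \<open>h\<close>. In the other direction
  \<open>ep\<close> cancels \<open>dl\<close> over each completion.\<close>

lemma module_translate: "adelic_module r h = act dl AM"
proof -
 interpret i: inverse_pair r ep dl by (rule inverse_pair_sym)
 have "dl *v x : adelic_module r h" if x: "x : AM" for x
 proof -
 have xc: "x : carrier_vec r" using x AM_carrier by blast
 have "EX y:carrier_vec r. (ALL i<r. y $ i : local_integers v) &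
 map_vec (local_emb v) (dl *v x) = mat_times_vec (Lf v) (fin_comp h v) y" if v: "v : FP" for v
 proof -
 interpret nonarch v using v by (rule nonarch_place)
 obtain y where y: "y : carrier_vec r" "ALL i<r. y $ i : local_integers v"
 "map_vec (local_emb v) x = mat_times_vec LF (fin_comp g v) y"
 using x v unfolding adelic_module_def by blast
 have yc: "y $ k : carrier LF" if "k < r" for k using y(2) that by (simp add: local_int_iff)
 have ex: "local_emb v (x $ j) = finsum LF (%k. GG v j k \<otimes>\<^bsub>LF\<^esub> y $ k) {..<r}" if "j < r" for j
 using arg_cong[OF y(3), of "%z. z $ j"] that xc unfolding fin_comp_times_vec[OF v y(2)] by simp
 have "map_vec (local_emb v) (dl *v x) = mat_times_vec LF (fin_comp h v) y"
 unfolding h_times_vec[OF v y(2)]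
 proof (rule eq_vecI)
 fix i assume "i < dim_vec (vec r (%i. finsum LF (%j. local_emb v (dl $$ (i, j)) \<otimes>\<^bsub>LF\<^esub> finsum LF (%k. GG v j k \<otimes>\<^bsub>LF\<^esub> y $ k) {..<r}) {..<r}))"
 then have i: "i < r" by simp
 have "local_emb v ((dl *v x) $ i) = finsum LF (%j. local_emb v (dl $$ (i, j)) \<otimes>\<^bsub>LF\<^esub> local_emb v (x $ j)) {..<r}"
 unfolding mult_vec_index[OF xc i] local_emb_sum[OF finite_lessThan] local_emb_hom(2) ..
 also have "... = finsum LF (%j. local_emb v (dl $$ (i, j)) \<otimes>\<^bsub>LF\<^esub> finsum LF (%k. GG v j k \<otimes>\<^bsub>LF\<^esub> y $ k) {..<r}) {..<r}"
 by (rule LF.finsum_cong') (use GG_carrier[OF v] yc in "auto simp: ex intro!: LF.m_closed LF.finsum_closed")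
 finally show "map_vec (local_emb v) (dl *v x) $ i =
 vec r (%i. finsum LF (%j. local_emb v (dl $$ (i, j)) \<otimes>\<^bsub>LF\<^esub> finsum LF (%k. GG v j k \<otimes>\<^bsub>LF\<^esub> y $ k) {..<r}) {..<r}) $ i"
 using i dl by (simp del: index_mult_mat_vec)
 qed (use dl in simp)
 then show ?thesis using y(1,2) by blast
 qed
 then show ?thesis unfolding adelic_module_def using mult_closed[OF xc] by blast
 qed
 moreover have "ep *v z : AM" if z: "z : adelic_module r h" for z
 proof -
 have zc: "z : carrier_vec r" using z unfolding adelic_module_def by blast
 have "EX y:carrier_vec r. (ALL i<r. y $ i : local_integers v) &
 map_vec (local_emb v) (ep *v z) = mat_times_vec (Lf v) (fin_comp g v) y" if v: "v : FP" for v
 proof -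
 interpret nonarch v using v by (rule nonarch_place)
 obtain y where y: "y : carrier_vec r" "ALL i<r. y $ i : local_integers v"
 "map_vec (local_emb v) z = mat_times_vec LF (fin_comp h v) y"
 using z v unfolding adelic_module_def by blast
 have yc: "y $ k : carrier LF" if "k < r" for k using y(2) that by (simp add: local_int_iff)
 define u where "u j = finsum LF (%k. GG v j k \<otimes>\<^bsub>LF\<^esub> y $ k) {..<r}" for j
 have uc: "u j : carrier LF" if "j < r" for j unfolding u_def using GG_carrier[OF v] yc that by (auto intro!: LF.finsum_closed)
 have ez: "local_emb v (z $ j) = finsum LF (%k. local_emb v (dl $$ (j, k)) \<otimes>\<^bsub>LF\<^esub> u k) {..<r}" if "j < r" for j
 using arg_cong[OF y(3), of "%z. z $ j"] that zc unfolding h_times_vec[OF v y(2)] u_def by simp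
 have ed: "finsum LF (%j. local_emb v (ep $$ (i, j)) \<otimes>\<^bsub>LF\<^esub> local_emb v (dl $$ (j, k))) {..<r} =
 (if i = k then \<one>\<^bsub>LF\<^esub> else \<zero>\<^bsub>LF\<^esub>)" if ik: "i < r" "k < r" for i k
 proof -
 have "(SUM j<r. ep $$ (i, j) * dl $$ (j, k)) = (if i = k then 1 else 0)"
 using mat_mult_index[OF ep dl ik] ik unfolding epdl by simp
 from arg_cong[OF this, of "local_emb v"] show ?thesis
 unfolding local_emb_sum[OF finite_lessThan] local_emb_hom(2) using local_emb_hom(3,4) by simp
 qed
 have "map_vec (local_emb v) (ep *v z) = mat_times_vec LF (fin_comp g v) y"
 unfolding fin_comp_times_vec[OF v y(2)] u_def[symmetric]
 proof (rule eq_vecI)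
 fix i assume "i < dim_vec (vec r u)"
 then have i: "i < r" by simp
 have "local_emb v ((ep *v z) $ i) = finsum LF (%j. local_emb v (ep $$ (i, j)) \<otimes>\<^bsub>LF\<^esub> local_emb v (z $ j)) {..<r}"
 unfolding i.mult_vec_index[OF zc i] local_emb_sum[OF finite_lessThan] local_emb_hom(2) ..
 also have "... = finsum LF (%j. local_emb v (ep $$ (i, j)) \<otimes>\<^bsub>LF\<^esub> finsum LF (%k. local_emb v (dl $$ (j, k)) \<otimes>\<^bsub>LF\<^esub> u k) {..<r}) {..<r}"
 by (rule LF.finsum_cong') (use uc in "auto simp: ez intro!: LF.m_closed LF.finsum_closed")
 also have "... = u i"
 by (rule LF.matrix_vector_cancel) (use i ed uc in simp_all)
 finally show "map_vec (local_emb v) (ep *v z) $ i = vec r u $ i"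
 using i ep by (simp del: index_mult_mat_vec)
 qed (use ep in simp)
 then show ?thesis using y(1,2) by blast
 qed
 then show ?thesis unfolding adelic_module_def using i.mult_closed[OF zc] by blast
 qed
 moreover have "adelic_module r h <= carrier_vec r" unfolding adelic_module_def by blast
 ultimately show ?thesis using cancel(1) by (metis (no_types, lifting) image_eqI image_subsetI subsetI subset_antisym subsetD)
qed

text \<open>The inverse of \<open>h\<close> at \<open>w\<close> is the inverse of \<open>g\<close>
  times \<open>Ee\<close>, and \<open>Ee\<close> cancels the image of \<open>dl\<close> on
  vectors.\<close>

lemma metric_translate:
 assumes xy: "x : carrier_vec r" "y : carrier_vec r"
 shows "euclid_ip (adelic_metric r h) (dl *v x) (dl *v y) = euclid_ip AH x y"
 unfolding euclid_ip_def
proof (intro sum.cong refl arg_cong[where f = Re])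
 fix w :: "('a => complex) set" assume w: "w : arch_places"
 note m = arch_comp_mult[OF w]
 define Ed where "Ed = map_mat (arch_emb w) dl"
 define Ee where "Ee = map_mat (arch_emb w) ep"
 have c: "Ed : carrier_mat r r" "Ee : carrier_mat r r" using dl ep by (simp_all add: Ed_def Ee_def)
 have em: "map_mat (arch_emb w) A * map_mat (arch_emb w) B = 1\<^sub>m r" if "A : carrier_mat r r" "B : carrier_mat r r" "A * B = 1\<^sub>m r" for A B
 proof (rule eq_matI)
 fix i k assume "i < dim_row (1\<^sub>m r :: complex mat)" "k < dim_col (1\<^sub>m r :: complex mat)"
 then have ik: "i < r" "k < r" by simp_all
 have mc: "map_mat (arch_emb w) A : carrier_mat r r" "map_mat (arch_emb w) B : carrier_mat r r" using that by simp_all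
 have "(map_mat (arch_emb w) A * map_mat (arch_emb w) B) $$ (i, k) = (SUM j<r. arch_emb w (A $$ (i, j)) * arch_emb w (B $$ (j, k)))"
 unfolding mat_mult_index[OF mc ik] using that ik by (intro sum.cong refl) simp
 also have "... = arch_emb w ((A * B) $$ (i, k))"
 unfolding mat_mult_index[OF that(1,2) ik] arch_emb_hom(5)[OF w] arch_emb_hom(2)[OF w] ..
 also have "... = 1\<^sub>m r $$ (i, k)" unfolding that(3) using ik arch_emb_hom(3,4)[OF w] by simp
 finally show "(map_mat (arch_emb w) A * map_mat (arch_emb w) B) $$ (i, k) = 1\<^sub>m r $$ (i, k)" .
 qed (use that in simp_all)
 have de: "Ed * Ee = 1\<^sub>m r" "Ee * Ed = 1\<^sub>m r" unfolding Ed_def Ee_def using em dl ep dlep epdl by blast+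
 have ah: "arch_comp h w = Ed * arch_comp g w"
 proof (rule eq_matI)
 fix i j assume "i < dim_row (Ed * arch_comp g w)" "j < dim_col (Ed * arch_comp g w)"
 then have ij: "i < r" "j < r" using c m by simp_all
 have "(Ed * arch_comp g w) $$ (i, j) = (SUM k<r. arch_emb w (dl $$ (i, k)) * snd (g $$ (k, j)) w)"
 unfolding mat_mult_index[OF c(1) m(3) ij] using ij dl dims
 by (intro sum.cong refl) (simp add: Ed_def arch_comp_def)
 then show "arch_comp h w $$ (i, j) = (Ed * arch_comp g w) $$ (i, j)"
 using ij h_dims h_snd[OF w ij] by (simp add: arch_comp_def del: index_mult_mat(1))
 qed (use c m h_dims in "simp_all add: arch_comp_def")
 have hi: "GLinv r (arch_comp h w) = arch_comp gi w * Ee"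
 proof (rule inv_GL_field(1))
 have "Ed * arch_comp g w * (arch_comp gi w * Ee) = Ed * (arch_comp g w * arch_comp gi w) * Ee"
 using assoc_mult_mat[OF c(1) m(3), of "arch_comp gi w * Ee" r] assoc_mult_mat[OF m(3,4) c(2)]
 assoc_mult_mat[OF c(1) _ c(2), of "arch_comp g w * arch_comp gi w"] m(3,4) c by simp
 also have "... = 1\<^sub>m r" unfolding m(1) using c de by simp
 finally show "arch_comp h w * (arch_comp gi w * Ee) = 1\<^sub>m r" unfolding ah .
 have "arch_comp gi w * Ee * (Ed * arch_comp g w) = arch_comp gi w * (Ee * Ed) * arch_comp g w"
 using assoc_mult_mat[OF m(4) c(2), of "Ed * arch_comp g w" r] assoc_mult_mat[OF c(2,1) m(3)]
 assoc_mult_mat[OF m(4) _ m(3), of "Ee * Ed"] m(3,4) c by simp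
 also have "... = 1\<^sub>m r" unfolding de(2) using m by simp
 finally show "arch_comp gi w * Ee * arch_comp h w = 1\<^sub>m r" unfolding ah .
 qed (use c m in "simp_all add: ah")
 have gi: "GLinv r (arch_comp g w) = arch_comp gi w"
 by (rule inv_GL_field(1)) (use m in auto)
 have tr: "arch_comp gi w * Ee *v map_vec (arch_emb w) (dl *v z) = arch_comp gi w *v map_vec (arch_emb w) z"
 if z: "z : carrier_vec r" for z
 proof -
 have mz: "map_vec (arch_emb w) z : carrier_vec r" using z by simp
 have "map_vec (arch_emb w) (dl *v z) = Ed *v map_vec (arch_emb w) z"
 proof (rule eq_vecI)
 fix i assume "i < dim_vec (Ed *v map_vec (arch_emb w) z)"
 then have i: "i < r" using c by simp
 have "(Ed *v map_vec (arch_emb w) z) $ i = (SUM j<r. arch_emb w (dl $$ (i, j)) * arch_emb w (z $ j))"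
 using c i z dl by (simp add: scalar_prod_def lessThan_atLeast0 Ed_def)
 also have "... = arch_emb w ((dl *v z) $ i)"
 unfolding mult_vec_index[OF z i] arch_emb_hom(5)[OF w] arch_emb_hom(2)[OF w] ..
 finally show "map_vec (arch_emb w) (dl *v z) $ i = (Ed *v map_vec (arch_emb w) z) $ i"
 using i dl by (simp del: index_mult_mat_vec)
 qed (use c dl in simp)
 moreover have "arch_comp gi w * Ee *v (Ed *v map_vec (arch_emb w) z) = arch_comp gi w *v (Ee *v (Ed *v map_vec (arch_emb w) z))"
 by (rule assoc_mult_mat_vec[OF m(4) c(2)]) (use c mz in simp)
 moreover have "Ee *v (Ed *v map_vec (arch_emb w) z) = map_vec (arch_emb w) z"
 using assoc_mult_mat_vec[OF c(2,1) mz, symmetric] mz unfolding de(2) by simp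
 ultimately show ?thesis by simp
 qed
 show "adelic_metric r h w (map_vec (arch_emb w) (dl *v x)) (map_vec (arch_emb w) (dl *v y)) =
 AH w (map_vec (arch_emb w) x) (map_vec (arch_emb w) y)"
 unfolding adelic_metric_def hi gi Let_def tr[OF xy(1)] tr[OF xy(2)] ..
qed

lemma deg_translate: assumes W: "W : subspaces r"
 shows "lattice_deg r (adelic_module r h Int act dl W) (adelic_metric r h) = lattice_deg r (AM Int W) AH"
proof -
 note dW = image_subspaces[OF W]
 have AMW: "AM Int W <= carrier_vec r" using AM_carrier by blast
 have im: "adelic_module r h Int act dl W = (%x. dl *v x) ` (AM Int W)"
 unfolding module_translate using inj_on_image_Int[OF inj AM_carrier subspacesD(1)[OF W]] by simp
 have "lattice_rank r ((%x. dl *v x) ` (AM Int W)) = subspace_dim r (act dl W)"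
 proof (rule lattice_rank_eq[OF dW])
 show "(%x. dl *v x) ` (AM Int W) <= act dl W" by blast
 fix z assume "z : act dl W"
 then obtain x where x: "x : W" "z = dl *v x" by blast
 obtain k :: int where k: "k ~= 0" "of_int k \<cdot>\<^sub>v x : AM Int W" using AM_multiple[OF W x(1)] by blast
 have "of_int k \<cdot>\<^sub>v z = dl *v (of_int k \<cdot>\<^sub>v x)" unfolding x(2) by (rule mult_mat_vec[OF dl subspacesD(5)[OF W x(1)], symmetric])
 then show "EX k::int. k ~= 0 & of_int k \<cdot>\<^sub>v z : (%x. dl *v x) ` (AM Int W)" using k by blast
 qed
 then have rk: "lattice_rank r ((%x. dl *v x) ` (AM Int W)) = lattice_rank r (AM Int W)"
 unfolding dim_image[OF W] rank_AM[OF W] .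
 have "covolume r ((%x. dl *v x) ` (AM Int W)) (adelic_metric r h) = covolume r (AM Int W) AH"
 by (rule covolume_image[OF _ AMW metric_translate]) (rule inverse_pair_axioms)
 then show ?thesis unfolding im lattice_deg_def lattice_volume_def rk by simp
qed

lemma node_translate: assumes W: "W : subspaces r"
 shows "lattice_node r (rational_mult r dl g) (act dl W) = lattice_node r g W"
proof -
 interpret i: inverse_pair r ep dl by (rule inverse_pair_sym)
 have "(%x. dl *v x) ` carrier_vec r = carrier_vec r"
 using mult_closed i.mult_closed cancel(1) by (metis (no_types, lifting) image_eqI image_subsetI subsetI subset_antisym)
 then have "lattice_deg r (adelic_module r h) (adelic_metric r h) = lattice_deg r AM AH"
 using deg_translate[OF subspaces_ends(2)] AM_carrier module_translate mult_closed
 by (metis Int_absorb2 image_mono)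
 then show ?thesis unfolding lattice_node_def h_def[symmetric] deg_translate[OF W] dim_image[OF W] by simp
qed

end

section \<open>Flags, their stabilizers and adapted bases\<close>

definition coord_sub :: "nat => nat => 'a::field vec set" where
 "coord_sub r d = {x : carrier_vec r. ALL i. d <= i & i < r --> x $ i = 0}"

lemma coord_mem: "coord_sub r d : subspaces r"
 by (auto simp: subspaces_iff coord_sub_def)

lemma coord_sub_0: "coord_sub r 0 = {0\<^sub>v r}" and coord_sub_r: "coord_sub r r = carrier_vec r"
 by (auto simp: coord_sub_def)

lemma coord_sub_dim: assumes d: "d <= r" shows "subspace_dim r (coord_sub r d :: 'a::field vec set) = d"
proof -
 have 1: "unit_funs d <= vf r ` (coord_sub r d :: 'a vec set)"
 proof
 fix f :: "nat => 'a" assume "f : unit_funs d"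
 then obtain j where j: "j < d" "f = (%i. if i = j then 1 else 0)" by (auto simp: unit_funs_def)
 have "f = vf r (vec r f)" using j d by (intro vf_vec[symmetric]) auto
 moreover have "vec r f : coord_sub r d" using j by (auto simp: coord_sub_def)
 ultimately show "f : vf r ` coord_sub r d" by (rule image_eqI)
 qed
 have 2: "vf r ` (coord_sub r d :: 'a vec set) <= FV.span (unit_funs d)"
 proof (rule image_subsetI)
 fix x :: "'a vec" assume "x : coord_sub r d"
 then show "vf r x : FV.span (unit_funs d)" by (intro supp_in_span) (auto simp: vf_def coord_sub_def)
 qed
 show ?thesis unfolding dim_eq_FV[OF coord_mem]
 using FV.basis_card_eq_dim[OF 1 2 unit_funs_independent] unit_funs_card[of d] by metis
qed

lemma coord_sub_strict: assumes "d < d'" "d' <= r" shows "coord_sub r d \<subset> (coord_sub r d' :: 'a::field vec set)"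
proof -
 have "coord_sub r d <= (coord_sub r d' :: 'a vec set)" using assms by (auto simp: coord_sub_def)
 moreover have "coord_sub r d ~= (coord_sub r d' :: 'a vec set)"
 using coord_sub_dim[of d r, where 'a = 'a] coord_sub_dim[of d' r, where 'a = 'a] assms by auto
 ultimately show ?thesis by blast
qed

lemma separating_functional:
 assumes W: "W : subspaces r" and u: "u : carrier_vec r" "u ~: (W :: 'a::field vec set)"
 obtains ph where "ALL x:W. (SUM j<r. ph j * x $ j) = 0" "(SUM j<r. ph j * u $ j) = 1"
proof -
 interpret FVF: vector_space_pair "%c (f :: nat => 'a) i. c * f i" "(*) :: 'a => 'a => 'a"
 by unfold_locales (auto simp: algebra_simps)
 obtain B where B: "B <= vf r ` W" "FV.independent B" "vf r ` W <= FV.span B" by (rule FV.maximal_independent_subset)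
 have "FV.span B <= vf r ` W" using B(1) vf_subspace[OF W] by (rule FV.span_minimal)
 moreover have "vf r u ~: vf r ` W"
 proof
 assume "vf r u : vf r ` W"
 then obtain x where x: "x : W" "vf r u = vf r x" by blast
 then show False using inj_onD[OF vf_inj x(2) u(1) subspacesD(5)[OF W x(1)]] u(2) by simp
 qed
 ultimately have un: "vf r u ~: FV.span B" by blast
 then have ind: "FV.independent (insert (vf r u) B)" using B(2) by (rule FV.independent_insertI)
 from FVF.linear_independent_extend[OF ind, of "%y. if y = vf r u then 1 else 0"]
 obtain g where g: "Vector_Spaces.linear (%c (f :: nat => 'a) i. c * f i) (*) g"
 and gB: "ALL x:insert (vf r u) B. g x = (if x = vf r u then 1 else 0)" by blast
 have g0: "g x = 0" if "x : FV.span B" for x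
 proof -
 have "B <= {x. g x = 0}"
 proof
 fix x assume x: "x : B"
 have "x ~= vf r u" using un FV.span_base[OF x] by auto
 then show "x : {x. g x = 0}" using gB x by simp
 qed
 moreover have "FV.subspace {x. g x = 0}"
 using FVF.linear_0[OF g] FVF.linear_add[OF g] FVF.linear_scale[OF g] by (auto simp: FV.subspace_def)
 ultimately have "FV.span B <= {x. g x = 0}" by (rule FV.span_minimal)
 then show ?thesis using that by blast
 qed
 define ph where "ph j = g (%i. if i = j then 1 else 0)" for j :: nat
 have gx: "g (vf r x) = (SUM j<r. ph j * x $ j)" for x
 proof -
 have 1: "vf r x = (SUM j<r. (%i. x $ j * (if i = j then 1 else 0)))"
 by (rule ext) (simp add: vf_def sum_fun_apply if_distrib cong: if_cong)
 have "g (vf r x) = (SUM j<r. x $ j * ph j)"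
 unfolding 1 FVF.linear_sum[OF g] FVF.linear_scale[OF g] ph_def ..
 also have "... = (SUM j<r. ph j * x $ j)" by (simp only: mult.commute)
 finally show ?thesis .
 qed
 show thesis
 proof (rule that[of ph])
 show "ALL x:W. (SUM j<r. ph j * x $ j) = 0" unfolding gx[symmetric] using g0 B(3) by blast
 show "(SUM j<r. ph j * u $ j) = 1" unfolding gx[symmetric] using gB by simp
 qed
qed

definition transv :: "nat => 'a => 'a vec => (nat => 'a) => 'a::field mat" where
 "transv r c w ph = mat r r (%(i, j). (if i = j then 1 else 0) + c * w $ i * ph j)"

lemma transv_carrier: "transv r c w ph : carrier_mat r r"
 by (simp add: transv_def)

lemma mat_vec_index:
 assumes "A : carrier_mat r r" "x : carrier_vec r" "i < r"
 shows "(A *v x) $ i = (SUM j<r. A $$ (i, j) * x $ j)"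
 using assms by (simp add: scalar_prod_def lessThan_atLeast0)

lemma transv_vec:
 assumes "w : carrier_vec r" "x : carrier_vec r"
 shows "transv r c w ph *v x = x + (c * (SUM j<r. ph j * x $ j)) \<cdot>\<^sub>v w"
proof (rule eq_vecI)
 fix i assume "i < dim_vec (x + (c * (SUM j<r. ph j * x $ j)) \<cdot>\<^sub>v w)"
 then have i: "i < r" using assms by simp
 have "(transv r c w ph *v x) $ i = (SUM j<r. ((if i = j then 1 else 0) + c * w $ i * ph j) * x $ j)"
 unfolding mat_vec_index[OF transv_carrier assms(2) i]
 by (rule sum.cong[OF refl]) (simp add: transv_def i)
 also have "... = (SUM j<r. (if i = j then x $ j else 0) + c * w $ i * (ph j * x $ j))"
 by (intro sum.cong refl) (simp add: algebra_simps)
 also have "... = x $ i + c * w $ i * (SUM j<r. ph j * x $ j)"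
 unfolding sum.distrib sum_distrib_left using i by simp
 also have "... = (x + (c * (SUM j<r. ph j * x $ j)) \<cdot>\<^sub>v w) $ i" using i assms by (simp add: algebra_simps)
 finally show "(transv r c w ph *v x) $ i = (x + (c * (SUM j<r. ph j * x $ j)) \<cdot>\<^sub>v w) $ i" .
qed (use assms in "simp add: transv_def")

text \<open>The rank-one map sending \<open>x\<close> to \<open>ph(x)\<close> times \<open>w\<close>
  has square \<open>ph(w)\<close> times itself. So the product of the two transvections is the one
  with parameter \<open>c + c' + c * c' * ph(w)\<close>.\<close>

lemma transv_mult:
 assumes w: "w : carrier_vec r" and c: "c + c' + c * c' * (SUM j<r. ph j * w $ j) = 0"
 shows "transv r c w ph * transv r c' w ph = 1\<^sub>m r"
proof (rule eq_matI)
 fix i k assume "i < dim_row (1\<^sub>m r :: 'a mat)" "k < dim_col (1\<^sub>m r :: 'a mat)"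
 then have ik: "i < r" "k < r" by simp_all
 have "(transv r c w ph * transv r c' w ph) $$ (i, k) =
 (SUM j<r. ((if i = j then 1 else 0) + c * w $ i * ph j) * ((if j = k then 1 else 0) + c' * w $ j * ph k))"
 unfolding mat_mult_index[OF transv_carrier transv_carrier ik] using ik
 by (intro sum.cong refl) (simp add: transv_def)
 also have "... = (SUM j<r. (if i = j then 1 else 0) * (if j = k then 1 else 0) + (if i = j then 1 else 0) * (c' * w $ j * ph k) +
 (if j = k then 1 else 0) * (c * w $ i * ph j) + c * c' * w $ i * ph k * (ph j * w $ j))"
 proof (rule sum.cong[OF refl])
 have *: "(a + c * x * p) * (b + c' * v * q) = a * b + a * (c' * v * q) + b * (c * x * p) + c * c' * x * q * (p * v)" for a b x p v q
 by (simp add: algebra_simps)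
 fix j show "((if i = j then 1 else 0) + c * w $ i * ph j) * ((if j = k then 1 else 0) + c' * w $ j * ph k) =
 (if i = j then 1 else 0) * (if j = k then 1 else 0) + (if i = j then 1 else 0) * (c' * w $ j * ph k) +
 (if j = k then 1 else 0) * (c * w $ i * ph j) + c * c' * w $ i * ph k * (ph j * w $ j)" by (rule *)
 qed
 also have "... = (if i = k then 1 else 0) + c' * w $ i * ph k + c * w $ i * ph k + c * c' * w $ i * ph k * (SUM j<r. ph j * w $ j)"
 proof -
 have l: "(SUM j<r. (if i = j then 1 else 0) * X j) = X i" for X :: "nat => 'a"
 unfolding mult_delta_left using ik(1) by simp
 have l': "(SUM j<r. (if j = k then 1 else 0) * X j) = X k" for X :: "nat => 'a"
 unfolding mult_delta_left using ik(2) by simp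
 show ?thesis unfolding sum.distrib l l' sum_distrib_left[symmetric] ..
 qed
 also have "... = (if i = k then 1 else 0) + w $ i * ph k * (c + c' + c * c' * (SUM j<r. ph j * w $ j))"
 proof -
 have *: "b + c' * x * q + c * x * q + c * c' * x * q * t = b + x * q * (c + c' + c * c' * t)" for b x q t
 by (simp add: algebra_simps)
 show ?thesis by (rule *)
 qed
 also have "... = 1\<^sub>m r $$ (i, k)" unfolding c using ik by simp
 finally show "(transv r c w ph * transv r c' w ph) $$ (i, k) = 1\<^sub>m r $$ (i, k)" .
qed (simp_all add: transv_def)

lemma is_flagD:
 assumes "is_flag r Ws"
 shows "Ws ~= []" "hd Ws = {0\<^sub>v r}" "last Ws = carrier_vec r" "!!W. W : set Ws ==> W : subspaces r" "sorted_wrt (\<subset>) Ws"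
 using assms unfolding is_flag_def subspaces_def by blast+

text \<open>A subspace stable under the stabilizer is a member of the flag: the transvections
 \<open>x \<mapsto> x + c ph(x) w\<close> with \<open>w\<close> in the smallest member \<open>W\<close> containing the subspace and \<open>ph\<close>
 vanishing on the predecessor of \<open>W\<close> move a suitable vector by every \<open>w\<close> in \<open>W\<close>.\<close>

lemma stable_subspace_in_flag:
 fixes U :: "'a::number_field vec set"
 assumes F: "is_flag r Ws" and U: "U : subspaces r"
 and st: "!!A x. A : flag_stabilizer r Ws ==> x : U ==> A *v x : U"
 shows "U : set Ws"
proof -
 note f = is_flagD[OF F]
 define j where "j = (LEAST j. j < length Ws & U <= Ws ! j)"
 have "length Ws - 1 < length Ws & U <= Ws ! (length Ws - 1)"
 using f(1,3) subspacesD(1)[OF U] by (simp add: last_conv_nth)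
 then have j: "j < length Ws & U <= Ws ! j" unfolding j_def by (rule LeastI)
 have min: "~ U <= Ws ! k" if "k < j" for k
 using not_less_Least[of k "%j. j < length Ws & U <= Ws ! j"] that j unfolding j_def[symmetric] by auto
 have Wj: "Ws ! j : set Ws" using j by simp
 have "Ws ! j <= U"
 proof (cases "j = 0")
 case True
 then have "Ws ! j = {0\<^sub>v r}" using f(1,2) by (simp add: hd_conv_nth)
 then show ?thesis using subspacesD(2)[OF U] by simp
 next
 case False
 have k: "j - 1 < j" "j - 1 < length Ws" using False j[THEN conjunct1] by linarith+
 then have Wk: "Ws ! (j - 1) : subspaces r" using f(4) by simp
 obtain u where u: "u : U" "u ~: Ws ! (j - 1)" using min[OF k(1)] by blast
 have uc: "u : carrier_vec r" by (rule subspacesD(5)[OF U u(1)])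
 obtain ph where phi: "ALL x:Ws ! (j - 1). (SUM j<r. ph j * x $ j) = 0" "(SUM j<r. ph j * u $ j) = 1"
 by (rule separating_functional[OF Wk uc u(2)])
 show ?thesis
 proof
 fix w assume w: "w : Ws ! j"
 have wc: "w : carrier_vec r" by (rule subspacesD(5)[OF f(4)[OF Wj] w])
 define s where "s = (SUM j<r. ph j * w $ j)"
 \<comment> \<open>The transvection with parameter \<open>c\<close> is invertible when
   \<open>1 + c * s\<close> is nonzero. The choice 1 fails only for \<open>s = -1\<close>, and there
   2 works.\<close>
 define c :: 'a where "c = (if s = -1 then 2 else 1)"
 have c: "c ~= 0" "1 + c * s ~= 0"
 proof -
 show "c ~= 0" by (simp add: c_def)
 show "1 + c * s ~= 0"
 proof (cases "s = -1")
 case False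
 then have "1 + s ~= 0" unfolding add_eq_0_iff .
 then show ?thesis using False by (simp add: c_def)
 qed (simp add: c_def)
 qed
 define c' where "c' = - c / (1 + c * s)"
 have "c' * (1 + c * s) = - c" using c(2) by (simp add: c'_def)
 moreover have "c + c' + c * c' * s = c + c' * (1 + c * s)" "c' + c + c' * c * s = c + c' * (1 + c * s)" by (simp_all add: algebra_simps)
 ultimately have cc: "c + c' + c * c' * s = 0" and cc': "c' + c + c' * c * s = 0" by simp_all
 note m = transv_mult[OF wc cc[unfolded s_def]] transv_mult[OF wc cc'[unfolded s_def]]
 have inv: "inverse_pair r (transv r c w ph) (transv r c' w ph)"
 by (intro inverse_pair.intro transv_carrier m)
 \<comment> \<open>Members before position \<open>j\<close> lie in the kernel of \<open>ph\<close>
   and are fixed pointwise; members from \<open>j\<close> on contain \<open>w\<close>, so adding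
   multiples of \<open>w\<close> does not leave them.\<close>
 have sub: "transv r d w ph *v x : W" if W: "W : set Ws" and x: "x : W" for d W x
 proof -
 obtain i where i: "i < length Ws" "W = Ws ! i" using W by (auto simp: in_set_conv_nth)
 have xc: "x : carrier_vec r" by (rule subspacesD(5)[OF f(4)[OF W] x])
 show ?thesis unfolding transv_vec[OF wc xc]
 proof (cases "i < j")
 case True
 then have "Ws ! i <= Ws ! (j - 1)"
 using k(2) by (intro psubset_nth_mono[OF f(5)]) linarith+
 then have "(SUM j<r. ph j * x $ j) = 0" using phi(1) x i(2) by blast
 then have "x + (d * (SUM j<r. ph j * x $ j)) \<cdot>\<^sub>v w = x" using xc wc by (intro eq_vecI) auto
 then show "x + (d * (SUM j<r. ph j * x $ j)) \<cdot>\<^sub>v w : W" using x by simp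
 next
 case False
 then have "Ws ! j <= Ws ! i" using i(1) by (intro psubset_nth_mono[OF f(5)]) linarith+
 then have "w : W" using w i(2) by blast
 then show "x + (d * (SUM j<r. ph j * x $ j)) \<cdot>\<^sub>v w : W"
 by (intro subspacesD(3)[OF f(4)[OF W] x] subspacesD(4)[OF f(4)[OF W]])
 qed
 qed
 have "(%x. transv r c w ph *v x) ` W = W" if W: "W : set Ws" for W
 proof
 show "(%x. transv r c w ph *v x) ` W <= W" using sub[OF W] by blast
 show "W <= (%x. transv r c w ph *v x) ` W"
 proof
 fix x assume x: "x : W"
 have "x = transv r c w ph *v (transv r c' w ph *v x)"
 using inverse_pair.cancel(1)[OF inv subspacesD(5)[OF f(4)[OF W] x]] by simp
 then show "x : (%x. transv r c w ph *v x) ` W" using sub[OF W x] by (rule image_eqI)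
 qed
 qed
 moreover have "transv r c w ph : carrier (GL_field r)"
 by (rule inv_GL_field(2)[OF transv_carrier transv_carrier m])
 ultimately have "transv r c w ph : flag_stabilizer r Ws" unfolding flag_stabilizer_def by blast
 \<comment> \<open>The transvection sends \<open>u\<close> to \<open>u + c w\<close>. Subtracting
   \<open>u\<close>, which lies in \<open>U\<close>, and dividing by \<open>c\<close> isolates
   \<open>w\<close>.\<close>
 from st[OF this u(1)] have "u + c \<cdot>\<^sub>v w : U" unfolding transv_vec[OF wc uc] phi(2) by simp
 from subspacesD(3)[OF U this subspacesD(4)[OF U u(1), of "-1"]] subspacesD(4)[OF U, of _ "1 / c"]
 have "(1 / c) \<cdot>\<^sub>v (u + c \<cdot>\<^sub>v w + (-1) \<cdot>\<^sub>v u) : U" by blast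
 moreover have "(1 / c) \<cdot>\<^sub>v (u + c \<cdot>\<^sub>v w + (-1) \<cdot>\<^sub>v u) = w" using uc wc c(1) by (intro eq_vecI) auto
 ultimately show "w : U" by simp
 qed
 qed
 then have "U = Ws ! j" using j by blast
 then show ?thesis using Wj by simp
qed

lemma stabilizer_mono_flag:
 fixes Ws Ws' :: "'a::number_field vec set list"
 assumes F: "is_flag r Ws" and F': "is_flag r Ws'" and sub: "flag_stabilizer r Ws <= flag_stabilizer r Ws'"
 shows "set Ws' <= set Ws"
proof
 fix U assume U: "U : set Ws'"
 show "U : set Ws"
 proof (rule stable_subspace_in_flag[OF F is_flagD(4)[OF F' U]])
 fix A x assume "A : flag_stabilizer r Ws" "x : U"
 from subsetD[OF sub this(1)] have "ALL W:set Ws'. (%x. A *v x) ` W = W"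
 unfolding flag_stabilizer_def mem_Collect_eq by (rule conjunct2)
 from bspec[OF this U] have "(%x. A *v x) ` U = U" .
 then show "A *v x : U" using \<open>x : U\<close> by blast
 qed
qed

lemma flag_of_stabilizer:
 fixes Ws :: "'a::number_field vec set list"
 assumes F: "is_flag r Ws" shows "parabolic_flag r (flag_stabilizer r Ws) = Ws"
 unfolding parabolic_flag_def
proof (rule the_equality)
 show "is_flag r Ws & flag_stabilizer r Ws = flag_stabilizer r Ws" using F by simp
 fix Ws' assume a: "is_flag r Ws' & flag_stabilizer r Ws = flag_stabilizer r Ws'"
 then have F': "is_flag r Ws'" by blast
 have e: "flag_stabilizer r Ws = flag_stabilizer r Ws'" using a by (rule conjunct2)
 have "set Ws' = set Ws"
 by (rule equalityI[OF stabilizer_mono_flag[OF F F'] stabilizer_mono_flag[OF F' F]]) (simp_all only: e order_refl)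
 then show "Ws' = Ws" by (rule psubset_sorted_unique[OF is_flagD(5)[OF F'] is_flagD(5)[OF F]])
qed

lemma extend_basis_list:
 assumes W: "W : subspaces r" and bs: "distinct bs" "FV.independent (set bs)" "set bs <= vf r ` (W :: 'a::field vec set)"
 shows "EX cs. distinct (bs @ cs) & FV.independent (set (bs @ cs)) & FV.span (set (bs @ cs)) = vf r ` W &
 length (bs @ cs) = subspace_dim r W"
proof -
 obtain C where C: "set bs <= C" "C <= vf r ` W" "FV.independent C" "vf r ` W <= FV.span C"
 by (rule FV.maximal_independent_subset_extend[OF bs(3,2)])
 have "C <= FV.span (unit_funs r)" using C(2) vf_in_span[of r W] by (rule subset_trans)
 from FV.independent_span_bound[OF fin_unit_funs C(3) this] have fC: "finite C" by (rule conjunct1)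
 obtain cs where cs: "set cs = C - set bs" "distinct cs" using finite_distinct_list[of "C - set bs"] fC by blast
 have s: "set (bs @ cs) = C" using cs(1) C(1) by auto
 have d: "distinct (bs @ cs)" using cs bs(1) by auto
 have "FV.span C = vf r ` W" using C(4) FV.span_minimal[OF C(2) vf_subspace[OF W]] by blast
 moreover have "length (bs @ cs) = subspace_dim r W"
 using distinct_card[OF d] FV.basis_card_eq_dim[OF C(2,4,3)] unfolding s dim_eq_FV[OF W] by simp
 ultimately show ?thesis using s d C(3) by metis
qed

lemma adapted_basis:
 assumes "Ws ~= []" "sorted_wrt (\<subset>) Ws" "ALL W:set Ws. W : subspaces r"
 shows "EX bs. distinct bs & FV.independent (set bs) & FV.span (set bs) = vf r ` last Ws & length bs = subspace_dim r (last Ws) &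
 (ALL W:set Ws. FV.span (set (take (subspace_dim r W) bs)) = vf r ` (W :: 'a::field vec set))"
 using assms
proof (induction Ws rule: rev_nonempty_induct)
 case (single W)
 have W: "W : subspaces r" using single by simp
 have e: "distinct ([] :: (nat => 'a) list)" "FV.independent (set ([] :: (nat => 'a) list))" "set [] <= vf r ` W"
 by (simp_all add: FV.independent_empty)
 from extend_basis_list[OF W e] obtain cs where "distinct cs" "FV.independent (set cs)" "FV.span (set cs) = vf r ` W"
 "length cs = subspace_dim r W" by auto
 then show ?case by (intro exI[of _ cs]) simp
next
 case (snoc W Ws)
 have W: "W : subspaces r" using snoc.prems by simp
 have "sorted_wrt (\<subset>) Ws" "ALL W:set Ws. W : subspaces r" using snoc.prems by (simp_all add: sorted_wrt_append)
 from snoc.IH[OF this] obtain bs where bs: "distinct bs" "FV.independent (set bs)" "FV.span (set bs) = vf r ` last Ws"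
 "length bs = subspace_dim r (last Ws)" "ALL W:set Ws. FV.span (set (take (subspace_dim r W) bs)) = vf r ` W" by blast
 have lW: "last Ws \<subset> W" using snoc.prems snoc.hyps by (simp add: sorted_wrt_append)
 have "set bs <= vf r ` last Ws" unfolding bs(3)[symmetric] using FV.span_superset by blast
 also have "... <= vf r ` W" using lW by blast
 finally have sb: "set bs <= vf r ` W" .
 from extend_basis_list[OF W bs(1,2) sb] obtain cs where cs: "distinct (bs @ cs)" "FV.independent (set (bs @ cs))"
 "FV.span (set (bs @ cs)) = vf r ` W" "length (bs @ cs) = subspace_dim r W" by blast
 have "FV.span (set (take (subspace_dim r V) (bs @ cs))) = vf r ` V" if V: "V : set (Ws @ [W])" for V
 proof (cases "V = W")
 case True
 have "take (subspace_dim r W) (bs @ cs) = bs @ cs" using cs(4) by simp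
 then show ?thesis using True cs(3) by simp
 next
 case False
 then have V': "V : set Ws" using V by simp
 have "V = last Ws \<or> V \<subset> last Ws"
 proof -
 obtain i where i: "i < length Ws" "V = Ws ! i" using V' by (auto simp: in_set_conv_nth)
 have "sorted_wrt (\<subset>) Ws" using snoc.prems by (simp add: sorted_wrt_append)
 from sorted_wrt_nth_less[OF this, of i "length Ws - 1"] show ?thesis
 using i snoc.hyps by (cases "i = length Ws - 1") (auto simp: last_conv_nth)
 qed
 then have le: "subspace_dim r V <= length bs"
 proof
 have Vs: "V : subspaces r" "last Ws : subspaces r" using snoc.prems snoc.hyps V' by simp_all
 assume "V \<subset> last Ws"
 from subspaces_lattice(6)[OF Vs this] show ?thesis using bs(4) by simp
 qed (simp add: bs(4))
 have te: "take (subspace_dim r V) (bs @ cs) = take (subspace_dim r V) bs" using le by simp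
 show ?thesis unfolding te using bs(5) V' by blast
 qed
 then show ?case using cs by (intro exI[of _ "bs @ cs"]) simp
qed

text \<open>The columns of \<open>dl\<close> form a basis adapted to the flag, so the first
  \<open>d\<close> of them, which span the image of \<open>coord_sub r d\<close>, span the member of
  dimension \<open>d\<close>.\<close>

lemma flag_transitive:
 assumes F: "is_flag r (Ws :: 'a::field vec set list)"
 obtains dl ep where "inverse_pair r dl ep" "ALL W:set Ws. (%x. dl *v x) ` coord_sub r (subspace_dim r W) = W"
proof -
 note f = is_flagD[OF F]
 have "ALL W:set Ws. W : subspaces r" using f(4) by blast
 from adapted_basis[OF f(1,5) this, unfolded f(3) subspaces_ends(4)]
 obtain bs :: "(nat => 'a) list" where b: "distinct bs & FV.independent (set bs) &
 FV.span (set bs) = vf r ` carrier_vec r & length bs = r &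
 (ALL W:set Ws. FV.span (set (take (subspace_dim r W) bs)) = vf r ` W)" by (rule exE)
 note bs = b[THEN conjunct1] b[THEN conjunct2, THEN conjunct2, THEN conjunct1]
 b[THEN conjunct2, THEN conjunct2, THEN conjunct2, THEN conjunct1]
 b[THEN conjunct2, THEN conjunct2, THEN conjunct2, THEN conjunct2]
 have supp: "(bs ! j) i = 0" if "j < r" "i >= r" for i j
 proof -
 have "bs ! j : vf r ` carrier_vec r" unfolding bs(2)[symmetric] using that bs(3) by (intro FV.span_base) simp
 then obtain a where "bs ! j = vf r a" by (rule imageE)
 then show ?thesis using vf_supp[OF that(2)] by simp
 qed
 have sum_nth: "(SUM v:set (take d bs). F v) = (SUM j<d. F (bs ! j))" if "d <= r" for F :: "(nat => 'a) => nat => 'a" and d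
 proof -
 have l: "length (take d bs) = d" using that bs(3) by simp
 have "(SUM v:set (take d bs). F v) = (SUM j<length (take d bs). F (take d bs ! j))"
 by (rule sum.reindex_bij_betw[OF bij_betw_nth, symmetric]) (use bs(1) in simp_all)
 also have "... = (SUM j<d. F (bs ! j))" unfolding l by (intro sum.cong refl) simp
 finally show ?thesis .
 qed
 \<comment> \<open>The coefficients of the unit vectors in the adapted basis; they become the
   entries of the inverse \<open>ep\<close>.\<close>
 have "EX u. ALL i<r. (%k. if k = i then 1 else 0) = (SUM j<r. (%k. u i (bs ! j) * (bs ! j) k))"
 proof -
 have "EX u. (%k. if k = i then 1 else 0) = (SUM j<r. (%k. u (bs ! j) * (bs ! j) k))" if i: "i < r" for i
 proof -
 have 1: "(%k. if k = i then 1 else 0 :: 'a) = vf r (vec r (%k. if k = i then 1 else 0))" using i by (intro vf_vec[symmetric]) auto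
 have "vf r (vec r (%k. if k = i then 1 else 0 :: 'a)) : FV.span (set bs)" unfolding bs(2) by (rule imageI) simp
 then have "(%k. if k = i then 1 else 0 :: 'a) : FV.span (set bs)" by (simp only: 1[symmetric])
 then obtain u where u: "(%k. if k = i then 1 else 0 :: 'a) = (SUM v:set bs. (%k. u v * v k))"
 unfolding FV.span_finite[OF finite_set] by (rule rangeE)
 have "take r bs = bs" using bs(3) by simp
 with sum_nth[of r "%v k. u v * v k"] have 2: "(SUM v:set bs. (%k. u v * v k)) = (SUM j<r. (%k. u (bs ! j) * (bs ! j) k))" by simp
 show ?thesis by (rule exI[of _ u], rule trans[OF u 2])
 qed
 then have "ALL i. EX u. i < r --> (%k. if k = i then 1 else 0) = (SUM j<r. (%k. u (bs ! j) * (bs ! j) k))" by blast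
 from choice[OF this] show ?thesis by blast
 qed
 then obtain u where u: "ALL i<r. (%k. if k = i then 1 else 0) = (SUM j<r. (%k. u i (bs ! j) * (bs ! j) k))" by blast
 define dl where "dl = mat r r (%(i, j). (bs ! j) i)"
 define ep where "ep = mat r r (%(j, i). u i (bs ! j))"
 have c: "dl : carrier_mat r r" "ep : carrier_mat r r" by (simp_all add: dl_def ep_def)
 have de: "dl * ep = 1\<^sub>m r"
 proof (rule eq_matI)
 fix i k assume "i < dim_row (1\<^sub>m r :: 'a mat)" "k < dim_col (1\<^sub>m r :: 'a mat)"
 then have ik: "i < r" "k < r" by simp_all
 have 1: "(dl * ep) $$ (i, k) = (SUM j<r. (bs ! j) i * u k (bs ! j))"
 unfolding mat_mult_index[OF c ik] using ik by (intro sum.cong refl) (simp add: dl_def ep_def)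
 have "(if i = k then 1 else 0) = (SUM j<r. u k (bs ! j) * (bs ! j) i)"
 using fun_cong[OF u[rule_format, OF ik(2)], of i] by (simp only: sum_fun_apply)
 then show "(dl * ep) $$ (i, k) = 1\<^sub>m r $$ (i, k)" unfolding 1 using ik by (simp add: mult.commute)
 qed (use c in simp_all)
 then have inv: "inverse_pair r dl ep"
 using mat_mult_left_right_inverse[OF c de] c by (intro inverse_pair.intro)
 interpret inverse_pair r dl ep by (rule inv)
 have vd: "vf r (dl *v x) = (SUM j<r. (%i. x $ j * (bs ! j) i))" if x: "x : carrier_vec r" for x
 proof
 fix i show "vf r (dl *v x) i = (SUM j<r. (%i. x $ j * (bs ! j) i)) i"
 proof (cases "i < r")
 case True
 have "vf r (dl *v x) i = (SUM j<r. dl $$ (i, j) * x $ j)" using True unfolding vf_def by (simp only: if_True mult_vec_index[OF x])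
 also have "... = (SUM j<r. x $ j * (bs ! j) i)" using True by (intro sum.cong refl) (simp add: dl_def mult.commute)
 finally show ?thesis by (simp add: sum_fun_apply)
 next
 case False
 then show ?thesis using supp by (simp add: vf_supp sum_fun_apply)
 qed
 qed
 have im: "vf r ` (%x. dl *v x) ` coord_sub r d = FV.span (set (take d bs))" if d: "d <= r" for d
 proof
 show "vf r ` (%x. dl *v x) ` coord_sub r d <= FV.span (set (take d bs))"
 proof
 fix y assume "y : vf r ` (%x. dl *v x) ` coord_sub r d"
 then obtain x where x: "x : coord_sub r d" "y = vf r (dl *v x)" by blast
 have xc: "x : carrier_vec r" using x(1) by (simp add: coord_sub_def)
 have "(%i. x $ j * (bs ! j) i) : FV.span (set (take d bs))" if j: "j < r" for j
 proof (cases "j < d")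
 case True
 then have "bs ! j : set (take d bs)" using d bs(3) by (auto simp: in_set_conv_nth)
 then show ?thesis by (intro FV.span_scale FV.span_base)
 next
 case False
 then have "x $ j = 0" using x(1) j by (simp add: coord_sub_def)
 then have z: "(%i. x $ j * (bs ! j) i) = 0" by (intro ext) simp
 show ?thesis unfolding z by (rule FV.span_zero)
 qed
 then show "y : FV.span (set (take d bs))" unfolding x(2) vd[OF xc] by (intro FV.span_sum) simp
 qed
 show "FV.span (set (take d bs)) <= vf r ` (%x. dl *v x) ` coord_sub r d"
 proof
 fix y assume "y : FV.span (set (take d bs))"
 then obtain a where "y = (SUM v:set (take d bs). (%i. a v * v i))" unfolding FV.span_finite[OF finite_set] by (rule rangeE)
 then have y: "y = (SUM j<d. (%i. a (bs ! j) * (bs ! j) i))" unfolding sum_nth[OF d, of "%v i. a v * v i"] .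
 define x where "x = vec r (%j. if j < d then a (bs ! j) else 0)"
 have xE: "x : coord_sub r d" by (simp add: x_def coord_sub_def)
 have xc: "x : carrier_vec r" by (simp add: x_def)
 have "vf r (dl *v x) = (SUM j<d. (%i. a (bs ! j) * (bs ! j) i))" unfolding vd[OF xc]
 proof (rule sum.mono_neutral_cong_right)
 show "ALL j:{..<r} - {..<d}. (%i. x $ j * (bs ! j) i) = 0" by (auto simp: x_def fun_eq_iff)
 show "(%i. x $ j * (bs ! j) i) = (%i. a (bs ! j) * (bs ! j) i)" if "j : {..<d}" for j
 using that d by (auto simp: x_def fun_eq_iff)
 qed (use d in auto)
 then have "y = vf r (dl *v x)" unfolding y by (rule sym)
 then show "y : vf r ` (%x. dl *v x) ` coord_sub r d" using xE by (simp only: imageI)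
 qed
 qed
 have all: "(%x. dl *v x) ` coord_sub r (subspace_dim r W) = W" if W: "W : set Ws" for W
 proof -
 have Ws: "W : subspaces r" by (rule f(4)[OF W])
 have d: "subspace_dim r W <= r"
 using subspaces_lattice(6)[OF Ws subspaces_ends(2)] subspacesD(1)[OF Ws] subspaces_ends(4)[of r, where 'a = 'a]
 by (cases "W = carrier_vec r") (auto simp: less_imp_le)
 have e: "vf r ` (%x. dl *v x) ` coord_sub r (subspace_dim r W) = vf r ` W" unfolding im[OF d] by (rule bspec[OF bs(4) W])
 have "(%x. dl *v x) ` coord_sub r (subspace_dim r W) <= carrier_vec r"
 using subspacesD(1)[OF image_subspaces[OF coord_mem]] .
 from iffD1[OF inj_on_image_eq_iff[OF vf_inj this subspacesD(1)[OF Ws]] e] show ?thesis .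
 qed
 show thesis by (rule that[OF inv], rule ballI, rule all)
qed

section \<open>Interpolation and concave polygons\<close>

lemma interp_segment:
 assumes len: "length xs = length ys" "2 <= length xs" and t: "hd xs <= t" "t <= last xs"
 obtains i where "Suc i < length xs" "xs ! i <= t" "t <= xs ! Suc i"
 "interpolation xs ys t = ys ! i + (ys ! Suc i - ys ! i) / (xs ! Suc i - xs ! i) * (t - xs ! i)"
proof -
 define i where "i = (LEAST i. t <= xs ! Suc i)"
 have ne: "xs ~= []" using len(2) by auto
 have e: "Suc (length xs - 2) = length xs - 1" using len(2) by linarith
 have l: "t <= xs ! Suc (length xs - 2)" unfolding e using t(2) ne by (simp add: last_conv_nth)
 have 1: "t <= xs ! Suc i" unfolding i_def using l by (rule LeastI)
 have "i <= length xs - 2" unfolding i_def using l by (rule Least_le)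
 then have 2: "Suc i < length xs" using len(2) by linarith
 have 3: "xs ! i <= t"
 proof (cases i)
 case 0
 then show ?thesis using t(1) ne by (simp add: hd_conv_nth)
 next
 case (Suc k)
 then have "~ t <= xs ! Suc k" using not_less_Least[of k "%i. t <= xs ! Suc i"] unfolding i_def[symmetric] by simp
 then show ?thesis using Suc by simp
 qed
 have "interpolation xs ys t = ys ! i + (ys ! Suc i - ys ! i) / (xs ! Suc i - xs ! i) * (t - xs ! i)"
 using t unfolding interpolation_def Let_def i_def by simp
 with 1 2 3 show thesis using that by blast
qed

lemma interp_node:
 assumes len: "length xs = length ys" "2 <= length xs" and s: "sorted_wrt (<) xs" and j: "j < length xs"
 shows "interpolation xs ys (xs ! j) = (ys ! j :: real)"
proof -
 have ne: "xs ~= []" using len(2) by auto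
 have mono: "xs ! a < xs ! b" if "a < b" "b < length xs" for a b using sorted_wrt_nth_less[OF s that] .
 have "hd xs <= xs ! j" using mono[of 0 j] j ne by (cases "j = 0") (simp_all add: hd_conv_nth less_imp_le)
 moreover have "xs ! j <= last xs" using mono[of j "length xs - 1"] j ne
 by (cases "j = length xs - 1") (simp_all add: last_conv_nth less_imp_le)
 ultimately obtain i where i: "Suc i < length xs" "xs ! i <= xs ! j" "xs ! j <= xs ! Suc i"
 "interpolation xs ys (xs ! j) = ys ! i + (ys ! Suc i - ys ! i) / (xs ! Suc i - xs ! i) * (xs ! j - xs ! i)"
 by (rule interp_segment[OF len])
 have "~ j < i" using mono[of j i] i(1,2) by auto
 moreover have "~ Suc i < j" using mono[of "Suc i" j] i(3) j by auto
 ultimately consider "j = i" | "j = Suc i" by linarith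
 then show ?thesis
 proof cases
 case 1
 then show ?thesis using i(4) by simp
 next
 case 2
 have nz: "xs ! Suc i - xs ! i ~= 0" using mono[of i "Suc i"] i(1) by simp
 have "interpolation xs ys (xs ! Suc i) = ys ! i + (ys ! Suc i - ys ! i) / (xs ! Suc i - xs ! i) * (xs ! Suc i - xs ! i)"
 using i(4) unfolding 2 .
 also have "... = ys ! Suc i" using nz by simp
 finally show ?thesis unfolding 2 .
 qed
qed

lemma segment_le_line:
 fixes a b t :: real
 assumes "a < b" "a <= t" "t <= b" "ya <= c + s * a" "yb <= c + s * b"
 shows "ya + (yb - ya) / (b - a) * (t - a) <= c + s * t"
proof -
 define l where "l = (t - a) / (b - a)"
 have l: "0 <= l" "l <= 1" "l * (b - a) = t - a" using assms(1-3) by (simp_all add: l_def)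
 have "(yb - ya) / (b - a) * (t - a) = (yb - ya) * l" by (simp add: l_def)
 then have "ya + (yb - ya) / (b - a) * (t - a) = (1 - l) * ya + l * yb" by (simp add: algebra_simps)
 also have "... <= (1 - l) * (c + s * a) + l * (c + s * b)" using l assms(4,5) by (intro add_mono mult_left_mono) simp_all
 also have "... = c + s * (a + l * (b - a))" by (simp add: algebra_simps)
 also have "... = c + s * t" unfolding l(3) by simp
 finally show ?thesis .
qed

lemma interp_le_line:
 assumes len: "length xs = length ys" "2 <= length xs" and s: "sorted_wrt (<) xs" and t: "hd xs <= t" "t <= last xs"
 and le: "!!j. j < length xs ==> ys ! j <= c + m * xs ! j"
 shows "interpolation xs ys t <= c + m * t"
proof -
 obtain i where i: "Suc i < length xs" "xs ! i <= t" "t <= xs ! Suc i"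
 "interpolation xs ys t = ys ! i + (ys ! Suc i - ys ! i) / (xs ! Suc i - xs ! i) * (t - xs ! i)"
 by (rule interp_segment[OF len t])
 show ?thesis unfolding i(4)
 by (rule segment_le_line[OF _ i(2,3) le le]) (use i(1) sorted_wrt_nth_less[OF s, of i "Suc i"] in simp_all)
qed

text \<open>The line \<open>l\<close> continues the segment \<open>k\<close> that contains
  \<open>t\<close>. Slopes decrease from left to right, so moving away from that segment
  \<open>p\<close> falls below \<open>l\<close> on either side: \<open>up\<close> follows the
  breakpoints to the right, \<open>down\<close> to the left.\<close>

lemma polygon_support:
 assumes p: "convex_polygon r p" and r: "r >= 1" and t: "0 <= t" "t <= real r"
 shows "EX c s. p t = c + s * t & (ALL u:{0..real r}. p u <= c + s * u)"
proof -
 obtain xs ss where xs: "length xs = Suc (length ss)" "sorted_wrt (<) xs" "hd xs = 0" "last xs = real r"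
 and seg: "ALL i<length ss. ALL t:{xs ! i..xs ! Suc i}. p t = p (xs ! i) + ss ! i * (t - xs ! i)"
 and ss: "sorted_wrt (>=) ss" using p unfolding convex_polygon_def by blast
 have ne: "xs ~= []" using xs(1) by auto
 have "length xs ~= 1"
 proof
 assume "length xs = 1"
 then have "hd xs = last xs" using ne by (simp add: hd_conv_nth last_conv_nth)
 then show False using xs(3,4) r by simp
 qed
 then have l2: "2 <= length xs" using xs(1) by linarith
 have segm: "EX i<length ss. xs ! i <= u & u <= xs ! Suc i" if u: "0 <= u" "u <= real r" for u
 proof -
 obtain i where "Suc i < length xs" "xs ! i <= u" "u <= xs ! Suc i"
 by (rule interp_segment[of xs xs u]) (use l2 u xs in simp_all)
 then show ?thesis using xs(1) by (intro exI[of _ i]) simp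
 qed
 have mono: "xs ! i < xs ! Suc i" if "i < length ss" for i using sorted_wrt_nth_less[OF xs(2), of i "Suc i"] that xs(1) by simp
 have dec: "ss ! j <= ss ! i" if "i <= j" "j < length ss" for i j
 using sorted_wrt_nth_less[OF ss, of i j] that by (cases "i = j") auto
 obtain k where k: "k < length ss" "xs ! k <= t" "t <= xs ! Suc k" using segm[OF t] by blast
 define l where "l u = p (xs ! k) + ss ! k * (u - xs ! k)" for u
 have ldiff: "l u - l u' = ss ! k * (u - u')" for u u' by (simp add: l_def algebra_simps)
 have seg_diff: "p u - p (xs ! j) = ss ! j * (u - xs ! j)" if "j < length ss" "xs ! j <= u" "u <= xs ! Suc j" for u j
 proof -
 have "u : {xs ! j..xs ! Suc j}" using that by simp
 from seg[rule_format, OF that(1) this] show ?thesis by simp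
 qed
 have up: "p (xs ! j) <= l (xs ! j)" if "k <= j" "j <= length ss" for j
 using that
 proof (induction j rule: dec_induct)
 case base
 show ?case by (simp add: l_def)
 next
 case (step j)
 have j: "j < length ss" using step.prems by simp
 have "p (xs ! Suc j) - p (xs ! j) = ss ! j * (xs ! Suc j - xs ! j)"
 by (rule seg_diff[OF j less_imp_le[OF mono[OF j]] order_refl])
 also have "... <= ss ! k * (xs ! Suc j - xs ! j)" using dec[OF step.hyps(1) j] mono[OF j] by (intro mult_right_mono) simp_all
 also have "... = l (xs ! Suc j) - l (xs ! j)" by (rule ldiff[symmetric])
 finally show ?case using step.IH j by simp
 qed
 have down: "p (xs ! j) <= l (xs ! j)" if "j <= k" for j
 using that
 proof (induction j rule: inc_induct)
 case base
 show ?case by (simp add: l_def)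
 next
 case (step j)
 have j: "j < length ss" using step.hyps k(1) by simp
 have "l (xs ! Suc j) - l (xs ! j) = ss ! k * (xs ! Suc j - xs ! j)" by (rule ldiff)
 also have "... <= ss ! j * (xs ! Suc j - xs ! j)" using dec[of j k] step.hyps k(1) mono[OF j] by (intro mult_right_mono) simp_all
 also have "... = p (xs ! Suc j) - p (xs ! j)" by (rule seg_diff[OF j less_imp_le[OF mono[OF j]] order_refl, symmetric])
 finally show ?case using step.IH by simp
 qed
 have "p u <= l u" if u: "u : {0..real r}" for u
 proof -
 have "0 <= u" "u <= real r" using u by simp_all
 from segm[OF this] obtain j where j: "j < length ss" "xs ! j <= u" "u <= xs ! Suc j" by blast
 show ?thesis
 proof (cases "k <= j")
 case True
 have "p u - p (xs ! j) <= ss ! k * (u - xs ! j)"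
 unfolding seg_diff[OF j] using dec[OF True j(1)] j(2) by (intro mult_right_mono) simp_all
 then show ?thesis using up[OF True] j(1) ldiff[of u "xs ! j"] by simp
 next
 case False
 have e: "p (xs ! Suc j) - p u = ss ! j * (xs ! Suc j - u)"
 using seg_diff[OF j] seg_diff[OF j(1) less_imp_le[OF mono[OF j(1)]] order_refl] by (simp add: algebra_simps)
 have "ss ! k * (xs ! Suc j - u) <= p (xs ! Suc j) - p u"
 unfolding e using dec[of j k] False k(1) j(3) by (intro mult_right_mono) simp_all
 then show ?thesis using down[of "Suc j"] False ldiff[of "xs ! Suc j" u] by simp
 qed
 qed
 moreover have "p t = l t" using seg_diff[OF k] by (simp add: l_def)
 moreover have "l u = (p (xs ! k) - ss ! k * xs ! k) + ss ! k * u" for u by (simp add: l_def algebra_simps)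
 ultimately show ?thesis by (intro exI[of _ "p (xs ! k) - ss ! k * xs ! k"] exI[of _ "ss ! k"]) simp
qed

text \<open>The chord inequality \<open>key\<close> comes from a supporting line at
  \<open>u\<close>. Adding it for \<open>u = c\<close> and \<open>u = d\<close> gives the claim,
  because \<open>a + b = c + d\<close> makes the weights of \<open>p a\<close> and of
  \<open>p b\<close> each add up to \<open>b - a\<close>.\<close>

lemma convex_polygon_concave:
 assumes p: "convex_polygon r p" and r: "r >= 1" and abcd: "a <= c" "c <= b" "a + b = c + d" "b <= r"
 shows "p (real a) + p (real b) <= p (real c) + p (real d)"
proof (cases "a = b")
 case True
 then show ?thesis using abcd by simp
next
 case False
 then have ab: "real a < real b" using abcd by simp
 have key: "(real b - real u) * p (real a) + (real u - real a) * p (real b) <= (real b - real a) * p (real u)"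
 if u: "a <= u" "u <= b" for u
 proof -
 have "0 <= real u" "real u <= real r" using u abcd(4) by simp_all
 from polygon_support[OF p r this]
 obtain c0 s where cs: "p (real u) = c0 + s * real u" "ALL u:{0..real r}. p u <= c0 + s * u" by blast
 have pa: "p (real a) <= c0 + s * real a" and pb: "p (real b) <= c0 + s * real b" using cs(2) u abcd(4) by simp_all
 have "(real b - real u) * p (real a) + (real u - real a) * p (real b) <=
 (real b - real u) * (c0 + s * real a) + (real u - real a) * (c0 + s * real b)"
 using u by (intro add_mono mult_left_mono pa pb) simp_all
 also have "... = (real b - real a) * p (real u)" unfolding cs(1) by (simp add: algebra_simps)
 finally show ?thesis .
 qed
 have d: "a <= d" "d <= b" using abcd by linarith+
 have rd: "real d = real a + real b - real c" using abcd(3) by linarith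
 have "(real b - real a) * (p (real a) + p (real b)) =
 ((real b - real c) * p (real a) + (real c - real a) * p (real b)) + ((real b - real d) * p (real a) + (real d - real a) * p (real b))"
 unfolding rd by (simp add: algebra_simps)
 also have "... <= (real b - real a) * p (real c) + (real b - real a) * p (real d)"
 by (intro add_mono key abcd(1,2) d)
 also have "... = (real b - real a) * (p (real c) + p (real d))" by (simp add: algebra_simps)
 finally show ?thesis using ab by simp
qed

definition flag_dims :: "nat => 'a::field vec set list => real list" where
 "flag_dims r Ws = map (%W. real (subspace_dim r W)) Ws"

lemma parabolic_polygon_flag:
 "is_flag r Ws ==> parabolic_polygon r g (flag_stabilizer r Ws) = interpolation (flag_dims r Ws) (map (lattice_node r g) Ws)"
 unfolding parabolic_polygon_def Let_def flag_dims_def lattice_node_def by (simp add: flag_of_stabilizer)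

lemma flag_dims:
 assumes F: "is_flag r (Ws :: 'a::field vec set list)" and r: "r >= 1"
 shows "sorted_wrt (<) (flag_dims r Ws)" "hd (flag_dims r Ws) = 0" "last (flag_dims r Ws) = real r" "2 <= length (flag_dims r Ws)"
 "length (flag_dims r Ws) = length Ws"
proof -
 note f = is_flagD[OF F]
 show "sorted_wrt (<) (flag_dims r Ws)" unfolding flag_dims_def sorted_wrt_map
 by (rule sorted_wrt_mono_rel[OF _ f(5)]) (simp add: subspaces_lattice(6) f(4))
 show h: "hd (flag_dims r Ws) = 0" unfolding flag_dims_def using f(1,2) subspaces_ends(3)[of r, where 'a = 'a] by (simp add: hd_map)
 show l: "last (flag_dims r Ws) = real r" unfolding flag_dims_def using f(1,3) subspaces_ends(4)[of r, where 'a = 'a] by (simp add: last_map)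
 show len: "length (flag_dims r Ws) = length Ws" by (simp add: flag_dims_def)
 have ne: "flag_dims r Ws ~= []" using f(1) by (simp add: flag_dims_def)
 have "length (flag_dims r Ws) ~= 1"
 proof
 assume "length (flag_dims r Ws) = 1"
 then have "hd (flag_dims r Ws) = last (flag_dims r Ws)" using ne by (simp add: hd_conv_nth last_conv_nth)
 then show False using h l r by simp
 qed
 moreover have "length (flag_dims r Ws) ~= 0" using ne by simp
 ultimately show "2 <= length (flag_dims r Ws)" by linarith
qed

section \<open>The canonical polygon and the subspaces above \<open>p\<close>\<close>

context adelic_matrix begin

lemma node_lattice_node: "node = lattice_node r g"
 by (rule ext) (simp add: node_def lattice_node_def)

definition above :: "(real => real) => 'a vec set set" where
 "above p = {W : subspaces r. node W > p (real (subspace_dim r W))}"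

text \<open>At every point the polygon \<open>q\<close> of the Harder-Narasimhan flag touches a line
  that lies above all nodes. Hence \<open>q\<close> dominates all parabolic polygons and is the
  canonical one, and a bound by \<open>p\<close> on \<open>q\<close> bounds every node. Conversely,
  a supporting line of \<open>p\<close> at \<open>t\<close> that bounds the nodes of the flag bounds
  their interpolation at \<open>t\<close>.\<close>

lemma canonical_polygon_le_iff:
 assumes r: "r >= 1" and p: "convex_polygon r p"
 shows "(ALL t:{0..real r}. canonical_polygon r g t <= p t) \<longleftrightarrow> above p = {}"
proof -
 interpret SL: supermodular_lattice "subspaces r" subspace_join "subspace_dim r" "{0\<^sub>v r}" "carrier_vec r" r node
 by (rule node_lattice[OF r])
 obtain Ws where Ws: "Ws ~= []" "hd Ws = {0\<^sub>v r}" "last Ws = carrier_vec r" "set Ws <= subspaces r" "sorted_wrt (\<subset>) Ws"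
 and lines: "ALL i. Suc i < length Ws --> (EX (s::real) (c::real). node (Ws ! i) = c + s * subspace_dim r (Ws ! i) &
 node (Ws ! Suc i) = c + s * subspace_dim r (Ws ! Suc i) & (ALL A:subspaces r. node A <= c + s * subspace_dim r A))"
 proof (rule SL.harder_narasimhan)
 fix Ws assume a: "Ws ~= []" "hd Ws = {0\<^sub>v r}" "last Ws = carrier_vec r" "set Ws <= subspaces r" "sorted_wrt (\<subset>) Ws"
 "!!i. Suc i < length Ws ==> EX (s::real) (c::real). node (Ws ! i) = c + s * subspace_dim r (Ws ! i) &
 node (Ws ! Suc i) = c + s * subspace_dim r (Ws ! Suc i) & (ALL A:subspaces r. node A <= c + s * subspace_dim r A)"
 show thesis by (rule that[OF a(1-5)], intro allI impI, rule a(6))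
 qed
 have F: "is_flag r Ws" unfolding is_flag_def using Ws unfolding subspaces_def by blast
 note fd = flag_dims[OF F r]
 define q where "q = parabolic_polygon r g (flag_stabilizer r Ws)"
 have q: "q = interpolation (flag_dims r Ws) (map node Ws)"
 unfolding q_def parabolic_polygon_flag[OF F] node_lattice_node ..
 have len: "length (flag_dims r Ws) = length (map node Ws)" using fd(5) by simp
 have supp: "EX c s. q t = c + s * t & (ALL A:subspaces r. node A <= c + s * real (subspace_dim r A))"
 if t: "0 <= t" "t <= real r" for t
 proof -
 have t': "hd (flag_dims r Ws) <= t" "t <= last (flag_dims r Ws)" using t fd by simp_all
 obtain i where i: "Suc i < length (flag_dims r Ws)" "flag_dims r Ws ! i <= t" "t <= flag_dims r Ws ! Suc i"
 "q t = map node Ws ! i + (map node Ws ! Suc i - map node Ws ! i) /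
 (flag_dims r Ws ! Suc i - flag_dims r Ws ! i) * (t - flag_dims r Ws ! i)"
 unfolding q by (rule interp_segment[OF len fd(4) t'])
 have il: "Suc i < length Ws" using i(1) fd(5) by simp
 obtain s c :: real where cs: "node (Ws ! i) = c + s * subspace_dim r (Ws ! i)"
 "node (Ws ! Suc i) = c + s * subspace_dim r (Ws ! Suc i)" "ALL A:subspaces r. node A <= c + s * subspace_dim r A"
 using lines[THEN spec, THEN mp, OF il] by blast
 have x: "flag_dims r Ws ! i = real (subspace_dim r (Ws ! i))" "flag_dims r Ws ! Suc i = real (subspace_dim r (Ws ! Suc i))"
 using il by (simp_all add: flag_dims_def)
 have lt: "flag_dims r Ws ! i < flag_dims r Ws ! Suc i" using sorted_wrt_nth_less[OF fd(1), of i "Suc i"] i(1) by simp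
 have "q t = (c + s * flag_dims r Ws ! i) + s * (flag_dims r Ws ! Suc i - flag_dims r Ws ! i) /
 (flag_dims r Ws ! Suc i - flag_dims r Ws ! i) * (t - flag_dims r Ws ! i)"
 unfolding i(4) using il cs(1,2) x by (simp add: algebra_simps)
 also have "... = c + s * t"
 proof -
 have "s * (flag_dims r Ws ! Suc i - flag_dims r Ws ! i) / (flag_dims r Ws ! Suc i - flag_dims r Ws ! i) = s" using lt by simp
 then show ?thesis by (simp add: algebra_simps)
 qed
 finally show ?thesis using cs(3) by blast
 qed
 have dom: "parabolic_polygon r g (flag_stabilizer r Ws') t <= q t" if F': "is_flag r Ws'" and t: "0 <= t" "t <= real r" for Ws' t
 proof -
 note fd' = flag_dims[OF F' r]
 obtain c s where cs: "q t = c + s * t" "ALL A:subspaces r. node A <= c + s * real (subspace_dim r A)" using supp[OF t] by blast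
 show ?thesis unfolding cs(1) parabolic_polygon_flag[OF F'] node_lattice_node[symmetric]
 proof (rule interp_le_line[OF _ fd'(4,1)])
 fix j assume "j < length (flag_dims r Ws')"
 then have j: "j < length Ws'" using fd'(5) by simp
 then have "Ws' ! j : subspaces r" using is_flagD(4)[OF F'] by simp
 then show "map node Ws' ! j <= c + s * flag_dims r Ws' ! j" using cs(2) j by (simp add: flag_dims_def)
 qed (use t fd' in simp_all)
 qed
 have can: "canonical_polygon r g = q" unfolding canonical_polygon_def
 proof (rule the_equality)
 show "(EX Q:parabolics r. q = parabolic_polygon r g Q) & (ALL Q:parabolics r. ALL t:{0..real r}. parabolic_polygon r g Q t <= q t)"
 using F dom unfolding parabolics_def q_def by auto
 fix q' assume a: "(EX Q:parabolics r. q' = parabolic_polygon r g Q) & (ALL Q:parabolics r. ALL t:{0..real r}. parabolic_polygon r g Q t <= q' t)"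
 then obtain Ws' where F': "is_flag r Ws'" and q': "q' = parabolic_polygon r g (flag_stabilizer r Ws')" unfolding parabolics_def by blast
 have sp: "flag_stabilizer r Ws : parabolics r" unfolding parabolics_def using F by blast
 show "q' = q"
 proof
 fix t
 show "q' t = q t"
 proof (cases "t : {0..real r}")
 case True
 have "q t <= q' t" using a sp True unfolding q_def by blast
 moreover have "q' t <= q t" unfolding q' using dom[OF F'] True by simp
 ultimately show ?thesis by simp
 next
 case False
 \<comment> \<open>Outside \<open>[0, r]\<close> both interpolations have the default value of
   \<open>restrict\<close>, so the polygons agree as functions and not just on the interval.\<close>
 then have "t ~: {hd (flag_dims r Ws)..last (flag_dims r Ws)}" "t ~: {hd (flag_dims r Ws')..last (flag_dims r Ws')}"
 using fd flag_dims[OF F' r] by simp_all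
 then show ?thesis unfolding q q' parabolic_polygon_flag[OF F'] interpolation_def by (simp only: restrict_def if_False)
 qed
 qed
 qed
 show ?thesis
 proof
 assume le: "ALL t:{0..real r}. canonical_polygon r g t <= p t"
 have "node W <= p (real (subspace_dim r W))" if W: "W : subspaces r" for W
 proof -
 have d: "0 <= real (subspace_dim r W)" "real (subspace_dim r W) <= real r" using subspace_dim_le[OF W] by simp_all
 obtain c s where cs: "q (real (subspace_dim r W)) = c + s * real (subspace_dim r W)"
 "ALL A:subspaces r. node A <= c + s * real (subspace_dim r A)" using supp[OF d] by blast
 have "node W <= q (real (subspace_dim r W))" using cs W by simp
 also have "... <= p (real (subspace_dim r W))" using le d unfolding can by simp
 finally show ?thesis .
 qed
 then show "above p = {}" unfolding above_def by (auto simp: not_less)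
 next
 assume ab: "above p = {}"
 have le: "node W <= p (real (subspace_dim r W))" if W: "W : subspaces r" for W
 proof (rule ccontr)
 assume "~ ?thesis"
 then have "W : above p" unfolding above_def using W by simp
 then show False using ab by blast
 qed
 show "ALL t:{0..real r}. canonical_polygon r g t <= p t"
 proof
 fix t assume t: "t : {0..real r}"
 then obtain c s where cs: "p t = c + s * t" "ALL u:{0..real r}. p u <= c + s * u"
 using polygon_support[OF p r, of t] by auto
 show "canonical_polygon r g t <= p t" unfolding can q cs(1)
 proof (rule interp_le_line[OF len fd(4,1)])
 fix j assume "j < length (flag_dims r Ws)"
 then have j: "j < length Ws" using fd(5) by simp
 then have W: "Ws ! j : subspaces r" using Ws(4) by auto
 have "node (Ws ! j) <= p (real (subspace_dim r (Ws ! j)))" by (rule le[OF W])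
 also have "... <= c + s * real (subspace_dim r (Ws ! j))" using cs(2) subspace_dim_le[OF W] by simp
 finally show "map node Ws ! j <= c + s * flag_dims r Ws ! j" using j by (simp add: flag_dims_def)
 qed (use t fd in simp_all)
 qed
 qed
qed

lemma finite_above:
 assumes r: "r >= 1" shows "finite (above p)"
proof -
 interpret SL: supermodular_lattice "subspaces r" subspace_join "subspace_dim r" "{0\<^sub>v r}" "carrier_vec r" r node
 by (rule node_lattice[OF r])
 show ?thesis unfolding above_def by (rule SL.finite_gt[of "%d. p (real d)"])
qed

text \<open>If no subspace lies above \<open>p\<close>, the empty chain alone remains and
  contributes 1. Otherwise \<open>meet_witness\<close>, applied to the values of \<open>p\<close> at
  integers, supplies the subspace for the contraction.\<close>

lemma alternating_sum_above:
 assumes r: "r >= 1" and p: "convex_polygon r p"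
 shows "(SUM K:chains_in (above p). (-1) ^ card K :: real) = of_bool (above p = {})"
proof (cases "above p = {}")
 case True
 then have "chains_in (above p) = {{}}" by (auto simp: chains_in_def)
 then show ?thesis using True by simp
next
 case False
 interpret SL: supermodular_lattice "subspaces r" subspace_join "subspace_dim r" "{0\<^sub>v r}" "carrier_vec r" r node
 by (rule node_lattice[OF r])
 have "EX W:above p. ALL A:above p. A Int W : above p"
 by (rule SL.meet_witness[of "%d. p (real d)"]) (use convex_polygon_concave[OF p r] False in "auto simp: above_def")
 then obtain W where W: "W : above p" "ALL A:above p. A Int W : above p" by blast
 have "(SUM K:chains_in (above p). (-1) ^ card K :: real) = 0"
 by (rule alternating_sum_chains_zero[OF finite_above[OF r] W(1)]) (use W(2) in blast)
 then show ?thesis using False by simp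
qed

end

section \<open>Standard parabolic subgroups\<close>

lemma GL_group: "group (GL_field r :: 'a::field mat monoid)"
proof -
 interpret R: ring "ring_mat TYPE('a) r ()" by (rule ring_mat)
 show ?thesis unfolding GL_field_def by (rule R.units_group)
qed

lemma GL_simps: "A \<otimes>\<^bsub>GL_field r\<^esub> B = A * (B :: 'a::field mat)" "\<one>\<^bsub>GL_field r\<^esub> = (1\<^sub>m r :: 'a mat)"
 by (simp_all add: GL_field_def units_of_mult units_of_one ring_mat_simps)

lemma GL_inverse: assumes "A : carrier (GL_field r)" shows "inverse_pair r A (GLinv r (A :: 'a::field mat))"
proof -
 obtain B where B: "inverse_pair r A B" by (rule inverse_pair_GL[OF assms])
 have "GLinv r A = B"
 by (rule inv_GL_field(1)[OF inverse_pair.dl[OF B] inverse_pair.ep[OF B] inverse_pair.dlep[OF B] inverse_pair.epdl[OF B]])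
 then show ?thesis using B by simp
qed

lemma act_mult:
 assumes "A : carrier_mat r r" "B : carrier_mat r r" "W <= carrier_vec r"
 shows "act (A * B) W = act A (act B W)"
 unfolding image_image by (rule image_cong[OF refl], rule assoc_mult_mat_vec[OF assms(1,2)]) (rule subsetD[OF assms(3)])

lemma act_cancel:
 assumes A: "A : carrier (GL_field r)" and W: "W <= carrier_vec r"
 shows "act (GLinv r A) (act A W) = W" "act A (act (GLinv r A) W) = W"
 using inverse_pair.image_cancel[OF GL_inverse[OF A] W]
 inverse_pair.image_cancel[OF inverse_pair.inverse_pair_sym[OF GL_inverse[OF A]] W] .

lemma GL_carrier_mat: "A : carrier (GL_field r) ==> A : carrier_mat r r"
 by (rule inverse_pair.dl[OF GL_inverse])

lemma act_subspaces: "A : carrier (GL_field r) ==> W : subspaces r ==> act A W : subspaces r"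
 and act_dim: "A : carrier (GL_field r) ==> W : subspaces r ==> subspace_dim r (act A W) = subspace_dim r W"
 by (rule inverse_pair.image_subspaces[OF GL_inverse], assumption+)
 (rule inverse_pair.dim_image[OF GL_inverse], assumption+)

lemma act_eq_if_subset:
 assumes A: "A : carrier (GL_field r)" and W: "W : subspaces r" and sub: "act A W <= W"
 shows "act A W = W"
proof (rule ccontr)
 assume "act A W ~= W"
 then have "act A W \<subset> W" using sub by blast
 from subspaces_lattice(6)[OF act_subspaces[OF A W] W this] show False by (simp add: act_dim[OF A W])
qed

lemma flag_stabilizer_subgroup:
 assumes F: "is_flag r (Ws :: 'a::field vec set list)"
 shows "subgroup (flag_stabilizer r Ws) (GL_field r)"
proof (rule group.subgroupI[OF GL_group])
 interpret G: group "GL_field r :: 'a mat monoid" by (rule GL_group)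
 have Wc: "W <= carrier_vec r" if "W : set Ws" for W by (rule subspacesD(1)[OF is_flagD(4)[OF F that]])
 show "flag_stabilizer r Ws <= carrier (GL_field r)" unfolding flag_stabilizer_def by blast
 have "act (1\<^sub>m r) W = W" if "W : set Ws" for W
 proof -
 have "act (1\<^sub>m r) W = (%x. x) ` W"
 by (rule image_cong[OF refl], rule one_mult_mat_vec) (rule subsetD[OF Wc[OF that]])
 then show ?thesis by simp
 qed
 then have "\<one>\<^bsub>GL_field r\<^esub> : flag_stabilizer r Ws" unfolding flag_stabilizer_def using G.one_closed by (simp add: GL_simps)
 then show "flag_stabilizer r Ws ~= {}" by blast
 fix A assume "A : flag_stabilizer r Ws"
 then have A: "A : carrier (GL_field r)" "!!W. W : set Ws ==> act A W = W" unfolding flag_stabilizer_def by blast+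
 have "act (GLinv r A) W = W" if "W : set Ws" for W
 using act_cancel(1)[OF A(1) Wc[OF that]] A(2)[OF that] by simp
 then show "GLinv r A : flag_stabilizer r Ws" unfolding flag_stabilizer_def using A(1) by simp
 fix B assume "B : flag_stabilizer r Ws"
 then have B: "B : carrier (GL_field r)" "!!W. W : set Ws ==> act B W = W" unfolding flag_stabilizer_def by blast+
 have "act (A * B) W = W" if "W : set Ws" for W
 using act_mult[OF GL_carrier_mat[OF A(1)] GL_carrier_mat[OF B(1)] Wc[OF that]] A(2)[OF that] B(2)[OF that] by simp
 moreover have "A * B : carrier (GL_field r)" using G.m_closed[OF A(1) B(1)] by (simp add: GL_simps)
 ultimately show "A \<otimes>\<^bsub>GL_field r\<^esub> B : flag_stabilizer r Ws" unfolding flag_stabilizer_def by (simp add: GL_simps)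
qed

text \<open>Standard flags are indexed by the set \<open>S\<close> of dimensions of their proper
  nonzero members; 0 and \<open>r\<close> are added at the ends. Sums over standard parabolics thus
  become sums over subsets of \<open>{1..<r}\<close>.\<close>

definition std_dims :: "nat => nat set => nat list" where
 "std_dims r S = 0 # sorted_list_of_set S @ [r]"

definition std_flag :: "nat => nat set => 'a::field vec set list" where
 "std_flag r S = map (coord_sub r) (std_dims r S)"

lemma set_std_flag: "finite S ==> set (std_flag r S) = coord_sub r ` insert 0 (insert r S)"
 by (auto simp: std_flag_def std_dims_def)

lemma std_dims_sorted: assumes S: "S <= {1..<r}" and r: "r >= 1" shows "sorted_wrt (<) (std_dims r S)"
proof -
 have f: "finite S" using S by (rule finite_subset) simp
 show ?thesis unfolding std_dims_def using S r f by (auto simp: sorted_wrt_append)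
qed

lemma std_dims_le: assumes S: "S <= {1..<r}" "d : set (std_dims r S)" shows "d <= r"
proof -
 have f: "finite S" using S(1) by (rule finite_subset) simp
 show ?thesis using S f by (auto simp: std_dims_def)
qed

lemma std_flag: assumes S: "S <= {1..<r}" and r: "r >= 1" shows "is_flag r (std_flag r S :: 'a::field vec set list)"
 unfolding is_flag_def
proof (intro conjI ballI)
 show "std_flag r S ~= []" "hd (std_flag r S) = {0\<^sub>v r}" "last (std_flag r S) = carrier_vec r"
 by (simp_all add: std_flag_def std_dims_def coord_sub_0 coord_sub_r last_map)
 show "subspace class_ring W (module_vec TYPE('a) r)" if "W : set (std_flag r S)" for W
 using that coord_mem unfolding std_flag_def subspaces_def by auto
 show "sorted_wrt (\<subset>) (std_flag r S :: 'a vec set list)" unfolding std_flag_def sorted_wrt_map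
 by (rule sorted_wrt_mono_rel[OF _ std_dims_sorted[OF S r]]) (simp add: coord_sub_strict std_dims_le[OF S])
qed

lemma dims_std_flag:
 assumes S: "S <= {1..<r}" shows "subspace_dim r ` set (std_flag r S :: 'a::field vec set list) - {0, r} = S"
proof -
 have f: "finite S" using S by (rule finite_subset) simp
 have "subspace_dim r ` set (std_flag r S :: 'a vec set list) = (%d. d) ` insert 0 (insert r S)"
 unfolding set_std_flag[OF f] image_image by (rule image_cong[OF refl]) (use S in "auto intro!: coord_sub_dim")
 then show ?thesis using S by auto
qed

lemma borel_act:
 assumes A: "A : borel_subgroup r" shows "act A (coord_sub r d) = (coord_sub r d :: 'a::field vec set)"
proof (rule act_eq_if_subset)
 show AG: "A : carrier (GL_field r)" using A unfolding borel_subgroup_def by blast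
 note Ac = GL_carrier_mat[OF AG]
 have ut: "A $$ (i, j) = 0" if "j < i" "i < r" for i j using A that Ac unfolding borel_subgroup_def upper_triangular_def by auto
 show "coord_sub r d : subspaces r" by (rule coord_mem)
 show "act A (coord_sub r d) <= coord_sub r d"
 proof (rule image_subsetI)
 fix x :: "'a vec" assume x: "x : coord_sub r d"
 then have xc: "x : carrier_vec r" unfolding coord_sub_def by blast
 have "(A *v x) $ i = 0" if i: "d <= i" "i < r" for i
 unfolding mat_vec_index[OF Ac xc i(2)]
 proof (rule sum.neutral, rule ballI)
 fix j assume j: "j : {..<r}"
 show "A $$ (i, j) * x $ j = 0"
 proof (cases "j < i")
 case True
 then show ?thesis using ut[OF True i(2)] by simp
 next
 case False
 then have "x $ j = 0" using x j i(1) unfolding coord_sub_def by simp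
 then show ?thesis by simp
 qed
 qed
 moreover have "A *v x : carrier_vec r" by (rule mult_mat_vec_carrier[OF Ac xc])
 ultimately show "A *v x : coord_sub r d" unfolding coord_sub_def by blast
 qed
qed

lemma borel_subset_std:
 assumes S: "S <= {1..<r}" shows "borel_subgroup r <= flag_stabilizer r (std_flag r S :: 'a::field vec set list)"
proof
 fix A :: "'a mat" assume A: "A : borel_subgroup r"
 then have "A : carrier (GL_field r)" unfolding borel_subgroup_def by blast
 then show "A : flag_stabilizer r (std_flag r S)" unfolding flag_stabilizer_def std_flag_def using borel_act[OF A] by auto
qed

lemma full_stabilizer_subset_borel:
 assumes r: "r >= 1" shows "flag_stabilizer r (std_flag r {1..<r}) <= (borel_subgroup r :: 'a::field mat set)"
proof
 fix A :: "'a mat" assume "A : flag_stabilizer r (std_flag r {1..<r})"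
 then have AG: "A : carrier (GL_field r)" and st: "ALL W:set (std_flag r {1..<r}). act A W = W" unfolding flag_stabilizer_def by blast+
 note Ac = GL_carrier_mat[OF AG]
 have "A $$ (i, j) = 0" if ij: "j < i" "i < r" for i j
 proof -
 have "Suc j : insert 0 (insert r {1..<r})" using ij by auto
 then have "coord_sub r (Suc j) : set (std_flag r {1..<r} :: 'a vec set list)" unfolding set_std_flag[OF finite_atLeastLessThan] by blast
 then have e: "act A (coord_sub r (Suc j)) = coord_sub r (Suc j)" using st by blast
 have "unit_vec r j : (coord_sub r (Suc j) :: 'a vec set)" unfolding coord_sub_def using ij by auto
 then have "A *v unit_vec r j : coord_sub r (Suc j)" using e by blast
 then have "(A *v unit_vec r j) $ i = 0" unfolding coord_sub_def using ij by simp
 moreover have "(A *v unit_vec r j) $ i = A $$ (i, j)"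
 proof -
 have "(A *v unit_vec r j) $ i = (SUM k<r. A $$ (i, k) * unit_vec r j $ k)"
 by (rule mat_vec_index[OF Ac unit_vec_carrier ij(2)])
 also have "... = (SUM k<r. if k = j then A $$ (i, k) else 0)" using ij by (intro sum.cong refl) (simp add: unit_vec_def)
 also have "... = A $$ (i, j)" using ij by simp
 finally show ?thesis .
 qed
 ultimately show ?thesis by simp
 qed
 then show "A : borel_subgroup r" unfolding borel_subgroup_def upper_triangular_def using AG Ac by auto
qed

text \<open>The stabilizer of the full coordinate flag lies in the Borel subgroup, hence in every
  standard parabolic. By \<open>stabilizer_mono_flag\<close> the flag of the latter is part of the
  full coordinate flag, and \<open>S\<close> collects its dimensions. Injectivity holds because the
  group determines its flag.\<close>

lemma standard_parabolics_eq:
 assumes r: "r >= 1"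
 shows "bij_betw (%S. flag_stabilizer r (std_flag r S)) (Pow {1..<r}) (standard_parabolics r :: 'a::number_field mat set set)"
proof (rule bij_betw_imageI)
 show "inj_on (%S. flag_stabilizer r (std_flag r S) :: 'a mat set) (Pow {1..<r})"
 proof (rule inj_onI)
 fix S S' assume SS: "S : Pow {1..<r}" "S' : Pow {1..<r}"
 and eq: "flag_stabilizer r (std_flag r S) = (flag_stabilizer r (std_flag r S') :: 'a mat set)"
 then have S: "S <= {1..<r}" "S' <= {1..<r}" by simp_all
 have eqf: "(std_flag r S :: 'a vec set list) = std_flag r S'"
 using arg_cong[OF eq, of "parabolic_flag r"] unfolding flag_of_stabilizer[OF std_flag[OF S(1) r]] flag_of_stabilizer[OF std_flag[OF S(2) r]] .
 show "S = S'" using dims_std_flag[OF S(1), where 'a = 'a] unfolding eqf dims_std_flag[OF S(2), where 'a = 'a] by (rule sym)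
 qed
 show "(%S. flag_stabilizer r (std_flag r S)) ` Pow {1..<r} = (standard_parabolics r :: 'a mat set set)"
 proof
 show "(%S. flag_stabilizer r (std_flag r S)) ` Pow {1..<r} <= (standard_parabolics r :: 'a mat set set)"
 unfolding standard_parabolics_def parabolics_def using std_flag[OF _ r] borel_subset_std by blast
 show "(standard_parabolics r :: 'a mat set set) <= (%S. flag_stabilizer r (std_flag r S)) ` Pow {1..<r}"
 proof
 fix P :: "'a mat set" assume "P : standard_parabolics r"
 then obtain Ws where F: "is_flag r Ws" and P: "P = flag_stabilizer r Ws" and b: "borel_subgroup r <= P"
 unfolding standard_parabolics_def parabolics_def by blast
 have full: "is_flag r (std_flag r {1..<r} :: 'a vec set list)" by (rule std_flag[OF subset_refl r])
 have "flag_stabilizer r (std_flag r {1..<r}) <= flag_stabilizer r Ws"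
 using full_stabilizer_subset_borel[OF r] b unfolding P by (rule subset_trans)
 from stabilizer_mono_flag[OF full F this] have sub: "set Ws <= coord_sub r ` insert 0 (insert r {1..<r})"
 unfolding set_std_flag[OF finite_atLeastLessThan] .
 define S where "S = {d : {1..<r}. coord_sub r d : set Ws}"
 have S: "S <= {1..<r}" by (auto simp: S_def)
 have f: "finite S" using S by (rule finite_subset) simp
 note fl = is_flagD[OF F]
 have z: "coord_sub r 0 : set Ws" "coord_sub r r : set Ws"
 using fl(1-3) hd_in_set[OF fl(1)] last_in_set[OF fl(1)] by (simp_all add: coord_sub_0 coord_sub_r)
 have "set (std_flag r S) = set Ws" unfolding set_std_flag[OF f]
 proof
 show "coord_sub r ` insert 0 (insert r S) <= set Ws" using z by (auto simp: S_def)
 show "set Ws <= coord_sub r ` insert 0 (insert r S)"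
 proof
 fix W assume W: "W : set Ws"
 then obtain d where d: "d : insert 0 (insert r {1..<r})" "W = coord_sub r d" using sub by blast
 then have "d : insert 0 (insert r S)" using W by (auto simp: S_def)
 then show "W : coord_sub r ` insert 0 (insert r S)" using d(2) by blast
 qed
 qed
 then have "std_flag r S = Ws" by (rule psubset_sorted_unique[OF is_flagD(5)[OF std_flag[OF S r]] fl(5)])
 then show "P : (%S. flag_stabilizer r (std_flag r S)) ` Pow {1..<r}" unfolding P using S by blast
 qed
 qed
qed

lemma std_stabilizer_iff:
 assumes S: "S <= {1..<r}"
 shows "A : flag_stabilizer r (std_flag r S) \<longleftrightarrow>
 A : carrier (GL_field r) & (ALL d:S. act A (coord_sub r d) = (coord_sub r d :: 'a::field vec set))"
proof -
 have f: "finite S" using S by (rule finite_subset) simp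
 have ends: "act A (coord_sub r 0) = coord_sub r 0 & act A (coord_sub r r) = coord_sub r r"
 if A: "A : carrier (GL_field r)" for A :: "'a mat"
 proof (intro conjI act_eq_if_subset[OF A coord_mem])
 note s = act_subspaces[OF A coord_mem]
 show "act A (coord_sub r r) <= coord_sub r r" unfolding coord_sub_r using subspacesD(1)[OF s[of r]] by (simp add: coord_sub_r)
 show "act A (coord_sub r 0) <= coord_sub r 0"
 unfolding coord_sub_0 using subspacesD(2)[OF s[of 0]] by (auto simp: coord_sub_0)
 qed
 have iff: "(ALL W:coord_sub r ` insert 0 (insert r S). act A W = W) \<longleftrightarrow>
 (ALL d:S. act A (coord_sub r d) = (coord_sub r d :: 'a vec set))" if "A : carrier (GL_field r)"
 using ends[OF that] by simp
 show ?thesis unfolding flag_stabilizer_def mem_Collect_eq set_std_flag[OF f] by (rule conj_cong[OF refl iff])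
qed

section \<open>Cosets as chains of subspaces\<close>

context adelic_matrix begin

text \<open>By \<open>node_translate\<close> the ordinate of a coordinate subspace for the translate
  of \<open>g\<close> by \<open>dl\<close> is the ordinate for \<open>g\<close> of its preimage
  under \<open>dl\<close>. The condition thereby speaks about subspaces and the fixed function
  \<open>node\<close>.\<close>

lemma polygon_gt_translate:
 assumes r: "r >= 1" and S: "S <= {1..<r}" and dG: "dl : carrier (GL_field r)"
 defines "P \<equiv> flag_stabilizer r (std_flag r S :: 'a vec set list)"
 shows "polygon_gt r P (parabolic_polygon r (rational_mult r dl g) P) p \<longleftrightarrow>
 (ALL d:S. node (act (GLinv r dl) (coord_sub r d)) > p (real d))"
proof -
 interpret rational_translate r g dl "GLinv r dl"
 by (rule rational_translate.intro[OF adelic_matrix_axioms GL_inverse[OF dG]])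
 let ?h = "rational_mult r dl g" and ?Ws = "std_flag r S :: 'a vec set list" and ?ss = "sorted_list_of_set S"
 have f: "finite S" using S by (rule finite_subset) simp
 have F: "is_flag r ?Ws" by (rule std_flag[OF S r])
 note fd = flag_dims[OF F r]
 have pf: "parabolic_flag r P = ?Ws" unfolding P_def by (rule flag_of_stabilizer[OF F])
 have pp: "parabolic_polygon r ?h P = interpolation (flag_dims r ?Ws) (map (lattice_node r ?h) ?Ws)"
 unfolding P_def by (rule parabolic_polygon_flag[OF F])
 have steps: "parabolic_steps r P = Suc (length ?ss)" unfolding parabolic_steps_def pf by (simp add: std_flag_def std_dims_def)
 have len: "length ?Ws = Suc (Suc (length ?ss))" by (simp add: std_flag_def std_dims_def)
 \<comment> \<open>The flag starts with the zero space, so its member number \<open>Suc k\<close>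
   belongs to entry \<open>k\<close> of the sorted list of \<open>S\<close>.\<close>
 have main: "(let d = real (subspace_dim r (?Ws ! Suc k)) in parabolic_polygon r ?h P d - p d > 0) \<longleftrightarrow>
 node (act (GLinv r dl) (coord_sub r (?ss ! k))) > p (real (?ss ! k))" if k: "k < length ?ss" for k
 proof -
 let ?d = "?ss ! k"
 have "?d : S" using nth_mem[OF k] f by simp
 then have dr: "?d <= r" using S by auto
 have W: "?Ws ! Suc k = coord_sub r ?d" using k by (simp add: std_flag_def std_dims_def nth_append)
 have dim: "subspace_dim r (?Ws ! Suc k) = ?d" unfolding W by (rule coord_sub_dim[OF dr])
 have sk: "Suc k < length (flag_dims r ?Ws)" using k len fd(5) by simp
 have "flag_dims r ?Ws ! Suc k = real ?d" using k len dim by (simp add: flag_dims_def)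
 then have "parabolic_polygon r ?h P (real ?d) = map (lattice_node r ?h) ?Ws ! Suc k"
 unfolding pp using interp_node[of "flag_dims r ?Ws" "map (lattice_node r ?h) ?Ws", OF _ fd(4,1) sk] fd(5) by simp
 also have "... = lattice_node r ?h (coord_sub r ?d)" using k len W by simp
 also have "... = lattice_node r ?h (act dl (act (GLinv r dl) (coord_sub r ?d)))"
 unfolding act_cancel(2)[OF dG subspacesD(1)[OF coord_mem]] ..
 also have "... = node (act (GLinv r dl) (coord_sub r ?d))"
 unfolding node_lattice_node
 by (rule node_translate[OF inverse_pair.image_subspaces[OF inverse_pair_sym coord_mem]])
 finally show ?thesis unfolding dim Let_def by simp
 qed
 have "polygon_gt r P (parabolic_polygon r ?h P) p \<longleftrightarrow> (ALL k<length ?ss. node (act (GLinv r dl) (coord_sub r (?ss ! k))) > p (real (?ss ! k)))"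
 unfolding polygon_gt_def pf steps
 proof
 assume a: "ALL i:{1..<Suc (length ?ss)}. let d = real (subspace_dim r (?Ws ! i)) in 0 < parabolic_polygon r ?h P d - p d"
 show "ALL k<length ?ss. node (act (GLinv r dl) (coord_sub r (?ss ! k))) > p (real (?ss ! k))"
 proof (intro allI impI)
 fix k assume k: "k < length ?ss"
 then have "Suc k : {1..<Suc (length ?ss)}" by simp
 from bspec[OF a this] main[OF k] show "node (act (GLinv r dl) (coord_sub r (?ss ! k))) > p (real (?ss ! k))" by (rule iffD1[rotated])
 qed
 next
 assume a: "ALL k<length ?ss. node (act (GLinv r dl) (coord_sub r (?ss ! k))) > p (real (?ss ! k))"
 show "ALL i:{1..<Suc (length ?ss)}. let d = real (subspace_dim r (?Ws ! i)) in 0 < parabolic_polygon r ?h P d - p d"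
 proof
 fix i assume "i : {1..<Suc (length ?ss)}"
 then obtain k where k: "i = Suc k" "k < length ?ss" by (cases i) auto
 show "let d = real (subspace_dim r (?Ws ! i)) in 0 < parabolic_polygon r ?h P d - p d"
 unfolding k(1) by (rule iffD2[OF main[OF k(2)] a[rule_format, OF k(2)]])
 qed
 qed
 also have "... \<longleftrightarrow> (ALL d:set ?ss. node (act (GLinv r dl) (coord_sub r d)) > p (real d))"
 unfolding all_set_conv_all_nth ..
 finally show ?thesis using f by simp
qed

definition dim_chains :: "(real => real) => nat set => 'a vec set set set" where
 "dim_chains p S = {K : chains_in (above p). subspace_dim r ` K = S}"

text \<open>The coset of \<open>dl\<close> corresponds to the chain of preimages under
  \<open>dl\<close> of the coordinate subspaces with dimensions in \<open>S\<close>: equal chains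
  differ by an element of the stabilizer, and every chain arises because rational matrices act
  transitively on flags of given dimensions. The chains above \<open>p\<close> are finitely many, so
  the infinite sum is a finite count.\<close>

lemma coset_term_sum:
 assumes r: "r >= 1" and S: "S <= {1..<r}"
 defines "P \<equiv> flag_stabilizer r (std_flag r S :: 'a vec set list)"
 shows "coset_term r p g P summable_on (rcosets\<^bsub>GL_field r\<^esub> P)"
 and "(\<Sum>\<^sub>\<infinity>c\<in>rcosets\<^bsub>GL_field r\<^esub> P. coset_term r p g P c) = real (card (dim_chains p S))"
proof -
 interpret G: group "GL_field r :: 'a mat monoid" by (rule GL_group)
 have F: "is_flag r (std_flag r S :: 'a vec set list)" by (rule std_flag[OF S r])
 have sg: "subgroup P (GL_field r)" unfolding P_def by (rule flag_stabilizer_subgroup[OF F])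
 \<comment> \<open>The same choice as in \<open>coset_term\<close>, so that terms can be rewritten
   without first showing independence of the representative.\<close>
 define rep where "rep c = (SOME dl :: 'a mat. dl : c)" for c
 define T where "T dl d = act (GLinv r dl) (coord_sub r d)" for dl :: "'a mat" and d
 define C where "C = {c : rcosets\<^bsub>GL_field r\<^esub> P. ALL d:S. node (T (rep c) d) > p (real d)}"
 have rep: "rep c : carrier (GL_field r) & rep c : c & c = P #>\<^bsub>GL_field r\<^esub> rep c" if c: "c : rcosets\<^bsub>GL_field r\<^esub> P" for c
 proof -
 obtain a where a: "a : carrier (GL_field r)" "c = P #>\<^bsub>GL_field r\<^esub> a" using c unfolding RCOSETS_def by blast
 have "a : c" unfolding a(2) by (rule G.rcos_self[OF a(1) sg])
 then have rc: "rep c : c" unfolding rep_def by (rule someI[of "%dl. dl : c"])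
 have "rep c : carrier (GL_field r)" using G.r_coset_subset_G[OF subgroup.subset[OF sg] a(1)] rc a(2) by blast
 moreover have "c = P #>\<^bsub>GL_field r\<^esub> rep c" using G.repr_independence[OF _ a(1) sg, of "rep c"] rc a(2) by simp
 ultimately show ?thesis using rc by blast
 qed
 have tm: "coset_term r p g P c = of_bool (c : C)" if c: "c : rcosets\<^bsub>GL_field r\<^esub> P" for c
 unfolding coset_term_def Let_def rep_def[symmetric] P_def polygon_gt_translate[OF r S conjunct1[OF rep[OF c]]]
 using c unfolding C_def T_def P_def by simp
 have Td: "subspace_dim r (T dl d) = d" and Ts: "T dl d : subspaces r" if "dl : carrier (GL_field r)" "d : S" for dl d
 proof -
 have i: "GLinv r dl : carrier (GL_field r)" using that(1) by simp
 have "d <= r" using S that(2) by auto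
 then show "subspace_dim r (T dl d) = d" unfolding T_def act_dim[OF i coord_mem] by (rule coord_sub_dim)
 show "T dl d : subspaces r" unfolding T_def by (rule act_subspaces[OF i coord_mem])
 qed
 have bij: "bij_betw (%c. T (rep c) ` S) C (dim_chains p S)"
 proof (rule bij_betw_imageI)
 show "inj_on (%c. T (rep c) ` S) C"
 proof (rule inj_onI)
 fix c c' assume "c : C" "c' : C" and eq: "T (rep c) ` S = T (rep c') ` S"
 then have cc: "c : rcosets\<^bsub>GL_field r\<^esub> P" "c' : rcosets\<^bsub>GL_field r\<^esub> P" unfolding C_def by blast+
 define a where "a = rep c" define b where "b = rep c'"
 note ra = rep[OF cc(1), folded a_def] and rb = rep[OF cc(2), folded b_def]
 have ag: "a : carrier (GL_field r)" and bg: "b : carrier (GL_field r)" using ra rb by blast+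
 have TT: "T a d = T b d" if d: "d : S" for d
 proof -
 have "T a d : T b ` S" using eq d unfolding a_def b_def by blast
 then obtain d' where d': "d' : S" "T a d = T b d'" by blast
 have "d = d'" using Td[OF ag d] Td[OF bg d'(1)] d'(2) by simp
 then show ?thesis using d'(2) by simp
 qed
 let ?m = "b \<otimes>\<^bsub>GL_field r\<^esub> GLinv r a"
 have mG: "?m : carrier (GL_field r)" using ag bg by simp
 have "act ?m (coord_sub r d) = coord_sub r d" if d: "d : S" for d
 proof -
 have cs: "coord_sub r d <= (carrier_vec r :: 'a vec set)" by (rule subspacesD(1)[OF coord_mem])
 have "act ?m (coord_sub r d) = act b (T a d)"
 unfolding GL_simps T_def by (rule act_mult[OF GL_carrier_mat[OF bg] GL_carrier_mat cs]) (use ag in simp)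
 also have "... = act b (T b d)" by (simp only: TT[OF d])
 also have "... = coord_sub r d" unfolding T_def by (rule act_cancel(2)[OF bg cs])
 finally show ?thesis .
 qed
 then have "?m : P" unfolding P_def std_stabilizer_iff[OF S] using mG by blast
 moreover have "b = ?m \<otimes>\<^bsub>GL_field r\<^esub> a" using ag bg by (simp add: G.m_assoc)
 ultimately have "b : P #>\<^bsub>GL_field r\<^esub> a" unfolding r_coset_def by blast
 from G.repr_independence[OF this ag sg] ra rb show "c = c'" by blast
 qed
 show "(%c. T (rep c) ` S) ` C = dim_chains p S"
 proof
 show "(%c. T (rep c) ` S) ` C <= dim_chains p S"
 proof (rule image_subsetI)
 fix c assume c: "c : C"
 then have cc: "c : rcosets\<^bsub>GL_field r\<^esub> P" and n: "ALL d:S. node (T (rep c) d) > p (real d)" unfolding C_def by blast+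
 have ag: "rep c : carrier (GL_field r)" using rep[OF cc] by blast
 have "T (rep c) d : above p" if "d : S" for d
 unfolding above_def using n that Td[OF ag that] Ts[OF ag that] by simp
 moreover have "T (rep c) d <= T (rep c) d' \<or> T (rep c) d' <= T (rep c) d" for d d'
 proof -
 have "coord_sub r d <= coord_sub r d' \<or> coord_sub r d' <= (coord_sub r d :: 'a vec set)"
 unfolding coord_sub_def by (cases "d <= d'") auto
 then show ?thesis unfolding T_def by (blast intro: image_mono)
 qed
 moreover have "subspace_dim r ` T (rep c) ` S = S" unfolding image_image using Td[OF ag] by simp
 ultimately show "T (rep c) ` S : dim_chains p S" unfolding dim_chains_def chains_in_def by blast
 qed
 show "dim_chains p S <= (%c. T (rep c) ` S) ` C"
 proof
 fix K assume "K : dim_chains p S"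
 then have K: "K <= above p" "ALL A:K. ALL B:K. A <= B \<or> B <= A" "subspace_dim r ` K = S"
 unfolding dim_chains_def chains_in_def by blast+
 have Ks: "K <= subspaces r" using K(1) unfolding above_def by blast
 have fK: "finite K" using finite_subset[OF K(1) finite_above[OF r]] .
 \<comment> \<open>The zero space and the whole space complete the chain to a flag, to which
   \<open>flag_transitive\<close> applies.\<close>
 let ?K = "insert {0\<^sub>v r} (insert (carrier_vec r) K)"
 have b: "{0\<^sub>v r} <= A" "A <= carrier_vec r" if "A : ?K" for A
 using that Ks subspacesD(1,2)[of A r] by auto
 have "ALL A:?K. ALL B:?K. A <= B \<or> B <= A"
 proof (intro ballI)
 fix A B assume A: "A : ?K" and B: "B : ?K"
 then consider "A : K" "B : K" | "A = {0\<^sub>v r}" | "A = carrier_vec r" | "B = {0\<^sub>v r}" | "B = carrier_vec r" by blast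
 then show "A <= B \<or> B <= A"
 proof cases
 case 1
 then show ?thesis by (rule K(2)[rule_format])
 qed (use b[OF A] b[OF B] in simp_all)
 qed
 then have "EX Ws. set Ws = ?K & sorted_wrt (\<subset>) Ws" using fK by (intro finite_chain_list_exists) simp_all
 then obtain Ws where Ws: "set Ws = ?K" "sorted_wrt (\<subset>) Ws" by blast
 have ne: "Ws ~= []" using Ws(1) by auto
 have hd: "hd Ws = {0\<^sub>v r}"
 proof -
 obtain i where i: "i < length Ws" "Ws ! i = {0\<^sub>v r}" using Ws(1) by (metis in_set_conv_nth insertI1)
 have "Ws ! 0 <= Ws ! i" using i(1) by (intro psubset_nth_mono[OF Ws(2)]) simp_all
 moreover have "{0\<^sub>v r} <= Ws ! 0" using b(1)[of "Ws ! 0"] Ws(1) ne by (metis length_greater_0_conv nth_mem)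
 ultimately show ?thesis using i(2) ne by (simp add: hd_conv_nth)
 qed
 have last: "last Ws = carrier_vec r"
 proof -
 obtain i where i: "i < length Ws" "Ws ! i = carrier_vec r" using Ws(1) by (metis in_set_conv_nth insertCI)
 have "Ws ! i <= Ws ! (length Ws - 1)" using i(1) by (intro psubset_nth_mono[OF Ws(2)]) simp_all
 moreover have "last Ws <= carrier_vec r" using b(2)[of "last Ws"] Ws(1) last_in_set[OF ne] by blast
 ultimately show ?thesis using i(2) ne by (simp add: last_conv_nth)
 qed
 have "{0\<^sub>v r} : (subspaces r :: 'a vec set set)" "carrier_vec r : (subspaces r :: 'a vec set set)" by (rule subspaces_ends)+
 then have "W : subspaces r" if "W : set Ws" for W using that Ks unfolding Ws(1) by blast
 then have FW: "is_flag r Ws" unfolding is_flag_def using ne hd last Ws(2) unfolding subspaces_def by blast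
 obtain gm ep where inv: "inverse_pair r gm ep" and tr: "ALL W:set Ws. act gm (coord_sub r (subspace_dim r W)) = W"
 by (rule flag_transitive[OF FW])
 interpret iv: inverse_pair r gm ep by (rule inv)
 have eG: "ep : carrier (GL_field r)" "GLinv r ep = gm"
 using inv_GL_field(1,2)[OF iv.ep iv.dl iv.epdl iv.dlep] by blast+
 define c where "c = P #>\<^bsub>GL_field r\<^esub> ep"
 have cc: "c : rcosets\<^bsub>GL_field r\<^esub> P" unfolding c_def RCOSETS_def using eG(1) by blast
 have ag: "rep c : carrier (GL_field r)" and "rep c : P #>\<^bsub>GL_field r\<^esub> ep" using rep[OF cc] unfolding c_def by blast+
 \<comment> \<open>The chosen representative differs from \<open>ep\<close> by some \<open>a\<close>
   in \<open>P\<close>. Its inverse fixes the coordinate subspaces with dimensions in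
   \<open>S\<close>, so the chain attached to the coset is still \<open>K\<close>.\<close>
 then obtain a where a: "a : P" "rep c = a \<otimes>\<^bsub>GL_field r\<^esub> ep" unfolding r_coset_def by blast
 have aG: "a : carrier (GL_field r)" using subgroup.subset[OF sg] a(1) by blast
 have iaP: "GLinv r a : P" by (rule subgroup.m_inv_closed[OF sg a(1)])
 have iaG: "GLinv r a : carrier (GL_field r)" using aG by simp
 have TK: "T (rep c) (subspace_dim r W) = W" if W: "W : K" for W
 proof -
 have cs: "coord_sub r d <= (carrier_vec r :: 'a vec set)" for d by (rule subspacesD(1)[OF coord_mem])
 have d: "subspace_dim r W : S" using K(3) W by blast
 have e: "GLinv r (rep c) = gm * GLinv r a"
 unfolding a(2) unfolding G.inv_mult_group[OF aG eG(1)] unfolding eG(2) unfolding GL_simps ..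
 have "T (rep c) (subspace_dim r W) = act gm (act (GLinv r a) (coord_sub r (subspace_dim r W)))"
 unfolding T_def e by (rule act_mult[OF iv.dl GL_carrier_mat[OF iaG] cs])
 also have "... = act gm (coord_sub r (subspace_dim r W))"
 using iaP d unfolding P_def std_stabilizer_iff[OF S] by simp
 also have "... = W" using tr W Ws(1) by blast
 finally show ?thesis .
 qed
 have "T (rep c) ` S = K" unfolding K(3)[symmetric] image_image using TK by simp
 moreover have "c : C" unfolding C_def
 proof (intro CollectI conjI ballI cc)
 fix d assume "d : S"
 then obtain W where W: "W : K" "d = subspace_dim r W" using K(3) by blast
 then have "W : above p" using K(1) by blast
 then show "node (T (rep c) d) > p (real d)" unfolding W(2) TK[OF W(1)] above_def by blast
 qed
 ultimately show "K : (%c. T (rep c) ` S) ` C" by blast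
 qed
 qed
 qed
 have "dim_chains p S <= Pow (above p)" unfolding dim_chains_def chains_in_def by blast
 then have "finite (dim_chains p S)" by (rule finite_subset) (simp add: finite_above[OF r])
 then have fC: "finite C" using bij_betw_finite[OF bij] by blast
 have CR: "C <= rcosets\<^bsub>GL_field r\<^esub> P" unfolding C_def by blast
 have n0: "coset_term r p g P c = 0" if "c : rcosets\<^bsub>GL_field r\<^esub> P - C" for c using tm[of c] that by simp
 have "coset_term r p g P summable_on C" by (rule summable_on_finite[OF fC])
 then show "coset_term r p g P summable_on (rcosets\<^bsub>GL_field r\<^esub> P)"
 by (rule summable_on_cong_neutral[THEN iffD1, rotated 3]) (use n0 CR in auto)
 have "(\<Sum>\<^sub>\<infinity>c\<in>rcosets\<^bsub>GL_field r\<^esub> P. coset_term r p g P c) = (\<Sum>\<^sub>\<infinity>c\<in>C. coset_term r p g P c)"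
 by (rule infsum_cong_neutral) (use n0 CR in auto)
 also have "... = (SUM c:C. coset_term r p g P c)" by (rule infsum_finite[OF fC])
 also have "... = (SUM c:C. 1)" by (rule sum.cong[OF refl]) (use tm CR in auto)
 also have "... = real (card C)" by simp
 also have "card C = card (dim_chains p S)" by (rule bij_betw_same_card[OF bij])
 finally show "(\<Sum>\<^sub>\<infinity>c\<in>rcosets\<^bsub>GL_field r\<^esub> P. coset_term r p g P c) = real (card (dim_chains p S))" .
qed

text \<open>In dimensions 0 and \<open>r\<close> both \<open>node\<close> and \<open>p\<close>
  vanish, so the strict inequality fails there. Chains above \<open>p\<close> therefore have
  dimension sets inside \<open>{1..<r}\<close>, matching the index sets of standard flags.\<close>

lemma above_dims:
 assumes r: "r >= 1" and p: "p 0 = 0" "p (real r) = 0" and W: "W : above p"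
 shows "subspace_dim r W : {1..<r}"
proof -
 interpret SL: supermodular_lattice "subspaces r" subspace_join "subspace_dim r" "{0\<^sub>v r}" "carrier_vec r" r node
 by (rule node_lattice[OF r])
 have Ws: "W : subspaces r" and n: "node W > p (real (subspace_dim r W))" using W unfolding above_def by blast+
 have "subspace_dim r W ~= 0"
 proof
 assume d: "subspace_dim r W = 0"
 then have "{0\<^sub>v r} = W" using SL.dm_eq[OF SL.bt(1) Ws SL.bt(2)[OF Ws]] SL.bt(3) by simp
 then show False using n d p(1) SL.bt(4) by simp
 qed
 moreover have "subspace_dim r W ~= r"
 proof
 assume d: "subspace_dim r W = r"
 then have "W = carrier_vec r" using SL.dm_eq[OF Ws SL.tp(1) SL.tp(2)[OF Ws]] SL.tp(3) by simp
 then show False using n d p(2) SL.tp(4) by simp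
 qed
 ultimately show ?thesis using subspace_dim_le[OF Ws] by simp
qed

text \<open>Dimension is injective on a chain, so a chain has as many members as its dimension set;
  grouping the chains by dimension set makes the sign constant on each group.\<close>

lemma sum_dim_chains:
 assumes r: "r >= 1" and p: "p 0 = 0" "p (real r) = 0"
 shows "(SUM S:Pow {1..<r}. (-1) ^ card S * real (card (dim_chains p S))) = (SUM K:chains_in (above p). (-1) ^ card K)"
proof -
 have fin: "finite (chains_in (above p))"
 by (rule finite_subset[of _ "Pow (above p)"]) (auto simp: chains_in_def finite_above[OF r])
 have cK: "card K = card (subspace_dim r ` K)" if K: "K : chains_in (above p)" for K
 proof (rule card_image[symmetric], rule inj_onI)
 fix A B assume AB: "A : K" "B : K" and d: "subspace_dim r A = subspace_dim r B"
 have s: "A : subspaces r" "B : subspaces r" and c: "A <= B \<or> B <= A"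
 using K AB unfolding chains_in_def above_def by blast+
 show "A = B"
 proof (rule ccontr)
 assume "A ~= B"
 then have "A \<subset> B \<or> B \<subset> A" using c by blast
 then show False using subspaces_lattice(6)[OF s] subspaces_lattice(6)[OF s(2,1)] d by auto
 qed
 qed
 have im: "(%K. subspace_dim r ` K) ` chains_in (above p) <= Pow {1..<r}"
 using above_dims[of p] assms unfolding chains_in_def by blast
 have "(-1) ^ card S * real (card (dim_chains p S)) = (SUM K:{K : chains_in (above p). subspace_dim r ` K = S}. (-1) ^ card K)" for S
 proof -
 have "(SUM K:{K : chains_in (above p). subspace_dim r ` K = S}. (-1) ^ card K :: real) = (SUM K:dim_chains p S. (-1) ^ card S)"
 unfolding dim_chains_def by (rule sum.cong[OF refl]) (use cK in auto)
 then show ?thesis by simp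
 qed
 then have "(SUM S:Pow {1..<r}. (-1) ^ card S * real (card (dim_chains p S))) =
 (SUM S:Pow {1..<r}. SUM K:{K : chains_in (above p). subspace_dim r ` K = S}. (-1) ^ card K)" by simp
 also have "... = (SUM K:chains_in (above p). (-1) ^ card K)" by (rule sum.group[OF fin _ im]) simp
 finally show ?thesis .
qed

end

theorem mainTheorem4:
  fixes r :: nat and p :: "real \<Rightarrow> real"
  assumes "r \<ge> 1"
    and "convex_polygon r p" and "p 0 = 0" and "p (real r) = 0"
  shows "\<forall>g \<in> carrier (GL_adele r :: 'a::number_field adele mat monoid).
    (\<forall>P \<in> standard_parabolics r. coset_term r p g P summable_on (rcosets\<^bsub>GL_field r\<^esub> P)) \<and>
    of_bool (\<forall>t\<in>{0..real r}. canonical_polygon r g t \<le> p t) =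
      (\<Sum>P\<in>standard_parabolics r. (-1) ^ (parabolic_steps r P - 1) *
        (\<Sum>\<^sub>\<infinity>c\<in>rcosets\<^bsub>GL_field r\<^esub> P. coset_term r p g P c))"
proof
 fix g :: "'a adele mat" assume g: "g : carrier (GL_adele r)"
 interpret adelic_matrix r g by (rule adelic_matrix.intro[OF g])
 note r = assms(1) and p = assms(2)
 let ?P = "%S. flag_stabilizer r (std_flag r S :: 'a vec set list)"
 note bij = standard_parabolics_eq[OF r, where 'a = 'a]
 have "coset_term r p g P summable_on (rcosets\<^bsub>GL_field r\<^esub> P)" if P: "P : standard_parabolics r" for P
 proof -
 obtain S where "S <= {1..<r}" "P = ?P S" using P bij unfolding bij_betw_def by blast
 then show ?thesis using coset_term_sum(1)[OF r] by simp
 qed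
 moreover have "(SUM P:standard_parabolics r. (-1) ^ (parabolic_steps r P - 1) *
 (\<Sum>\<^sub>\<infinity>c\<in>rcosets\<^bsub>GL_field r\<^esub> P. coset_term r p g P c)) = (of_bool (ALL t:{0..real r}. canonical_polygon r g t <= p t) :: real)"
 proof -
 have "(SUM P:standard_parabolics r. (-1) ^ (parabolic_steps r P - 1) * (\<Sum>\<^sub>\<infinity>c\<in>rcosets\<^bsub>GL_field r\<^esub> P. coset_term r p g P c)) =
 (SUM S:Pow {1..<r}. (-1) ^ (parabolic_steps r (?P S) - 1) * (\<Sum>\<^sub>\<infinity>c\<in>rcosets\<^bsub>GL_field r\<^esub> (?P S). coset_term r p g (?P S) c))"
 by (rule sum.reindex_bij_betw[OF bij, symmetric])
 also have "... = (SUM S:Pow {1..<r}. (-1) ^ card S * real (card (dim_chains p S)))"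
 proof (rule sum.cong[OF refl])
 fix S assume "S : Pow {1..<r}"
 then have S: "S <= {1..<r}" by simp
 \<comment> \<open>The standard flag has \<open>card S + 2\<close> members, hence
   \<open>card S + 1\<close> steps; the exponent of the sign is one less.\<close>
 have "parabolic_steps r (?P S) - 1 = card S"
 unfolding parabolic_steps_def flag_of_stabilizer[OF std_flag[OF S r]] by (simp add: std_flag_def std_dims_def)
 then show "(-1) ^ (parabolic_steps r (?P S) - 1) * (\<Sum>\<^sub>\<infinity>c\<in>rcosets\<^bsub>GL_field r\<^esub> (?P S). coset_term r p g (?P S) c) =
 (-1) ^ card S * real (card (dim_chains p S))" using coset_term_sum(2)[OF r S] by simp
 qed
 also have "... = (SUM K:chains_in (above p). (-1) ^ card K)" by (rule sum_dim_chains[OF r assms(3,4)])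
 also have "... = of_bool (above p = {})" by (rule alternating_sum_above[OF r p])
 finally show ?thesis unfolding canonical_polygon_le_iff[OF r p] .
 qed
 ultimately show "(ALL P : standard_parabolics r. coset_term r p g P summable_on (rcosets\<^bsub>GL_field r\<^esub> P)) &
 of_bool (ALL t:{0..real r}. canonical_polygon r g t <= p t) =
 (SUM P:standard_parabolics r. (-1) ^ (parabolic_steps r P - 1) *
 (\<Sum>\<^sub>\<infinity>c\<in>rcosets\<^bsub>GL_field r\<^esub> P. coset_term r p g P c))" by simp
qed

end
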